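(* Let $\mathcal{B}_{s}$ be the state-space system $\mathcal{B}_{s} = \lbrace (\mathbf{u}, \mathbf{y}, \mathbf{x}) \in \mathcal{L}_{2}^{\text{loc}}(\mathbb{R}, \mathbb{R}^{n}) \times \mathcal{L}_{2}^{\text{loc}}(\mathbb{R}, \mathbb{R}^{n}) \times \mathcal{L}_{2}^{\text{loc}}(\mathbb{R}, \mathbb{R}^{d}) \text{ such that } \tfrac{d\mathbf{x}}{dt} = A\mathbf{x} + B\mathbf{u} \text{ and } \mathbf{y} = C\mathbf{x} + D\mathbf{u}\rbrace$ with $A \in \mathbb{R}^{d \times d}$, $B \in \mathbb{R}^{d \times n}$, $C \in \mathbb{R}^{n \times d}$, $D \in \mathbb{R}^{n \times n}$ (so $m = n$), and let $\mathcal{B}_{s}^{(\mathbf{u},\mathbf{y})} \coloneqq \lbrace (\mathbf{u}, \mathbf{y}) \mid \exists \mathbf{x} \text{ such that } (\mathbf{u},\mathbf{y},\mathbf{x}) \in \mathcal{B}_{s}\rbrace$ be its external behavior. For $\mathbf{x}_{0} \in \mathbb{R}^{d}$ let $S_{a}^{\sigma_{p}}(\mathbf{x}_{0})$ be the available energy, i.e., the supremum of $\int_{t_{0}}^{t_{1}}-(\mathbf{u}^{T}\mathbf{y})(t)dt$ over all $t_{1} \geq t_{0}$ and $(\mathbf{u}, \mathbf{y}, \mathbf{x}) \in \mathcal{B}_{s}$ with $\mathbf{x}(t_{0}) = \mathbf{x}_{0}$ (equal to $\infty$ if this set is unbounded above). Let $V_{o} \coloneqq \text{col}(C, CA, \ldots,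 CA^{d-1})$ and $\Omega(X) \coloneqq \begin{bmatrix}-A^{T}X - XA& C^{T}-XB\\ C-B^{T}X& D + D^{T}\end{bmatrix}$. The following are equivalent: 1. $S_{a}^{\sigma_{p}}(\mathbf{x}_{0}) < \infty$ for all $\mathbf{x}_{0} \in \mathbb{R}^{d}$ (i.e., $\mathcal{B}_{s}^{(\mathbf{u}, \mathbf{y})}$ is passive). 2. The external behavior $\mathcal{B}_{s}^{(\mathbf{u}, \mathbf{y})}$ takes the form $\lbrace (\mathbf{u}, \mathbf{y}) \in \mathcal{L}_{2}^{\text{loc}}(\mathbb{R}, \mathbb{R}^{n}) \times \mathcal{L}_{2}^{\text{loc}}(\mathbb{R}, \mathbb{R}^{n}) \mid P(\tfrac{d}{dt})\mathbf{u} = Q(\tfrac{d}{dt})\mathbf{y} \rbrace$ for polynomial matrices $P, Q \in \mathbb{R}^{n \times n}[\xi]$, where $(P, Q)$ is a positive-real pair. 3. There exists $X \in \mathbb{R}^{d \times d}_{s}$ such that $X \geq 0$ and $\Omega(X) \geq 0$. 4. $S_{a}^{\sigma_{p}}(\mathbf{x}_{0}) = \tfrac{1}{2}\mathbf{x}_{0}^{T}X_{-}\mathbf{x}_{0}$, where $X_{-} \in \mathbb{R}^{d \times d}_{s}$ satisfies (i) $X_{-} \geq 0$; (ii) $\Omega(X_{-}) \geq 0$; (iii) if $\mathbf{z} \in \mathbb{R}^{d}$, then $V_{o}\mathbf{z} = 0 \iff X_{-}\mathbf{z} = 0$; and (iv) if $X \in \mathbb{R}^{d \times d}_{s}$ satisfies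 $X \geq 0$ and $\Omega(X) \geq 0$, then $X_{-} \leq X$. Moreover, if $(C,A)$ is observable and conditions 1–4 hold, then (i) $\text{spec}(A) \in \overline{\mathbb{C}}_{-}$; and (ii) if $X \in \mathbb{R}_{s}^{d \times d}$ satisfies $\Omega(X) \geq 0$, then $X_{-} \leq X$.
   Context: $(P,Q)$ with $P, Q \in \mathbb{R}^{n \times n}[\xi]$ is a positive-real pair if (a) $P(\lambda)Q(\bar{\lambda})^{T} + Q(\lambda)P(\bar{\lambda})^{T} \geq 0$ for all $\lambda \in \mathbb{C}_{+}$; (b) $\text{rank}([P \;\; -Q](\lambda)) = n$ for all $\lambda \in \overline{\mathbb{C}}_{+}$; (c) if $\mathbf{p} \in \mathbb{R}^{n}[\xi]$ and $\lambda \in \mathbb{C}$ satisfy $\mathbf{p}^{T}(PQ^{\star} + QP^{\star}) = 0$ and $\mathbf{p}(\lambda)^{T}[P \;\; -Q](\lambda) = 0$, then $\mathbf{p}(\lambda) = 0$, where $Q^{\star}(\xi) \coloneqq Q(-\xi)^{T}$. $\mathbb{R}^{d\times d}_{s}$ denotes real symmetric matrices; $\overline{\mathbb{C}}_{-}$ is the closed left half-plane; $(C,A)$ observable means $\text{rank}(V_{o}) = d$. No controllability or observability assumptions are made in the equivalence. *)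

theory Defs
  imports "HOL-Analysis.Analysis" "HOL-Computational_Algebra.Polynomial"
begin

text \<open>Locally square integrable signals R -> R^k (represented by functions;
  all conditions below are insensitive to changes on null sets except where the
  state equation forces the continuous representative of x).\<close>
definition L2loc :: "(real \<Rightarrow> real^'k) set" where
  "L2loc = {f. f \<in> borel_measurable lborel \<and>
              (\<forall>a b. set_integrable lborel {a..b} (\<lambda>t. (norm (f t))\<^sup>2))}"

text \<open>dx/dt = Ax + Bu in the (weak / absolutely continuous) sense:
  x(t) - x(s) is the integral of Ax+Bu over [s,t]; y = Cx + Du almost everywhere.\<close>
definition state_behavior ::
  "real^'d^'d \<Rightarrow> real^'n^'d \<Rightarrow> real^'d^'n \<Rightarrow> real^'n^'n \<Rightarrow>
   ((real \<Rightarrow> real^'n) \<times> (real \<Rightarrow> real^'n) \<times> (real \<Rightarrow> real^'d)) set" where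
  "state_behavior A B C D =
     {(u, y, x). u \<in> L2loc \<and> y \<in> L2loc \<and> x \<in> L2loc \<and>
        (\<forall>s t. s \<le> t \<longrightarrow>
           ((\<lambda>\<tau>. A *v x \<tau> + B *v u \<tau>) has_integral (x t - x s)) {s..t}) \<and>
        (AE t in lborel. y t = C *v x t + D *v u t)}"

definition external_behavior ::
  "real^'d^'d \<Rightarrow> real^'n^'d \<Rightarrow> real^'d^'n \<Rightarrow> real^'n^'n \<Rightarrow>
   ((real \<Rightarrow> real^'n) \<times> (real \<Rightarrow> real^'n)) set" where
  "external_behavior A B C D = {(u, y). \<exists>x. (u, y, x) \<in> state_behavior A B C D}"

definition available_energy ::
  "real^'d^'d \<Rightarrow> real^'n^'d \<Rightarrow> real^'d^'n \<Rightarrow> real^'n^'n \<Rightarrow> real \<Rightarrow> real^'d \<Rightarrow> ereal" where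
  "available_energy A B C D t0 x0 =
     Sup {ereal (integral {t0..t1} (\<lambda>t. - (u t \<bullet> y t))) | t1 u y x.
            t1 \<ge> t0 \<and> (u, y, x) \<in> state_behavior A B C D \<and> x t0 = x0}"

definition psd :: "real^'k^'k \<Rightarrow> bool" where
  "psd M \<longleftrightarrow> transpose M = M \<and> (\<forall>v. 0 \<le> v \<bullet> (M *v v))"

definition symm_mat :: "real^'k^'k \<Rightarrow> bool" where
  "symm_mat M \<longleftrightarrow> transpose M = M"

definition Omega ::
  "real^'d^'d \<Rightarrow> real^'n^'d \<Rightarrow> real^'d^'n \<Rightarrow> real^'n^'n \<Rightarrow> real^'d^'d \<Rightarrow>
   real^('d + 'n)^('d + 'n)" where
  "Omega A B C D X = (\<chi> i j. case (i, j) of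
      (Inl i, Inl j) \<Rightarrow> (- (transpose A ** X) - X ** A) $ i $ j
    | (Inl i, Inr j) \<Rightarrow> (transpose C - X ** B) $ i $ j
    | (Inr i, Inl j) \<Rightarrow> (C - transpose B ** X) $ i $ j
    | (Inr i, Inr j) \<Rightarrow> (D + transpose D) $ i $ j)"

definition matpow :: "real^'d^'d \<Rightarrow> nat \<Rightarrow> real^'d^'d" where
  "matpow A k = ((\<lambda>M. A ** M) ^^ k) (mat 1)"

definition Vo_kernel :: "real^'d^'n \<Rightarrow> real^'d^'d \<Rightarrow> real^'d \<Rightarrow> bool" where
  "Vo_kernel C A z \<longleftrightarrow> (\<forall>k < CARD('d). (C ** matpow A k) *v z = 0)"

definition observable :: "real^'d^'n \<Rightarrow> real^'d^'d \<Rightarrow> bool" where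
  "observable C A \<longleftrightarrow> (\<forall>z. Vo_kernel C A z \<longrightarrow> z = 0)"

definition cmat :: "real^'b^'a \<Rightarrow> complex^'b^'a" where
  "cmat M = (\<chi> i j. complex_of_real (M $ i $ j))"

definition spectrum_in_closed_lhp :: "real^'d^'d \<Rightarrow> bool" where
  "spectrum_in_closed_lhp A \<longleftrightarrow>
     (\<forall>s :: complex. (\<exists>v. v \<noteq> 0 \<and> cmat A *v v = s *s v) \<longrightarrow> Re s \<le> 0)"

definition peval :: "real poly^'b^'a \<Rightarrow> complex \<Rightarrow> complex^'b^'a" where
  "peval P s = (\<chi> i j. poly (map_poly complex_of_real (P $ i $ j)) s)"

definition pveval :: "real poly^'a \<Rightarrow> complex \<Rightarrow> complex^'a" where
  "pveval p s = (\<chi> i. poly (map_poly complex_of_real (p $ i)) s)"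

definition pstar :: "real poly^'n^'n \<Rightarrow> real poly^'n^'n" where
  "pstar Q = (\<chi> i j. pcompose (Q $ j $ i) [:0, -1:])"

definition hpsd :: "complex^'n^'n \<Rightarrow> bool" where
  "hpsd M \<longleftrightarrow> (\<forall>v. let q = (\<Sum>i\<in>UNIV. \<Sum>j\<in>UNIV. cnj (v $ i) * M $ i $ j * v $ j)
                    in Im q = 0 \<and> 0 \<le> Re q)"

definition PmQ :: "real poly^'n^'n \<Rightarrow> real poly^'n^'n \<Rightarrow> complex \<Rightarrow> complex^('n + 'n)^'n" where
  "PmQ P Q s = (\<chi> i j. case j of Inl j \<Rightarrow> peval P s $ i $ j | Inr j \<Rightarrow> - (peval Q s $ i $ j))"

definition positive_real_pair :: "real poly^'n^'n \<Rightarrow> real poly^'n^'n \<Rightarrow> bool" where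
  "positive_real_pair P Q \<longleftrightarrow>
     (\<forall>s. Re s > 0 \<longrightarrow>
        hpsd (peval P s ** transpose (peval Q (cnj s)) + peval Q s ** transpose (peval P (cnj s)))) \<and>
     (\<forall>s. Re s \<ge> 0 \<longrightarrow> rank (PmQ P Q s) = CARD('n)) \<and>
     (\<forall>(p :: real poly^'n) s. p v* (P ** pstar Q + Q ** pstar P) = 0 \<and>
         pveval p s v* PmQ P Q s = 0 \<longrightarrow> pveval p s = 0)"

definition smooth_fun :: "(real \<Rightarrow> real) \<Rightarrow> bool" where
  "smooth_fun f \<longleftrightarrow> (\<forall>k t. ((deriv ^^ k) f) field_differentiable (at t))"

definition test_fun :: "('n \<Rightarrow> real \<Rightarrow> real) \<Rightarrow> bool" where
  "test_fun \<phi> \<longleftrightarrow> (\<forall>i. smooth_fun (\<phi> i)) \<and> (\<exists>a b. \<forall>i t. t \<notin> {a..b} \<longrightarrow> \<phi> i t = 0)"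

text \<open>The pairing of (R^star(d/dt) phi) with w, i.e. the distribution R(d/dt)w applied to phi:
  sum over i,j,k of (-1)^k R_ij,k phi_i^(k) w_j.\<close>
definition weak_apply :: "real poly^'n^'n \<Rightarrow> (real \<Rightarrow> real^'n) \<Rightarrow> ('n \<Rightarrow> real \<Rightarrow> real) \<Rightarrow> real" where
  "weak_apply R w \<phi> =
     (LINT t|lborel. (\<Sum>i\<in>UNIV. \<Sum>j\<in>UNIV. \<Sum>k\<le>degree (R $ i $ j).
         (-1) ^ k * coeff (R $ i $ j) k * (deriv ^^ k) (\<phi> i) t * w t $ j))"

definition poly_behavior :: "real poly^'n^'n \<Rightarrow> real poly^'n^'n \<Rightarrow>
    ((real \<Rightarrow> real^'n) \<times> (real \<Rightarrow> real^'n)) set" where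
  "poly_behavior P Q = {(u, y). u \<in> L2loc \<and> y \<in> L2loc \<and>
      (\<forall>\<phi>. test_fun \<phi> \<longrightarrow> weak_apply P u \<phi> = weak_apply Q y \<phi>)}"

definition cond4 ::
  "real^'d^'d \<Rightarrow> real^'n^'d \<Rightarrow> real^'d^'n \<Rightarrow> real^'n^'n \<Rightarrow> real \<Rightarrow> real^'d^'d \<Rightarrow> bool" where
  "cond4 A B C D t0 Xm \<longleftrightarrow>
     symm_mat Xm \<and> psd Xm \<and> psd (Omega A B C D Xm) \<and>
     (\<forall>z. Vo_kernel C A z \<longleftrightarrow> Xm *v z = 0) \<and>
     (\<forall>X. symm_mat X \<and> psd X \<and> psd (Omega A B C D X) \<longrightarrow> psd (X - Xm)) \<and>
     (\<forall>x0. available_energy A B C D t0 x0 = ereal (1/2 * (x0 \<bullet> (Xm *v x0))))"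

end

theory Submission
  imports Defs "HOL-Complex_Analysis.Complex_Analysis" "HOL-Computational_Algebra.Fraction_Field"
    "HOL-Computational_Algebra.Fundamental_Theorem_Algebra"
begin

text \<open>The dissipation inequality for \<open>x\<^sup>T X x / 2\<close> gives 1 from 3, and the parallelogram identity for
  extracted energies makes the available energy a quadratic form. The polynomial rows annihilating all free outputs
  are the rows of \<open>k Q\<close> for one square \<open>Q\<close>, and \<open>Q C = R (\<xi> I - A)\<close>, \<open>P = Q D + R B\<close> then describe the external
  behavior; evaluated on complex states, the dissipation inequality shows that this pair is positive-real. Conversely, a Cayley
  transform turns a positive-real pair into a discrete-time system whose supply is a nonnegative form on
  polynomial inputs, by a contour mean over the unit circle. Rank condition (b) makes the interaction of an
  initial state with past inputs bounded in this form, condition (c) handles its null module, and the resulting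
  quadratic discrete storage is a solution \<open>X\<close> of \<open>\<Omega>(X) \<ge> 0\<close>.\<close>

unbundle no fps_syntax

section \<open>Trajectories and matrix exponentials\<close>

text \<open>The hard direction is from 2 to 3. Without controllability the transfer matrix does not
  determine the system, so a storage function has to exist at unreachable states too. The discrete
  energy extractable from \<open>x\<close> is bounded because the cross term \<open>ell x\<close>
  between the free response of \<open>x\<close> and the input is bounded in the supply seminorm;
  completing the square does the rest. That seminorm is degenerate when lossless directions exist,
  so \<open>ell x\<close> first has to vanish on all null inputs, which is what (c) achieves. The
  Cayley transform is chosen because inputs become polynomial vectors, on which the argument is
  algebra plus a few norm estimates, while at the midpoint \<open>m\<close> of a step the scaled
  increment is still \<open>A m + B u\<close>. Hence a quadratic form whose discrete increments stay
  below the supply solves the original inequality up to the constant \<open>4 / a\<close>.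
  Identities in the frequency variable are proved where the needed inverses exist, off the spectrum
  of \<open>A\<close> or on part of the imaginary axis, and spread from there because polynomials
  that agree at infinitely many points coincide.\<close>

definition abs_primitive :: "(real \<Rightarrow> 'a::euclidean_space) \<Rightarrow> (real \<Rightarrow> 'a) \<Rightarrow> bool" where
  "abs_primitive g x \<longleftrightarrow> (\<forall>a b. g absolutely_integrable_on {a..b}) \<and>
     (\<forall>s t. s \<le> t \<longrightarrow> (g has_integral (x t - x s)) {s..t})"

lemma abs_primitive_continuous:
  assumes "abs_primitive g x" shows "continuous_on S x"
proof -
  have "isCont x t" for t
  proof -
    have "continuous_on {t-1..t+1} (\<lambda>r. x (t-1) + integral {t-1..r} g)"
      using assms by (intro continuous_intros indefinite_integral_continuous_1)
        (auto simp: abs_primitive_def absolutely_integrable_on_def)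
    moreover have "x (t-1) + integral {t-1..r} g = x r" if "r \<in> {t-1..t+1}" for r
    proof -
      have "(g has_integral (x r - x (t-1))) {t-1..r}"
        using assms that by (auto simp: abs_primitive_def)
      thus ?thesis by (simp add: integral_unique)
    qed
    ultimately have "continuous_on {t-1..t+1} x"
      using continuous_on_cong[of "{t-1..t+1}"] by (metis (no_types, lifting))
    thus ?thesis
      by (rule continuous_on_interior) auto
  qed
  thus ?thesis by (simp add: continuous_at_imp_continuous_on)
qed

lemma absolutely_integrable_continuous_mult:
  fixes F g :: "real \<Rightarrow> real"
  assumes "continuous_on {a..b} F" "g absolutely_integrable_on {a..b}"
  shows "(\<lambda>t. F t * g t) absolutely_integrable_on {a..b}"
  using assms by (intro absolutely_integrable_bounded_measurable_product_real
        continuous_imp_measurable_on_sets_lebesgue compact_imp_bounded compact_continuous_image) auto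

text \<open>Product rule for absolutely continuous functions, with \<open>f\<close> and
  \<open>g\<close> carried as explicit densities so that almost everywhere derivatives never appear.
  The defect \<open>H\<close> and the majorant \<open>K\<close> are both additive over adjacent
  intervals, so the estimate \<open>\<bar>H\<bar> \<le> e * K\<close> on short intervals passes to
  all intervals.\<close>

lemma abs_primitive_mult:
  fixes f g F G :: "real \<Rightarrow> real"
  assumes F: "abs_primitive f F" and G: "abs_primitive g G"
  shows "abs_primitive (\<lambda>t. F t * g t + f t * G t) (\<lambda>t. F t * G t)"
proof -
  let ?h = "\<lambda>t. F t * g t + f t * G t"
  have cF: "continuous_on S F" and cG: "continuous_on S G" for S
    using F G abs_primitive_continuous by auto
  have fi: "f absolutely_integrable_on {a..b}" and gi: "g absolutely_integrable_on {a..b}" for a b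
    using F G by (auto simp: abs_primitive_def)
  have Fg: "(\<lambda>t. F t * g t) absolutely_integrable_on {a..b}"
   and fG: "(\<lambda>t. f t * G t) absolutely_integrable_on {a..b}" for a b
    using absolutely_integrable_continuous_mult[OF cF gi, of a b]
      absolutely_integrable_continuous_mult[OF cG fi, of a b] by (auto simp: mult.commute)
  have hi: "?h absolutely_integrable_on {a..b}" for a b
    using set_integral_add(1)[OF Fg fG] by simp
  define H where "H s t = F t * G t - F s * G s - integral {s..t} ?h" for s t
  define K where "K s t = integral {s..t} (\<lambda>r. \<bar>f r\<bar> + \<bar>g r\<bar>)" for s t
  have fabs: "(\<lambda>r. \<bar>f r\<bar>) absolutely_integrable_on {a..b}"
   and gabs: "(\<lambda>r. \<bar>g r\<bar>) absolutely_integrable_on {a..b}" for a b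
    using fi gi by (blast intro: set_integrable_abs)+
  have ki: "(\<lambda>r. \<bar>f r\<bar> + \<bar>g r\<bar>) integrable_on {a..b}" for a b
    using fabs gabs by (intro integrable_add) (auto simp: absolutely_integrable_on_def)
  have hi': "?h integrable_on {a..b}" for a b using hi by (auto simp: absolutely_integrable_on_def)
  have main: "H a b = 0" if "a \<le> b" for a b
  proof -
    have "\<bar>H a b\<bar> \<le> e * K a b" if "e > 0" for e
    proof (rule Bolzano[OF \<open>a \<le> b\<close>])
      fix r s t assume *: "\<bar>H r s\<bar> \<le> e * K r s" "\<bar>H s t\<bar> \<le> e * K s t" "r \<le> s" "s \<le> t"
      have "H r t = H r s + H s t"
        unfolding H_def using Henstock_Kurzweil_Integration.integral_combine[OF *(3,4) hi'] by simp
      moreover have "K r t = K r s + K s t"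
        unfolding K_def using Henstock_Kurzweil_Integration.integral_combine[OF *(3,4) ki] by simp
      ultimately show "\<bar>H r t\<bar> \<le> e * K r t" using * by (simp add: distrib_left)
    next
      fix x assume "a \<le> x" "x \<le> b"
      have "isCont F x" "isCont G x" using cF[of UNIV] cG[of UNIV] by (auto simp: continuous_on_eq_continuous_at)
      then obtain d1 d2 where d: "d1 > 0" "d2 > 0"
        "\<And>y. dist y x < d1 \<Longrightarrow> dist (F y) (F x) < e/2" "\<And>y. dist y x < d2 \<Longrightarrow> dist (G y) (G x) < e/2"
        unfolding continuous_at_eps_delta using \<open>e > 0\<close> by (metis half_gt_zero)
      have "\<bar>H s t\<bar> \<le> e * K s t" if st: "s \<le> x" "x \<le> t" "t - s < min d1 d2" for s t
      proof -
        have "s \<le> t" using st by simp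
        have "(g has_integral (G t - G s)) {s..t}" "(f has_integral (F t - F s)) {s..t}"
          using F G \<open>s \<le> t\<close> by (auto simp: abs_primitive_def)
        \<comment> \<open>Freezing \<open>F\<close> at the right end and \<open>G\<close> at the
          left end makes this integral telescope to the exact increment of \<open>F * G\<close>; its
          integrand differs from \<open>?h\<close> only by oscillations of \<open>F\<close> and
          \<open>G\<close>.\<close>
        hence "((\<lambda>r. F t * g r + G s * f r) has_integral (F t * (G t - G s) + G s * (F t - F s))) {s..t}"
          by (intro has_integral_add has_integral_mult_right)
        moreover have "F t * (G t - G s) + G s * (F t - F s) = F t * G t - F s * G s"
          by (simp add: algebra_simps)
        ultimately have i1: "((\<lambda>r. (F t * g r + G s * f r) - ?h r) has_integral H s t) {s..t}"
          unfolding H_def using has_integral_diff[OF _ integrable_integral[OF hi']] by fastforce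
        have i2: "((\<lambda>r. e * (\<bar>f r\<bar> + \<bar>g r\<bar>)) has_integral e * K s t) {s..t}"
          unfolding K_def by (intro has_integral_mult_right integrable_integral ki)
        have i3: "norm ((F t * g r + G s * f r) - ?h r) \<le> e * (\<bar>f r\<bar> + \<bar>g r\<bar>)" if "r \<in> {s..t}" for r
        proof -
          have "dist r x < d1" "dist r x < d2" "dist t x < d1" "dist s x < d2"
            using that st by (auto simp: dist_real_def)
          hence "dist (F t) (F r) < e" "dist (G s) (G r) < e"
            using dist_triangle_half_l[OF d(3)[of t] d(3)[of r]] dist_triangle_half_l[OF d(4)[of s] d(4)[of r]] by blast+
          hence "\<bar>F t - F r\<bar> \<le> e" "\<bar>G s - G r\<bar> \<le> e" by (auto simp: dist_real_def)
          hence "\<bar>(F t - F r) * g r\<bar> + \<bar>(G s - G r) * f r\<bar> \<le> e * \<bar>g r\<bar> + e * \<bar>f r\<bar>"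
            unfolding abs_mult by (intro add_mono mult_right_mono) auto
          moreover have "(F t * g r + G s * f r) - ?h r = (F t - F r) * g r + (G s - G r) * f r"
            by (simp add: algebra_simps)
          ultimately show ?thesis
            using abs_triangle_ineq[of "(F t - F r) * g r" "(G s - G r) * f r"] by (simp add: distrib_left)
        qed
        show ?thesis
          using integral_norm_bound_integral[OF has_integral_integrable[OF i1] has_integral_integrable[OF i2] i3]
          unfolding integral_unique[OF i1] integral_unique[OF i2] by simp
      qed
      thus "\<exists>d>0. \<forall>a b. a \<le> x \<and> x \<le> b \<and> b - a < d \<longrightarrow> \<bar>H a b\<bar> \<le> e * K a b"
        using d by (intro exI[of _ "min d1 d2"]) auto
    qed
    hence *: "\<And>e. e > 0 \<Longrightarrow> \<bar>H a b\<bar> \<le> e * K a b" .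
    have "K a b \<ge> 0" unfolding K_def by (intro Henstock_Kurzweil_Integration.integral_nonneg ki) auto
    show "H a b = 0"
    proof (rule ccontr)
      assume "H a b \<noteq> 0"
      hence "\<bar>H a b\<bar> / (K a b + 1) * K a b < \<bar>H a b\<bar>" using \<open>K a b \<ge> 0\<close>
        by (simp add: field_simps)
      thus False using *[of "\<bar>H a b\<bar> / (K a b + 1)"] \<open>H a b \<noteq> 0\<close> \<open>K a b \<ge> 0\<close> by fastforce
    qed
  qed
  show ?thesis unfolding abs_primitive_def
  proof (intro conjI allI impI)
    show "?h absolutely_integrable_on {a..b}" for a b by (rule hi)
    fix s t :: real assume "s \<le> t"
    from main[OF this] have "integral {s..t} ?h = F t * G t - F s * G s" by (simp add: H_def)
    thus "(?h has_integral F t * G t - F s * G s) {s..t}" using hi' by (metis integrable_integral)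
  qed
qed

lemma abs_primitive_add:
  "abs_primitive f F \<Longrightarrow> abs_primitive g G \<Longrightarrow> abs_primitive (\<lambda>t. f t + g t) (\<lambda>t. F t + G t)"
  unfolding abs_primitive_def
  by (auto intro!: set_integral_add(1) simp: add_diff_add intro: has_integral_add)

lemma abs_primitive_zero: "abs_primitive (\<lambda>t. 0) (\<lambda>t. c)"
  unfolding abs_primitive_def by auto

lemma abs_primitive_sum:
  "finite I \<Longrightarrow> (\<And>i. i \<in> I \<Longrightarrow> abs_primitive (f i) (F i)) \<Longrightarrow>
    abs_primitive (\<lambda>t. \<Sum>i\<in>I. f i t) (\<lambda>t. \<Sum>i\<in>I. F i t)"
  by (induction I rule: finite_induct) (auto intro: abs_primitive_add abs_primitive_zero)

lemma abs_primitive_linear: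
  assumes "bounded_linear h" "abs_primitive f F"
  shows "abs_primitive (\<lambda>t. h (f t)) (\<lambda>t. h (F t))"
proof -
  have "h (F t - F s) = h (F t) - h (F s)" for s t
    by (simp add: assms(1) linear_diff bounded_linear.linear)
  moreover have "((\<lambda>t. h (f t)) has_integral h (F t - F s)) {s..t}" if "s \<le> t" for s t
    using has_integral_linear[OF _ assms(1), where f=f and y="F t - F s" and S="{s..t}"] assms(2) that
    by (simp add: abs_primitive_def o_def)
  moreover have "(\<lambda>t. h (f t)) absolutely_integrable_on {a..b}" for a b
  proof -
    have "f absolutely_integrable_on {a..b}" using assms(2) by (simp add: abs_primitive_def)
    from absolutely_integrable_linear[OF this assms(1)] show ?thesis by (simp add: o_def)
  qed
  ultimately show ?thesis by (simp add: abs_primitive_def)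
qed

lemma abs_primitive_component:
  fixes f F :: "real \<Rightarrow> real^'n"
  shows "abs_primitive f F \<Longrightarrow> abs_primitive (\<lambda>t. f t $ i) (\<lambda>t. F t $ i)"
  by (rule abs_primitive_linear[OF bounded_linear_vec_nth])

lemma abs_primitive_vecI:
  fixes f F :: "real \<Rightarrow> real^'n"
  assumes "\<And>i. abs_primitive (\<lambda>t. f t $ i) (\<lambda>t. F t $ i)"
  shows "abs_primitive f F"
proof -
  have "abs_primitive (\<lambda>t. \<Sum>i\<in>UNIV. (f t $ i) *\<^sub>R axis i 1) (\<lambda>t. \<Sum>i\<in>UNIV. (F t $ i) *\<^sub>R axis i (1::real))"
    by (intro abs_primitive_sum abs_primitive_linear[OF bounded_linear_scaleR_left] assms) auto
  moreover have "(\<Sum>i\<in>UNIV. (v $ i) *\<^sub>R axis i (1::real)) = v" for v :: "real^'n"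
    by (simp add: vec_eq_iff axis_def if_distrib cong: if_cong)
  ultimately show ?thesis by simp
qed

lemma abs_primitive_deriv:
  fixes F :: "real \<Rightarrow> real"
  assumes "\<And>t. (F has_real_derivative f t) (at t)" "continuous_on UNIV f"
  shows "abs_primitive f F"
  unfolding abs_primitive_def
proof (intro conjI allI impI)
  show "f absolutely_integrable_on {a..b}" for a b
    using assms(2) continuous_on_subset by (intro absolutely_integrable_continuous_real) blast
  fix s t :: real assume "s \<le> t"
  thus "(f has_integral F t - F s) {s..t}"
    by (intro fundamental_theorem_of_calculus)
      (auto simp flip: has_real_derivative_iff_has_vector_derivative intro: has_field_derivative_at_within assms)
qed

lemma abs_primitive_exists:
  fixes g :: "real \<Rightarrow> 'a::euclidean_space"
  assumes g: "\<And>a b. g absolutely_integrable_on {a..b}"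
  shows "\<exists>x. x c = 0 \<and> abs_primitive g x"
proof -
  have gi: "g integrable_on {a..b}" for a b using g by (auto simp: absolutely_integrable_on_def)
  define x where "x t = (if c \<le> t then integral {c..t} g else - integral {t..c} g)" for t
  have comb: "integral {a..b} g + integral {b..d} g = integral {a..d} g" if "a \<le> b" "b \<le> d" for a b d
    using Henstock_Kurzweil_Integration.integral_combine[OF that gi] .
  have "x t - x s = integral {s..t} g" if "s \<le> t" for s t
    using that comb[of c s t] comb[of s c t] comb[of s t c] by (auto simp: x_def algebra_simps)
  thus ?thesis using gi g
    by (intro exI[of _ x]) (auto simp: abs_primitive_def x_def integrable_integral)
qed

section \<open>Locally square integrable signals\<close>

lemma L2loc_measurable: "f \<in> L2loc \<Longrightarrow> f \<in> borel_measurable borel"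
  by (simp add: L2loc_def)

text \<open>One dominating function serves for the signals themselves, because
  \<open>x \<le> x\<^sup>2 + 1\<close>, and for their inner products, because
  \<open>2 a b \<le> a\<^sup>2 + b\<^sup>2\<close>.\<close>

lemma L2loc_bound:
  fixes f :: "real \<Rightarrow> real^'k" and g :: "real \<Rightarrow> real^'m"
  assumes "f \<in> L2loc" "g \<in> L2loc" "h \<in> borel_measurable borel"
    and "\<And>t. norm (h t) \<le> c * ((norm (f t))\<^sup>2 + (norm (g t))\<^sup>2 + 1)"
  shows "set_integrable lborel {a..b} (h :: real \<Rightarrow> 'b::euclidean_space)"
proof -
  have 1: "set_integrable lborel {a..b} (\<lambda>t. c * ((norm (f t))\<^sup>2 + (norm (g t))\<^sup>2 + 1))"
    using assms(1,2) borel_integrable_compact[of "{a..b}" "\<lambda>_. 1::real"]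
    by (intro set_integrable_mult_right set_integral_add)
      (auto simp: L2loc_def set_integrable_def)
  show ?thesis
    by (rule set_integrable_bound[OF 1])
      (use assms in \<open>auto simp: set_borel_measurable_def intro!: AE_I2 order_trans[OF _ abs_ge_self]\<close>)
qed

lemma square_le_norm_bound: "x \<le> x\<^sup>2 + (1::real)"
proof -
  have "0 \<le> (x - 1)\<^sup>2 + x\<^sup>2 + 1" by simp
  thus ?thesis by (simp add: power2_eq_square algebra_simps)
qed

lemma le_mult_imp_le_squares:
  fixes a b x :: real
  assumes "x \<le> a * b" "0 \<le> a * b" shows "x \<le> a\<^sup>2 + b\<^sup>2 + 1"
  using sum_squares_bound[of a b] assms by linarith

lemma set_integrable_lborel_imp_absolutely:
  fixes f :: "real \<Rightarrow> 'b::euclidean_space"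
  shows "set_integrable lborel S f \<Longrightarrow> f absolutely_integrable_on S"
  unfolding set_integrable_def by (subst integrable_completion) (auto dest: borel_measurable_integrable)

lemma L2loc_absolutely_integrable:
  fixes f :: "real \<Rightarrow> real^'k"
  assumes "f \<in> L2loc" shows "f absolutely_integrable_on {a..b}"
  using L2loc_bound[OF assms assms, of f 1 a b] L2loc_measurable[OF assms]
  by (intro set_integrable_lborel_imp_absolutely) (force simp: intro: order_trans[OF square_le_norm_bound])

lemma L2loc_inner_integrable:
  fixes f g :: "real \<Rightarrow> real^'k"
  assumes "f \<in> L2loc" "g \<in> L2loc" shows "(\<lambda>t. f t \<bullet> g t) absolutely_integrable_on {a..b}"
proof (intro set_integrable_lborel_imp_absolutely L2loc_bound[OF assms, of _ 1])
  show "(\<lambda>t. f t \<bullet> g t) \<in> borel_measurable borel"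
    using assms[THEN L2loc_measurable] by measurable
  show "norm (f t \<bullet> g t) \<le> 1 * ((norm (f t))\<^sup>2 + (norm (g t))\<^sup>2 + 1)" for t
    using le_mult_imp_le_squares[OF Cauchy_Schwarz_ineq2[of "f t" "g t"]] by simp
qed

lemma L2locI:
  fixes f :: "real \<Rightarrow> real^'k" and g :: "real \<Rightarrow> real^'m" and h :: "real \<Rightarrow> real^'l"
  assumes "f \<in> L2loc" "g \<in> L2loc" "h \<in> borel_measurable borel"
    and "\<And>t. norm (h t) \<le> c * (norm (f t) + norm (g t))"
  shows "h \<in> L2loc"
  unfolding L2loc_def
proof (safe)
  show "h \<in> borel_measurable lborel" using assms by simp
  fix a b
  have "norm ((norm (h t))\<^sup>2) \<le> (2 * c\<^sup>2) * ((norm (f t))\<^sup>2 + (norm (g t))\<^sup>2 + 1)" for t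
  proof -
    have "(norm (h t))\<^sup>2 \<le> (c * (norm (f t) + norm (g t)))\<^sup>2"
      using assms(4) by (intro power_mono) auto
    also have "\<dots> = c\<^sup>2 * (norm (f t) + norm (g t))\<^sup>2" by (simp add: power_mult_distrib)
    also have "\<dots> \<le> c\<^sup>2 * (2 * ((norm (f t))\<^sup>2 + (norm (g t))\<^sup>2))"
      using sum_squares_bound[of "norm (f t)" "norm (g t)"]
      by (intro mult_left_mono) (auto simp: power2_sum)
    also have "\<dots> \<le> (2 * c\<^sup>2) * ((norm (f t))\<^sup>2 + (norm (g t))\<^sup>2 + 1)"
      by (simp add: algebra_simps)
    finally show ?thesis by simp
  qed
  thus "set_integrable lborel {a..b} (\<lambda>t. (norm (h t))\<^sup>2)"
    using assms(3) by (intro L2loc_bound[OF assms(1,2)]) auto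
qed

lemma L2loc_add: "f \<in> L2loc \<Longrightarrow> g \<in> L2loc \<Longrightarrow> (\<lambda>t. f t + g t) \<in> L2loc"
  by (rule L2locI[of f g _ 1]) (auto simp: norm_triangle_ineq intro: borel_measurable_add L2loc_measurable)

lemma L2loc_linear:
  fixes h :: "real^'k \<Rightarrow> real^'m"
  assumes "f \<in> L2loc" "bounded_linear h" shows "(\<lambda>t. h (f t)) \<in> L2loc"
proof -
  interpret bounded_linear h by fact
  obtain K where K: "K \<ge> 0" "\<And>x. norm (h x) \<le> norm x * K" using nonneg_bounded by blast
  show ?thesis
  proof (rule L2locI[OF assms(1) assms(1), of _ K])
    have "h \<in> borel_measurable borel" by (intro borel_measurable_continuous_onI linear_continuous_on assms)
    thus "(\<lambda>t. h (f t)) \<in> borel_measurable borel"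
      using L2loc_measurable[OF assms(1)] by measurable
    show "norm (h (f t)) \<le> K * (norm (f t) + norm (f t))" for t
      using K(2)[of "f t"] mult_nonneg_nonneg[OF K(1) norm_ge_zero[of "f t"]] unfolding distrib_left mult.commute[of "norm (f t)" K] by linarith
  qed
qed

lemma L2loc_matrix: "f \<in> L2loc \<Longrightarrow> (\<lambda>t. M *v f t) \<in> L2loc"
  for f :: "real \<Rightarrow> real^'k" and M :: "real^'k^'m"
  by (rule L2loc_linear[OF _ matrix_vector_mul_bounded_linear])

lemma L2loc_scaleR: "f \<in> L2loc \<Longrightarrow> (\<lambda>t. c *\<^sub>R f t) \<in> L2loc"
  for f :: "real \<Rightarrow> real^'k"
  by (rule L2loc_linear[OF _ bounded_linear_scaleR_right])

lemma L2loc_diff: "f \<in> L2loc \<Longrightarrow> g \<in> L2loc \<Longrightarrow> (\<lambda>t. f t - g t) \<in> L2loc"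
  using L2loc_add[of f "\<lambda>t. (-1) *\<^sub>R g t"] L2loc_scaleR[of g "-1"] by simp

lemma L2loc_continuous:
  fixes f :: "real \<Rightarrow> real^'k"
  assumes "continuous_on UNIV f" shows "f \<in> L2loc"
  unfolding L2loc_def
proof safe
  show "f \<in> borel_measurable lborel" using assms by (simp add: borel_measurable_continuous_onI)
  show "set_integrable lborel {a..b} (\<lambda>t. (norm (f t))\<^sup>2)" for a b
    unfolding set_integrable_def
    by (intro borel_integrable_compact continuous_intros continuous_on_subset[OF assms]) auto
qed

lemma L2loc_If:
  fixes f g :: "real \<Rightarrow> real^'k"
  assumes "f \<in> L2loc" "g \<in> L2loc" shows "(\<lambda>t. if t < c then f t else g t) \<in> L2loc"
proof (rule L2locI[OF assms, of _ 1])
  show "(\<lambda>t. if t < c then f t else g t) \<in> borel_measurable borel"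
    using assms[THEN L2loc_measurable] by measurable
qed auto

lemma L2loc_shift:
  fixes f :: "real \<Rightarrow> real^'k"
  assumes "f \<in> L2loc" shows "(\<lambda>t. f (t + c)) \<in> L2loc"
  unfolding L2loc_def
proof safe
  show "(\<lambda>t. f (t + c)) \<in> borel_measurable lborel"
    using L2loc_measurable[OF assms] by simp
  fix a b
  have "set_integrable lborel {a+c..b+c} (\<lambda>t. (norm (f t))\<^sup>2)"
    using assms by (auto simp: L2loc_def)
  hence "integrable lborel (\<lambda>t. indicator {a+c..b+c} (c + 1 * t) *\<^sub>R (norm (f (c + 1 * t)))\<^sup>2)"
    unfolding set_integrable_def by (subst lborel_integrable_real_affine_iff) auto
  moreover have "indicator {a+c..b+c} (c + t) = (indicator {a..b} t :: real)" for t
    by (auto simp: indicator_def)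
  ultimately show "set_integrable lborel {a..b} (\<lambda>t. (norm (f (t + c)))\<^sup>2)"
    by (simp add: set_integrable_def add.commute)
qed

section \<open>Matrix powers and the matrix exponential\<close>

lemma matpow_0 [simp]: "matpow A 0 = mat 1" and matpow_Suc: "matpow A (Suc k) = A ** matpow A k"
  by (auto simp: matpow_def)

lemma matpow_Suc2: "matpow A (Suc k) = matpow A k ** A"
  by (induction k) (auto simp: matpow_Suc matrix_mul_assoc)

lemma matpow_entry_bound:
  fixes A :: "real^'d^'d"
  shows "\<bar>matpow A k $ i $ j\<bar> \<le> (\<Sum>a\<in>UNIV. \<Sum>b\<in>UNIV. \<bar>A $ a $ b\<bar>) ^ k"
proof (induction k arbitrary: i j)
  case 0 thus ?case by (simp add: mat_def)
next
  case (Suc k)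
  let ?c = "\<Sum>a\<in>UNIV. \<Sum>b\<in>UNIV. \<bar>A $ a $ b\<bar>"
  have "\<bar>matpow A (Suc k) $ i $ j\<bar> \<le> (\<Sum>l\<in>UNIV. \<bar>A $ i $ l\<bar> * \<bar>matpow A k $ l $ j\<bar>)"
    by (auto simp: matpow_Suc matrix_matrix_mult_def abs_mult intro: order_trans[OF sum_abs])
  also have "\<dots> \<le> (\<Sum>l\<in>UNIV. \<bar>A $ i $ l\<bar> * ?c ^ k)"
    by (intro sum_mono mult_left_mono Suc) auto
  also have "\<dots> = (\<Sum>l\<in>UNIV. \<bar>A $ i $ l\<bar>) * ?c ^ k" by (simp add: sum_distrib_right)
  also have "\<dots> \<le> ?c * ?c ^ k"
    by (intro mult_right_mono member_le_sum[of i UNIV "\<lambda>a. \<Sum>b\<in>UNIV. \<bar>A $ a $ b\<bar>"]) (auto intro!: sum_nonneg zero_le_power)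
  finally show ?case by simp
qed

text \<open>Defined entrywise, so that convergence and termwise differentiation are statements about
  real power series.\<close>

definition mexp :: "real^'d^'d \<Rightarrow> real \<Rightarrow> real^'d^'d" where
  "mexp A t = (\<chi> i j. \<Sum>k. (matpow A k $ i $ j / fact k) * t ^ k)"

lemma mexp_summable:
  fixes A :: "real^'d^'d"
  shows "summable (\<lambda>k. (matpow A k $ i $ j / fact k) * t ^ k)"
proof (rule summable_comparison_test)
  let ?c = "\<Sum>a\<in>UNIV. \<Sum>b\<in>UNIV. \<bar>A $ a $ b\<bar>"
  have "norm ((matpow A k $ i $ j / fact k) * t ^ k) \<le> inverse (fact k) * (?c * \<bar>t\<bar>) ^ k" for k
    using mult_right_mono[OF matpow_entry_bound[of A k i j], of "\<bar>t\<bar>^k"]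
    by (auto simp: abs_mult power_abs power_mult_distrib field_simps)
  thus "\<exists>N. \<forall>n\<ge>N. norm ((matpow A n $ i $ j / fact n) * t ^ n) \<le> inverse (fact n) * (?c * \<bar>t\<bar>) ^ n"
    by blast
  show "summable (\<lambda>n. inverse (fact n) * (?c * \<bar>t\<bar>) ^ n)" by (rule summable_exp)
qed

lemma mexp_0 [simp]: "mexp A 0 = mat 1"
  using powser_zero[of "\<lambda>k. matpow A k $ _ $ _ / fact k"]
  by (simp only: mexp_def vec_eq_iff vec_lambda_beta) simp

lemma matrix_mexp_sums:
  fixes A :: "real^'d^'d" and M :: "real^'d^'m"
  shows "(\<lambda>k. ((M ** matpow A k) $ i $ j / fact k) * t ^ k) sums ((M ** mexp A t) $ i $ j)"
proof -
  have "(\<lambda>k. \<Sum>l\<in>UNIV. M $ i $ l * ((matpow A k $ l $ j / fact k) * t ^ k)) sums (\<Sum>l\<in>UNIV. M $ i $ l * mexp A t $ l $ j)"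
    by (intro sums_sum sums_mult) (simp add: mexp_def, rule summable_sums[OF mexp_summable[unfolded times_divide_eq_left]])
  thus ?thesis by (simp add: matrix_matrix_mult_def sum_distrib_right sum_divide_distrib mult.assoc)
qed

lemma mexp_deriv_entry:
  "((\<lambda>t. mexp A t $ i $ j) has_real_derivative ((A ** mexp A t) $ i $ j)) (at t)"
proof -
  let ?c = "\<lambda>k. matpow A k $ i $ j / fact k"
  have "DERIV (\<lambda>t. \<Sum>k. ?c k * t ^ k) t :> (\<Sum>k. diffs ?c k * t ^ k)"
    by (rule termdiffs_strong_converges_everywhere) (rule mexp_summable)
  moreover have "diffs ?c k = (A ** matpow A k) $ i $ j / fact k" for k
    by (simp add: diffs_def matpow_Suc del: of_nat_Suc)
  moreover have "(\<Sum>k. (A ** matpow A k) $ i $ j / fact k * t ^ k) = (A ** mexp A t) $ i $ j"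
    using matrix_mexp_sums[of A A i j t] by (rule sums_unique[symmetric])
  ultimately show ?thesis by (simp add: mexp_def)
qed

lemma mexp_commute: "A ** mexp A t = mexp A t ** A"
proof -
  have "(\<lambda>k. (A ** matpow A k) $ i $ j / fact k * t ^ k) sums ((mexp A t ** A) $ i $ j)" for i j
  proof -
    have "(\<lambda>k. \<Sum>l\<in>UNIV. ((matpow A k $ i $ l / fact k) * t ^ k) * A $ l $ j) sums (\<Sum>l\<in>UNIV. mexp A t $ i $ l * A $ l $ j)"
      by (intro sums_sum sums_mult2) (simp add: mexp_def, rule summable_sums[OF mexp_summable[unfolded times_divide_eq_left]])
    moreover have "(\<Sum>l\<in>UNIV. ((matpow A k $ i $ l / fact k) * t ^ k) * A $ l $ j) = (A ** matpow A k) $ i $ j / fact k * t ^ k" for k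
    proof -
      have "A ** matpow A k = matpow A k ** A" using matpow_Suc matpow_Suc2 by metis
      thus ?thesis
        by (simp only:) (simp add: matrix_matrix_mult_def sum_distrib_left sum_distrib_right sum_divide_distrib mult_ac)
    qed
    ultimately show ?thesis by (simp only:) (simp add: matrix_matrix_mult_def)
  qed
  hence "(A ** mexp A t) $ i $ j = (mexp A t ** A) $ i $ j" for i j
    using matrix_mexp_sums[of A A i j t] sums_unique2 by blast
  thus ?thesis by (simp add: vec_eq_iff)
qed

lemma mexp_matrix_deriv_entry:
  fixes M :: "real^'d^'m" and A :: "real^'d^'d"
  shows "((\<lambda>t. (M ** mexp A t) $ i $ j) has_real_derivative ((M ** A ** mexp A t) $ i $ j)) (at t)"
  unfolding matrix_mul_assoc[symmetric]
  by (subst (1 2) matrix_matrix_mult_def) (auto intro!: derivative_eq_intros mexp_deriv_entry simp: mult.commute)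

lemma mexp_vec_deriv:
  fixes M :: "real^'d^'m" and A :: "real^'d^'d"
  shows "((\<lambda>t. (M ** mexp A t *v v) $ i) has_real_derivative ((M ** A ** mexp A t *v v) $ i)) (at t)"
  by (subst (1 2) matrix_vector_mult_def) (auto intro!: derivative_eq_intros mexp_matrix_deriv_entry)

text \<open>The derivative of the product is \<open>- A e^{-tA} e^{tA} + e^{-tA} A e^{tA}\<close>,
  which vanishes because \<open>A\<close> commutes with its exponential; at \<open>t = 0\<close> the
  product is the identity.\<close>

lemma mexp_minus: "mexp A (-t) ** mexp A t = mat 1"
proof -
  have "((\<lambda>t. (mexp A (-t) ** mexp A t) $ i $ j) has_real_derivative 0) (at t)" for i j t
  proof -
    have 1: "((\<lambda>t. mexp A (-t) $ i $ j) has_real_derivative - ((A ** mexp A (-t)) $ i $ j)) (at t)" for i j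
    proof -
      have "((\<lambda>t. mexp A (-t) $ i $ j) has_real_derivative (A ** mexp A (-t)) $ i $ j * (-1)) (at t)"
        by (rule DERIV_chain2[where f="\<lambda>t. mexp A t $ i $ j" and g=uminus, OF mexp_deriv_entry])
          (auto intro!: derivative_eq_intros)
      thus ?thesis by simp
    qed
    have "((\<lambda>t. \<Sum>l\<in>UNIV. mexp A (-t) $ i $ l * mexp A t $ l $ j) has_real_derivative
        (\<Sum>l\<in>UNIV. - ((A ** mexp A (-t)) $ i $ l) * mexp A t $ l $ j + mexp A (-t) $ i $ l * (A ** mexp A t) $ l $ j)) (at t)"
      by (auto intro!: derivative_eq_intros 1 mexp_deriv_entry simp: algebra_simps)
    moreover have "(\<Sum>l\<in>UNIV. - ((A ** mexp A (-t)) $ i $ l) * mexp A t $ l $ j + mexp A (-t) $ i $ l * (A ** mexp A t) $ l $ j)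
      = - (((A ** mexp A (-t)) ** mexp A t) $ i $ j) + (mexp A (-t) ** (A ** mexp A t)) $ i $ j"
      unfolding matrix_matrix_mult_def[of "A ** mexp A (-t)"] matrix_matrix_mult_def[of "mexp A (-t)"]
      by (simp add: sum.distrib sum_negf sum_subtractf)
    moreover have "\<dots> = 0" by (simp add: mexp_commute[of A "-t"] matrix_mul_assoc)
    ultimately show ?thesis by (simp add: matrix_matrix_mult_def)
  qed
  hence "(mexp A (-t) ** mexp A t) $ i $ j = (mexp A (-0) ** mexp A 0) $ i $ j" for i j
    by (intro DERIV_isconst_all) blast
  thus ?thesis by (simp add: vec_eq_iff)
qed

lemma mexp_minus': "mexp A t ** mexp A (-t) = mat 1"
  using mexp_minus[of A "-t"] by simp

lemma mexp_entry_continuous: "continuous_on S (\<lambda>t. mexp A t $ i $ j)"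
  by (intro continuous_at_imp_continuous_on ballI DERIV_isCont[OF mexp_deriv_entry])

section \<open>Storage functions and available energy\<close>

lemma UNIV_sum_type: "(\<Sum>k\<in>(UNIV::('a::finite + 'b::finite) set). h k) = (\<Sum>i\<in>UNIV. h (Inl i)) + (\<Sum>j\<in>UNIV. h (Inr j))"
  using sum.Plus[of "UNIV::'a set" "UNIV::'b set" h] by simp

lemma matrix_inner_transpose: "x \<bullet> (M *v y) = (transpose M *v x) \<bullet> (y :: real^'n)" for M :: "real^'n^'m"
  by (metis dot_lmul_matrix transpose_matrix_vector)

lemma symm_inner: "symm_mat M \<Longrightarrow> x \<bullet> (M *v y) = y \<bullet> (M *v x)" for M :: "real^'n^'n"
  by (metis inner_commute matrix_inner_transpose symm_mat_def)

text \<open>Supply \<open>u^T y\<close> minus the derivative of the storage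
  \<open>x^T X x / 2\<close> along the state equation. It is half the quadratic form of
  \<open>Omega\<close>, so the matrix inequality is a pointwise dissipation inequality.\<close>

definition dissipation :: "real^'d^'d \<Rightarrow> real^'n^'d \<Rightarrow> real^'d^'n \<Rightarrow> real^'n^'n \<Rightarrow> real^'d^'d \<Rightarrow> real^'d \<Rightarrow> real^'n \<Rightarrow> real" where
  "dissipation A B C D X x u = u \<bullet> (C *v x + D *v u) - x \<bullet> (X *v (A *v x + B *v u))"

definition stack :: "real^'d \<Rightarrow> real^'n \<Rightarrow> real^('d + 'n)" where
  "stack x u = (\<chi> k. case k of Inl i \<Rightarrow> x $ i | Inr j \<Rightarrow> u $ j)"

lemma stack_surj: "\<exists>x u. z = stack x u"
  by (rule exI[of _ "\<chi> i. z $ Inl i"], rule exI[of _ "\<chi> j. z $ Inr j"])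
    (auto simp: stack_def vec_eq_iff split: sum.split)

lemma Omega_mult_stack:
  "(Omega A B C D X *v stack x u) $ Inl i
     = ((- (transpose A ** X) - X ** A) *v x + (transpose C - X ** B) *v u) $ i"
  "(Omega A B C D X *v stack x u) $ Inr j
     = ((C - transpose B ** X) *v x + (D + transpose D) *v u) $ j"
  unfolding Omega_def stack_def by (simp_all add: matrix_vector_mult_def UNIV_sum_type)

lemma minus_matrix_vector: "(- M) *v x = - (M *v x)" for M :: "'a::comm_ring_1^'n^'m"
  by (simp add: matrix_vector_mult_def vec_eq_iff sum_negf)

lemma Omega_quadratic_form:
  assumes "symm_mat X"
  shows "stack x u \<bullet> (Omega A B C D X *v stack x u) = 2 * dissipation A B C D X x u"
proof -
  have "stack x u \<bullet> (Omega A B C D X *v stack x u)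
     = x \<bullet> ((- (transpose A ** X) - X ** A) *v x + (transpose C - X ** B) *v u)
       + u \<bullet> ((C - transpose B ** X) *v x + (D + transpose D) *v u)"
    by (simp only: inner_vec_def[of "stack x u"] inner_vec_def[of x] inner_vec_def[of u] UNIV_sum_type Omega_mult_stack)
       (simp add: stack_def)
  also have "\<dots> = 2 * dissipation A B C D X x u"
  proof -
    have 1: "(- (transpose A ** X) - X ** A) *v x = - (transpose A *v (X *v x)) - X *v (A *v x)"
      by (simp add: matrix_vector_mult_diff_rdistrib matrix_vector_mul_assoc minus_matrix_vector
        del: transpose_matrix_vector)
    have 2: "x \<bullet> (transpose A *v (X *v x)) = x \<bullet> (X *v (A *v x))"
      using symm_inner[OF assms, of "A *v x" x] by (metis matrix_inner_transpose transpose_transpose)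
    have 3: "x \<bullet> (transpose C *v u) = u \<bullet> (C *v x)"
      by (metis inner_commute matrix_inner_transpose transpose_transpose)
    have 4: "u \<bullet> (transpose B *v (X *v x)) = x \<bullet> (X *v (B *v u))"
      using symm_inner[OF assms, of "B *v u" x] by (metis matrix_inner_transpose transpose_transpose)
    have 5: "u \<bullet> (transpose D *v u) = u \<bullet> (D *v u)"
      by (metis inner_commute matrix_inner_transpose transpose_transpose)
    show ?thesis using 2 3 4 5
      unfolding dissipation_def 1
      by (simp add: matrix_vector_mult_diff_rdistrib matrix_vector_mult_add_rdistrib inner_add_right inner_diff_right
         matrix_vector_mul_assoc[symmetric] matrix_vector_right_distrib algebra_simps del: transpose_matrix_vector)
  qed
  finally show ?thesis .
qed

lemma transpose_Omega:
  assumes "symm_mat X" shows "transpose (Omega A B C D X) = Omega A B C D X"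
proof -
  have X: "X $ i $ j = X $ j $ i" for i j
    using assms by (auto simp: symm_mat_def transpose_def vec_eq_iff)
  have 1: "(transpose A ** X) $ i $ j = (X ** A) $ j $ i" for i j
    by (simp add: matrix_matrix_mult_def transpose_def X[of i] mult.commute) (simp add: X)
  have 2: "(transpose B ** X) $ i $ j = (X ** B) $ j $ i" for i j
    by (simp add: matrix_matrix_mult_def transpose_def mult.commute) (simp add: X)
  show ?thesis
    unfolding Omega_def vec_eq_iff transpose_def
    by (auto simp: 1[unfolded transpose_def] 2[unfolded transpose_def] split: sum.split)
qed

lemma psd_Omega_iff:
  assumes "symm_mat X"
  shows "psd (Omega A B C D X) \<longleftrightarrow> (\<forall>x u. 0 \<le> dissipation A B C D X x u)"
  unfolding psd_def using transpose_Omega[OF assms] Omega_quadratic_form[OF assms, of _ _ A B C D]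
  by (metis (no_types, lifting) mult_nonneg_nonneg stack_surj zero_le_mult_iff zero_less_numeral not_less zero_le_numeral)

text \<open>A quadratic polynomial that is nonnegative everywhere and zero at \<open>t = 0\<close>
  has a minimum there.\<close>

lemma linear_term_zero:
  fixes a b c :: real
  assumes "\<And>t. 0 \<le> a + t * b + t\<^sup>2 * c" "a = 0" shows "b = 0"
proof (rule ccontr)
  assume "b \<noteq> 0"
  \<comment> \<open>Enlarging \<open>c\<close> to \<open>\<bar>c\<bar> + 1\<close> keeps the
    denominator positive; at this \<open>t\<close> the enlarged quadratic is exactly zero, so the
    original one is negative.\<close>
  define t where "t = - b / (\<bar>c\<bar> + 1)"
  have "t * b + t\<^sup>2 * c \<le> t * b + t\<^sup>2 * \<bar>c\<bar>" by (simp add: mult_left_mono)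
  also have "\<dots> < t * b + t\<^sup>2 * (\<bar>c\<bar> + 1)"
  proof -
    have "t \<noteq> 0" using \<open>b \<noteq> 0\<close> by (auto simp: t_def)
    thus ?thesis by (intro add_strict_left_mono mult_strict_left_mono) auto
  qed
  also have "\<dots> = t * (b + t * (\<bar>c\<bar> + 1))" by (simp add: power2_eq_square algebra_simps)
  also have "\<dots> = 0" by (simp add: t_def)
  finally show False using assms(1)[of t] \<open>a = 0\<close> by simp
qed

lemma vector_zeroI: "(\<And>w :: real^'n. w \<bullet> v = 0) \<Longrightarrow> v = 0"
  by (metis inner_eq_zero_iff)

lemma dissipation_add:
  assumes "symm_mat X"
  shows "dissipation A B C D X (z + t *\<^sub>R x) (w + t *\<^sub>R u) = dissipation A B C D X z w
    + t * (u \<bullet> (C *v z + D *v w) + w \<bullet> (C *v x + D *v u) - x \<bullet> (X *v (A *v z + B *v w)) - z \<bullet> (X *v (A *v x + B *v u)))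
    + t\<^sup>2 * dissipation A B C D X x u"
  unfolding dissipation_def
  by (simp add: matrix_vector_right_distrib inner_add_left inner_add_right inner_diff_right
      matrix_vector_mult_scaleR algebra_simps power2_eq_square)

text \<open>Equality case of the dissipation inequality: a nonnegative quadratic form has zero
  gradient wherever it vanishes. The two equations are the block rows of \<open>Omega(X)\<close>
  applied to \<open>(z, w)\<close>; they turn losslessness into linear equations.\<close>

lemma dissipation_kernel:
  assumes "symm_mat X" "\<And>x u. 0 \<le> dissipation A B C D X x u" "dissipation A B C D X z w = 0"
  shows "transpose A *v (X *v z) + X *v (A *v z + B *v w) = transpose C *v w"
    and "C *v z + D *v w + transpose D *v w = transpose B *v (X *v z)"
proof -
  have *: "u \<bullet> (C *v z + D *v w) + w \<bullet> (C *v x + D *v u) - x \<bullet> (X *v (A *v z + B *v w)) - z \<bullet> (X *v (A *v x + B *v u)) = 0" for x u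
    by (rule linear_term_zero[of "dissipation A B C D X z w" _ "dissipation A B C D X x u"])
      (use assms dissipation_add[OF assms(1), of A B C D z _ x w u] in \<open>metis\<close>)+
  have "x \<bullet> (transpose A *v (X *v z) + X *v (A *v z + B *v w) - transpose C *v w) = 0" for x
  proof -
    have "z \<bullet> (X *v (A *v x)) = x \<bullet> (transpose A *v (X *v z))"
      by (metis inner_commute matrix_inner_transpose symm_inner[OF assms(1)] transpose_transpose)
    moreover have "w \<bullet> (C *v x) = x \<bullet> (transpose C *v w)"
      by (metis inner_commute matrix_inner_transpose)
    ultimately show ?thesis using *[of 0 x] by (simp add: inner_add_right inner_diff_right)
  qed
  thus "transpose A *v (X *v z) + X *v (A *v z + B *v w) = transpose C *v w"
    using vector_zeroI by fastforce
  have "u \<bullet> (C *v z + D *v w + transpose D *v w - transpose B *v (X *v z)) = 0" for u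
  proof -
    have "z \<bullet> (X *v (B *v u)) = u \<bullet> (transpose B *v (X *v z))"
      by (metis inner_commute matrix_inner_transpose symm_inner[OF assms(1)] transpose_transpose)
    moreover have "w \<bullet> (D *v u) = u \<bullet> (transpose D *v w)"
      by (metis inner_commute matrix_inner_transpose)
    ultimately show ?thesis using *[of u 0] by (simp add: inner_add_right inner_diff_right)
  qed
  thus "C *v z + D *v w + transpose D *v w = transpose B *v (X *v z)"
    using vector_zeroI by fastforce
qed

lemma psd_kernel:
  assumes "psd M" "v \<bullet> (M *v v) = 0" shows "M *v v = 0"
proof -
  have s: "symm_mat M" using assms by (simp add: psd_def symm_mat_def)
  have "2 * (w \<bullet> (M *v v)) = 0" for w
  proof (rule linear_term_zero[of "v \<bullet> (M *v v)" _ "w \<bullet> (M *v w)"])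
    fix t :: real
    have "0 \<le> (v + t *\<^sub>R w) \<bullet> (M *v (v + t *\<^sub>R w))" using assms by (simp add: psd_def)
    also have "\<dots> = v \<bullet> (M *v v) + t * (2 * (w \<bullet> (M *v v))) + t\<^sup>2 * (w \<bullet> (M *v w))"
      using symm_inner[OF s, of v w]
      by (simp add: matrix_vector_right_distrib inner_add_left inner_add_right matrix_vector_mult_scaleR algebra_simps power2_eq_square)
    finally show "0 \<le> v \<bullet> (M *v v) + t * (2 * (w \<bullet> (M *v v))) + t\<^sup>2 * (w \<bullet> (M *v w))" .
  qed (use assms in auto)
  thus ?thesis using vector_zeroI[of "M *v v"] by simp
qed

section \<open>Quadratic forms from the parallelogram law\<close>

lemma additive_bounded_imp_linear:
  fixes f :: "real \<Rightarrow> real"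
  assumes add: "\<And>s t. f (s + t) = f s + f t" and bd: "\<And>t. 0 \<le> t \<Longrightarrow> t \<le> 1 \<Longrightarrow> \<bar>f t\<bar> \<le> M"
  shows "f t = t * f 1"
proof -
  define g where "g t = f t - t * f 1" for t
  have gadd: "g (s + t) = g s + g t" for s t by (simp add: g_def add algebra_simps)
  have gn: "g (real n * t) = real n * g t" for n t
    by (induction n) (use gadd[of 0 0] in \<open>auto simp: gadd algebra_simps\<close>)
  have g1: "g 1 = 0" by (simp add: g_def)
  have gneg: "g (- t) = - g t" for t using gadd[of t "-t"] gadd[of 0 0] by simp
  have gint: "g (of_int k) = 0" for k
    by (cases k rule: int_cases2) (use gn[of _ 1] g1 gneg in auto)
  \<comment> \<open>\<open>g\<close> is additive and vanishes on the integers, hence has period 1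
    and inherits the bound on the unit interval everywhere; a bounded additive function is
    zero.\<close>
  have bound: "\<bar>g t\<bar> \<le> M + \<bar>f 1\<bar>" for t
  proof -
    have "g t = g (frac t)" using gadd[of "of_int \<lfloor>t\<rfloor>" "frac t"] gint by (simp add: frac_def)
    moreover have "0 \<le> frac t" "frac t \<le> 1" using frac_lt_1[of t] by auto
    moreover have "\<bar>frac t * f 1\<bar> \<le> \<bar>f 1\<bar>" using calculation by (simp add: abs_mult mult_left_le_one_le)
    ultimately show ?thesis using bd[of "frac t"] by (auto simp: g_def)
  qed
  have "g t = 0"
  proof (rule ccontr)
    assume "g t \<noteq> 0"
    then obtain n where "real n * \<bar>g t\<bar> > M + \<bar>f 1\<bar>" using reals_Archimedean3[of "\<bar>g t\<bar>"] by auto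
    thus False using bound[of "real n * t"] by (simp add: gn abs_mult)
  qed
  thus ?thesis by (simp add: g_def)
qed

text \<open>Jordan-von Neumann argument. Polarization gives an additive \<open>b\<close>; its real
  homogeneity follows from boundedness for \<open>0 \<le> t \<le> 1\<close>, and that bound comes
  from nonnegativity of \<open>S\<close> together with the parallelogram law.\<close>

lemma parallelogram_quadratic_form:
  fixes S :: "real^'d \<Rightarrow> real"
  assumes hom: "\<And>c x. S (c *\<^sub>R x) = c\<^sup>2 * S x"
    and par: "\<And>x y. S (x + y) + S (x - y) = 2 * S x + 2 * S y"
    and nn: "\<And>x. 0 \<le> S x"
  shows "\<exists>M. symm_mat M \<and> (\<forall>x. S x = x \<bullet> (M *v x))"
proof -
  define b where "b x y = (S (x + y) - S (x - y)) / 4" for x y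
  have Sm: "S (- x) = S x" for x using hom[of "-1" x] by simp
  have S0: "S 0 = 0" using hom[of 0 0] by simp
  have sym: "b x y = b y x" for x y
    using Sm[of "x - y"] by (simp add: b_def add.commute)
  have half: "b x y + b x' y = b (x + x') (2 *\<^sub>R y) / 2" for x x' y
  proof -
    have 1: "2 * S (x + y) + 2 * S (x' + y) = S (x + x' + 2 *\<^sub>R y) + S (x - x')"
      using par[of "x + y" "x' + y"] by (simp add: algebra_simps scaleR_2)
    have 2: "2 * S (x - y) + 2 * S (x' - y) = S (x + x' - 2 *\<^sub>R y) + S (x - x')"
      using par[of "x - y" "x' - y"] by (simp add: algebra_simps scaleR_2)
    show ?thesis using 1 2 by (simp add: b_def field_simps)
  qed
  have "b 0 y = 0" for y by (simp add: b_def Sm)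
  hence "b x y = b x (2 *\<^sub>R y) / 2" for x y using half[of x y 0] by simp
  hence add: "b (x + x') y = b x y + b x' y" for x x' y using half[of x y x'] by metis
  have scale: "b (c *\<^sub>R x) y = c * b x y" for c x y
  proof -
    have "b (c *\<^sub>R x) y = c * b (1 *\<^sub>R x) y"
    proof (rule additive_bounded_imp_linear[where M = "S x + S y"])
      show "b ((s + t) *\<^sub>R x) y = b (s *\<^sub>R x) y + b (t *\<^sub>R x) y" for s t by (simp add: add scaleR_add_left)
      fix t :: real assume t: "0 \<le> t" "t \<le> 1"
      have "S (t *\<^sub>R x + y) + S (t *\<^sub>R x - y) = 2 * (t\<^sup>2 * S x) + 2 * S y" using par hom by simp
      moreover have "t\<^sup>2 * S x \<le> S x" using t nn[of x] by (simp add: mult_left_le_one_le power_le_one)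
      ultimately show "\<bar>b (t *\<^sub>R x) y\<bar> \<le> S x + S y"
        using nn[of "t *\<^sub>R x + y"] nn[of "t *\<^sub>R x - y"] nn[of x] nn[of y] by (simp add: b_def abs_le_iff field_simps)
    qed
    thus ?thesis by simp
  qed
  have lin: "b (\<Sum>i\<in>I. f i) y = (\<Sum>i\<in>I. b (f i) y)" if "finite I" for I :: "'d set" and f y
    using that by (induction I rule: finite_induct) (auto simp: add \<open>\<And>y. b 0 y = 0\<close>)
  have expand: "b x y = (\<Sum>i\<in>UNIV. x $ i * b (axis i 1) y)" for x y
  proof -
    have "b x y = b (\<Sum>i\<in>UNIV. (x $ i) *\<^sub>R axis i 1) y"
      using basis_expansion[of x] by (simp add: scalar_mult_eq_scaleR)
    thus ?thesis by (simp add: lin scale)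
  qed
  define M where "M = (\<chi> i j. b (axis i 1) (axis j 1))"
  have "S x = x \<bullet> (M *v x)" for x
  proof -
    have "S x = b x x" using hom[of 2 x] S0 by (simp add: b_def flip: scaleR_2)
    also have "\<dots> = (\<Sum>i\<in>UNIV. x $ i * b x (axis i 1))" by (subst expand) (simp add: sym)
    also have "\<dots> = (\<Sum>i\<in>UNIV. x $ i * (\<Sum>j\<in>UNIV. x $ j * b (axis i 1) (axis j 1)))"
      by (subst expand) (simp add: sym)
    finally show ?thesis by (simp add: M_def inner_vec_def matrix_vector_mult_def mult.commute)
  qed
  moreover have "symm_mat M" by (simp add: M_def symm_mat_def transpose_def vec_eq_iff sym)
  ultimately show ?thesis by blast
qed

text \<open>Shared by the continuous-time and the discrete-time available energies. Attained values
  can only be compared pairwise, so \<open>par\<close> yields one inequality between suprema; the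
  reverse one follows by applying it to \<open>x + y\<close> and \<open>x - y\<close> and using
  homogeneity.\<close>

lemma Sup_value_quadratic_form:
  fixes V :: "real^'d \<Rightarrow> real set"
  assumes zero: "\<And>x. 0 \<in> V x" and bdd: "\<And>x. bdd_above (V x)"
    and hom: "\<And>x v c. v \<in> V x \<Longrightarrow> c\<^sup>2 * v \<in> V (c *\<^sub>R x)"
    and par: "\<And>x y v w. v \<in> V x \<Longrightarrow> w \<in> V y \<Longrightarrow> \<exists>a\<in>V (x + y). \<exists>b\<in>V (x - y). a + b = 2 * v + 2 * w"
  shows "\<exists>M. symm_mat M \<and> (\<forall>x. Sup (V x) = x \<bullet> (M *v x))"
proof (rule parallelogram_quadratic_form)
  let ?S = "\<lambda>x. Sup (V x)"
  show nn: "0 \<le> ?S x" for x using zero bdd by (simp add: cSup_upper)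
  have le: "c\<^sup>2 * ?S x \<le> ?S (c *\<^sub>R x)" if "c \<noteq> 0" for c x
  proof -
    have "v \<le> ?S (c *\<^sub>R x) / c\<^sup>2" if "v \<in> V x" for v
      using cSup_upper[OF hom[OF that, of c] bdd] \<open>c \<noteq> 0\<close> by (simp add: field_simps)
    hence "?S x \<le> ?S (c *\<^sub>R x) / c\<^sup>2" using zero by (intro cSup_least) auto
    thus ?thesis using that by (simp add: field_simps)
  qed
  have nz: "?S (c *\<^sub>R x) = c\<^sup>2 * ?S x" if "c \<noteq> 0" for c x
    using le[OF that, of x] le[of "inverse c" "c *\<^sub>R x"] that by (simp add: field_simps)
  have "?S 0 = 0" using nz[of 2 0] by simp
  thus hom': "?S (c *\<^sub>R x) = c\<^sup>2 * ?S x" for c x using nz by (cases "c = 0") auto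
  have par1: "2 * ?S x + 2 * ?S y \<le> ?S (x + y) + ?S (x - y)" for x y
  proof -
    have *: "2 * v + 2 * w \<le> ?S (x + y) + ?S (x - y)" if "v \<in> V x" "w \<in> V y" for v w
      using par[OF that] cSup_upper[OF _ bdd] by (metis add_mono)
    have "w \<le> (?S (x + y) + ?S (x - y)) / 2 - v" if "v \<in> V x" "w \<in> V y" for v w
      using *[OF that] by (simp add: field_simps)
    hence "?S y \<le> (?S (x + y) + ?S (x - y)) / 2 - v" if "v \<in> V x" for v
      using zero that by (intro cSup_least) auto
    hence "v \<le> (?S (x + y) + ?S (x - y)) / 2 - ?S y" if "v \<in> V x" for v
      using that by (smt (verit))
    hence "?S x \<le> (?S (x + y) + ?S (x - y)) / 2 - ?S y"
      using zero by (intro cSup_least) auto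
    thus ?thesis by (simp add: field_simps)
  qed
  show "?S (x + y) + ?S (x - y) = 2 * ?S x + 2 * ?S y" for x y
  proof -
    have "2 * ?S (x + y) + 2 * ?S (x - y) \<le> ?S (2 *\<^sub>R x) + ?S (2 *\<^sub>R y)"
      using par1[of "x + y" "x - y"] by (simp add: scaleR_2)
    thus ?thesis using par1[of x y] hom'[of 2] by simp
  qed
qed

text \<open>Krylov argument: among \<open>z, A z, ..., A^d z\<close> some vector lies in the span of
  its predecessors; that span is \<open>A\<close>-invariant, and \<open>C\<close> vanishes on
  it.\<close>

lemma Vo_kernel_all:
  fixes A :: "real^'d^'d"
  assumes "Vo_kernel C A z" shows "(C ** matpow A k) *v z = 0"
proof -
  define w where "w k = matpow A k *v z" for k
  have wS: "w (Suc k) = A *v w k" for k by (simp add: w_def matpow_Suc matrix_vector_mul_assoc)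
  have "\<exists>m\<le>CARD('d). w m \<in> span (w ` {..<m})"
  proof (rule ccontr)
    assume *: "\<not> ?thesis"
    have "m \<le> Suc CARD('d) \<Longrightarrow> independent (w ` {..<m}) \<and> card (w ` {..<m}) = m" for m
    proof (induction m)
      case (Suc m)
      hence n: "w m \<notin> span (w ` {..<m})" using * by simp
      hence "w m \<notin> w ` {..<m}" by (meson span_base)
      thus ?case using Suc n by (simp add: lessThan_Suc independent_insert)
    qed (simp add: real_vector.independent_empty)
    from this[of "Suc CARD('d)"] have "independent (w ` {..<Suc CARD('d)})" "card (w ` {..<Suc CARD('d)}) = Suc CARD('d)"
      by auto
    thus False using independent_bound[of "w ` {..<Suc CARD('d)}"] by simp
  qed
  then obtain m where m: "m \<le> CARD('d)" "w m \<in> span (w ` {..<m})" by blast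
  have inv: "A *v v \<in> span (w ` {..<m})" if "v \<in> span (w ` {..<m})" for v
  proof -
    have "A *v v \<in> span ((*v) A ` w ` {..<m})"
      using that by (metis image_eqI linear_span_image matrix_vector_mul_linear)
    also have "\<dots> \<subseteq> span (w ` {..<m})"
    proof (rule span_minimal[OF _ subspace_span], safe)
      fix k assume "k < m"
      hence "w (Suc k) \<in> span (w ` {..<m})"
        using m(2) by (cases "Suc k = m") (auto intro!: span_base simp del: wS)
      thus "A *v w k \<in> span (w ` {..<m})" by (simp only: wS)
    qed
    finally show ?thesis .
  qed
  have "w k \<in> span (w ` {..<m})" for k
  proof (induction k)
    case 0 thus ?case using m(2) by (cases m) (auto intro: span_base)
  qed (simp add: wS inv)
  moreover have "span (w ` {..<m}) \<subseteq> {v. C *v v = 0}"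
  proof (rule span_minimal)
    show "w ` {..<m} \<subseteq> {v. C *v v = 0}"
      using assms m(1) by (auto simp: Vo_kernel_def w_def matrix_vector_mul_assoc)
    show "subspace {v. C *v v = 0}"
      by (auto simp: subspace_def matrix_vector_right_distrib matrix_vector_mult_scaleR)
  qed
  ultimately show ?thesis by (auto simp: w_def simp flip: matrix_vector_mul_assoc)
qed

lemma Vo_kernelI:
  assumes inv: "\<And>z. z \<in> K \<Longrightarrow> A *v z \<in> K" and C: "\<And>z. z \<in> K \<Longrightarrow> C *v z = 0" and "z \<in> K"
  shows "Vo_kernel C A z"
proof -
  have "matpow A k *v z \<in> K" for k
    using inv \<open>z \<in> K\<close> by (induction k) (auto simp: matpow_Suc simp flip: matrix_vector_mul_assoc)
  thus ?thesis using C by (auto simp: Vo_kernel_def simp flip: matrix_vector_mul_assoc)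
qed

text \<open>On the kernel of \<open>X\<close> the dissipation with zero input vanishes, so the
  equality case applies: the kernel is \<open>A\<close>-invariant and contained in the kernel of
  \<open>C\<close>.\<close>

lemma kernel_imp_Vo_kernel:
  assumes "psd X" "symm_mat X" "psd (Omega A B C D X)" "X *v z = 0"
  shows "Vo_kernel C A z"
proof (rule Vo_kernelI[of "{z. X *v z = 0}"])
  have d: "0 \<le> dissipation A B C D X x u" for x u using assms psd_Omega_iff by blast
  have *: "X *v (A *v z) = 0 \<and> C *v z = 0" if "X *v z = 0" for z
  proof -
    have "z \<bullet> (X *v (A *v z)) = 0" using symm_inner[OF assms(2)] that by (metis inner_zero_right)
    hence "dissipation A B C D X z 0 = 0" by (simp add: dissipation_def)
    from dissipation_kernel[OF assms(2) d this] that show ?thesis by simp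
  qed
  show "A *v z \<in> {z. X *v z = 0}" "C *v z = 0" if "z \<in> {z. X *v z = 0}" for z
    using * that by auto
qed (use assms in auto)

section \<open>Trajectories, extracted energy and its supremum\<close>

definition trajectory :: "real^'d^'d \<Rightarrow> real^'n^'d \<Rightarrow> (real \<Rightarrow> real^'n) \<Rightarrow> (real \<Rightarrow> real^'d) \<Rightarrow> bool" where
  "trajectory A B u x \<longleftrightarrow> u \<in> L2loc \<and> abs_primitive (\<lambda>t. A *v x t + B *v u t) x"

lemma trajectory_L2loc: "trajectory A B u x \<Longrightarrow> u \<in> L2loc \<and> x \<in> L2loc"
  unfolding trajectory_def using abs_primitive_continuous L2loc_continuous by blast

lemma trajectory_output_L2loc: "trajectory A B u x \<Longrightarrow> (\<lambda>t. C *v x t + D *v u t) \<in> L2loc"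
  by (intro L2loc_add L2loc_matrix) (auto dest: trajectory_L2loc)

lemma state_behavior_iff:
  "(u, y, x) \<in> state_behavior A B C D \<longleftrightarrow>
     y \<in> L2loc \<and> trajectory A B u x \<and> (AE t in lborel. y t = C *v x t + D *v u t)"
proof -
  have "abs_primitive (\<lambda>t. A *v x t + B *v u t) x \<longleftrightarrow> x \<in> L2loc \<and> (\<forall>s t. s \<le> t \<longrightarrow>
     ((\<lambda>\<tau>. A *v x \<tau> + B *v u \<tau>) has_integral (x t - x s)) {s..t})" if "u \<in> L2loc"
  proof
    assume "abs_primitive (\<lambda>t. A *v x t + B *v u t) x"
    thus "x \<in> L2loc \<and> (\<forall>s t. s \<le> t \<longrightarrow>
        ((\<lambda>\<tau>. A *v x \<tau> + B *v u \<tau>) has_integral (x t - x s)) {s..t})"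
      using abs_primitive_continuous L2loc_continuous unfolding abs_primitive_def by blast
  next
    assume *: "x \<in> L2loc \<and> (\<forall>s t. s \<le> t \<longrightarrow>
        ((\<lambda>\<tau>. A *v x \<tau> + B *v u \<tau>) has_integral (x t - x s)) {s..t})"
    hence "(\<lambda>t. A *v x t + B *v u t) absolutely_integrable_on {a..b}" for a b
      using that by (intro L2loc_absolutely_integrable L2loc_add L2loc_matrix) auto
    thus "abs_primitive (\<lambda>t. A *v x t + B *v u t) x" using * by (simp add: abs_primitive_def)
  qed
  thus ?thesis unfolding state_behavior_def trajectory_def by auto
qed

lemma AE_lborel_negligible:
  assumes "AE t in lborel. P (t::real)" shows "\<exists>N. negligible N \<and> (\<forall>t. t \<notin> N \<longrightarrow> P t)"
proof -
  obtain N where "N \<in> null_sets lborel" "{t \<in> space lborel. \<not> P t} \<subseteq> N"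
    using assms unfolding eventually_ae_filter by blast
  thus ?thesis by (intro exI[of _ N]) (auto simp: negligible_iff_null_sets null_sets_completionI)
qed

definition extracted :: "real^'d^'n \<Rightarrow> real^'n^'n \<Rightarrow> (real \<Rightarrow> real^'n) \<Rightarrow> (real \<Rightarrow> real^'d) \<Rightarrow> real \<Rightarrow> real \<Rightarrow> real" where
  "extracted C D u x s t = integral {s..t} (\<lambda>r. - (u r \<bullet> (C *v x r + D *v u r)))"

definition extractable :: "real^'d^'d \<Rightarrow> real^'n^'d \<Rightarrow> real^'d^'n \<Rightarrow> real^'n^'n \<Rightarrow> real \<Rightarrow> real^'d \<Rightarrow> real set" where
  "extractable A B C D t0 x0 = {extracted C D u x t0 t1 | u x t1. t0 \<le> t1 \<and> trajectory A B u x \<and> x t0 = x0}"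

text \<open>\<open>state_behavior\<close> fixes the output only almost everywhere. Integrals do not
  see this, so the output may be taken to be \<open>C x + D u\<close> at every time.\<close>

lemma available_energy_eq: "available_energy A B C D t0 x0 = Sup (ereal ` extractable A B C D t0 x0)"
proof -
  have "{ereal (integral {t0..t1} (\<lambda>t. - (u t \<bullet> y t))) | t1 u y x.
            t1 \<ge> t0 \<and> (u, y, x) \<in> state_behavior A B C D \<and> x t0 = x0} = ereal ` extractable A B C D t0 x0"
    (is "?L = ?R")
  proof (rule antisym; rule subsetI)
    fix e assume "e \<in> ?L"
    then obtain t1 u y x where *: "e = ereal (integral {t0..t1} (\<lambda>t. - (u t \<bullet> y t)))" "t1 \<ge> t0"
      "(u, y, x) \<in> state_behavior A B C D" "x t0 = x0" by blast
    then obtain N where N: "negligible N" "\<And>t. t \<notin> N \<Longrightarrow> y t = C *v x t + D *v u t"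
      using AE_lborel_negligible[of "\<lambda>t. y t = C *v x t + D *v u t"] by (auto simp: state_behavior_iff)
    have "integral {t0..t1} (\<lambda>t. - (u t \<bullet> y t)) = extracted C D u x t0 t1"
      unfolding extracted_def by (rule integral_spike[OF N(1)]) (use N(2) in auto)
    thus "e \<in> ?R" using * unfolding extractable_def state_behavior_iff by blast
  next
    fix e assume "e \<in> ?R"
    then obtain u x t1 where *: "e = ereal (extracted C D u x t0 t1)" "t0 \<le> t1" "trajectory A B u x" "x t0 = x0"
      by (auto simp: extractable_def)
    hence "(u, \<lambda>t. C *v x t + D *v u t, x) \<in> state_behavior A B C D"
      by (simp add: state_behavior_iff trajectory_output_L2loc)
    thus "e \<in> ?L" unfolding *(1) extracted_def
      using * by (intro CollectI exI[of _ t1] exI[of _ u] exI[of _ "\<lambda>t. C *v x t + D *v u t"] exI[of _ x]) auto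
  qed
  thus ?thesis by (simp add: available_energy_def)
qed

lemma supply_integrable:
  assumes "trajectory A B u x"
  shows "(\<lambda>r. - (u r \<bullet> (C *v x r + D *v u r))) integrable_on {s..t}"
proof -
  have "(\<lambda>r. u r \<bullet> (C *v x r + D *v u r)) absolutely_integrable_on {s..t}"
    using trajectory_L2loc[OF assms] by (intro L2loc_inner_integrable trajectory_output_L2loc[OF assms]) auto
  thus ?thesis by (simp add: absolutely_integrable_on_def integrable_neg)
qed

lemma extracted_split:
  "trajectory A B u x \<Longrightarrow> s \<le> r \<Longrightarrow> r \<le> t \<Longrightarrow> extracted C D u x s t = extracted C D u x s r + extracted C D u x r t"
  unfolding extracted_def
  by (rule Henstock_Kurzweil_Integration.integral_combine[symmetric]) (auto intro: supply_integrable)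

lemma abs_primitive_quadratic:
  assumes "abs_primitive g x" "symm_mat X"
  shows "abs_primitive (\<lambda>t. 2 * (x t \<bullet> (X *v g t))) (\<lambda>t. x t \<bullet> (X *v x t))"
proof -
  have "abs_primitive (\<lambda>t. X *v g t) (\<lambda>t. X *v x t)"
    by (rule abs_primitive_linear[OF matrix_vector_mul_bounded_linear assms(1)])
  hence "abs_primitive (\<lambda>t. \<Sum>i\<in>UNIV. x t $ i * (X *v g t) $ i + g t $ i * (X *v x t) $ i)
     (\<lambda>t. \<Sum>i\<in>UNIV. x t $ i * (X *v x t) $ i)"
    by (intro abs_primitive_sum abs_primitive_mult abs_primitive_component assms) auto
  moreover have "(\<Sum>i\<in>UNIV. x t $ i * (X *v g t) $ i + g t $ i * (X *v x t) $ i) = 2 * (x t \<bullet> (X *v g t))" for t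
    using symm_inner[OF assms(2), of "g t" "x t"] by (simp add: sum.distrib inner_vec_def)
  ultimately show ?thesis by (simp add: inner_vec_def)
qed

lemma extracted_le_storage:
  assumes X: "symm_mat X" "\<And>x u. 0 \<le> dissipation A B C D X x u"
    and tr: "trajectory A B u x" and "s \<le> t"
  shows "extracted C D u x s t \<le> 1/2 * (x s \<bullet> (X *v x s)) - 1/2 * (x t \<bullet> (X *v x t))"
proof -
  have "abs_primitive (\<lambda>t. A *v x t + B *v u t) x" using tr by (simp add: trajectory_def)
  from abs_primitive_quadratic[OF this X(1)] \<open>s \<le> t\<close>
  have "((\<lambda>r. 2 * (x r \<bullet> (X *v (A *v x r + B *v u r)))) has_integral (x t \<bullet> (X *v x t) - x s \<bullet> (X *v x s))) {s..t}"
    by (simp add: abs_primitive_def)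
  from has_integral_mult_right[OF this, of "-1/2"]
  have i: "((\<lambda>r. - (x r \<bullet> (X *v (A *v x r + B *v u r)))) has_integral
     (1/2 * (x s \<bullet> (X *v x s)) - 1/2 * (x t \<bullet> (X *v x t)))) {s..t}"
    by (simp add: algebra_simps)
  show ?thesis unfolding extracted_def integral_unique[OF i, symmetric]
    by (intro integral_le supply_integrable[OF tr] has_integral_integrable[OF i])
      (use X(2) in \<open>simp add: dissipation_def\<close>)
qed

lemma storage_bound:
  assumes "psd X" "psd (Omega A B C D X)" "v \<in> extractable A B C D t0 x0"
  shows "v \<le> 1/2 * (x0 \<bullet> (X *v x0))"
proof -
  have X: "symm_mat X" using assms by (simp add: psd_def symm_mat_def)
  hence d: "0 \<le> dissipation A B C D X x u" for x u using assms psd_Omega_iff by blast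
  obtain u x t1 where *: "v = extracted C D u x t0 t1" "t0 \<le> t1" "trajectory A B u x" "x t0 = x0"
    using assms by (auto simp: extractable_def)
  have "0 \<le> x t1 \<bullet> (X *v x t1)" using assms by (simp add: psd_def)
  thus ?thesis using extracted_le_storage[OF X d *(3,2)] * by simp
qed

theorem storage_imp_finite:
  assumes "psd X" "psd (Omega A B C D X)" shows "available_energy A B C D t0 x0 < \<infinity>"
proof -
  have "available_energy A B C D t0 x0 \<le> ereal (1/2 * (x0 \<bullet> (X *v x0)))"
    unfolding available_energy_eq using storage_bound[OF assms] by (intro Sup_least) auto
  from le_less_trans[OF this, of \<infinity>] show ?thesis by simp
qed

text \<open>Variation of constants: \<open>x = e^{A(r-s)} z\<close>, where \<open>z\<close> starts
  at \<open>x0\<close> and is a primitive of \<open>e^{-A(r-s)} B u\<close>. The input is merely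
  locally integrable, so the product is differentiated through \<open>abs_primitive_mult\<close>,
  entry by entry.\<close>

lemma solution_exists:
  assumes "u \<in> L2loc" shows "\<exists>x. x s = x0 \<and> trajectory A B u x"
proof -
  define g where "g r = mexp A (- (r - s)) *v (B *v u r)" for r
  have Bu: "(\<lambda>r. B *v u r) absolutely_integrable_on {a..b}" for a b
    by (intro L2loc_absolutely_integrable L2loc_matrix assms)
  have Bui: "(\<lambda>r. (B *v u r) $ j) absolutely_integrable_on {a..b}" for a b j
    using absolutely_integrable_linear[OF Bu bounded_linear_vec_nth] by (simp add: o_def)
  have gi: "(\<lambda>r. g r $ i) absolutely_integrable_on {a..b}" for i a b
  proof -
    have "(\<lambda>r. mexp A (- (r - s)) $ i $ j * (B *v u r) $ j) absolutely_integrable_on {a..b}" for j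
      by (intro absolutely_integrable_continuous_mult Bui
           continuous_on_compose2[OF mexp_entry_continuous[of UNIV]] continuous_intros) auto
    hence "(\<lambda>r. \<Sum>j\<in>UNIV. mexp A (- (r - s)) $ i $ j * (B *v u r) $ j) absolutely_integrable_on {a..b}"
      by (intro absolutely_integrable_sum) auto
    thus ?thesis by (simp add: g_def matrix_vector_mult_def[of "mexp A _"])
  qed
  have "\<exists>w. \<forall>i. w i s = 0 \<and> abs_primitive (\<lambda>r. g r $ i) (w i)"
    using abs_primitive_exists[OF gi] by metis
  then obtain w where w: "\<And>i. w i s = 0" "\<And>i. abs_primitive (\<lambda>r. g r $ i) (w i)" by blast
  define z where "z r = x0 + (\<chi> i. w i r)" for r
  define x where "x r = mexp A (r - s) *v z r" for r
  have zp: "abs_primitive (\<lambda>r. g r $ i) (\<lambda>r. z r $ i)" for i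
    using abs_primitive_add[OF abs_primitive_zero[of "x0 $ i"] w(2)[of i]] by (simp add: z_def)
  have Ep: "abs_primitive (\<lambda>r. (A ** mexp A (r - s)) $ i $ j) (\<lambda>r. mexp A (r - s) $ i $ j)" for i j
  proof (rule abs_primitive_deriv)
    have "((\<lambda>r. mexp A (r - s) $ i $ j) has_real_derivative (A ** mexp A (r - s)) $ i $ j * 1) (at r)" for r
      by (rule DERIV_chain2[where f="\<lambda>r. mexp A r $ i $ j" and g="\<lambda>r. r - s", OF mexp_deriv_entry])
        (auto intro!: derivative_eq_intros)
    thus "((\<lambda>r. mexp A (r - s) $ i $ j) has_real_derivative (A ** mexp A (r - s)) $ i $ j) (at r)" for r by simp
    show "continuous_on UNIV (\<lambda>r. (A ** mexp A (r - s)) $ i $ j)"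
      unfolding matrix_matrix_mult_def vec_lambda_beta
      by (intro continuous_intros continuous_on_compose2[OF mexp_entry_continuous[of UNIV]]) auto
  qed
  have "abs_primitive (\<lambda>r. (A *v x r + B *v u r) $ i) (\<lambda>r. x r $ i)" for i
  proof -
    have "abs_primitive (\<lambda>r. \<Sum>j\<in>UNIV. mexp A (r - s) $ i $ j * g r $ j + (A ** mexp A (r - s)) $ i $ j * z r $ j)
       (\<lambda>r. \<Sum>j\<in>UNIV. mexp A (r - s) $ i $ j * z r $ j)"
      by (intro abs_primitive_sum abs_primitive_mult zp Ep) auto
    moreover have "(\<Sum>j\<in>UNIV. mexp A (r - s) $ i $ j * g r $ j + (A ** mexp A (r - s)) $ i $ j * z r $ j)
       = (A *v x r + B *v u r) $ i" for r
    proof -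
      have "mexp A (r - s) *v g r = B *v u r"
        using mexp_minus'[of A "r - s"] by (simp add: g_def matrix_vector_mul_assoc)
          (metis matrix_mul_lid matrix_mul_assoc)
      moreover have "(A ** mexp A (r - s)) *v z r = A *v x r" by (simp add: x_def matrix_vector_mul_assoc)
      moreover have "(\<Sum>j\<in>UNIV. mexp A (r - s) $ i $ j * g r $ j + (A ** mexp A (r - s)) $ i $ j * z r $ j)
          = (mexp A (r - s) *v g r) $ i + ((A ** mexp A (r - s)) *v z r) $ i"
        by (simp add: matrix_vector_mult_def sum.distrib)
      ultimately show ?thesis by (simp add: add.commute)
    qed
    ultimately show ?thesis by (simp add: x_def matrix_vector_mult_def[of "mexp A _"])
  qed
  hence "trajectory A B u x"
    unfolding trajectory_def using assms by (intro conjI abs_primitive_vecI) auto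
  moreover have "x s = x0" by (simp add: x_def z_def w(1) zero_vec_def[symmetric])
  ultimately show ?thesis by blast
qed

lemma trajectory_add:
  "trajectory A B u x \<Longrightarrow> trajectory A B v z \<Longrightarrow> trajectory A B (\<lambda>t. u t + v t) (\<lambda>t. x t + z t)"
  unfolding trajectory_def
  using abs_primitive_add[of "\<lambda>t. A *v x t + B *v u t" x "\<lambda>t. A *v z t + B *v v t" z]
  by (auto intro: L2loc_add simp: matrix_vector_right_distrib algebra_simps)

lemma trajectory_scale:
  "trajectory A B u x \<Longrightarrow> trajectory A B (\<lambda>t. c *\<^sub>R u t) (\<lambda>t. c *\<^sub>R x t)"
  unfolding trajectory_def
  using abs_primitive_linear[OF bounded_linear_scaleR_right, of "\<lambda>t. A *v x t + B *v u t" x c]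
  by (auto intro: L2loc_scaleR simp: matrix_vector_mult_scaleR scaleR_add_right)

lemma trajectory_diff:
  "trajectory A B u x \<Longrightarrow> trajectory A B v z \<Longrightarrow> trajectory A B (\<lambda>t. u t - v t) (\<lambda>t. x t - z t)"
  using trajectory_add[of A B u x "\<lambda>t. (-1) *\<^sub>R v t" "\<lambda>t. (-1) *\<^sub>R z t"] trajectory_scale[of A B v z "-1"] by simp

lemma trajectory_concat:
  assumes 1: "trajectory A B u1 x1" and 2: "trajectory A B u2 x2" and eq: "x1 c = x2 c"
  shows "trajectory A B (\<lambda>t. if t < c then u1 t else u2 t) (\<lambda>t. if t < c then x1 t else x2 t)"
proof -
  let ?u = "\<lambda>t. if t < c then u1 t else u2 t" and ?x = "\<lambda>t. if t < c then x1 t else x2 t"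
  let ?g = "\<lambda>t. A *v ?x t + B *v ?u t"
  have u: "?u \<in> L2loc" and x: "?x \<in> L2loc" using 1 2 by (auto intro!: L2loc_If dest: trajectory_L2loc)
  have g1: "((\<lambda>t. A *v x1 t + B *v u1 t) has_integral (x1 t - x1 s)) {s..t}"
   and g2: "((\<lambda>t. A *v x2 t + B *v u2 t) has_integral (x2 t - x2 s)) {s..t}" if "s \<le> t" for s t
    using 1 2 that by (auto simp: trajectory_def abs_primitive_def)
  have left: "(?g has_integral (x1 t - x1 s)) {s..t}" if "s \<le> t" "t \<le> c" for s t
    by (rule has_integral_spike_finite[OF _ _ g1[OF that(1)], of "{c}"]) (use that in auto)
  have right: "(?g has_integral (x2 t - x2 s)) {s..t}" if "s \<le> t" "c \<le> s" for s t
    by (rule has_integral_spike_finite[OF _ _ g2[OF that(1)], of "{}"]) (use that in auto)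
  have "(?g has_integral (?x t - ?x s)) {s..t}" if "s \<le> t" for s t
  proof (cases "t < c")
    case True thus ?thesis using left[of s t] that by simp
  next
    case False
    show ?thesis
    proof (cases "s < c")
      case True
      hence "(?g has_integral ((x1 c - x1 s) + (x2 t - x2 c))) {s..t}"
        using False by (intro has_integral_combine[of s c t] left right) auto
      thus ?thesis using True False eq by simp
    next
      case c: False
      thus ?thesis using right[of s t] that False by simp
    qed
  qed
  moreover have "?g absolutely_integrable_on {a..b}" for a b
    by (intro L2loc_absolutely_integrable L2loc_add L2loc_matrix u x)
  ultimately show ?thesis using u by (simp only: trajectory_def abs_primitive_def) blast
qed

lemma has_integral_shift:
  fixes f :: "real \<Rightarrow> 'a::euclidean_space"
  assumes "(f has_integral i) {s + c..t + c}"
  shows "((\<lambda>r. f (r + c)) has_integral i) {s..t}"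
proof -
  have "(\<lambda>r::real. r - c) ` {s + c..t + c} = {s..t}"
    by (auto simp: image_iff intro!: bexI[of _ "_ + c"])
  thus ?thesis using has_integral_affinity[of f i "s + c" "t + c" 1 c] assms
    by (simp add: cbox_interval)
qed

lemma trajectory_shift:
  assumes "trajectory A B u x" shows "trajectory A B (\<lambda>t. u (t + c)) (\<lambda>t. x (t + c))"
proof -
  have "((\<lambda>r. A *v x (r + c) + B *v u (r + c)) has_integral (x (t + c) - x (s + c))) {s..t}" if "s \<le> t" for s t
    by (rule has_integral_shift[of "\<lambda>r. A *v x r + B *v u r"]) (use assms that in \<open>simp add: trajectory_def abs_primitive_def\<close>)
  moreover have u: "(\<lambda>t. u (t + c)) \<in> L2loc" and "(\<lambda>t. x (t + c)) \<in> L2loc"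
    using trajectory_L2loc[OF assms] by (auto intro: L2loc_shift)
  moreover have "(\<lambda>r. A *v x (r + c) + B *v u (r + c)) absolutely_integrable_on {a..b}" for a b
    using calculation by (intro L2loc_absolutely_integrable L2loc_add L2loc_matrix) auto
  ultimately show ?thesis by (simp add: trajectory_def abs_primitive_def)
qed

lemma extracted_shift:
  assumes "trajectory A B u x"
  shows "extracted C D (\<lambda>t. u (t + c)) (\<lambda>t. x (t + c)) s t = extracted C D u x (s + c) (t + c)"
  unfolding extracted_def
  using has_integral_shift[OF integrable_integral[OF supply_integrable[OF assms, of C D "s + c" "t + c"]]]
  by (rule integral_unique)

lemma extracted_concat:
  assumes 1: "trajectory A B u1 x1" and 2: "trajectory A B u2 x2" and eq: "x1 c = x2 c" and "s \<le> c" "c \<le> t"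
  shows "extracted C D (\<lambda>t. if t < c then u1 t else u2 t) (\<lambda>t. if t < c then x1 t else x2 t) s t
    = extracted C D u1 x1 s c + extracted C D u2 x2 c t"
proof -
  let ?u = "\<lambda>t. if t < c then u1 t else u2 t" and ?x = "\<lambda>t. if t < c then x1 t else x2 t"
  have "extracted C D ?u ?x s c = extracted C D u1 x1 s c"
    unfolding extracted_def by (rule integral_spike[of "{c}"]) auto
  moreover have "extracted C D ?u ?x c t = extracted C D u2 x2 c t"
    unfolding extracted_def by (rule integral_spike[of "{}"]) auto
  ultimately show ?thesis using extracted_split[OF trajectory_concat[OF 1 2 eq] \<open>s \<le> c\<close> \<open>c \<le> t\<close>, of C D] by simp
qed

text \<open>Zero input extracts nothing, so an extraction can be prolonged to any later time. Two
  extractions thereby get a common horizon, on which they can be added and subtracted.\<close>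

lemma extract_then_rest:
  assumes "trajectory A B u x" "s \<le> c" "c \<le> t"
  shows "\<exists>v z. trajectory A B v z \<and> z s = x s \<and> extracted C D v z s t = extracted C D u x s c"
proof (cases "s = c")
  case True
  obtain z where z: "z c = x c" "trajectory A B (\<lambda>_. 0) z"
    using solution_exists[of "\<lambda>_. 0" c "x c" A B] L2loc_continuous[OF continuous_on_const] by blast
  have "extracted C D (\<lambda>_. 0) z c t = 0" by (simp add: extracted_def)
  moreover have "extracted C D u x c c = 0" by (simp add: extracted_def)
  ultimately show ?thesis using z True by metis
next
  case False
  obtain z where z: "z c = x c" "trajectory A B (\<lambda>_. 0) z"
    using solution_exists[of "\<lambda>_. 0" c "x c" A B] L2loc_continuous[OF continuous_on_const] by blast
  have "extracted C D (\<lambda>_. 0) z c t = 0" by (simp add: extracted_def)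
  thus ?thesis
    using trajectory_concat[OF assms(1) z(2) z(1)[symmetric]] extracted_concat[OF assms(1) z(2) z(1)[symmetric] assms(2,3), of C D]
      False assms(2) by (intro exI conjI) (assumption, auto)
qed

lemma extractable_zero: "0 \<in> extractable A B C D t0 x0"
proof -
  obtain z where z: "z t0 = x0" "trajectory A B (\<lambda>_. 0) z"
    using solution_exists[of "\<lambda>_. 0" t0 x0 A B] L2loc_continuous[OF continuous_on_const] by blast
  have "extracted C D (\<lambda>_. 0) z t0 t0 = 0" by (simp add: extracted_def)
  thus ?thesis unfolding extractable_def using z by (metis (mono_tags, lifting) mem_Collect_eq order_refl)
qed

lemma extractable_scale:
  assumes "v \<in> extractable A B C D t0 x0" shows "c\<^sup>2 * v \<in> extractable A B C D t0 (c *\<^sub>R x0)"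
proof -
  obtain u x t1 where *: "v = extracted C D u x t0 t1" "t0 \<le> t1" "trajectory A B u x" "x t0 = x0"
    using assms by (auto simp: extractable_def)
  have "- ((c *\<^sub>R u r) \<bullet> (C *v (c *\<^sub>R x r) + D *v (c *\<^sub>R u r))) = c\<^sup>2 * (- (u r \<bullet> (C *v x r + D *v u r)))" for r
    by (simp add: matrix_vector_mult_scaleR inner_add_right algebra_simps power2_eq_square)
  hence "extracted C D (\<lambda>t. c *\<^sub>R u t) (\<lambda>t. c *\<^sub>R x t) t0 t1 = c\<^sup>2 * v"
    unfolding extracted_def *(1) by (simp only: integral_mult_right)
  thus ?thesis unfolding extractable_def using trajectory_scale[OF *(3), of c] *
    by (intro CollectI exI[of _ "\<lambda>t. c *\<^sub>R u t"] exI[of _ "\<lambda>t. c *\<^sub>R x t"] exI[of _ t1]) auto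
qed

text \<open>The system is linear and the supply quadratic, so the parallelogram identity holds under
  the integral for the sum and the difference of two trajectories.\<close>

lemma extractable_parallelogram:
  assumes "v \<in> extractable A B C D t0 x0" "w \<in> extractable A B C D t0 z0"
  shows "\<exists>a\<in>extractable A B C D t0 (x0 + z0). \<exists>b\<in>extractable A B C D t0 (x0 - z0). a + b = 2 * v + 2 * w"
proof -
  obtain u1 x1 t1 where 1: "v = extracted C D u1 x1 t0 t1" "t0 \<le> t1" "trajectory A B u1 x1" "x1 t0 = x0"
    using assms by (auto simp: extractable_def)
  obtain u2 x2 t2 where 2: "w = extracted C D u2 x2 t0 t2" "t0 \<le> t2" "trajectory A B u2 x2" "x2 t0 = z0"
    using assms by (auto simp: extractable_def)
  define T where "T = max t1 t2"
  obtain u x where ux: "trajectory A B u x" "x t0 = x0" "extracted C D u x t0 T = v"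
    using extract_then_rest[OF 1(3,2), of T C D] 1 by (auto simp: T_def)
  obtain r z where rz: "trajectory A B r z" "z t0 = z0" "extracted C D r z t0 T = w"
    using extract_then_rest[OF 2(3,2), of T C D] 2 by (auto simp: T_def)
  let ?a = "extracted C D (\<lambda>t. u t + r t) (\<lambda>t. x t + z t) t0 T"
  let ?b = "extracted C D (\<lambda>t. u t - r t) (\<lambda>t. x t - z t) t0 T"
  note s = trajectory_add[OF ux(1) rz(1)] and d = trajectory_diff[OF ux(1) rz(1)]
  have T: "t0 \<le> T" using 1 by (simp add: T_def)
  have "?a \<in> extractable A B C D t0 (x0 + z0)" unfolding extractable_def using s T ux rz by blast
  moreover have "?b \<in> extractable A B C D t0 (x0 - z0)" unfolding extractable_def using d T ux rz by blast
  moreover have "?a + ?b = 2 * v + 2 * w"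
  proof -
    have "?a + ?b = integral {t0..T} (\<lambda>q. - ((u q + r q) \<bullet> (C *v (x q + z q) + D *v (u q + r q)))
        + - ((u q - r q) \<bullet> (C *v (x q - z q) + D *v (u q - r q))))"
      unfolding extracted_def
      by (rule Henstock_Kurzweil_Integration.integral_add[symmetric, OF supply_integrable[OF s] supply_integrable[OF d]])
    also have "\<dots> = integral {t0..T} (\<lambda>q. 2 * (- (u q \<bullet> (C *v x q + D *v u q))) + 2 * (- (r q \<bullet> (C *v z q + D *v r q))))"
      by (simp add: matrix_vector_right_distrib matrix_vector_mult_diff_distrib inner_add_left inner_add_right
          inner_diff_left inner_diff_right algebra_simps)
    also have "\<dots> = 2 * v + 2 * w"
      unfolding ux(3)[symmetric] rz(3)[symmetric] extracted_def
      by (subst Henstock_Kurzweil_Integration.integral_add)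
        (auto simp only: integral_mult_right intro!: integrable_on_mult_right supply_integrable[OF ux(1)] supply_integrable[OF rz(1)])
    finally show ?thesis .
  qed
  ultimately show ?thesis by blast
qed

lemma ereal_Sup_image:
  assumes "V \<noteq> {}" "bdd_above V" shows "Sup (ereal ` V) = ereal (Sup V)"
proof (rule antisym)
  show "Sup (ereal ` V) \<le> ereal (Sup V)" using assms by (intro Sup_least) (auto intro: cSup_upper)
  show "ereal (Sup V) \<le> Sup (ereal ` V)"
  proof (cases "Sup (ereal ` V)")
    case (real r)
    hence "v \<le> r" if "v \<in> V" for v using that Sup_upper[of "ereal v" "ereal ` V"] by auto
    thus ?thesis using real assms by (auto intro: cSup_least)
  next
    case MInf
    thus ?thesis using assms(1) Sup_upper[of _ "ereal ` V"] by force
  qed auto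
qed

lemma available_energy_finite_imp_bdd:
  assumes "available_energy A B C D t0 x0 < \<infinity>" shows "bdd_above (extractable A B C D t0 x0)"
proof -
  obtain r where "available_energy A B C D t0 x0 \<le> ereal r"
    using assms by (cases "available_energy A B C D t0 x0") auto
  hence "v \<le> r" if "v \<in> extractable A B C D t0 x0" for v
  proof -
    have "ereal v \<le> available_energy A B C D t0 x0"
      unfolding available_energy_eq using that by (intro Sup_upper) auto
    also have "\<dots> \<le> ereal r" by fact
    finally show ?thesis by simp
  qed
  thus ?thesis by (rule bdd_aboveI)
qed

text \<open>Bellman inequality: an extraction up to \<open>t1\<close> followed by any extraction
  from the state reached there is again an extraction from the initial state.\<close>

lemma extractable_dynamic_programming:
  assumes bdd: "bdd_above (extractable A B C D t0 (x t0))"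
    and tr: "trajectory A B u x" and "t0 \<le> t1"
  shows "extracted C D u x t0 t1 + Sup (extractable A B C D t0 (x t1)) \<le> Sup (extractable A B C D t0 (x t0))"
proof -
  have "w \<le> Sup (extractable A B C D t0 (x t0)) - extracted C D u x t0 t1" if w: "w \<in> extractable A B C D t0 (x t1)" for w
  proof -
    obtain u2 x2 t2 where 2: "w = extracted C D u2 x2 t0 t2" "t0 \<le> t2" "trajectory A B u2 x2" "x2 t0 = x t1"
      using w by (auto simp: extractable_def)
    \<comment> \<open>The second extraction starts at \<open>t0\<close>; time invariance moves its
      start to \<open>t1\<close>.\<close>
    define c where "c = t0 - t1"
    let ?u = "\<lambda>t. u2 (t + c)" and ?x = "\<lambda>t. x2 (t + c)"
    have tr2: "trajectory A B ?u ?x" by (rule trajectory_shift[OF 2(3)])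
    have eq: "x t1 = ?x t1" using 2 by (simp add: c_def)
    have "extracted C D ?u ?x t1 (t2 - c) = w"
      unfolding extracted_shift[OF 2(3)] by (simp add: 2(1) c_def)
    hence e: "extracted C D (\<lambda>t. if t < t1 then u t else ?u t) (\<lambda>t. if t < t1 then x t else ?x t) t0 (t2 - c)
        = extracted C D u x t0 t1 + w"
      using extracted_concat[OF tr tr2 eq \<open>t0 \<le> t1\<close>, of "t2 - c" C D] 2(2) by (simp add: c_def)
    have "extracted C D u x t0 t1 + w \<in> extractable A B C D t0 (x t0)"
      unfolding extractable_def e[symmetric]
      using trajectory_concat[OF tr tr2 eq] 2(2,4) \<open>t0 \<le> t1\<close>
      by (intro CollectI exI conjI) (rule refl, auto simp: c_def)
    thus ?thesis using cSup_upper[OF _ bdd] by (simp add: algebra_simps)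
  qed
  hence "Sup (extractable A B C D t0 (x t1)) \<le> Sup (extractable A B C D t0 (x t0)) - extracted C D u x t0 t1"
    using extractable_zero by (intro cSup_least) blast+
  thus ?thesis by simp
qed

lemma integral_nonpos_imp_nonpos:
  fixes h :: "real \<Rightarrow> real"
  assumes cont: "continuous_on UNIV h" and le: "\<And>t. t0 \<le> t \<Longrightarrow> integral {t0..t} h \<le> 0"
  shows "h t0 \<le> 0"
proof (rule ccontr)
  assume "\<not> h t0 \<le> 0"
  hence pos: "h t0 / 2 > 0" by simp
  have "isCont h t0" using cont by (simp add: continuous_on_eq_continuous_at)
  then obtain d where d: "d > 0" "\<And>t. dist t t0 < d \<Longrightarrow> dist (h t) (h t0) < h t0 / 2"
    unfolding continuous_at_eps_delta using pos by blast
  define t1 where "t1 = t0 + d / 2"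
  have t1: "t0 < t1" using d(1) by (simp add: t1_def)
  have "h t0 / 2 \<le> h t" if "t \<in> {t0..t1}" for t
  proof -
    have "dist t t0 < d" using that d(1) by (auto simp: t1_def dist_real_def)
    hence "\<bar>h t - h t0\<bar> < h t0 / 2" using d(2)[of t] by (simp add: dist_real_def)
    thus ?thesis by linarith
  qed
  hence "integral {t0..t1} (\<lambda>_. h t0 / 2) \<le> integral {t0..t1} h"
    by (intro integral_le integrable_continuous_real continuous_on_subset[OF cont]) auto
  hence "(t1 - t0) * (h t0 / 2) \<le> 0" using le[of t1] t1 by simp
  thus False using pos t1 by (metis mult_pos_pos diff_gt_0_iff_gt not_less)
qed

lemma matrix_mexp_vec_sums:
  fixes A :: "real^'d^'d" and M :: "real^'d^'m"
  shows "(\<lambda>k. ((M ** matpow A k) *v z) $ i * (t ^ k / fact k)) sums (((M ** mexp A t) *v z) $ i)"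
proof -
  have "(\<lambda>k. \<Sum>j\<in>UNIV. ((M ** matpow A k) $ i $ j / fact k) * t ^ k * z $ j) sums (\<Sum>j\<in>UNIV. (M ** mexp A t) $ i $ j * z $ j)"
    by (intro sums_sum sums_mult2 matrix_mexp_sums)
  moreover have "(\<Sum>j\<in>UNIV. ((M ** matpow A k) $ i $ j / fact k) * t ^ k * z $ j)
      = ((M ** matpow A k) *v z) $ i * (t ^ k / fact k)" for k
    by (simp add: matrix_vector_mult_def[of "M ** matpow A k"] sum_distrib_left sum_distrib_right sum_divide_distrib mult_ac)
  ultimately show ?thesis by (simp only: matrix_vector_mult_def[of "M ** mexp A t"] vec_lambda_beta)
qed

text \<open>A free output depends on the system only through the vectors \<open>M A^k z\<close>. Two
  different matrices are allowed because the free response recovered from a weak solution first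
  appears with an auxiliary matrix in place of \<open>A\<close>.\<close>

lemma matrix_mexp_eqI:
  fixes A :: "real^'d^'d" and A' :: "real^'e^'e"
  assumes "\<And>k. (M ** matpow A k) *v z = (M' ** matpow A' k) *v z'"
  shows "(M ** mexp A t) *v z = (M' ** mexp A' t) *v z'"
proof -
  have "((M ** mexp A t) *v z) $ i = ((M' ** mexp A' t) *v z') $ i" for i
    using matrix_mexp_vec_sums[of M A z i t] matrix_mexp_vec_sums[of M' A' z' i t]
    unfolding assms by (rule sums_unique2)
  thus ?thesis by (simp add: vec_eq_iff)
qed

lemma Vo_kernel_mexp:
  assumes "Vo_kernel C A z" shows "C *v (mexp A t *v z) = 0"
  using matrix_mexp_eqI[of C A z C A 0 t] Vo_kernel_all[OF assms] by (simp add: matrix_vector_mul_assoc)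

lemma mexp_shift_deriv:
  fixes M :: "real^'d^'m" and A :: "real^'d^'d"
  shows "((\<lambda>t. (M ** mexp A (t - s) *v v) $ i) has_real_derivative ((M ** A ** mexp A (t - s) *v v) $ i)) (at t)"
proof -
  have "((\<lambda>t. (M ** mexp A (t - s) *v v) $ i) has_real_derivative ((M ** A ** mexp A (t - s) *v v) $ i) * 1) (at t)"
    by (rule DERIV_chain2[where f="\<lambda>t. (M ** mexp A t *v v) $ i" and g="\<lambda>r. r - s", OF mexp_vec_deriv])
      (auto intro!: derivative_eq_intros)
  thus ?thesis by simp
qed

lemma mexp_trajectory: "trajectory A B (\<lambda>_. 0) (\<lambda>t. mexp A (t - s) *v z)"
proof -
  have 1: "((\<lambda>t. (mexp A (t - s) *v z) $ i) has_real_derivative (A *v (mexp A (t - s) *v z) + B *v 0) $ i) (at t)" for i t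
    using mexp_shift_deriv[of "mat 1" A s z i t] by (simp add: matrix_vector_mul_assoc)
  have 2: "continuous_on UNIV (\<lambda>t. (A *v (mexp A (t - s) *v z) + B *v 0) $ i)" for i
    using DERIV_isCont[OF mexp_shift_deriv[of A A s z i]]
    by (simp add: matrix_vector_mul_assoc continuous_at_imp_continuous_on)
  show ?thesis unfolding trajectory_def
    by (intro conjI L2loc_continuous continuous_on_const abs_primitive_vecI abs_primitive_deriv 1 2)
qed

text \<open>Subtracting the free motion from \<open>z\<close> changes neither input nor output and
  moves the initial state to 0.\<close>

lemma extractable_unobservable:
  assumes "Vo_kernel C A z"
  shows "extractable A B C D t0 z \<subseteq> extractable A B C D t0 0"
proof
  fix v assume "v \<in> extractable A B C D t0 z"
  then obtain u x t1 where *: "v = extracted C D u x t0 t1" "t0 \<le> t1" "trajectory A B u x" "x t0 = z"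
    by (auto simp: extractable_def)
  let ?x = "\<lambda>t. x t - mexp A (t - t0) *v z"
  have "trajectory A B u ?x" using trajectory_diff[OF *(3) mexp_trajectory[of A B t0 z]] by simp
  moreover have "extracted C D u ?x t0 t1 = v"
    unfolding *(1) extracted_def using Vo_kernel_mexp[OF assms] by (simp add: matrix_vector_mult_diff_distrib)
  ultimately show "v \<in> extractable A B C D t0 0"
    unfolding extractable_def using * by (intro CollectI exI[of _ u] exI[of _ ?x] exI[of _ t1]) auto
qed

lemma finite_available_energy_imp_cond4:
  fixes A :: "real^'d^'d"
  assumes fin: "\<forall>x0. available_energy A B C D t0 x0 < \<infinity>"
  shows "\<exists>Xm. cond4 A B C D t0 Xm"
proof -
  let ?V = "extractable A B C D t0"
  have bdd: "bdd_above (?V x)" for x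
    by (rule available_energy_finite_imp_bdd) (use fin in auto)
  obtain M where M: "symm_mat M" "\<And>x. Sup (?V x) = x \<bullet> (M *v x)"
    using Sup_value_quadratic_form[of ?V, OF extractable_zero bdd extractable_scale extractable_parallelogram] by blast
  \<comment> \<open>The factor 2 converts the supremum \<open>x^T M x\<close> into the form
    \<open>x^T X x / 2\<close> of condition 4.\<close>
  define X where "X = 2 *\<^sub>R M"
  have SX: "Sup (?V x) = 1/2 * (x \<bullet> (X *v x))" for x
    by (simp add: M(2) X_def scaleR_matrix_vector_assoc[symmetric])
  have symX: "symm_mat X" using M(1) by (simp add: X_def symm_mat_def transpose_def vec_eq_iff)
  have nn: "0 \<le> Sup (?V x)" for x by (rule cSup_upper[OF extractable_zero bdd])
  have psdX: "psd X" unfolding psd_def using symX nn SX by (auto simp: symm_mat_def zero_le_mult_iff)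
  \<comment> \<open>The Bellman inequality is differentiated along the constant input
    \<open>u\<close>: the integral of the negative dissipation over every interval from
    \<open>t0\<close> is at most 0, hence so is the integrand at \<open>t0\<close>.\<close>
  have "0 \<le> dissipation A B C D X z u" for z u
  proof -
    let ?u = "\<lambda>_. u"
    obtain x where x: "x t0 = z" "trajectory A B ?u x"
      using solution_exists[of ?u t0 z A B] L2loc_continuous[OF continuous_on_const] by blast
    have ap: "abs_primitive (\<lambda>t. A *v x t + B *v ?u t) x" using x by (simp add: trajectory_def)
    have contx: "continuous_on UNIV x" by (rule abs_primitive_continuous[OF ap])
    let ?h = "\<lambda>t. - dissipation A B C D X (x t) u"
    have "?h t0 \<le> 0"
    proof (rule integral_nonpos_imp_nonpos[where h = ?h])
      show "continuous_on UNIV ?h" unfolding dissipation_def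
        by (intro continuous_intros contx bounded_linear.continuous_on[OF matrix_vector_mul_bounded_linear])
      fix t assume t: "t0 \<le> t"
      from extractable_dynamic_programming[where x=x, OF bdd x(2) t]
      have le: "extracted C D ?u x t0 t \<le> 1/2 * (x t0 \<bullet> (X *v x t0)) - 1/2 * (x t \<bullet> (X *v x t))" by (simp add: SX)
      have i: "((\<lambda>r. 2 * (x r \<bullet> (X *v (A *v x r + B *v u)))) has_integral (x t \<bullet> (X *v x t) - x t0 \<bullet> (X *v x t0))) {t0..t}"
        using abs_primitive_quadratic[OF ap symX] t by (simp add: abs_primitive_def)
      have "((\<lambda>r. - (u \<bullet> (C *v x r + D *v u)) + 1/2 * (2 * (x r \<bullet> (X *v (A *v x r + B *v u)))))
          has_integral (extracted C D ?u x t0 t + 1/2 * (x t \<bullet> (X *v x t) - x t0 \<bullet> (X *v x t0)))) {t0..t}"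
        unfolding extracted_def
        by (intro has_integral_add has_integral_mult_right i integrable_integral supply_integrable[OF x(2)])
      hence "integral {t0..t} ?h = extracted C D ?u x t0 t + 1/2 * (x t \<bullet> (X *v x t) - x t0 \<bullet> (X *v x t0))"
        by (intro integral_unique) (simp add: dissipation_def algebra_simps)
      thus "integral {t0..t} ?h \<le> 0" using le by (simp add: algebra_simps)
    qed
    thus ?thesis using x by simp
  qed
  hence Om: "psd (Omega A B C D X)" using psd_Omega_iff[OF symX] by blast
  have "cond4 A B C D t0 X"
    unfolding cond4_def
  proof (intro conjI allI impI symX psdX Om)
    fix z
    show "Vo_kernel C A z \<longleftrightarrow> X *v z = 0"
    proof
      assume "Vo_kernel C A z"
      \<comment> \<open>An unobservable state has no more available energy than the zero state, for
        which it is 0.\<close>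
      hence "Sup (?V z) \<le> Sup (?V 0)"
        using extractable_unobservable extractable_zero bdd by (intro cSup_subset_mono) blast+
      hence "z \<bullet> (X *v z) = 0" using nn[of z] SX[of z] SX[of 0] by simp
      thus "X *v z = 0" by (rule psd_kernel[OF psdX])
    qed (rule kernel_imp_Vo_kernel[OF psdX symX Om])
  next
    fix Y :: "real^'d^'d" assume Y: "symm_mat Y \<and> psd Y \<and> psd (Omega A B C D Y)"
    have "x \<bullet> (X *v x) \<le> x \<bullet> (Y *v x)" for x
    proof -
      have "Sup (?V x) \<le> 1/2 * (x \<bullet> (Y *v x))"
        using Y storage_bound extractable_zero by (intro cSup_least) blast+
      thus ?thesis using SX by simp
    qed
    moreover have "transpose (Y - X) = Y - X"
      using Y symX by (simp add: symm_mat_def transpose_def vec_eq_iff)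
    ultimately show "psd (Y - X)"
      by (simp add: psd_def matrix_vector_mult_diff_rdistrib inner_diff_right)
  next
    fix x0 show "available_energy A B C D t0 x0 = ereal (1/2 * (x0 \<bullet> (X *v x0)))"
      unfolding available_energy_eq SX[symmetric] using extractable_zero bdd by (intro ereal_Sup_image) blast+
  qed
  thus ?thesis by blast
qed

lemma cond4_Sup:
  assumes "cond4 A B C D t0 Xm"
  shows "bdd_above (extractable A B C D t0 x)" and "Sup (extractable A B C D t0 x) = 1/2 * (x \<bullet> (Xm *v x))"
proof -
  have e: "available_energy A B C D t0 x = ereal (1/2 * (x \<bullet> (Xm *v x)))" using assms by (simp add: cond4_def)
  thus b: "bdd_above (extractable A B C D t0 x)" by (intro available_energy_finite_imp_bdd) simp
  have "ereal (Sup (extractable A B C D t0 x)) = ereal (1/2 * (x \<bullet> (Xm *v x)))"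
    unfolding e[symmetric] available_energy_eq using extractable_zero b by (intro ereal_Sup_image[symmetric]) blast+
  thus "Sup (extractable A B C D t0 x) = 1/2 * (x \<bullet> (Xm *v x))" by simp
qed

section \<open>Observable systems\<close>

lemma positive_definite_lower_bound:
  fixes M :: "real^'d^'d"
  assumes "\<And>v. v \<noteq> 0 \<Longrightarrow> 0 < v \<bullet> (M *v v)"
  shows "\<exists>m>0. \<forall>v. m * (norm v)\<^sup>2 \<le> v \<bullet> (M *v v)"
proof -
  have "continuous_on (sphere (0::real^'d) 1) (\<lambda>v. v \<bullet> (M *v v))"
    by (intro continuous_intros bounded_linear.continuous_on[OF matrix_vector_mul_bounded_linear])
  moreover have "sphere (0::real^'d) 1 \<noteq> {}" by simp
  ultimately have "\<exists>w\<in>sphere 0 1. \<forall>v\<in>sphere 0 1. w \<bullet> (M *v w) \<le> v \<bullet> (M *v v)"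
    by (intro continuous_attains_inf compact_sphere)
  then obtain w where w: "w \<in> sphere 0 1" "\<And>v. v \<in> sphere 0 1 \<Longrightarrow> w \<bullet> (M *v w) \<le> v \<bullet> (M *v v)" by blast
  have "(w \<bullet> (M *v w)) * (norm v)\<^sup>2 \<le> v \<bullet> (M *v v)" for v
  proof (cases "v = 0")
    case False
    let ?e = "(1 / norm v) *\<^sub>R v"
    have "w \<bullet> (M *v w) \<le> ?e \<bullet> (M *v ?e)" using False by (intro w(2)) simp
    also have "\<dots> = (v \<bullet> (M *v v)) / (norm v)\<^sup>2"
      by (simp add: matrix_vector_mult_scaleR power2_eq_square)
    finally show ?thesis using False by (simp add: field_simps)
  qed auto
  moreover have "w \<noteq> 0" using w(1) by auto
  hence "0 < w \<bullet> (M *v w)" by (rule assms)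
  ultimately show ?thesis by blast
qed

lemma observable_positive_definite:
  assumes "observable C A" "cond4 A B C D t0 Xm" "v \<noteq> 0" shows "0 < v \<bullet> (Xm *v v)"
proof -
  have "psd Xm" "Xm *v v \<noteq> 0" using assms by (auto simp: cond4_def observable_def)
  thus ?thesis using psd_kernel[of Xm v] by (metis order_le_imp_less_or_eq psd_def)
qed

text \<open>A nearly optimal extraction ends in a state of small available energy, hence, by
  observability, in a small state, so that the sign of the final storage does not matter.\<close>

lemma observable_imp_minimal:
  assumes obs: "observable C A" and c4: "cond4 A B C D t0 Xm"
    and X: "symm_mat X" "psd (Omega A B C D X)"
  shows "psd (X - Xm)"
proof -
  let ?S = "\<lambda>x. Sup (extractable A B C D t0 x)"
  note S = cond4_Sup[OF c4]
  obtain m where m: "m > 0" "\<And>v. m * (norm v)\<^sup>2 \<le> v \<bullet> (Xm *v v)"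
    using positive_definite_lower_bound[of Xm] observable_positive_definite[OF obs c4] by blast
  obtain K where K: "K > 0" "\<And>v. norm (X *v v) \<le> norm v * K"
    using bounded_linear.pos_bounded[OF matrix_vector_mul_bounded_linear[of X]] by blast
  have d: "0 \<le> dissipation A B C D X x u" for x u using X psd_Omega_iff by blast
  have main: "?S x0 \<le> 1/2 * (x0 \<bullet> (X *v x0))" for x0
  proof (rule field_le_epsilon)
    fix e :: real assume e: "e > 0"
    \<comment> \<open>\<open>\<epsilon>\<close> is paid once for the distance of the extraction from
      the supremum, and \<open>K / m\<close> times for the storage left in the final state.\<close>
    define \<epsilon> where "\<epsilon> = e / (1 + K / m)"
    have den: "1 + K / m > 0" using K m by (simp add: add_pos_pos)
    have "\<epsilon> * (1 + K / m) = e" using den by (simp add: \<epsilon>_def)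
    hence eps: "\<epsilon> > 0" "\<epsilon> + K / m * \<epsilon> = e" using e den
      by (simp add: \<epsilon>_def, simp add: algebra_simps)
    obtain v where "v \<in> extractable A B C D t0 x0" "?S x0 - \<epsilon> < v"
      using less_cSup_iff[of "extractable A B C D t0 x0" "?S x0 - \<epsilon>"] extractable_zero S(1) eps by force
    then obtain u x t1 where *: "?S x0 - \<epsilon> < extracted C D u x t0 t1" "t0 \<le> t1" "trajectory A B u x" "x t0 = x0"
      by (auto simp: extractable_def)
    \<comment> \<open>What is still available at the end is at most the amount by which the
      extraction misses the supremum.\<close>
    have "?S (x t1) \<le> \<epsilon>"
      using extractable_dynamic_programming[where x=x, OF S(1) *(3,2)] * by simp
    moreover have "x t1 \<bullet> (Xm *v x t1) = 2 * ?S (x t1)" using S(2)[of "x t1"] by simp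
    ultimately have "m * (norm (x t1))\<^sup>2 \<le> 2 * \<epsilon>" using m(2)[of "x t1"] by linarith
    hence n: "(norm (x t1))\<^sup>2 \<le> 2 * \<epsilon> / m" using m(1) by (simp add: field_simps)
    have "- (x t1 \<bullet> (X *v x t1)) \<le> norm (x t1) * norm (X *v x t1)"
      using Cauchy_Schwarz_ineq2[of "x t1" "X *v x t1"] by simp
    also have "\<dots> \<le> norm (x t1) * (norm (x t1) * K)" by (intro mult_left_mono K(2)) auto
    also have "\<dots> = K * (norm (x t1))\<^sup>2" by (simp add: power2_eq_square)
    also have "\<dots> \<le> K * (2 * \<epsilon> / m)" using n K by (intro mult_left_mono) auto
    also have "\<dots> = 2 * (K / m * \<epsilon>)" by simp
    finally have "- 1/2 * (x t1 \<bullet> (X *v x t1)) \<le> K / m * \<epsilon>" by linarith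
    thus "?S x0 \<le> 1/2 * (x0 \<bullet> (X *v x0)) + e"
      using extracted_le_storage[OF X(1) d *(3,2)] * eps(2) by simp
  qed
  have "x \<bullet> (Xm *v x) \<le> x \<bullet> (X *v x)" for x using main[of x] S(2) by simp
  moreover have "transpose (X - Xm) = X - Xm"
    using X c4 by (simp add: symm_mat_def cond4_def transpose_def vec_eq_iff)
  ultimately show ?thesis by (simp add: psd_def matrix_vector_mult_diff_rdistrib inner_diff_right)
qed

text \<open>With zero input \<open>Xm\<close> is a Lyapunov form. For an eigenvector
  \<open>a + i b\<close> the two real inequalities add up to a bound on \<open>Re s\<close> times
  \<open>a^T Xm a + b^T Xm b\<close>, the cross terms cancelling by symmetry; observability makes
  that sum positive.\<close>

lemma observable_spectrum:
  assumes obs: "observable C A" and c4: "cond4 A B C D t0 Xm"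
  shows "spectrum_in_closed_lhp A"
  unfolding spectrum_in_closed_lhp_def
proof (intro allI impI)
  fix s :: complex assume "\<exists>v. v \<noteq> 0 \<and> cmat A *v v = s *s v"
  then obtain v where v: "v \<noteq> 0" "cmat A *v v = s *s v" by blast
  define a b where "a = (\<chi> i. Re (v $ i))" and "b = (\<chi> i. Im (v $ i))"
  have eq: "(\<Sum>j\<in>UNIV. complex_of_real (A $ i $ j) * v $ j) = s * v $ i" for i
    using v(2) by (simp add: vec_eq_iff matrix_vector_mult_def cmat_def)
  have Aa: "A *v a = Re s *\<^sub>R a - Im s *\<^sub>R b"
    using arg_cong[OF eq, of Re] by (simp add: vec_eq_iff matrix_vector_mult_def a_def b_def)
  have Ab: "A *v b = Im s *\<^sub>R a + Re s *\<^sub>R b"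
    using arg_cong[OF eq, of Im] by (simp add: vec_eq_iff matrix_vector_mult_def a_def b_def algebra_simps)
  have X: "symm_mat Xm" "psd (Omega A B C D Xm)" using c4 by (auto simp: cond4_def)
  have d: "0 \<le> dissipation A B C D Xm x u" for x u using X psd_Omega_iff by blast
  have "a \<bullet> (Xm *v (A *v a)) \<le> 0" "b \<bullet> (Xm *v (A *v b)) \<le> 0"
    using d[of a 0] d[of b 0] by (auto simp: dissipation_def)
  hence "Re s * (a \<bullet> (Xm *v a) + b \<bullet> (Xm *v b)) \<le> 0"
    using symm_inner[OF X(1), of a b]
    by (simp add: Aa Ab matrix_vector_mult_diff_distrib matrix_vector_right_distrib matrix_vector_mult_scaleR
       inner_add_right inner_diff_right algebra_simps)
  moreover have "a \<bullet> (Xm *v a) + b \<bullet> (Xm *v b) > 0"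
  proof -
    have "a \<noteq> 0 \<or> b \<noteq> 0" using v(1) by (auto simp: vec_eq_iff a_def b_def complex_eq_iff)
    moreover have "0 \<le> w \<bullet> (Xm *v w)" for w using c4 by (simp add: cond4_def psd_def)
    ultimately show ?thesis using observable_positive_definite[OF obs c4] by (metis add_pos_nonneg add_nonneg_pos)
  qed
  ultimately show "Re s \<le> 0" by (metis mult_pos_pos not_less)
qed

section \<open>Test functions\<close>

text \<open>Smoothness is defined through iterated \<open>deriv\<close>, so it can be proved by
  exhibiting a set of functions closed under differentiation.\<close>

lemma smooth_fun_coinduct:
  assumes "f \<in> S" and step: "\<And>g. g \<in> S \<Longrightarrow> \<exists>g'\<in>S. \<forall>t. (g has_real_derivative g' t) (at t)"
  shows "smooth_fun f"
proof -
  have S: "(deriv ^^ k) f \<in> S" for k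
  proof (induction k)
    case (Suc k)
    obtain g' where "g' \<in> S" "\<And>t. ((deriv ^^ k) f has_real_derivative g' t) (at t)" using step[OF Suc] by blast
    moreover from this(2) have "deriv ((deriv ^^ k) f) = g'" by (auto intro: DERIV_imp_deriv)
    ultimately show ?case by simp
  qed (use assms in auto)
  show ?thesis unfolding smooth_fun_def field_differentiable_def using step[OF S] by blast
qed

lemma smooth_fun_has_deriv: "smooth_fun f \<Longrightarrow> (f has_real_derivative deriv f t) (at t)"
  unfolding smooth_fun_def using field_differentiable_derivI by (metis funpow_0)

lemma smooth_fun_deriv: "smooth_fun f \<Longrightarrow> smooth_fun (deriv f)"
  unfolding smooth_fun_def by (metis comp_apply funpow_Suc_right)

lemma smooth_fun_continuous: "smooth_fun f \<Longrightarrow> continuous_on S f"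
  by (meson DERIV_isCont continuous_at_imp_continuous_on smooth_fun_has_deriv)

lemma smooth_fun_by_deriv:
  assumes "\<And>t. (f has_real_derivative g t) (at t)" "smooth_fun g" shows "smooth_fun f"
proof (rule smooth_fun_coinduct[of f "insert f {h. smooth_fun h}"])
  fix h assume "h \<in> insert f {h. smooth_fun h}"
  thus "\<exists>g'\<in>insert f {h. smooth_fun h}. \<forall>t. (h has_real_derivative g' t) (at t)"
    using assms smooth_fun_has_deriv smooth_fun_deriv by blast
qed auto

lemma smooth_fun_const: "smooth_fun (\<lambda>_. c)"
proof (rule smooth_fun_coinduct[of _ "range (\<lambda>c _. c)"])
  fix g :: "real \<Rightarrow> real" assume "g \<in> range (\<lambda>c _. c)"
  thus "\<exists>g'\<in>range (\<lambda>c _. c). \<forall>t. (g has_real_derivative g' t) (at t)"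
    by (intro bexI[of _ "\<lambda>_. 0"]) auto
qed auto

lemma smooth_fun_add:
  assumes "smooth_fun f" "smooth_fun g" shows "smooth_fun (\<lambda>t. f t + g t)"
proof (rule smooth_fun_coinduct[of _ "{\<lambda>t. a t + b t | a b. smooth_fun a \<and> smooth_fun b}"])
  fix h assume "h \<in> {\<lambda>t. a t + b t | a b. smooth_fun a \<and> smooth_fun b}"
  then obtain a b where h: "h = (\<lambda>t. a t + b t)" "smooth_fun a" "smooth_fun b" by blast
  hence "(h has_real_derivative deriv a t + deriv b t) (at t)" for t
    by (auto intro: DERIV_add smooth_fun_has_deriv)
  thus "\<exists>g'\<in>{\<lambda>t. a t + b t | a b. smooth_fun a \<and> smooth_fun b}. \<forall>t. (h has_real_derivative g' t) (at t)"
    using h(2,3) smooth_fun_deriv by (intro bexI[of _ "\<lambda>t. deriv a t + deriv b t"]) blast+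
qed (use assms in blast)

lemma smooth_fun_affine:
  assumes "smooth_fun f" shows "smooth_fun (\<lambda>t. c * f (m * t + b))"
proof (rule smooth_fun_coinduct[of _ "{\<lambda>t. c * f (m * t + b) | c f. smooth_fun f}"])
  fix h assume "h \<in> {\<lambda>t. c * f (m * t + b) | c f. smooth_fun f}"
  then obtain c f where h: "h = (\<lambda>t. c * f (m * t + b))" "smooth_fun f" by blast
  have "(h has_real_derivative c * m * deriv f (m * t + b)) (at t)" for t
  proof -
    have "((\<lambda>t. f (m * t + b)) has_real_derivative deriv f (m * t + b) * m) (at t)"
      by (rule DERIV_chain2[OF smooth_fun_has_deriv[OF h(2)]]) (auto intro!: derivative_eq_intros)
    from DERIV_cmult[OF this, of c] show ?thesis by (simp add: h(1) mult_ac)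
  qed
  thus "\<exists>g'\<in>{\<lambda>t. c * f (m * t + b) | c f. smooth_fun f}. \<forall>t. (h has_real_derivative g' t) (at t)"
    using smooth_fun_deriv[OF h(2)] by (intro bexI[of _ "\<lambda>t. c * m * deriv f (m * t + b)"]) blast+
qed (use assms in blast)

lemma smooth_fun_cmult: "smooth_fun f \<Longrightarrow> smooth_fun (\<lambda>t. c * f t)"
  using smooth_fun_affine[of f c 1 0] by simp

text \<open>Leibniz' rule leads out of the set of products, but not out of the set of their finite
  sums.\<close>

inductive_set smooth_products :: "(real \<Rightarrow> real) set" where
  prod: "smooth_fun f \<Longrightarrow> smooth_fun g \<Longrightarrow> (\<lambda>t. f t * g t) \<in> smooth_products"
| plus: "p \<in> smooth_products \<Longrightarrow> q \<in> smooth_products \<Longrightarrow> (\<lambda>t. p t + q t) \<in> smooth_products"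

lemma smooth_fun_mult:
  assumes "smooth_fun f" "smooth_fun g" shows "smooth_fun (\<lambda>t. f t * g t)"
proof (rule smooth_fun_coinduct[of _ smooth_products])
  show "\<exists>g'\<in>smooth_products. \<forall>t. (h has_real_derivative g' t) (at t)" if "h \<in> smooth_products" for h
    using that
  proof (induction rule: smooth_products.induct)
    case (prod f g)
    have "((\<lambda>t. f t * g t) has_real_derivative deriv f t * g t + f t * deriv g t) (at t)" for t
      using smooth_fun_has_deriv[OF prod(1), of t] smooth_fun_has_deriv[OF prod(2), of t]
      by (auto intro!: derivative_eq_intros)
    thus ?case
      using prod smooth_fun_deriv by (intro bexI[of _ "\<lambda>t. deriv f t * g t + f t * deriv g t"])
        (auto intro!: smooth_products.intros)
  next
    case (plus p q)
    then obtain p' q' where "p' \<in> smooth_products" "q' \<in> smooth_products"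
      "\<And>t. (p has_real_derivative p' t) (at t)" "\<And>t. (q has_real_derivative q' t) (at t)" by blast
    thus ?case
      by (intro bexI[of _ "\<lambda>t. p' t + q' t"] allI DERIV_add smooth_products.plus) auto
  qed
qed (use assms smooth_products.prod in blast)

text \<open>A flat function: the powers of 1/x are beaten by exp(-1/x).\<close>

definition flat :: "real poly \<Rightarrow> real \<Rightarrow> real" where
  "flat p x = (if x > 0 then poly p (1 / x) * exp (- 1 / x) else 0)"

lemma poly_exp_tendsto_0: "((\<lambda>y. poly p y * exp (- y)) \<longlongrightarrow> 0) (at_top :: real filter)"
proof -
  have "((\<lambda>y. \<Sum>k\<le>degree p. coeff p k * (y ^ k / exp y)) \<longlongrightarrow> (\<Sum>k\<le>degree p. coeff p k * 0)) (at_top :: real filter)"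
    by (intro tendsto_sum tendsto_mult tendsto_const tendsto_power_div_exp_0)
  thus ?thesis by (simp add: poly_altdef sum_distrib_left sum_distrib_right exp_minus divide_inverse mult_ac)
qed

lemma flat_tendsto_0: "((\<lambda>x. poly p (1 / x) * exp (- 1 / x)) \<longlongrightarrow> 0) (at_right 0)" for p :: "real poly"
proof -
  have "filterlim (\<lambda>x::real. 1 / x) at_top (at_right 0)"
    using filterlim_inverse_at_top_right by (simp add: inverse_eq_divide)
  from filterlim_compose[OF poly_exp_tendsto_0[of p] this] show ?thesis by simp
qed

text \<open>In the variable \<open>1 / x\<close> differentiation replaces \<open>p\<close> by the
  square of the variable times \<open>p - p'\<close>, so the family stays closed; this is why a
  polynomial parameter is carried. At 0 the right difference quotient has the same shape, with
  \<open>p\<close> multiplied once by the variable.\<close>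

lemma flat_deriv:
  "(flat p has_real_derivative flat ([:0, 0, 1:] * (p - pderiv p)) x) (at x)"
proof (cases x "0::real" rule: linorder_cases)
  case less
  have "(flat p has_real_derivative 0) (at x)"
  proof (rule has_field_derivative_transform_within_open[of "\<lambda>_. 0" _ _ "{..<0}"])
    show "((\<lambda>_. 0) has_real_derivative 0) (at x)" by simp
  qed (use less in \<open>auto simp: flat_def\<close>)
  thus ?thesis using less by (simp add: flat_def)
next
  case greater
  have "((\<lambda>x. poly p (1 / x) * exp (- 1 / x)) has_real_derivative
      poly (pderiv p) (1 / x) * (- 1 / x^2) * exp (- 1 / x) + poly p (1 / x) * (exp (- 1 / x) * (1 / x^2))) (at x)"
    using greater by (auto intro!: derivative_eq_intros DERIV_chain2[OF poly_DERIV] simp: power2_eq_square divide_simps)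
  also have "poly (pderiv p) (1 / x) * (- 1 / x^2) * exp (- 1 / x) + poly p (1 / x) * (exp (- 1 / x) * (1 / x^2))
     = flat ([:0, 0, 1:] * (p - pderiv p)) x"
    using greater by (simp add: flat_def power2_eq_square field_simps)
  finally show ?thesis
    by (rule has_field_derivative_transform_within_open[of _ _ _ "{0<..}"]) (use greater in \<open>auto simp: flat_def\<close>)
next
  case equal
  have "((\<lambda>y. (flat p y - flat p 0) / (y - 0)) \<longlongrightarrow> 0) (at 0)"
  proof (rule filterlim_split_at_real)
    show "((\<lambda>y. (flat p y - flat p 0) / (y - 0)) \<longlongrightarrow> 0) (at_left 0)"
    proof (rule Lim_transform_eventually[OF tendsto_const])
      show "\<forall>\<^sub>F y in at_left 0. 0 = (flat p y - flat p 0) / (y - 0)"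
        by (auto simp: flat_def eventually_at_left_field intro!: exI[of _ "-1"])
    qed
    show "((\<lambda>y. (flat p y - flat p 0) / (y - 0)) \<longlongrightarrow> 0) (at_right 0)"
    proof (rule Lim_transform_eventually[OF flat_tendsto_0[of "[:0, 1:] * p"]])
      show "\<forall>\<^sub>F y in at_right 0. poly ([:0, 1:] * p) (1 / y) * exp (- 1 / y) = (flat p y - flat p 0) / (y - 0)"
        by (auto simp: flat_def eventually_at_right_field intro!: exI[of _ 1])
    qed
  qed
  thus ?thesis using equal by (simp add: has_field_derivative_iff flat_def)
qed

lemma smooth_fun_flat: "smooth_fun (flat p)"
  by (rule smooth_fun_coinduct[of _ "range flat"]) (use flat_deriv in blast)+

definition test1 :: "(real \<Rightarrow> real) \<Rightarrow> bool" where
  "test1 \<phi> \<longleftrightarrow> smooth_fun \<phi> \<and> (\<exists>a b. \<forall>t. t \<notin> {a..b} \<longrightarrow> \<phi> t = 0)"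

lemma test1I: "smooth_fun \<phi> \<Longrightarrow> (\<And>t. t \<notin> {a..b} \<Longrightarrow> \<phi> t = 0) \<Longrightarrow> test1 \<phi>"
  unfolding test1_def by blast

lemma test1_smooth: "test1 \<phi> \<Longrightarrow> smooth_fun \<phi>"
  by (simp add: test1_def)

lemma test_fun_iff: "test_fun \<phi> \<longleftrightarrow> (\<forall>i. test1 (\<phi> i))" for \<phi> :: "'n::finite \<Rightarrow> real \<Rightarrow> real"
proof
  assume *: "\<forall>i. test1 (\<phi> i)"
  hence "\<forall>i. \<exists>a b. \<forall>t. t \<notin> {a..b} \<longrightarrow> \<phi> i t = 0" by (simp add: test1_def)
  then obtain a b where ab: "\<And>i t. t \<notin> {a i..b i} \<Longrightarrow> \<phi> i t = 0" by metis
  have "t \<notin> {Min (range a)..Max (range b)} \<longrightarrow> \<phi> i t = 0" for i t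
  proof
    assume "t \<notin> {Min (range a)..Max (range b)}"
    moreover have "Min (range a) \<le> a i" "b i \<le> Max (range b)" by auto
    ultimately have "t \<notin> {a i..b i}" unfolding atLeastAtMost_iff by linarith
    thus "\<phi> i t = 0" by (rule ab)
  qed
  thus "test_fun \<phi>" using * unfolding test_fun_def test1_def by blast
next
  assume "test_fun \<phi>"
  thus "\<forall>i. test1 (\<phi> i)" unfolding test_fun_def test1_def by blast
qed

lemma test1_zero: "test1 (\<lambda>_. 0)"
  by (auto simp: test1_def smooth_fun_const)

lemma test1_add:
  assumes "test1 \<phi>" "test1 \<psi>" shows "test1 (\<lambda>t. \<phi> t + \<psi> t)"
proof -
  obtain a b c d where ab: "\<And>t. t \<notin> {a..b} \<Longrightarrow> \<phi> t = 0" and cd: "\<And>t. t \<notin> {c..d} \<Longrightarrow> \<psi> t = 0"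
    using assms unfolding test1_def by blast
  have "\<phi> t + \<psi> t = 0" if "t \<notin> {min a c..max b d}" for t
  proof -
    have "t \<notin> {a..b}" "t \<notin> {c..d}" using that by auto
    thus ?thesis using ab cd by simp
  qed
  thus ?thesis using assms by (intro test1I smooth_fun_add) (auto simp: test1_def)
qed

lemma test1_smooth_mult:
  assumes "smooth_fun f" "test1 \<phi>" shows "test1 (\<lambda>t. f t * \<phi> t)"
  using assms by (auto simp: test1_def smooth_fun_mult)

lemma test1_cmult: "test1 \<phi> \<Longrightarrow> test1 (\<lambda>t. c * \<phi> t)"
  by (rule test1_smooth_mult[OF smooth_fun_const])

lemma test1_deriv:
  assumes "test1 \<phi>" shows "test1 (deriv \<phi>)"
proof -
  obtain a b where ab: "\<And>t. t \<notin> {a..b} \<Longrightarrow> \<phi> t = 0" using assms by (auto simp: test1_def)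
  have "deriv \<phi> t = 0" if "t \<notin> {a..b}" for t
  proof (rule DERIV_imp_deriv, rule has_field_derivative_transform_within_open[of "\<lambda>_. 0" _ _ "- {a..b}"])
    show "((\<lambda>_. 0) has_real_derivative 0) (at t)" by simp
  qed (use ab that in auto)
  thus ?thesis using assms by (intro test1I smooth_fun_deriv) (auto simp: test1_def)
qed

lemma test1_sum: "finite I \<Longrightarrow> (\<And>i. i \<in> I \<Longrightarrow> test1 (\<phi> i)) \<Longrightarrow> test1 (\<lambda>t. \<Sum>i\<in>I. \<phi> i t)"
  by (induction I rule: finite_induct) (auto intro: test1_add test1_zero)

lemma bump_exists:
  assumes "d > 0"
  shows "\<exists>\<phi>. test1 \<phi> \<and> (\<forall>t. 0 \<le> \<phi> t) \<and> \<phi> c > 0 \<and> (\<forall>t. t \<notin> {c - d..c + d} \<longrightarrow> \<phi> t = 0)"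
proof -
  define \<phi> where "\<phi> t = flat 1 (t - (c - d)) * flat 1 ((c + d) - t)" for t
  have "smooth_fun \<phi>"
    unfolding \<phi>_def using smooth_fun_affine[OF smooth_fun_flat[of 1], of 1 1 "- (c - d)"]
      smooth_fun_affine[OF smooth_fun_flat[of 1], of 1 "-1" "c + d"]
    by (intro smooth_fun_mult) (simp_all add: algebra_simps)
  moreover have z: "\<phi> t = 0" if "t \<notin> {c - d..c + d}" for t using that by (auto simp: \<phi>_def flat_def)
  moreover have "0 \<le> \<phi> t" for t by (simp add: \<phi>_def flat_def)
  moreover have "\<phi> c > 0" using assms by (simp add: \<phi>_def flat_def)
  ultimately show ?thesis using test1I[of \<phi> "c - d" "c + d"] by (intro exI[of _ \<phi>] conjI allI impI) simp_all
qed

section \<open>Pairings of test functions with locally integrable functions\<close>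

definition locint :: "(real \<Rightarrow> real) \<Rightarrow> bool" where
  "locint f \<longleftrightarrow> f \<in> borel_measurable borel \<and> (\<forall>a b. f absolutely_integrable_on {a..b})"

lemma locint_continuous: "continuous_on UNIV f \<Longrightarrow> locint f"
  unfolding locint_def
  by (auto intro: borel_measurable_continuous_onI absolutely_integrable_continuous_real continuous_on_subset)

lemma locint_add: "locint f \<Longrightarrow> locint g \<Longrightarrow> locint (\<lambda>t. f t + g t)"
  unfolding locint_def by (auto intro: set_integral_add(1))

lemma locint_cmult: "locint f \<Longrightarrow> locint (\<lambda>t. c * f t)"
  unfolding locint_def using set_integrable_mult_right[of c lebesgue] by auto

lemma locint_sum: "finite I \<Longrightarrow> (\<And>i. i \<in> I \<Longrightarrow> locint (f i)) \<Longrightarrow> locint (\<lambda>t. \<Sum>i\<in>I. f i t)"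
  by (induction I rule: finite_induct) (auto intro: locint_add locint_continuous)

lemma L2loc_component_locint:
  fixes w :: "real \<Rightarrow> real^'k"
  assumes "w \<in> L2loc" shows "locint (\<lambda>t. w t $ j)"
proof -
  have "(\<lambda>t. w t $ j) absolutely_integrable_on {a..b}" for a b
    using absolutely_integrable_linear[OF L2loc_absolutely_integrable[OF assms] bounded_linear_vec_nth] by (simp add: o_def)
  moreover have "(\<lambda>t. w t $ j) \<in> borel_measurable borel"
  proof -
    have "(\<lambda>v::real^'k. v $ j) \<in> borel_measurable borel" by (intro borel_measurable_continuous_onI continuous_intros)
    thus ?thesis using L2loc_measurable[OF assms] by measurable
  qed
  ultimately show ?thesis by (simp add: locint_def)
qed

definition pairing :: "(real \<Rightarrow> real) \<Rightarrow> (real \<Rightarrow> real) \<Rightarrow> real" where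
  "pairing \<phi> f = (LINT t|lborel. \<phi> t * f t)"

lemma test1_integrable:
  assumes "test1 \<phi>" "locint f" shows "integrable lborel (\<lambda>t. \<phi> t * f t)"
proof -
  obtain a b where ab: "\<And>t. t \<notin> {a..b} \<Longrightarrow> \<phi> t = 0" using assms unfolding test1_def by blast
  have c: "continuous_on S \<phi>" for S using assms(1) smooth_fun_continuous test1_smooth by blast
  have "(\<lambda>t. \<phi> t * f t) absolutely_integrable_on {a..b}"
    using assms(2) by (intro absolutely_integrable_continuous_mult c) (simp add: locint_def)
  hence "integrable lebesgue (\<lambda>t. indicator {a..b} t *\<^sub>R (\<phi> t * f t))" by (simp add: set_integrable_def)
  moreover have "(\<lambda>t. indicator {a..b} t *\<^sub>R (\<phi> t * f t)) = (\<lambda>t. \<phi> t * f t)"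
  proof
    show "indicator {a..b} t *\<^sub>R (\<phi> t * f t) = \<phi> t * f t" for t
      using ab[of t] by (cases "t \<in> {a..b}") (simp_all del: atLeastAtMost_iff)
  qed
  moreover have "(\<lambda>t. \<phi> t * f t) \<in> borel_measurable lborel"
    using assms(2) borel_measurable_continuous_onI[OF c[of UNIV]] by (auto simp: locint_def)
  ultimately show ?thesis using integrable_completion[of "\<lambda>t. \<phi> t * f t" lborel] by simp
qed

lemma pairing_has_integral:
  assumes "test1 \<phi>" "locint f" "\<And>t. t \<notin> {a..b} \<Longrightarrow> \<phi> t = 0"
  shows "((\<lambda>t. \<phi> t * f t) has_integral pairing \<phi> f) {a..b}"
proof -
  have "((\<lambda>t. \<phi> t * f t) has_integral pairing \<phi> f) UNIV"
    unfolding pairing_def by (rule has_integral_integral_lborel[OF test1_integrable[OF assms(1,2)]])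
  moreover have "(\<lambda>t. if t \<in> {a..b} then \<phi> t * f t else 0) = (\<lambda>t. \<phi> t * f t)" using assms(3) by auto
  ultimately show ?thesis using has_integral_restrict_UNIV[of "{a..b}" "\<lambda>t. \<phi> t * f t"] by metis
qed

lemma pairing_add_right: "test1 \<phi> \<Longrightarrow> locint f \<Longrightarrow> locint g \<Longrightarrow> pairing \<phi> (\<lambda>t. f t + g t) = pairing \<phi> f + pairing \<phi> g"
  unfolding pairing_def distrib_left by (intro Bochner_Integration.integral_add test1_integrable)

lemma pairing_add_left: "test1 \<phi> \<Longrightarrow> test1 \<psi> \<Longrightarrow> locint f \<Longrightarrow> pairing (\<lambda>t. \<phi> t + \<psi> t) f = pairing \<phi> f + pairing \<psi> f"
  unfolding pairing_def distrib_right by (intro Bochner_Integration.integral_add test1_integrable)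

lemma pairing_cmult_right: "pairing \<phi> (\<lambda>t. c * f t) = c * pairing \<phi> f"
  unfolding pairing_def mult.left_commute[of _ c] by simp

lemma pairing_cmult_left: "pairing (\<lambda>t. c * \<phi> t) f = c * pairing \<phi> f"
  unfolding pairing_def mult.assoc by simp

lemma pairing_zero [simp]: "pairing (\<lambda>_. 0) f = 0" "pairing \<phi> (\<lambda>_. 0) = 0"
  by (simp_all add: pairing_def)

lemma pairing_sum_right:
  assumes "finite I" "test1 \<phi>" "\<And>i. i \<in> I \<Longrightarrow> locint (f i)"
  shows "pairing \<phi> (\<lambda>t. \<Sum>i\<in>I. f i t) = (\<Sum>i\<in>I. pairing \<phi> (f i))"
  unfolding pairing_def sum_distrib_left
  by (rule Bochner_Integration.integral_sum) (use assms test1_integrable in blast)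

lemma pairing_sum_left:
  assumes "finite I" "locint f" "\<And>i. i \<in> I \<Longrightarrow> test1 (\<phi> i)"
  shows "pairing (\<lambda>t. \<Sum>i\<in>I. \<phi> i t) f = (\<Sum>i\<in>I. pairing (\<phi> i) f)"
  unfolding pairing_def sum_distrib_right
  by (rule Bochner_Integration.integral_sum) (use assms test1_integrable in blast)

lemma pairing_by_parts:
  assumes \<phi>: "test1 \<phi>" and x: "abs_primitive g x" and g: "g \<in> borel_measurable borel"
  shows "pairing (deriv \<phi>) x = - pairing \<phi> g"
proof -
  have lg: "locint g" using x g by (simp add: locint_def abs_primitive_def)
  have lx: "locint x" by (rule locint_continuous[OF abs_primitive_continuous[OF x]])
  obtain a' b' where ab': "\<And>t. t \<notin> {a'..b'} \<Longrightarrow> \<phi> t = 0" using \<phi> by (auto simp: test1_def)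
  obtain a2 b2 where ab2: "\<And>t. t \<notin> {a2..b2} \<Longrightarrow> deriv \<phi> t = 0" using test1_deriv[OF \<phi>] by (auto simp: test1_def)
  define a b where "a = min a' a2 - 1" and "b = max a (max b' b2 + 1)"
  have z: "\<phi> t = 0" "deriv \<phi> t = 0" if "t \<notin> {a..b}" for t
    using that by (intro ab' ab2; auto simp: a_def b_def)+
  have "\<phi> a = 0" "\<phi> b = 0" by (auto intro!: ab' simp: a_def b_def)
  have "abs_primitive (deriv \<phi>) \<phi>"
    using \<phi> by (intro abs_primitive_deriv smooth_fun_has_deriv smooth_fun_continuous smooth_fun_deriv test1_smooth)
  from abs_primitive_mult[OF this x] have "((\<lambda>t. \<phi> t * g t + deriv \<phi> t * x t) has_integral (\<phi> b * x b - \<phi> a * x a)) {a..b}"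
    by (simp add: abs_primitive_def b_def)
  moreover have "((\<lambda>t. \<phi> t * g t + deriv \<phi> t * x t) has_integral (pairing \<phi> g + pairing (deriv \<phi>) x)) {a..b}"
    by (intro has_integral_add pairing_has_integral test1_deriv \<phi> lg lx z)
  ultimately have "pairing \<phi> g + pairing (deriv \<phi>) x = \<phi> b * x b - \<phi> a * x a"
    by (rule has_integral_unique[symmetric])
  hence "pairing \<phi> g + pairing (deriv \<phi>) x = 0"
    using \<open>\<phi> a = 0\<close> \<open>\<phi> b = 0\<close> by simp
  thus ?thesis by simp
qed

text \<open>Tested with a bump supported where \<open>g\<close> keeps the sign it has at
  \<open>c\<close>.\<close>

lemma pairing_continuous_zero:
  assumes g: "continuous_on UNIV g" and p: "\<And>\<phi>. test1 \<phi> \<Longrightarrow> pairing \<phi> g = 0"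
  shows "g c = 0"
proof (rule ccontr)
  assume "g c \<noteq> 0"
  have "isCont g c" using g by (simp add: continuous_on_eq_continuous_at)
  then obtain e where e: "e > 0" "\<And>t. dist t c < e \<Longrightarrow> dist (g t) (g c) < \<bar>g c\<bar>"
    unfolding continuous_at_eps_delta using \<open>g c \<noteq> 0\<close> by (metis zero_less_abs_iff)
  define d where "d = e / 2"
  have d: "d > 0" "d < e" using e by (auto simp: d_def)
  obtain \<phi> where \<phi>: "test1 \<phi>" "\<And>t. 0 \<le> \<phi> t" "\<phi> c > 0" "\<And>t. t \<notin> {c - d..c + d} \<Longrightarrow> \<phi> t = 0"
    using bump_exists[OF d(1)] by blast
  have pos: "0 \<le> sgn (g c) * g t" if "t \<in> {c - d..c + d}" for t
  proof -
    have "\<bar>g t - g c\<bar> < \<bar>g c\<bar>" using e(2)[of t] that d by (auto simp: dist_real_def)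
    thus ?thesis by (cases "g c" "0::real" rule: linorder_cases) auto
  qed
  let ?h = "\<lambda>t. \<phi> t * (sgn (g c) * g t)"
  have "(?h has_integral pairing \<phi> (\<lambda>t. sgn (g c) * g t)) {c - d..c + d}"
    by (intro pairing_has_integral \<phi> locint_cmult locint_continuous g)
  hence i: "(?h has_integral 0) (cbox (c - d) (c + d))" by (simp add: pairing_cmult_right p[OF \<phi>(1)])
  have "?h c = 0"
  proof (rule has_integral_0_cbox_imp_0[OF _ _ i])
    show "continuous_on (cbox (c - d) (c + d)) ?h"
      by (intro continuous_intros smooth_fun_continuous test1_smooth \<phi> continuous_on_subset[OF g]) auto
    show "\<And>t. t \<in> box (c - d) (c + d) \<Longrightarrow> 0 \<le> ?h t"
      by (intro mult_nonneg_nonneg \<phi>(2) pos) (auto simp: box_real)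
  qed (use d in auto)
  thus False using \<phi>(3) \<open>g c \<noteq> 0\<close> by (simp add: sgn_zero_iff)
qed

text \<open>The primitive that vanishes to the left of the support also vanishes to the right of it,
  because the total integral is 0.\<close>

lemma test1_primitive:
  assumes \<phi>: "test1 \<phi>" and z: "pairing \<phi> (\<lambda>_. 1) = 0"
  shows "\<exists>\<psi>. test1 \<psi> \<and> deriv \<psi> = \<phi>"
proof -
  obtain a b' where ab': "\<And>t. t \<notin> {a..b'} \<Longrightarrow> \<phi> t = 0" using \<phi> unfolding test1_def by blast
  define b where "b = max a b'"
  have ab1: "a \<le> b" by (simp add: b_def)
  have ab2: "\<phi> t = 0" if "t \<notin> {a..b}" for t
  proof -
    have "t \<notin> {a..b'}" using that by (auto simp: b_def)
    thus ?thesis by (rule ab')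
  qed
  note ab = ab1 ab2
  have c: "continuous_on S \<phi>" for S using \<phi> smooth_fun_continuous test1_smooth by blast
  obtain \<psi> where \<psi>: "\<psi> a = 0" "abs_primitive \<phi> \<psi>"
    using abs_primitive_exists[of \<phi> a] absolutely_integrable_continuous_real[OF c] by blast
  have i: "(\<phi> has_integral (\<psi> t - \<psi> s)) {s..t}" if "s \<le> t" for s t
    using \<psi>(2) that by (simp add: abs_primitive_def)
  have "(\<psi> has_real_derivative \<phi> t) (at t)" for t
  proof -
    have "((\<lambda>r. integral {t - 1..r} \<phi>) has_real_derivative \<phi> t) (at t within {t - 1..t + 1})"
      by (rule integral_has_real_derivative[OF c]) auto
    hence "((\<lambda>r. integral {t - 1..r} \<phi> + \<psi> (t - 1)) has_real_derivative \<phi> t + 0) (at t within {t - 1..t + 1})"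
      by (intro DERIV_add DERIV_const)
    hence "((\<lambda>r. integral {t - 1..r} \<phi> + \<psi> (t - 1)) has_real_derivative \<phi> t) (at t)"
      by (simp add: at_within_Icc_at)
    thus ?thesis
    proof (rule has_field_derivative_transform_within_open[of _ _ _ "{t - 1<..}"])
      show "integral {t - 1..r} \<phi> + \<psi> (t - 1) = \<psi> r" if "r \<in> {t - 1<..}" for r
        using integral_unique[OF i[of "t - 1" r]] that by simp
    qed auto
  qed
  hence d: "\<And>t. (\<psi> has_real_derivative \<phi> t) (at t)" .
  have "(\<phi> has_integral 0) {a..b}"
    using pairing_has_integral[OF \<phi> locint_continuous[OF continuous_on_const[of _ 1]] ab(2)] z by simp
  hence "\<psi> b = 0" using has_integral_unique[OF i[OF ab(1)]] \<psi>(1) by simp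
  have "\<psi> t = 0" if "t \<notin> {a..b}" for t
  proof (cases "t < a")
    case True
    have "(\<phi> has_integral 0) {t..a}"
      by (rule has_integral_spike_finite[of "{a}" _ _ "\<lambda>_. 0"]) (use ab(2) in auto)
    thus ?thesis using has_integral_unique[OF i[of t a]] True \<psi>(1) by fastforce
  next
    case False
    hence "b < t" using that by auto
    have "(\<phi> has_integral 0) {b..t}"
      by (rule has_integral_spike_finite[of "{b}" _ _ "\<lambda>_. 0"]) (use ab(2) in auto)
    thus ?thesis using has_integral_unique[OF i[of b t]] \<open>b < t\<close> \<open>\<psi> b = 0\<close> by fastforce
  qed
  moreover have "smooth_fun \<psi>" using d \<phi> test1_smooth by (blast intro: smooth_fun_by_deriv)
  moreover have "deriv \<psi> = \<phi>" using d by (auto intro: DERIV_imp_deriv)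
  ultimately show ?thesis by (blast intro: test1I)
qed

lemma mollifier_exists: "\<exists>\<rho>. test1 \<rho> \<and> pairing \<rho> (\<lambda>_. 1) = 1"
proof -
  have "\<not> (\<forall>\<phi>. test1 \<phi> \<longrightarrow> pairing \<phi> (\<lambda>_. 1) = 0)"
    using pairing_continuous_zero[of "\<lambda>_. 1" 0] by auto
  then obtain \<phi> where \<phi>: "test1 \<phi>" "pairing \<phi> (\<lambda>_. 1) \<noteq> 0" by blast
  thus ?thesis
    by (intro exI[of _ "\<lambda>t. inverse (pairing \<phi> (\<lambda>_. 1)) * \<phi> t"]) (auto simp: pairing_cmult_left intro: test1_cmult)
qed

text \<open>A test function minus its integral times a mollifier has integral 0, hence is the
  derivative of a test function; so \<open>L\<close> is determined by its value at the mollifier.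
  The argument is purely algebraic, and \<open>L\<close> may be any linear functional built from
  weak derivatives.\<close>

lemma vanishing_on_derivatives:
  fixes L :: "(real \<Rightarrow> real) \<Rightarrow> real"
  assumes add: "\<And>\<phi> \<psi>. test1 \<phi> \<Longrightarrow> test1 \<psi> \<Longrightarrow> L (\<lambda>t. \<phi> t + \<psi> t) = L \<phi> + L \<psi>"
    and scale: "\<And>c \<phi>. test1 \<phi> \<Longrightarrow> L (\<lambda>t. c * \<phi> t) = c * L \<phi>"
    and der: "\<And>\<phi>. test1 \<phi> \<Longrightarrow> L (deriv \<phi>) = 0"
  shows "\<exists>c. \<forall>\<phi>. test1 \<phi> \<longrightarrow> L \<phi> = c * pairing \<phi> (\<lambda>_. 1)"
proof -
  obtain \<rho> where \<rho>: "test1 \<rho>" "pairing \<rho> (\<lambda>_. 1) = 1" using mollifier_exists by blast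
  have one: "locint (\<lambda>_. 1)" by (simp add: locint_continuous)
  have "L \<phi> = L \<rho> * pairing \<phi> (\<lambda>_. 1)" if \<phi>: "test1 \<phi>" for \<phi>
  proof -
    let ?c = "pairing \<phi> (\<lambda>_. 1)"
    have t: "test1 (\<lambda>t. \<phi> t + (- ?c) * \<rho> t)" "test1 (\<lambda>t. (- ?c) * \<rho> t)" by (intro test1_add test1_cmult \<phi> \<rho>)+
    have "pairing (\<lambda>t. \<phi> t + (- ?c) * \<rho> t) (\<lambda>_. 1) = 0"
      by (subst pairing_add_left[OF \<phi> t(2) one]) (simp only: pairing_cmult_left \<rho> mult_1_right add.right_inverse)
    then obtain \<psi> where "test1 \<psi>" "deriv \<psi> = (\<lambda>t. \<phi> t + (- ?c) * \<rho> t)" using test1_primitive[OF t(1)] by blast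
    hence "L (\<lambda>t. \<phi> t + (- ?c) * \<rho> t) = 0" using der by metis
    thus ?thesis using add[OF \<phi> t(2)] scale[OF \<rho>(1), of "- ?c"] by (simp add: mult.commute)
  qed
  thus ?thesis by blast
qed

lemma integrals_zero_imp_AE_zero:
  assumes f: "locint f" and z: "\<And>s t. s \<le> t \<Longrightarrow> (f has_integral 0) {s..t}"
  shows "AE t in lborel. f t = 0"
proof -
  have fm: "f \<in> borel_measurable borel" using f by (simp add: locint_def)
  have si: "integrable lborel (\<lambda>t. indicator {a..b} t * f t)" for a b
    using f integrable_completion[of "\<lambda>t. indicator {a..b} t * f t" lborel] fm
    by (simp add: locint_def set_integrable_def)
  have Icc: "(LINT t|lborel. indicator {a..b} t * f t) = 0" for a b
  proof -
    have "((\<lambda>t. indicator {a..b} t * f t) has_integral (LINT t|lborel. indicator {a..b} t * f t)) UNIV"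
      by (rule has_integral_integral_lborel[OF si])
    moreover have "(\<lambda>t. indicator {a..b} t * f t) = (\<lambda>t. if t \<in> {a..b} then f t else 0)" by (auto simp: indicator_def)
    ultimately have "(f has_integral (LINT t|lborel. indicator {a..b} t * f t)) {a..b}"
      using has_integral_restrict_UNIV by metis
    thus ?thesis using z[of a b] has_integral_unique by (cases "a \<le> b") auto
  qed
  have "AE t in lborel. indicator {- real n..real n} t * f t = 0" for n
  proof (rule sigma_finite_measure.density_zero[OF lborel.sigma_finite_measure_axioms si])
    let ?g = "\<lambda>t. indicator {- real n..real n} t * f t"
    have gi: "set_integrable lborel A ?g" if "A \<in> sets borel" for A
      unfolding set_integrable_def using that by (intro integrable_mult_indicator si) auto
    fix A :: "real set" assume "A \<in> sets lborel"
    \<comment> \<open>Half-lines generate the Borel sets and are stable under intersection, so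
      vanishing of the integrals extends from them to every Borel set.\<close>
    hence S: "A \<in> sigma_sets UNIV (range (\<lambda>a. {..a::real}))" by (simp add: borel_eq_atMost)
    have "Int_stable (range (\<lambda>a. {..a::real}))" "range (\<lambda>a. {..a::real}) \<subseteq> Pow UNIV"
      by (auto simp: Int_stable_def)
    from this S show "set_lebesgue_integral lborel A ?g = 0"
    proof (induction rule: sigma_sets_induct_disjoint)
      case (basic A)
      then obtain a where "A = {..a}" by auto
      hence "indicator A t *\<^sub>R ?g t = indicator {- real n..min a (real n)} t * f t" for t
        by (auto simp: indicator_def)
      thus ?case unfolding set_lebesgue_integral_def by (simp only: Icc)
    next
      case (compl A)
      hence A: "A \<in> sets borel" by (simp add: borel_eq_atMost)
      have "(LINT t|lborel. indicator (UNIV - A) t *\<^sub>R ?g t) = (LINT t|lborel. ?g t - indicator A t *\<^sub>R ?g t)"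
        by (intro Bochner_Integration.integral_cong) (auto simp: indicator_def)
      also have "\<dots> = (LINT t|lborel. ?g t) - (LINT t|lborel. indicator A t *\<^sub>R ?g t)"
        using gi[OF A] by (intro Bochner_Integration.integral_diff si) (simp add: set_integrable_def)
      also have "\<dots> = 0" using compl(2) Icc by (simp add: set_lebesgue_integral_def)
      finally show ?case by (simp add: set_lebesgue_integral_def)
    next
      case (union A)
      hence A: "A i \<in> sets borel" for i by (auto simp: borel_eq_atMost)
      have "set_lebesgue_integral lborel (\<Union>i. A i) ?g = (\<Sum>i. set_lebesgue_integral lborel (A i) ?g)"
        using union(1) A by (intro lebesgue_integral_countable_add gi sets.countable_UN) (auto simp: disjoint_family_on_def)
      thus ?case using union by simp
    qed (simp add: set_lebesgue_integral_def)
  qed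
  hence "AE t in lborel. \<forall>n. indicator {- real n..real n} t * f t = 0" unfolding AE_all_countable ..
  thus ?thesis
  proof (rule AE_mp, intro AE_I2 impI)
    fix t assume *: "\<forall>n. indicator {- real n..real n} t * f t = 0"
    obtain n where "\<bar>t\<bar> \<le> real n" using real_arch_simple by blast
    thus "f t = 0" using *[rule_format, of n] by (auto simp: indicator_def abs_le_iff split: if_splits)
  qed
qed

text \<open>du Bois-Reymond: the primitive of \<open>f\<close> has zero weak derivative, hence is
  constant, so the integral of \<open>f\<close> over every interval vanishes.\<close>

lemma pairing_zero_imp_AE_zero:
  assumes f: "locint f" and p: "\<And>\<phi>. test1 \<phi> \<Longrightarrow> pairing \<phi> f = 0"
  shows "AE t in lborel. f t = 0"
proof -
  obtain W where W: "abs_primitive f W" using abs_primitive_exists[of f 0] f by (auto simp: locint_def)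
  have cW: "continuous_on UNIV W" by (rule abs_primitive_continuous[OF W])
  have lW: "locint W" by (rule locint_continuous[OF cW])
  have "\<exists>c. \<forall>\<phi>. test1 \<phi> \<longrightarrow> pairing \<phi> W = c * pairing \<phi> (\<lambda>_. 1)"
  proof (rule vanishing_on_derivatives)
    show "pairing (deriv \<phi>) W = 0" if "test1 \<phi>" for \<phi>
      using pairing_by_parts[OF that W] p[OF that] f by (simp add: locint_def)
  qed (auto simp: pairing_add_left pairing_cmult_left lW)
  then obtain c where c: "\<And>\<phi>. test1 \<phi> \<Longrightarrow> pairing \<phi> W = c * pairing \<phi> (\<lambda>_. 1)" by blast
  have "W t + (- c) * 1 = 0" for t
  proof (rule pairing_continuous_zero[of "\<lambda>t. W t + (- c) * 1"])
    show "continuous_on UNIV (\<lambda>t. W t + (- c) * 1)" by (intro continuous_intros cW)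
    fix \<phi> assume \<phi>: "test1 \<phi>"
    show "pairing \<phi> (\<lambda>t. W t + (- c) * 1) = 0"
      using pairing_add_right[OF \<phi> lW locint_continuous, of "\<lambda>_. (- c) * 1"]
      by (simp only: pairing_cmult_right c[OF \<phi>]) (simp add: continuous_intros)
  qed
  hence W': "W t = c" for t by (smt (verit) mult_1_right)
  show ?thesis
  proof (rule integrals_zero_imp_AE_zero[OF f])
    show "(f has_integral 0) {s..t}" if "s \<le> t" for s t
      using W that W' by (auto simp: abs_primitive_def)
  qed
qed

section \<open>Weak solutions\<close>

text \<open>The formal adjoint \<open>p(-d/dt)\<close>: all derivatives act on the test function,
  since the signal is merely locally integrable.\<close>

definition adj_op :: "real poly \<Rightarrow> (real \<Rightarrow> real) \<Rightarrow> real \<Rightarrow> real" where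
  "adj_op p \<phi> t = (\<Sum>k\<le>degree p. (-1) ^ k * coeff p k * (deriv ^^ k) \<phi> t)"

lemma adj_op_sum_le: "degree p \<le> N \<Longrightarrow> adj_op p \<phi> t = (\<Sum>k\<le>N. (-1) ^ k * coeff p k * (deriv ^^ k) \<phi> t)"
  unfolding adj_op_def by (rule sum.mono_neutral_left) (auto simp: coeff_eq_0)

lemma adj_op_0 [simp]: "adj_op 0 \<phi> = (\<lambda>_. 0)"
  by (auto simp: adj_op_def)

lemma iterated_deriv_cmult:
  assumes "smooth_fun \<phi>" shows "(deriv ^^ k) (\<lambda>t. c * \<phi> t) = (\<lambda>t. c * (deriv ^^ k) \<phi> t)"
proof (induction k)
  case (Suc k)
  have "((deriv ^^ k) \<phi> has_real_derivative (deriv ^^ Suc k) \<phi> t) (at t)" for t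
    using assms by (simp add: smooth_fun_def field_differentiable_derivI)
  hence "deriv (\<lambda>t. c * (deriv ^^ k) \<phi> t) t = c * (deriv ^^ Suc k) \<phi> t" for t
    by (intro DERIV_imp_deriv DERIV_cmult)
  thus ?case using Suc by auto
qed auto

text \<open>Horner step of the adjoint, with the negative derivative as new test function. The rules
  for linear combinations, products and exponentials are inductions on \<open>p\<close> through this
  equation.\<close>

lemma adj_op_pCons:
  assumes "smooth_fun \<phi>"
  shows "adj_op (pCons a p) \<phi> = (\<lambda>t. a * \<phi> t + adj_op p (\<lambda>t. (-1) * deriv \<phi> t) t)"
proof
  fix t
  have "adj_op (pCons a p) \<phi> t = (\<Sum>k\<le>Suc (degree p). (-1) ^ k * coeff (pCons a p) k * (deriv ^^ k) \<phi> t)"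
    by (rule adj_op_sum_le) (simp add: degree_pCons_le)
  also have "\<dots> = a * \<phi> t + (\<Sum>k\<le>degree p. (-1) ^ Suc k * coeff p k * (deriv ^^ k) (deriv \<phi>) t)"
    by (subst sum.atMost_Suc_shift) (simp add: funpow_swap1)
  also have "(\<Sum>k\<le>degree p. (-1) ^ Suc k * coeff p k * (deriv ^^ k) (deriv \<phi>) t) = adj_op p (\<lambda>t. (-1) * deriv \<phi> t) t"
    unfolding adj_op_def iterated_deriv_cmult[OF smooth_fun_deriv[OF assms]] by (intro sum.cong) auto
  finally show "adj_op (pCons a p) \<phi> t = a * \<phi> t + adj_op p (\<lambda>t. (-1) * deriv \<phi> t) t" .
qed

lemma adj_op_add: "adj_op (p + q) \<phi> = (\<lambda>t. adj_op p \<phi> t + adj_op q \<phi> t)"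
proof
  fix t
  let ?N = "max (degree p) (degree q)"
  show "adj_op (p + q) \<phi> t = adj_op p \<phi> t + adj_op q \<phi> t"
    using adj_op_sum_le[of "p + q" ?N \<phi> t] adj_op_sum_le[of p ?N \<phi> t] adj_op_sum_le[of q ?N \<phi> t]
    by (simp add: degree_add_le sum.distrib algebra_simps)
qed

lemma adj_op_smult: "adj_op (smult c p) \<phi> = (\<lambda>t. c * adj_op p \<phi> t)"
proof
  fix t
  show "adj_op (smult c p) \<phi> t = c * adj_op p \<phi> t"
    using adj_op_sum_le[of "smult c p" "degree p" \<phi> t]
    by (simp add: adj_op_def sum_distrib_left algebra_simps)
qed

lemma adj_op_sum: "finite I \<Longrightarrow> adj_op (\<Sum>i\<in>I. p i) \<phi> = (\<lambda>t. \<Sum>i\<in>I. adj_op (p i) \<phi> t)"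
  by (induction I rule: finite_induct) (auto simp: adj_op_add)

lemma test1_adj_op: "test1 \<phi> \<Longrightarrow> test1 (adj_op p \<phi>)"
proof (induction p arbitrary: \<phi>)
  case 0 thus ?case by (simp add: test1_zero)
next
  case (pCons a p)
  thus ?case
    by (subst adj_op_pCons) (auto intro!: test1_smooth test1_add test1_cmult pCons test1_deriv[THEN test1_cmult, of _ "-1", simplified])
qed

lemma deriv_add_cmult:
  assumes "smooth_fun f" "smooth_fun g"
  shows "deriv (\<lambda>t. c * f t + g t) = (\<lambda>t. c * deriv f t + deriv g t)"
  by (intro ext DERIV_imp_deriv DERIV_add DERIV_cmult smooth_fun_has_deriv assms)

lemma smooth_fun_adj_op: "smooth_fun \<phi> \<Longrightarrow> smooth_fun (adj_op p \<phi>)"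
proof (induction p arbitrary: \<phi>)
  case 0 thus ?case by (simp add: smooth_fun_const)
next
  case (pCons a p)
  thus ?case
    by (subst adj_op_pCons) (auto intro!: smooth_fun_add smooth_fun_cmult pCons smooth_fun_deriv[THEN smooth_fun_cmult, of _ "-1", simplified])
qed

lemma adj_op_lincomb:
  "smooth_fun \<phi> \<Longrightarrow> smooth_fun \<psi> \<Longrightarrow>
    adj_op p (\<lambda>t. c * \<phi> t + \<psi> t) = (\<lambda>t. c * adj_op p \<phi> t + adj_op p \<psi> t)"
proof (induction p arbitrary: \<phi> \<psi>)
  case (pCons a p)
  have s: "smooth_fun (\<lambda>t. (-1) * deriv \<phi> t)" "smooth_fun (\<lambda>t. (-1) * deriv \<psi> t)"
    by (intro smooth_fun_cmult smooth_fun_deriv pCons)+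
  have "(\<lambda>t. (-1) * deriv (\<lambda>t. c * \<phi> t + \<psi> t) t) = (\<lambda>t. c * ((-1) * deriv \<phi> t) + (-1) * deriv \<psi> t)"
    unfolding deriv_add_cmult[OF pCons(3,4)] by (auto simp: algebra_simps)
  thus ?case
    using pCons.IH[OF s] pCons(3,4)
    by (subst (1 2 3) adj_op_pCons) (auto intro!: smooth_fun_add smooth_fun_cmult simp: algebra_simps)
qed simp

lemma adj_op_deriv: "smooth_fun \<phi> \<Longrightarrow> adj_op p (\<lambda>t. (-1) * deriv \<phi> t) = (\<lambda>t. (-1) * deriv (adj_op p \<phi>) t)"
proof (induction p arbitrary: \<phi>)
  case 0
  have "deriv (\<lambda>_::real. 0::real) t = 0" for t by (rule DERIV_imp_deriv) simp
  thus ?case by simp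
next
  case (pCons a p)
  let ?d = "\<lambda>t. (-1) * deriv \<phi> t"
  have s: "smooth_fun ?d" by (intro smooth_fun_cmult smooth_fun_deriv pCons)
  have "adj_op (pCons a p) ?d = (\<lambda>t. a * ?d t + adj_op p (\<lambda>t. (-1) * deriv ?d t) t)" by (rule adj_op_pCons[OF s])
  also have "\<dots> = (\<lambda>t. a * ?d t + (-1) * deriv (adj_op p ?d) t)" unfolding pCons.IH[OF s] ..
  also have "\<dots> = (\<lambda>t. (-1) * deriv (adj_op (pCons a p) \<phi>) t)"
    unfolding adj_op_pCons[OF pCons(3)] deriv_add_cmult[OF pCons(3) smooth_fun_adj_op[OF s]] by (auto simp: algebra_simps)
  finally show ?case .
qed

lemma adj_op_mult: "smooth_fun \<phi> \<Longrightarrow> adj_op (p * q) \<phi> = adj_op p (adj_op q \<phi>)"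
proof (induction p arbitrary: \<phi>)
  case (pCons a p)
  let ?d = "\<lambda>t. (-1) * deriv \<phi> t"
  have s: "smooth_fun ?d" by (intro smooth_fun_cmult smooth_fun_deriv pCons)
  have "adj_op (pCons a p * q) \<phi> = (\<lambda>t. a * adj_op q \<phi> t + adj_op (p * q) ?d t)"
    by (simp add: mult_pCons_left adj_op_add adj_op_smult adj_op_pCons[OF pCons(3), of 0])
  also have "\<dots> = adj_op (pCons a p) (adj_op q \<phi>)"
    unfolding pCons.IH[OF s] unfolding adj_op_deriv[OF pCons(3)] adj_op_pCons[OF smooth_fun_adj_op[OF pCons(3)]] ..
  finally show ?case .
qed simp

text \<open>Exponentials are eigenfunctions of \<open>p(d/dt)\<close>. Used as inputs they read off
  the values of a polynomial from its weak action.\<close>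

lemma pairing_adj_op_exp:
  assumes "test1 \<phi>"
  shows "pairing (adj_op p \<phi>) (\<lambda>t. exp (s * t)) = poly p s * pairing \<phi> (\<lambda>t. exp (s * t))"
  using assms
proof (induction p arbitrary: \<phi>)
  case (pCons a p)
  let ?d = "\<lambda>t. (-1) * deriv \<phi> t" and ?e = "\<lambda>t. exp (s * t)"
  have t: "test1 ?d" by (intro test1_cmult test1_deriv pCons)
  have c: "continuous_on UNIV (\<lambda>t. k * ?e t)" for k by (intro continuous_intros)
  have "abs_primitive (\<lambda>t. s * ?e t) ?e" by (rule abs_primitive_deriv[OF _ c]) (auto intro!: derivative_eq_intros)
  from pairing_by_parts[OF pCons(3) this] have "pairing ?d ?e = s * pairing \<phi> ?e"
    using c[of s] unfolding pairing_cmult_left by (simp add: borel_measurable_continuous_onI pairing_cmult_right)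
  moreover have "pairing (adj_op (pCons a p) \<phi>) ?e = a * pairing \<phi> ?e + pairing (adj_op p ?d) ?e"
    unfolding adj_op_pCons[OF test1_smooth[OF pCons(3)]] using c[of 1]
    by (subst pairing_add_left) (auto intro!: test1_cmult pCons test1_adj_op t locint_continuous simp only: pairing_cmult_left, simp_all)
  ultimately show ?case unfolding pCons.IH[OF t] by (simp add: algebra_simps)
qed (simp add: pairing_def)

section \<open>Rows of differential operators and elimination of the state\<close>

definition row_pairing :: "real poly^'n \<Rightarrow> (real \<Rightarrow> real^'n) \<Rightarrow> (real \<Rightarrow> real) \<Rightarrow> real" where
  "row_pairing q w \<phi> = (\<Sum>j\<in>UNIV. pairing (adj_op (q $ j) \<phi>) (\<lambda>t. w t $ j))"

lemma weak_apply_eq: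
  assumes "w \<in> L2loc" "\<And>i. test1 (\<phi> i)"
  shows "weak_apply R w \<phi> = (\<Sum>i\<in>UNIV. row_pairing (row i R) w (\<phi> i))"
proof -
  have "weak_apply R w \<phi> = (LINT t|lborel. (\<Sum>i\<in>UNIV. \<Sum>j\<in>UNIV. adj_op (R $ i $ j) (\<phi> i) t * w t $ j))"
    unfolding weak_apply_def adj_op_def by (simp add: sum_distrib_right)
  also have "\<dots> = (\<Sum>i\<in>UNIV. \<Sum>j\<in>UNIV. pairing (adj_op (R $ i $ j) (\<phi> i)) (\<lambda>t. w t $ j))"
  proof -
    have i: "integrable lborel (\<lambda>t. adj_op (R $ i $ j) (\<phi> i) t * w t $ j)" for i j
      by (intro test1_integrable test1_adj_op assms L2loc_component_locint)
    show ?thesis unfolding pairing_def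
      by (subst Bochner_Integration.integral_sum, intro Bochner_Integration.integrable_sum i)
        (intro sum.cong refl Bochner_Integration.integral_sum i)
  qed
  finally show ?thesis by (simp add: row_pairing_def row_def)
qed

definition const_pmat :: "'a::zero^'b^'c \<Rightarrow> 'a poly^'b^'c" where
  "const_pmat M = (\<chi> i j. [:M $ i $ j:])"

definition const_pvec :: "'a::zero^'b \<Rightarrow> 'a poly^'b" where
  "const_pvec v = (\<chi> j. [:v $ j:])"

definition xi_minus :: "'a::comm_ring_1^'d^'d \<Rightarrow> 'a poly^'d^'d" where
  "xi_minus A = (\<chi> i j. (if i = j then [:0, 1:] else 0) - [:A $ i $ j:])"

text \<open>Elimination of the state: \<open>Q y = Q C x + Q D u\<close>, and if
  \<open>Q C = R (xi I - A)\<close>, then \<open>Q C x = R B u\<close> along trajectories, which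
  leaves \<open>P u\<close>.\<close>

definition realizes :: "real^'d^'d \<Rightarrow> real^'n^'d \<Rightarrow> real^'d^'n \<Rightarrow> real^'n^'n \<Rightarrow>
   real poly^'n^'n \<Rightarrow> real poly^'n^'n \<Rightarrow> real poly^'d^'n \<Rightarrow> bool" where
  "realizes A B C D P Q R \<longleftrightarrow>
     Q ** const_pmat C = R ** xi_minus A \<and> P = Q ** const_pmat D + R ** const_pmat B"

lemma const_pvec_0: "const_pvec 0 = 0"
  by (simp add: const_pvec_def vec_eq_iff)

lemma xi_minus_mult: "(r v* xi_minus A) $ m = [:0, 1:] * r $ m - (r v* const_pmat A) $ m"
proof -
  have "(r v* xi_minus A) $ m = (\<Sum>i\<in>UNIV. (if i = m then [:0, 1:] * r $ i else 0) - [:A $ i $ m:] * r $ i)"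
    unfolding vector_matrix_mult_def xi_minus_def by (auto intro!: sum.cong simp: algebra_simps)
  thus ?thesis by (simp add: sum_subtractf vector_matrix_mult_def const_pmat_def)
qed

lemma row_matrix_mult: "row i (M ** N) = row i M v* N"
  by (simp add: row_def matrix_matrix_mult_def vector_matrix_mult_def vec_eq_iff mult.commute)

lemma pairing_const_pmat:
  fixes f :: "real \<Rightarrow> real^'b" and M :: "real^'b^'a"
  assumes \<phi>: "test1 \<phi>" and f: "\<And>b. locint (\<lambda>t. f t $ b)"
  shows "(\<Sum>a\<in>UNIV. pairing (adj_op (q $ a) \<phi>) (\<lambda>t. (M *v f t) $ a))
    = (\<Sum>b\<in>UNIV. pairing (adj_op ((q v* const_pmat M) $ b) \<phi>) (\<lambda>t. f t $ b))"
proof -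
  have "pairing (adj_op (q $ a) \<phi>) (\<lambda>t. (M *v f t) $ a)
      = (\<Sum>b\<in>UNIV. M $ a $ b * pairing (adj_op (q $ a) \<phi>) (\<lambda>t. f t $ b))" for a
    unfolding matrix_vector_mult_def vec_lambda_beta
    by (subst pairing_sum_right) (auto intro: test1_adj_op \<phi> locint_cmult f simp: pairing_cmult_right)
  moreover have "pairing (adj_op ((q v* const_pmat M) $ b) \<phi>) (\<lambda>t. f t $ b)
      = (\<Sum>a\<in>UNIV. M $ a $ b * pairing (adj_op (q $ a) \<phi>) (\<lambda>t. f t $ b))" for b
  proof -
    have "adj_op ((q v* const_pmat M) $ b) \<phi> = (\<lambda>t. \<Sum>a\<in>UNIV. M $ a $ b * adj_op (q $ a) \<phi> t)"
      by (simp add: vector_matrix_mult_def const_pmat_def adj_op_sum adj_op_smult)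
    thus ?thesis
      by (simp add: pairing_sum_left test1_cmult test1_adj_op \<phi> f pairing_cmult_left)
  qed
  ultimately show ?thesis by (simp add: sum.swap[of _ "UNIV::'a set"])
qed

lemma row_pairing_const_pmat:
  fixes f :: "real \<Rightarrow> real^'b" and M :: "real^'b^'a"
  assumes "test1 \<phi>" "\<And>b. locint (\<lambda>t. f t $ b)"
  shows "row_pairing q (\<lambda>t. M *v f t) \<phi> = row_pairing (q v* const_pmat M) f \<phi>"
  unfolding row_pairing_def by (rule pairing_const_pmat[OF assms])

lemma row_pairing_add:
  fixes w :: "real \<Rightarrow> real^'n"
  shows "test1 \<phi> \<Longrightarrow> (\<And>j. locint (\<lambda>t. w t $ j)) \<Longrightarrow> row_pairing (q + q') w \<phi> = row_pairing q w \<phi> + row_pairing q' w \<phi>"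
  by (simp add: row_pairing_def adj_op_add pairing_add_left test1_adj_op sum.distrib)

lemma row_pairing_add_right:
  fixes f g :: "real \<Rightarrow> real^'n"
  shows "test1 \<phi> \<Longrightarrow> (\<And>j. locint (\<lambda>t. f t $ j)) \<Longrightarrow> (\<And>j. locint (\<lambda>t. g t $ j)) \<Longrightarrow>
    row_pairing q (\<lambda>t. f t + g t) \<phi> = row_pairing q f \<phi> + row_pairing q g \<phi>"
  by (simp add: row_pairing_def pairing_add_right test1_adj_op sum.distrib)

lemma row_pairing_xi: "test1 \<phi> \<Longrightarrow> row_pairing ([:0, 1:] *s q) w \<phi> = row_pairing q w (\<lambda>t. (-1) * deriv \<phi> t)"
  unfolding row_pairing_def using adj_op_pCons[OF test1_smooth, of \<phi> 0] by simp

lemma row_pairing_by_parts: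
  fixes x g :: "real \<Rightarrow> real^'n"
  assumes \<phi>: "test1 \<phi>" and x: "abs_primitive g x" and m: "\<And>j. (\<lambda>t. g t $ j) \<in> borel_measurable borel"
  shows "row_pairing ([:0, 1:] *s q) x \<phi> = row_pairing q g \<phi>"
proof -
  have 1: "adj_op (q $ j) (\<lambda>t. (-1) * deriv \<phi> t) = (\<lambda>t. (-1) * deriv (adj_op (q $ j) \<phi>) t)" for j
    by (rule adj_op_deriv[OF test1_smooth[OF \<phi>]])
  have 2: "pairing (deriv (adj_op (q $ j) \<phi>)) (\<lambda>t. x t $ j) = - pairing (adj_op (q $ j) \<phi>) (\<lambda>t. g t $ j)" for j
    by (rule pairing_by_parts[OF test1_adj_op[OF \<phi>] abs_primitive_component[OF x] m])
  show ?thesis unfolding row_pairing_xi[OF \<phi>] unfolding row_pairing_def 1 pairing_cmult_left 2 by simp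
qed

text \<open>Along a trajectory \<open>xi\<close> acts on \<open>x\<close> as
  \<open>A x + B u\<close>, so the part \<open>r (xi I - A)\<close> of \<open>q C\<close> turns into
  \<open>r B u\<close>. The constant row \<open>c\<close> left over by the division is kept, because
  it decides whether \<open>q\<close> annihilates the free outputs.\<close>

lemma row_pairing_trajectory:
  fixes q :: "real poly^'n" and A :: "real^'d^'d"
  fixes B :: "real^'n^'d" and C :: "real^'d^'n" and D :: "real^'n^'n"
  assumes tr: "trajectory A B u x" and \<phi>: "test1 \<phi>" and eq: "q v* const_pmat C = r v* xi_minus A + const_pvec c"
  shows "row_pairing q (\<lambda>t. C *v x t + D *v u t) \<phi>
    = row_pairing (q v* const_pmat D + r v* const_pmat B) u \<phi> + row_pairing (const_pvec c) x \<phi>"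
proof -
  have L: "u \<in> L2loc" "x \<in> L2loc" using trajectory_L2loc[OF tr] by auto
  have lx: "locint (\<lambda>t. x t $ m)" and lu: "locint (\<lambda>t. u t $ b)"
   and lA: "locint (\<lambda>t. (A *v x t) $ m)" and lB: "locint (\<lambda>t. (B *v u t) $ m)"
   and lC: "locint (\<lambda>t. (C *v x t) $ b)" and lD: "locint (\<lambda>t. (D *v u t) $ b)" for m b
    by (intro L2loc_component_locint L2loc_matrix L)+
  have "row_pairing ([:0, 1:] *s r) x \<phi> = row_pairing r (\<lambda>t. A *v x t + B *v u t) \<phi>"
  proof (rule row_pairing_by_parts[OF \<phi>])
    show "abs_primitive (\<lambda>t. A *v x t + B *v u t) x" using tr by (simp add: trajectory_def)
    show "(\<lambda>t. (A *v x t + B *v u t) $ j) \<in> borel_measurable borel" for j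
      using locint_add[OF lA[of j] lB[of j]] by (simp add: locint_def)
  qed
  moreover have "[:0, 1:] *s r + const_pvec c = q v* const_pmat C + r v* const_pmat A"
    unfolding eq by (simp add: vec_eq_iff xi_minus_mult)
  ultimately show ?thesis
    using row_pairing_add[OF \<phi> lx, of "[:0, 1:] *s r" "const_pvec c"] row_pairing_add[OF \<phi> lx, of "q v* const_pmat C" "r v* const_pmat A"]
    by (simp add: row_pairing_add_right \<phi> lA lB lC lD lx lu row_pairing_const_pmat row_pairing_add)
qed

lemma pairing_cong_AE:
  assumes "AE t in lborel. f t = g t" "f \<in> borel_measurable borel" "g \<in> borel_measurable borel" "test1 \<phi>"
  shows "pairing \<phi> f = pairing \<phi> g"
proof -
  have "\<phi> \<in> borel_measurable borel" using assms(4) by (intro borel_measurable_continuous_onI smooth_fun_continuous test1_smooth)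
  thus ?thesis unfolding pairing_def using assms by (intro integral_cong_AE) auto
qed

lemma realizes_imp_behavior_subset:
  assumes re: "realizes A B C D P Q R" shows "external_behavior A B C D \<subseteq> poly_behavior P Q"
proof (clarify)
  fix u y assume "(u, y) \<in> external_behavior A B C D"
  then obtain x where x: "y \<in> L2loc" "trajectory A B u x" "AE t in lborel. y t = C *v x t + D *v u t"
    by (auto simp: external_behavior_def state_behavior_iff)
  have u: "u \<in> L2loc" using trajectory_L2loc[OF x(2)] by simp
  have "weak_apply P u \<phi> = weak_apply Q y \<phi>" if "test_fun \<phi>" for \<phi>
  proof -
    have t: "test1 (\<phi> i)" for i using that by (simp add: test_fun_iff)
    have y: "pairing \<psi> (\<lambda>t. y t $ j) = pairing \<psi> (\<lambda>t. (C *v x t + D *v u t) $ j)" if "test1 \<psi>" for \<psi> j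
    proof (rule pairing_cong_AE[OF _ _ _ that])
      show "AE t in lborel. y t $ j = (C *v x t + D *v u t) $ j" using x(3) by auto
      show "(\<lambda>t. y t $ j) \<in> borel_measurable borel" "(\<lambda>t. (C *v x t + D *v u t) $ j) \<in> borel_measurable borel"
        using L2loc_component_locint[OF x(1), of j] L2loc_component_locint[OF trajectory_output_L2loc[OF x(2), of C D], of j]
        unfolding locint_def by blast+
    qed
    have "row_pairing (row i Q) y (\<phi> i) = row_pairing (row i P) u (\<phi> i)" for i
    proof -
      have "row i Q v* const_pmat C = row i R v* xi_minus A + const_pvec 0"
        using re by (simp add: realizes_def row_matrix_mult[symmetric] const_pvec_0)
      from row_pairing_trajectory[OF x(2) t[of i] this, where D = D]
      have "row_pairing (row i Q) (\<lambda>t. C *v x t + D *v u t) (\<phi> i)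
          = row_pairing (row i Q v* const_pmat D + row i R v* const_pmat B) u (\<phi> i)"
        by (simp add: const_pvec_0 row_pairing_def pairing_def)
      moreover have "row i Q v* const_pmat D + row i R v* const_pmat B = row i P"
        using re by (simp add: realizes_def row_matrix_mult[symmetric]) (simp add: row_def vec_eq_iff)
      ultimately show ?thesis by (simp add: row_pairing_def y test1_adj_op t)
    qed
    thus ?thesis unfolding weak_apply_eq[OF u t] weak_apply_eq[OF x(1) t] by simp
  qed
  thus "(u, y) \<in> poly_behavior P Q" using u x(1) by (simp add: poly_behavior_def)
qed

lemma smooth_fun_mexp: "smooth_fun (\<lambda>t. (mexp A (s * t)) $ i $ j)"
proof (rule smooth_fun_coinduct[of _ "range (\<lambda>M t. (M ** mexp A (s * t)) $ i $ j)"])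
  show "(\<lambda>t. mexp A (s * t) $ i $ j) \<in> range (\<lambda>M t. (M ** mexp A (s * t)) $ i $ j)"
    by (rule range_eqI[of _ _ "mat 1"]) simp
  fix g assume "g \<in> range (\<lambda>M t. (M ** mexp A (s * t)) $ i $ j)"
  then obtain M where g: "g = (\<lambda>t. (M ** mexp A (s * t)) $ i $ j)" by blast
  have "(g has_real_derivative ((s *\<^sub>R (M ** A)) ** mexp A (s * t)) $ i $ j) (at t)" for t
  proof -
    have "((\<lambda>t. (M ** mexp A (s * t)) $ i $ j) has_real_derivative (M ** A ** mexp A (s * t)) $ i $ j * s) (at t)"
      by (rule DERIV_chain2[where f="\<lambda>t. (M ** mexp A t) $ i $ j" and g="\<lambda>t. s * t", OF mexp_matrix_deriv_entry])
        (auto intro!: derivative_eq_intros)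
    moreover have "((s *\<^sub>R (M ** A)) ** mexp A (s * t)) $ i $ j = (M ** A ** mexp A (s * t)) $ i $ j * s"
      by (simp add: matrix_matrix_mult_def[of "s *\<^sub>R _"] matrix_matrix_mult_def[of "M ** A"] sum_distrib_left mult_ac)
    ultimately show ?thesis by (simp add: g)
  qed
  thus "\<exists>g'\<in>range (\<lambda>M t. (M ** mexp A (s * t)) $ i $ j). \<forall>t. (g has_real_derivative g' t) (at t)"
    by (intro bexI[of _ "\<lambda>t. ((s *\<^sub>R (M ** A)) ** mexp A (s * t)) $ i $ j"] rangeI) auto
qed

text \<open>A vanishing remainder describes a differential equation satisfied by the outputs of all free responses.\<close>

definition remainder :: "real^'d^'d \<Rightarrow> real^'d^'n \<Rightarrow> real poly^'n \<Rightarrow> real^'d \<Rightarrow> bool" where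
  "remainder A C q c \<longleftrightarrow> (\<exists>r. q v* const_pmat C = r v* xi_minus A + const_pvec c)"

lemmas vmm_add = vector_matrix_left_distrib

lemma vmm_scale: "(f *s a) v* M = f *s (a v* (M :: 'a::comm_ring_1^'b^'c))"
  by (simp add: vec_eq_iff vector_matrix_mult_def sum_distrib_left mult_ac)

lemmas vmm_assoc = vector_matrix_mul_assoc

lemma remainder_add: "remainder A C q c \<Longrightarrow> remainder A C q' c' \<Longrightarrow> remainder A C (q + q') (c + c')"
proof -
  assume "remainder A C q c" "remainder A C q' c'"
  then obtain r r' where "q v* const_pmat C = r v* xi_minus A + const_pvec c"
     "q' v* const_pmat C = r' v* xi_minus A + const_pvec c'" by (auto simp: remainder_def)
  hence "(q + q') v* const_pmat C = (r + r') v* xi_minus A + const_pvec (c + c')"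
    by (simp add: vmm_add) (simp add: const_pvec_def vec_eq_iff)
  thus ?thesis by (auto simp: remainder_def)
qed

lemma remainder_scale: "remainder A C q c \<Longrightarrow> remainder A C ([:k:] *s q) (k *s c)"
proof -
  assume "remainder A C q c"
  then obtain r where "q v* const_pmat C = r v* xi_minus A + const_pvec c" by (auto simp: remainder_def)
  hence "([:k:] *s q) v* const_pmat C = ([:k:] *s r) v* xi_minus A + const_pvec (k *s c)"
    unfolding vmm_scale by (simp add: const_pvec_def vec_eq_iff smult_add_right)
  thus ?thesis by (auto simp: remainder_def)
qed

lemma const_pvec_xi: "[:0, 1:] *s const_pvec c = const_pvec c v* xi_minus A + const_pvec (c v* A)"
proof -
  have "(const_pvec c v* const_pmat A) $ m = [:(c v* A) $ m:]" for m
  proof -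
    have "(\<Sum>i\<in>S. [:A $ i $ m * c $ i:]) = [:\<Sum>i\<in>S. c $ i * A $ i $ m:]" for S
      by (induction S rule: infinite_finite_induct) (auto simp: mult.commute)
    thus ?thesis by (simp add: vector_matrix_mult_def const_pvec_def const_pmat_def)
  qed
  thus ?thesis by (simp add: vec_eq_iff xi_minus_mult) (simp add: const_pvec_def)
qed

text \<open>From \<open>xi c = c (xi I - A) + c A\<close>. Hence the remainder of \<open>q\<close>
  is the sum of the rows \<open>q_k C A^k\<close>, the remainders form an \<open>A\<close>-invariant
  space of rows, and multiplication by \<open>xi\<close> acts on them as \<open>A\<close>.\<close>

lemma remainder_xi: "remainder A C q c \<Longrightarrow> remainder A C ([:0, 1:] *s q) (c v* A)"
proof -
  assume "remainder A C q c"
  then obtain r where "q v* const_pmat C = r v* xi_minus A + const_pvec c" by (auto simp: remainder_def)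
  hence "([:0, 1:] *s q) v* const_pmat C = ([:0, 1:] *s r + const_pvec c) v* xi_minus A + const_pvec (c v* A)"
    unfolding vmm_scale vmm_add using const_pvec_xi[of c A] by (simp add: vector_space_over_itself.scale_right_distrib algebra_simps vec.scale_right_distrib)
  thus ?thesis by (auto simp: remainder_def)
qed

lemma remainder_axis: "remainder A C (axis i 1) (row i C)"
proof -
  have "axis i (1::real poly) $ k * M = (if k = i then M else 0)" for k M by (simp add: axis_def)
  hence "axis i 1 v* const_pmat C = 0 v* xi_minus A + const_pvec (row i C)"
    by (simp only: vec_eq_iff vector_matrix_mult_def vec_lambda_beta vector_add_component)
      (simp add: const_pmat_def const_pvec_def row_def)
  thus ?thesis unfolding remainder_def by (rule exI)
qed

lemma remainder_zero: "remainder A C 0 0"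
proof -
  have "0 v* const_pmat C = 0 v* xi_minus A + const_pvec 0" by (simp add: vec_eq_iff vector_matrix_mult_def const_pvec_def)
  thus ?thesis unfolding remainder_def by (rule exI)
qed

lemma remainder_sum:
  "finite I \<Longrightarrow> (\<And>i. i \<in> I \<Longrightarrow> remainder A C (q i) (c i)) \<Longrightarrow> remainder A C (\<Sum>i\<in>I. q i) (\<Sum>i\<in>I. c i)"
  by (induction I rule: finite_induct) (auto intro: remainder_add remainder_zero)

context
  fixes w :: "real \<Rightarrow> real^'n" and A :: "real^'d^'d" and C :: "real^'d^'n"
  assumes w: "w \<in> L2loc"
    and ann: "\<And>q \<phi>. remainder A C q 0 \<Longrightarrow> test1 \<phi> \<Longrightarrow> row_pairing q w \<phi> = 0"
begin

lemma locint_w: "locint (\<lambda>t. w t $ j)"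
  by (rule L2loc_component_locint[OF w])

lemma row_pairing_scale: "row_pairing ([:k:] *s q) w \<phi> = k * row_pairing q w \<phi>"
  unfolding row_pairing_def by (simp add: adj_op_smult pairing_cmult_left sum_distrib_left)

lemma row_pairing_lincomb:
  assumes "test1 \<phi>" "test1 \<psi>"
  shows "row_pairing q w (\<lambda>t. c * \<phi> t + \<psi> t) = c * row_pairing q w \<phi> + row_pairing q w \<psi>"
  unfolding row_pairing_def adj_op_lincomb[OF assms[THEN test1_smooth]]
  by (subst pairing_add_left) (auto intro!: test1_cmult test1_adj_op assms locint_w
      simp: pairing_cmult_left sum.distrib sum_distrib_left)

lemma row_pairing_0: "row_pairing 0 w \<phi> = 0"
  by (simp add: row_pairing_def)

lemma row_pairing_sum: "finite I \<Longrightarrow> test1 \<phi> \<Longrightarrow> row_pairing (\<Sum>i\<in>I. q i) w \<phi> = (\<Sum>i\<in>I. row_pairing (q i) w \<phi>)"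
  by (induction I rule: finite_induct) (auto simp: row_pairing_add locint_w row_pairing_0)

lemma row_pairing_cong:
  assumes "remainder A C q c" "remainder A C q' c" "test1 \<phi>"
  shows "row_pairing q w \<phi> = row_pairing q' w \<phi>"
proof -
  have "remainder A C (q + [:-1:] *s q') (c + (-1) *s c)" by (intro remainder_add remainder_scale assms)
  hence "row_pairing (q + [:-1:] *s q') w \<phi> = 0" using assms(3) by (intro ann) auto
  thus ?thesis by (simp only: row_pairing_add[OF assms(3) locint_w] row_pairing_scale)
qed

text \<open>Rows with remainder 0 annihilate \<open>w\<close>, so the pairing of a row with
  \<open>w\<close> depends only on its remainder. This leaves finitely many functionals on test
  functions, which satisfy a linear first-order system; multiplied by the inverse exponential they
  kill derivatives, hence are constant multiples of the integral, and the constants form the initial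
  state.\<close>

lemma free_response_of_annihilated: "\<exists>z. AE t in lborel. w t = C *v (mexp A t *v z)"
proof -
  define Ob where "Ob = {c. \<exists>q. remainder A C q c}"
  have sub: "subspace Ob"
    unfolding subspace_def Ob_def
    using remainder_add remainder_zero remainder_scale[of A C] by (fastforce simp flip: scalar_mult_eq_scaleR)
  \<comment> \<open>A linear projection onto the space of remainders. The images of the unit vectors
    span that space and are indexed by the state coordinates, so every matrix keeps the size of
    \<open>A\<close>.\<close>
  obtain g where g: "range g \<subseteq> Ob" "linear g" "\<And>c. c \<in> Ob \<Longrightarrow> g c = c"
    using linear_exists_left_inverse_on[OF linear_id sub] by auto
  define e where "e a = g (axis a 1)" for a :: 'd
  have "\<exists>q. remainder A C q (e a)" for a using g(1) by (auto simp: e_def Ob_def)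
  then obtain q where q: "\<And>a. remainder A C (q a) (e a)" by metis
  have expand: "c = (\<Sum>a\<in>UNIV. c $ a *s e a)" if "c \<in> Ob" for c
  proof -
    have "g (\<Sum>a\<in>UNIV. c $ a *s axis a 1) = (\<Sum>a\<in>UNIV. c $ a *s e a)"
      using g(2) by (simp add: linear_sum linear_scale scalar_mult_eq_scaleR e_def)
    thus ?thesis using g(3)[OF that] by (simp add: basis_expansion)
  qed
  define L where "L a \<phi> = row_pairing (q a) w \<phi>" for a \<phi>
  have Lrow: "row_pairing p w \<phi> = (\<Sum>a\<in>UNIV. c $ a * L a \<phi>)" if "remainder A C p c" "test1 \<phi>" for p c \<phi>
  proof -
    have "c \<in> Ob" using that by (auto simp: Ob_def)
    have "remainder A C (\<Sum>a\<in>UNIV. [:c $ a:] *s q a) (\<Sum>a\<in>UNIV. c $ a *s e a)"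
      by (intro remainder_sum remainder_scale q) auto
    hence "remainder A C (\<Sum>a\<in>UNIV. [:c $ a:] *s q a) c" using expand[OF \<open>c \<in> Ob\<close>] by simp
    from row_pairing_cong[OF that(1) this that(2)] show ?thesis
      by (simp add: row_pairing_sum that(2) row_pairing_scale L_def)
  qed
  \<comment> \<open>The projection followed by \<open>A\<close>. It agrees with \<open>A\<close> on
    remainders, and the rows of \<open>C\<close> are remainders.\<close>
  define A1 :: "real^'d^'d" where "A1 = (\<chi> a b. (e a v* A) $ b)"
  have Lderiv: "L a (\<lambda>t. (-1) * deriv \<phi> t) = (\<Sum>b\<in>UNIV. A1 $ a $ b * L b \<phi>)" if "test1 \<phi>" for a \<phi>
    unfolding L_def row_pairing_xi[OF that, symmetric]
    using Lrow[OF remainder_xi[OF q[of a]] that] by (simp add: A1_def L_def)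
  have Llin: "L a (\<lambda>t. c * \<phi> t + \<psi> t) = c * L a \<phi> + L a \<psi>" if "test1 \<phi>" "test1 \<psi>" for a c \<phi> \<psi>
    unfolding L_def by (rule row_pairing_lincomb[OF that])
  have L0: "L a (\<lambda>_. 0) = 0" for a using Llin[OF test1_zero test1_zero, of a 1] by simp
  have Lc: "L a (\<lambda>t. c * \<phi> t) = c * L a \<phi>" if "test1 \<phi>" for a c \<phi>
    using Llin[OF that test1_zero, of a c] L0 by simp
  have La: "L a (\<lambda>t. \<phi> t + \<psi> t) = L a \<phi> + L a \<psi>" if "test1 \<phi>" "test1 \<psi>" for a \<phi> \<psi>
    using Llin[OF that, of a 1] by simp
  have Ls: "L a (\<lambda>t. \<Sum>i\<in>I. \<phi> i t) = (\<Sum>i\<in>I. L a (\<phi> i))" if "finite I" "\<And>i. test1 (\<phi> i)" for a I and \<phi> :: "'d \<Rightarrow> real \<Rightarrow> real"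
    using that(1) by (induction I rule: finite_induct) (auto simp: L0 La that(2) test1_sum)
  define E where "E a b t = mexp A1 (-t) $ a $ b" for a b t
  define F where "F a b t = mexp A1 t $ a $ b" for a b t
  have sE: "smooth_fun (E a b)" for a b unfolding E_def using smooth_fun_mexp[of A1 "-1" a b] by simp
  have sF: "smooth_fun (F a b)" for a b unfolding F_def using smooth_fun_mexp[of A1 1 a b] by simp
  have tE: "test1 (\<lambda>t. E a b t * \<phi> t)" and tF: "test1 (\<lambda>t. F a b t * \<phi> t)" if "test1 \<phi>" for a b \<phi>
    by (intro test1_smooth_mult sE sF that)+
  \<comment> \<open>Integrating factor: the functionals \<open>L b\<close> are combined with the
    entries of the exponential of \<open>- t A1\<close>.\<close>
  define \<Gamma> where "\<Gamma> a \<phi> = (\<Sum>b\<in>UNIV. L b (\<lambda>t. E a b t * \<phi> t))" for a \<phi>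
  have "\<exists>z. \<forall>\<phi>. test1 \<phi> \<longrightarrow> \<Gamma> a \<phi> = z * pairing \<phi> (\<lambda>_. 1)" for a
  proof (rule vanishing_on_derivatives)
    show "\<Gamma> a (\<lambda>t. \<phi> t + \<psi> t) = \<Gamma> a \<phi> + \<Gamma> a \<psi>" if "test1 \<phi>" "test1 \<psi>" for \<phi> \<psi>
      unfolding \<Gamma>_def distrib_left by (simp add: La[OF tE[OF that(1)] tE[OF that(2)]] sum.distrib)
    show "\<Gamma> a (\<lambda>t. c * \<phi> t) = c * \<Gamma> a \<phi>" if "test1 \<phi>" for c \<phi>
      unfolding \<Gamma>_def mult.left_commute[of _ c] by (simp add: Lc[OF tE[OF that]] sum_distrib_left)
    fix \<phi> assume \<phi>: "test1 \<phi>"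
    have "L b (\<lambda>t. E a b t * deriv \<phi> t) = - (\<Sum>c\<in>UNIV. A1 $ b $ c * L c (\<lambda>t. E a b t * \<phi> t))
        + (\<Sum>c\<in>UNIV. A1 $ c $ b * L b (\<lambda>t. E a c t * \<phi> t))" for b
    proof -
      have dE: "(E a b has_real_derivative - (\<Sum>c\<in>UNIV. E a c t * A1 $ c $ b)) (at t)" for t
      proof -
        have "((\<lambda>t. mexp A1 (-t) $ a $ b) has_real_derivative (A1 ** mexp A1 (-t)) $ a $ b * (-1)) (at t)"
          by (rule DERIV_chain2[where f="\<lambda>t. mexp A1 t $ a $ b" and g=uminus, OF mexp_deriv_entry])
            (auto intro!: derivative_eq_intros)
        moreover have "(A1 ** mexp A1 (-t)) $ a $ b = (\<Sum>c\<in>UNIV. E a c t * A1 $ c $ b)"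
          unfolding mexp_commute by (simp add: matrix_matrix_mult_def E_def)
        ultimately show ?thesis by (simp add: E_def[abs_def])
      qed
      have "deriv (\<lambda>t. E a b t * \<phi> t) t = E a b t * deriv \<phi> t + - (\<Sum>c\<in>UNIV. E a c t * A1 $ c $ b) * \<phi> t" for t
        by (rule DERIV_imp_deriv, rule DERIV_mult'[OF dE smooth_fun_has_deriv[OF test1_smooth[OF \<phi>]], THEN DERIV_cong])
          (simp add: algebra_simps)
      hence "E a b t * deriv \<phi> t = (-1) * ((-1) * deriv (\<lambda>t. E a b t * \<phi> t) t)
          + (\<Sum>c\<in>UNIV. E a c t * A1 $ c $ b) * \<phi> t" for t by simp
      hence eq: "(\<lambda>t. E a b t * deriv \<phi> t) = (\<lambda>t. (-1) * ((-1) * deriv (\<lambda>t. E a b t * \<phi> t) t)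
          + (\<Sum>c\<in>UNIV. A1 $ c $ b * (E a c t * \<phi> t)))"
        by (simp only: sum_distrib_right) (simp only: mult_ac)
      have "L b (\<lambda>t. E a b t * deriv \<phi> t) = (-1) * L b (\<lambda>t. (-1) * deriv (\<lambda>t. E a b t * \<phi> t) t)
          + L b (\<lambda>t. \<Sum>c\<in>UNIV. A1 $ c $ b * (E a c t * \<phi> t))"
        unfolding eq by (intro Llin test1_cmult test1_deriv tE \<phi> test1_sum) auto
      also have "L b (\<lambda>t. \<Sum>c\<in>UNIV. A1 $ c $ b * (E a c t * \<phi> t)) = (\<Sum>c\<in>UNIV. A1 $ c $ b * L b (\<lambda>t. E a c t * \<phi> t))"
        by (subst Ls) (simp_all only: Lc[OF tE[OF \<phi>]] test1_cmult[OF tE[OF \<phi>]] finite)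
      finally show ?thesis unfolding Lderiv[OF tE[OF \<phi>]] by simp
    qed
    hence "\<Gamma> a (deriv \<phi>) = - (\<Sum>b\<in>UNIV. \<Sum>c\<in>UNIV. A1 $ b $ c * L c (\<lambda>t. E a b t * \<phi> t))
        + (\<Sum>b\<in>UNIV. \<Sum>c\<in>UNIV. A1 $ c $ b * L b (\<lambda>t. E a c t * \<phi> t))"
      by (simp add: \<Gamma>_def sum.distrib sum_negf sum_subtractf)
    also have "\<dots> = 0" by (subst sum.swap) simp
    finally show "\<Gamma> a (deriv \<phi>) = 0" .
  qed
  then obtain z where z: "\<And>a \<phi>. test1 \<phi> \<Longrightarrow> \<Gamma> a \<phi> = z a * pairing \<phi> (\<lambda>_. 1)" by metis
  define z' where "z' = (\<chi> a. z a)"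
  have cF: "continuous_on UNIV (F a b)" for a b by (rule smooth_fun_continuous[OF sF])
  have L_eq: "L c \<phi> = (\<Sum>a\<in>UNIV. z a * pairing \<phi> (F c a))" if \<phi>: "test1 \<phi>" for c \<phi>
  proof -
    have G: "(\<Sum>a\<in>UNIV. \<Gamma> a (\<lambda>t. F c a t * \<phi> t)) = (\<Sum>b\<in>UNIV. L b (\<lambda>t. \<Sum>a\<in>UNIV. E a b t * (F c a t * \<phi> t)))"
      unfolding \<Gamma>_def by (subst sum.swap) (simp add: Ls tE tF \<phi>)
    have EF: "(\<lambda>t. \<Sum>a\<in>UNIV. E a b t * (F c a t * \<phi> t)) = (\<lambda>t. (if c = b then 1 else 0) * \<phi> t)" for b
    proof
      fix t
      have "(\<Sum>a\<in>UNIV. F c a t * E a b t) = (mexp A1 t ** mexp A1 (-t)) $ c $ b"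
        by (simp add: matrix_matrix_mult_def F_def E_def)
      hence "(\<Sum>a\<in>UNIV. F c a t * E a b t) = (if c = b then 1 else 0)" by (simp add: mexp_minus' mat_def)
      thus "(\<Sum>a\<in>UNIV. E a b t * (F c a t * \<phi> t)) = (if c = b then 1 else 0) * \<phi> t"
        by (simp add: sum_distrib_right[symmetric] mult.assoc[symmetric] mult.commute[of "E _ _ _"])
    qed
    have "(\<Sum>b\<in>UNIV. L b (\<lambda>t. (if c = b then 1 else 0) * \<phi> t)) = L c \<phi>"
      by (simp only: Lc[OF \<phi>]) (simp add: if_distrib[of "\<lambda>x. x * _"] cong: if_cong)
    hence "L c \<phi> = (\<Sum>a\<in>UNIV. \<Gamma> a (\<lambda>t. F c a t * \<phi> t))" unfolding G EF ..
    moreover have "\<Gamma> a (\<lambda>t. F c a t * \<phi> t) = z a * pairing \<phi> (F c a)" for a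
      using z[OF tF[OF \<phi>]] by (simp add: pairing_def mult.commute)
    ultimately show ?thesis by simp
  qed
  have pw: "pairing \<phi> (\<lambda>t. w t $ i) = pairing \<phi> (\<lambda>t. (C *v (mexp A1 t *v z')) $ i)" if \<phi>: "test1 \<phi>" for \<phi> i
  proof -
    have "row_pairing (axis i 1) w \<phi> = pairing \<phi> (\<lambda>t. w t $ i)"
    proof -
      have "adj_op 1 \<phi> = \<phi>" by (rule ext) (simp add: adj_op_def)
      hence "pairing (adj_op (axis i 1 $ j) \<phi>) (\<lambda>t. w t $ j) = (if j = i then pairing \<phi> (\<lambda>t. w t $ i) else 0)" for j
        by (simp add: axis_def)
      thus ?thesis by (simp add: row_pairing_def)
    qed
    hence "pairing \<phi> (\<lambda>t. w t $ i) = (\<Sum>c\<in>UNIV. C $ i $ c * (\<Sum>a\<in>UNIV. z a * pairing \<phi> (F c a)))"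
      using Lrow[OF remainder_axis \<phi>, of i] L_eq[OF \<phi>] by (simp add: row_def)
    also have "\<dots> = pairing \<phi> (\<lambda>t. \<Sum>c\<in>UNIV. C $ i $ c * (\<Sum>a\<in>UNIV. z a * F c a t))"
      by (simp add: pairing_sum_right \<phi> locint_cmult locint_sum locint_continuous[OF cF] pairing_cmult_right)
    finally show ?thesis by (simp add: matrix_vector_mult_def z'_def F_def mult.commute)
  qed
  have A1_row: "c v* matpow A1 k = c v* matpow A k" if "c \<in> Ob" for c k
    using that
  proof (induction k arbitrary: c)
    case (Suc k)
    have "c v* A1 = c v* A"
    proof -
      have "(c v* A1) $ b = ((\<Sum>a\<in>UNIV. c $ a *s e a) v* A) $ b" for b
        unfolding vector_matrix_mult_def A1_def vec_lambda_beta sum_component vector_smult_component sum_distrib_left sum_distrib_right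
        by (subst sum.swap) (simp add: mult_ac)
      thus ?thesis using expand[OF Suc.prems] by (simp add: vec_eq_iff)
    qed
    moreover have "c v* A \<in> Ob" using Suc.prems remainder_xi by (fastforce simp: Ob_def)
    ultimately show ?case using Suc.IH[of "c v* A"] by (simp add: matpow_Suc vmm_assoc[symmetric])
  qed auto
  have "C ** matpow A1 k = C ** matpow A k" for k
  proof -
    have "row i C \<in> Ob" for i using remainder_axis by (auto simp: Ob_def)
    hence "row i (C ** matpow A1 k) = row i (C ** matpow A k)" for i by (simp add: row_matrix_mult A1_row)
    thus ?thesis by (simp add: row_def vec_eq_iff)
  qed
  hence CE: "C *v (mexp A1 t *v z') = C *v (mexp A t *v z')" for t
    using matrix_mexp_eqI[of C A1 z' C A z' t] by (simp add: matrix_vector_mul_assoc)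
  have "AE t in lborel. w t $ i = (C *v (mexp A t *v z')) $ i" for i
  proof -
    have "continuous_on UNIV (\<lambda>t. (C *v (mexp A t *v z')) $ i)"
      using DERIV_isCont[OF mexp_vec_deriv[of C A z' i]] by (simp add: matrix_vector_mul_assoc continuous_at_imp_continuous_on)
    hence l: "locint (\<lambda>t. (C *v (mexp A t *v z')) $ i)" by (rule locint_continuous)
    have "AE t in lborel. w t $ i + (-1) * (C *v (mexp A t *v z')) $ i = 0"
    proof (rule pairing_zero_imp_AE_zero)
      show "locint (\<lambda>t. w t $ i + (-1) * (C *v (mexp A t *v z')) $ i)" by (intro locint_add locint_cmult locint_w l)
      show "pairing \<phi> (\<lambda>t. w t $ i + (-1) * (C *v (mexp A t *v z')) $ i) = 0" if "test1 \<phi>" for \<phi>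
        using pairing_add_right[OF that locint_w locint_cmult[OF l, of "-1"]] pw[OF that]
        by (simp only: pairing_cmult_right CE)
    qed
    thus ?thesis by simp
  qed
  hence "AE t in lborel. \<forall>i\<in>UNIV. w t $ i = (C *v (mexp A t *v z')) $ i" by (subst AE_finite_all) auto
  thus ?thesis by (auto simp: vec_eq_iff)
qed

end

text \<open>Let \<open>y0\<close> be the output of some solution for the same input. Then
  \<open>Q(d/dt)\<close> annihilates \<open>y - y0\<close>; since the rows of \<open>Q\<close>
  generate all annihilating rows, \<open>y - y0\<close> is a free response, and adding its state to
  that solution realizes \<open>(u, y)\<close>.\<close>

lemma behavior_subset_external:
  fixes Q :: "real poly^'n^'n"
  assumes re: "realizes A B C D P Q R"
    and gen: "\<And>q. remainder A C q 0 \<Longrightarrow> \<exists>k. q = k v* Q"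
  shows "poly_behavior P Q \<subseteq> external_behavior A B C D"
proof (clarify)
  fix u y assume uy: "(u, y) \<in> poly_behavior P Q"
  hence L: "u \<in> L2loc" "y \<in> L2loc" and weak: "\<And>\<phi>. test_fun \<phi> \<Longrightarrow> weak_apply P u \<phi> = weak_apply Q y \<phi>"
    by (auto simp: poly_behavior_def)
  obtain x where x: "trajectory A B u x" using solution_exists[OF L(1)] by blast
  define y0 where "y0 t = C *v x t + D *v u t" for t
  have y0L: "y0 \<in> L2loc" unfolding y0_def by (rule trajectory_output_L2loc[OF x])
  have "(u, y0) \<in> external_behavior A B C D"
    unfolding external_behavior_def using x y0L by (auto simp: state_behavior_iff y0_def)
  hence weak0: "weak_apply P u \<phi> = weak_apply Q y0 \<phi>" if "test_fun \<phi>" for \<phi>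
    using realizes_imp_behavior_subset[OF re] that by (auto simp: poly_behavior_def)
  define w where "w t = y t - y0 t" for t
  have wL: "w \<in> L2loc" unfolding w_def by (intro L2loc_diff L y0L)
  have wz: "weak_apply Q w \<phi> = 0" if "test_fun \<phi>" for \<phi>
  proof -
    have t: "test1 (\<phi> i)" for i using that by (simp add: test_fun_iff)
    have "pairing \<psi> (\<lambda>t. w t $ j) = pairing \<psi> (\<lambda>t. y t $ j) - pairing \<psi> (\<lambda>t. y0 t $ j)" if "test1 \<psi>" for \<psi> j
      using pairing_add_right[OF that L2loc_component_locint[OF L(2)] locint_cmult[OF L2loc_component_locint[OF y0L]], of j "-1" j]
      by (simp only: pairing_cmult_right) (simp add: w_def)
    hence "weak_apply Q w \<phi> = weak_apply Q y \<phi> - weak_apply Q y0 \<phi>"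
      unfolding weak_apply_eq[OF wL t] weak_apply_eq[OF L(2) t] weak_apply_eq[OF y0L t]
      by (simp add: row_pairing_def test1_adj_op t sum_subtractf)
    thus ?thesis using weak[OF that] weak0[OF that] by simp
  qed
  have "row_pairing q w \<phi> = 0" if q: "remainder A C q 0" and \<phi>: "test1 \<phi>" for q \<phi>
  proof -
    obtain k where k: "q = k v* Q" using gen[OF q] by blast
    have lw: "locint (\<lambda>t. w t $ j)" for j by (rule L2loc_component_locint[OF wL])
    \<comment> \<open>The factor \<open>k\<close> is moved to the test side: testing
      \<open>k Q\<close> with \<open>\<phi>\<close> is testing \<open>Q\<close> with the adjoints of
      the entries of \<open>k\<close> applied to \<open>\<phi>\<close>.\<close>
    have "adj_op (q $ j) \<phi> = (\<lambda>t. \<Sum>i\<in>UNIV. adj_op (Q $ i $ j) (adj_op (k $ i) \<phi>) t)" for j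
      by (simp add: k vector_matrix_mult_def mult.commute[of "k $ _"] adj_op_sum adj_op_mult test1_smooth[OF \<phi>])
    hence "row_pairing q w \<phi> = (\<Sum>j\<in>UNIV. \<Sum>i\<in>UNIV. pairing (adj_op (Q $ i $ j) (adj_op (k $ i) \<phi>)) (\<lambda>t. w t $ j))"
      by (simp add: row_pairing_def pairing_sum_left lw test1_adj_op \<phi>)
    also have "\<dots> = weak_apply Q w (\<lambda>i. adj_op (k $ i) \<phi>)"
      by (simp add: weak_apply_eq[OF wL] test1_adj_op \<phi> row_pairing_def row_def) (rule sum.swap)
    also have "\<dots> = 0" by (intro wz) (simp add: test_fun_iff test1_adj_op \<phi>)
    finally show ?thesis .
  qed
  from free_response_of_annihilated[OF wL this] obtain z where z: "AE t in lborel. w t = C *v (mexp A t *v z)" by blast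
  have "trajectory A B u (\<lambda>t. x t + mexp A t *v z)"
    using trajectory_add[OF x mexp_trajectory[of A B 0 z]] by simp
  moreover have "AE t in lborel. y t = C *v (x t + mexp A t *v z) + D *v u t"
    using z by eventually_elim (simp add: w_def y0_def matrix_vector_right_distrib algebra_simps)
  ultimately show "(u, y) \<in> external_behavior A B C D"
    unfolding external_behavior_def using L by (auto simp: state_behavior_iff)
qed

section \<open>Polynomial realizations\<close>

definition adjm :: "'a::comm_ring_1^'n^'n \<Rightarrow> 'a^'n^'n" where
  "adjm A = (\<chi> i j. det (\<chi> k. if k = j then axis i 1 else row k A))"

text \<open>Writing row \<open>k\<close> as a combination of unit vectors collapses the sum to one
  determinant in which row \<open>j\<close> is replaced by row \<open>k\<close>; off the diagonal it
  has two equal rows. Over polynomials this takes the place of inversion.\<close>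

lemma matrix_mult_adjm: "A ** adjm A = mat (det A)" for A :: "'a::comm_ring_1^'n^'n"
proof -
  have "(A ** adjm A) $ k $ j = (if k = j then det A else 0)" for k j
  proof -
    let ?c = "\<lambda>l. row l A"
    have "(A ** adjm A) $ k $ j = (\<Sum>i\<in>UNIV. A $ k $ i * det (\<chi> l. if l = j then axis i 1 else ?c l))"
      by (simp add: matrix_matrix_mult_def adjm_def)
    also have "\<dots> = (\<Sum>i\<in>UNIV. det (\<chi> l. if l = j then A $ k $ i *s axis i 1 else ?c l))"
      using det_row_mul[of j "A $ k $ _" "\<lambda>_. axis _ 1" ?c] by simp
    also have "\<dots> = det (\<chi> l. if l = j then (\<Sum>i\<in>UNIV. A $ k $ i *s axis i 1) else ?c l)"
      by (rule det_linear_row_sum[symmetric]) simp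
    also have "(\<Sum>i\<in>UNIV. A $ k $ i *s axis i 1) = row k A"
      by (simp add: basis_expansion row_def vec_lambda_eta)
    also have "det (\<chi> l. if l = j then row k A else ?c l) = (if k = j then det A else 0)"
    proof (cases "k = j")
      case True
      hence "(\<chi> l. if l = j then row k A else ?c l) = A" by (simp add: vec_eq_iff row_def)
      thus ?thesis using True by simp
    next
      case False
      thus ?thesis by (simp, intro det_identical_rows[of k j]) (auto simp: row_def vec_eq_iff)
    qed
    finally show ?thesis .
  qed
  thus ?thesis by (simp add: vec_eq_iff mat_def)
qed

lemma adjm_mult: "transpose (adjm (transpose A)) ** A = mat (det A)" for A :: "'a::comm_ring_1^'n^'n"
proof -
  have "transpose (adjm (transpose A)) ** A = transpose (transpose A ** adjm (transpose A))"
    by (simp add: matrix_transpose_mul)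
  thus ?thesis by (simp add: matrix_mult_adjm transpose_mat)
qed

lemma det_hom:
  fixes M :: "'a::comm_ring_1^'n^'n" and h :: "'a \<Rightarrow> 'b::comm_ring_1"
  assumes "\<And>x y. h (x + y) = h x + h y" "\<And>x y. h (x * y) = h x * h y" "h 1 = 1"
  shows "h (det M) = det (\<chi> i j. h (M $ i $ j))"
proof -
  have h0: "h 0 = 0" using assms(1)[of 0 0] by simp
  have hneg: "h (- x) = - h x" for x using assms(1)[of x "-x"] h0 by (simp add: eq_neg_iff_add_eq_0 add.commute)
  have hs: "h (sum f S) = (\<Sum>x\<in>S. h (f x))" if "finite S" for S and f :: "('n \<Rightarrow> 'n) \<Rightarrow> 'a"
    using that by (induction S rule: finite_induct) (auto simp: h0 assms)
  have hp: "h (prod f S) = (\<Prod>x\<in>S. h (f x))" if "finite S" for S and f :: "'n \<Rightarrow> 'a"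
    using that by (induction S rule: finite_induct) (auto simp: assms)
  have hsign: "h (of_int (sign p)) = of_int (sign p)" for p :: "'n \<Rightarrow> 'n"
    by (simp add: sign_def assms(3) hneg)
  show ?thesis unfolding det_def by (subst hs) (auto simp: assms hp hsign finite_permutations)
qed

lemma poly_det: "poly (det M) s = det (\<chi> i j. poly (M $ i $ j) s)" for M :: "'a::comm_ring_1 poly^'n^'n"
  by (rule det_hom) auto

text \<open>For real \<open>s\<close> above an operator bound of \<open>A\<close> the matrix
  \<open>s I - A\<close> is injective, so the determinant is nonzero at \<open>s\<close>.\<close>

lemma det_xi_minus_nonzero: "det (xi_minus A) \<noteq> 0" for A :: "real^'d^'d"
proof
  assume z: "det (xi_minus A) = 0"
  obtain K where K: "K > 0" "\<And>x. norm (A *v x) \<le> norm x * K"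
    using bounded_linear.pos_bounded[OF matrix_vector_mul_bounded_linear[of A]] by blast
  define s where "s = K + 1"
  let ?N = "\<chi> i j. poly (xi_minus A $ i $ j) s"
  have "det ?N = 0" using poly_det[of "xi_minus A" s] z by simp
  hence "\<not> invertible ?N" by (simp add: invertible_det_nz)
  then obtain x where x: "?N *v x = 0" "x \<noteq> 0"
    using matrix_left_invertible_ker[of ?N] invertible_left_inverse by blast
  have "?N *v x = s *\<^sub>R x - A *v x"
    by (simp add: vec_eq_iff matrix_vector_mult_def xi_minus_def if_distrib[of "\<lambda>p. poly p s"] left_diff_distrib sum_subtractf
        if_distrib[of "\<lambda>y. y * _"] cong: if_cong)
  hence "A *v x = s *\<^sub>R x" using x(1) by simp
  hence "s * norm x \<le> norm x * K" using K(2)[of x] K(1) by (simp add: s_def)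
  thus False using x(2) by (simp add: s_def algebra_simps)
qed

section \<open>The module of rows that annihilate free outputs\<close>

lemma vsmult_add: "c *s (x + y) = c *s x + c *s (y :: 'a::comm_ring_1^'b)"
  by (simp add: vec_eq_iff algebra_simps)

lemma remainder_0_iff: "remainder A C q 0 \<longleftrightarrow> (\<exists>r. q v* const_pmat C = r v* xi_minus A)"
  by (simp add: remainder_def const_pvec_0)

lemma remainder_0_scale: "remainder A C q 0 \<Longrightarrow> remainder A C (f *s q) 0"
  unfolding remainder_0_iff vmm_scale by (metis vmm_scale)

lemma remainder_0_diff: "remainder A C q 0 \<Longrightarrow> remainder A C q' 0 \<Longrightarrow> remainder A C (q - f *s q') 0"
proof -
  assume *: "remainder A C q 0" "remainder A C q' 0"
  have e: "q - f *s q' = q + (- f) *s q'" by (simp add: vec_eq_iff)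
  from remainder_add[OF *(1) remainder_0_scale[OF *(2), of "- f"]] show ?thesis unfolding e add_0_left .
qed

lemma vmm_mat: "v v* mat c = c *s v" for c :: "'a::comm_ring_1"
  by (simp add: vec_eq_iff vector_matrix_mult_def mat_def if_distrib[of "\<lambda>y. _ * y"] mult.commute cong: if_cong)

text \<open>Cayley-Hamilton in polynomial form: the characteristic polynomial annihilates every free
  output. The module therefore has full rank, which later forces
  \<open>det Q \<noteq> 0\<close>.\<close>

lemma remainder_0_det: "remainder A C (det (xi_minus A) *s axis i 1) 0"
proof -
  have "axis i (1::real poly) $ k * M = (if k = i then M else 0)" for k M by (simp add: axis_def)
  hence "axis i 1 v* const_pmat C = const_pvec (row i C)"
    by (simp only: vec_eq_iff vector_matrix_mult_def vec_lambda_beta vector_add_component)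
      (simp add: const_pmat_def const_pvec_def row_def)
  hence "(det (xi_minus A) *s axis i 1) v* const_pmat C
    = (const_pvec (row i C) v* transpose (adjm (transpose (xi_minus A)))) v* xi_minus A"
    by (simp only: vmm_scale vmm_assoc adjm_mult vmm_mat)
  thus ?thesis unfolding remainder_0_iff by blast
qed

text \<open>Hermite-form induction over the coordinates that may be nonzero. It yields one generator
  per coordinate, which is what makes \<open>Q\<close> square.\<close>

lemma submodule_basis:
  fixes A :: "real^'d^'d" and C :: "real^'d^'n" and S :: "'n set"
  assumes "finite S"
  shows "\<exists>b. (\<forall>i\<in>S. remainder A C (b i) 0) \<and>
    (\<forall>q. remainder A C q 0 \<and> (\<forall>j. j \<notin> S \<longrightarrow> q $ j = 0) \<longrightarrow> (\<exists>k. q = (\<Sum>i\<in>S. k i *s b i)))"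
  using assms
proof (induction S rule: finite_induct)
  case empty
  show ?case by (auto simp: vec_eq_iff)
next
  case (insert i S)
  then obtain b where b: "\<And>i. i \<in> S \<Longrightarrow> remainder A C (b i) 0"
    "\<And>q. remainder A C q 0 \<Longrightarrow> (\<forall>j. j \<notin> S \<longrightarrow> q $ j = 0) \<Longrightarrow> \<exists>k. q = (\<Sum>i\<in>S. k i *s b i)" by blast
  define Mi where "Mi = {q. remainder A C q 0 \<and> (\<forall>j. j \<notin> insert i S \<longrightarrow> q $ j = 0)}"
  \<comment> \<open>An element whose new coordinate is nonzero of least degree; division with
    remainder by it clears that coordinate in any other element.\<close>
  define c where "c = (ARG_MIN (\<lambda>q. degree (q $ i)) q. q \<in> Mi \<and> q $ i \<noteq> 0)"
  have "det (xi_minus A) *s axis i 1 \<in> Mi" "(det (xi_minus A) *s axis i 1) $ i \<noteq> 0"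
    using remainder_0_det det_xi_minus_nonzero by (auto simp: Mi_def axis_def)
  hence c: "c \<in> Mi \<and> c $ i \<noteq> 0" "\<And>q. q \<in> Mi \<Longrightarrow> q $ i \<noteq> 0 \<Longrightarrow> degree (c $ i) \<le> degree (q $ i)"
    unfolding c_def by (metis (mono_tags, lifting) arg_min_natI, metis (mono_tags, lifting) arg_min_nat_le)
  have step: "\<exists>k. q = (\<Sum>j\<in>insert i S. k j *s (b(i := c)) j)" if q: "q \<in> Mi" for q
  proof -
    define f where "f = q $ i div c $ i"
    define q' where "q' = q - f *s c"
    have q'M: "q' \<in> Mi" using q c(1) remainder_0_diff by (auto simp: q'_def Mi_def)
    have "q' $ i = q $ i mod c $ i" by (simp add: q'_def f_def minus_mult_div_eq_mod mult.commute[of _ "c $ i"])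
    hence "q' $ i = 0" using c(2)[OF q'M] c(1) degree_mod_less'[of "c $ i" "q $ i"] by fastforce
    hence "\<forall>j. j \<notin> S \<longrightarrow> q' $ j = 0" "remainder A C q' 0" using q'M by (auto simp: Mi_def)
    then obtain k where k: "q' = (\<Sum>j\<in>S. k j *s b j)" using b(2) by blast
    have "q = f *s c + (\<Sum>j\<in>S. k j *s b j)" using k by (simp add: q'_def algebra_simps)
    also have "(\<Sum>j\<in>S. k j *s b j) = (\<Sum>j\<in>S. (k(i := f)) j *s (b(i := c)) j)"
      using insert.hyps by (intro sum.cong) auto
    finally have "q = (\<Sum>j\<in>insert i S. (k(i := f)) j *s (b(i := c)) j)" using insert.hyps by simp
    thus ?thesis by blast
  qed
  show ?case
  proof (intro exI[of _ "b(i := c)"] conjI ballI allI impI)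
    fix j assume "j \<in> insert i S"
    thus "remainder A C ((b(i := c)) j) 0" using b(1) c(1) by (auto simp: Mi_def)
  next
    fix q assume "remainder A C q 0 \<and> (\<forall>j. j \<notin> insert i S \<longrightarrow> q $ j = 0)"
    thus "\<exists>k. q = (\<Sum>j\<in>insert i S. k j *s (b(i := c)) j)" using step by (simp add: Mi_def)
  qed
qed

lemma realization_exists:
  fixes A :: "real^'d^'d" and B :: "real^'n^'d" and C :: "real^'d^'n" and D :: "real^'n^'n"
  shows "\<exists>P Q R. realizes A B C D P Q R \<and> (\<forall>q. remainder A C q 0 \<longrightarrow> (\<exists>k. q = k v* Q)) \<and> det Q \<noteq> 0"
proof -
  obtain b :: "'n \<Rightarrow> real poly^'n" where b: "\<And>i. remainder A C (b i) 0"
    "\<And>q. remainder A C q 0 \<Longrightarrow> \<exists>k. q = (\<Sum>i\<in>UNIV. k i *s b i)"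
    using submodule_basis[of UNIV A C] by auto
  obtain r where r: "\<And>i. b i v* const_pmat C = r i v* xi_minus A"
    using b(1) unfolding remainder_0_iff by metis
  define Q where "Q = (\<chi> i. b i)"
  define R where "R = (\<chi> i. r i)"
  have rowQ: "row i Q = b i" and rowR: "row i R = r i" for i by (auto simp: Q_def R_def row_def vec_lambda_eta)
  have "row i (Q ** const_pmat C) = row i (R ** xi_minus A)" for i
    unfolding row_matrix_mult rowQ rowR by (rule r)
  hence "Q ** const_pmat C = R ** xi_minus A" by (simp add: row_def vec_eq_iff)
  hence re: "realizes A B C D (Q ** const_pmat D + R ** const_pmat B) Q R" by (simp add: realizes_def)
  have gen: "\<exists>k. q = k v* Q" if q: "remainder A C q 0" for q
  proof -
    obtain k where k: "q = (\<Sum>i\<in>UNIV. k i *s b i)" using b(2)[OF q] by blast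
    have "q = (\<chi> i. k i) v* Q" by (simp add: k vec_eq_iff vector_matrix_mult_def Q_def)
    thus ?thesis by blast
  qed
  have "\<exists>K. \<forall>i. det (xi_minus A) *s axis i 1 = K i v* Q" by (intro choice allI gen remainder_0_det)
  then obtain K where K: "\<And>i. det (xi_minus A) *s axis i 1 = K i v* Q" by blast
  have "(\<chi> i. K i) ** Q = mat (det (xi_minus A))"
  proof -
    have "row i ((\<chi> i. K i) ** Q) = det (xi_minus A) *s axis i 1" for i
      unfolding K by (simp add: row_matrix_mult) (simp add: row_def vec_lambda_eta)
    thus ?thesis by (auto simp: row_def vec_eq_iff mat_def axis_def)
  qed
  hence "det (\<chi> i. K i) * det Q = det (mat (det (xi_minus A)) :: real poly^'n^'n)" by (metis det_mul)
  also have "\<dots> = det (xi_minus A) ^ CARD('n)" by (subst det_diagonal) (auto simp: mat_def)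
  finally have "det Q \<noteq> 0" using det_xi_minus_nonzero[of A] by auto
  thus ?thesis using re gen by blast
qed

lemma remainder_exists: "\<exists>c. remainder A C q c"
proof -
  have "\<exists>c. remainder A C (p *s axis j 1) c" for p j
  proof (induction p)
    case 0
    show ?case using remainder_zero by (auto intro: exI[of _ 0])
  next
    case (pCons a p)
    then obtain c where c: "remainder A C (p *s axis j 1) c" by blast
    have "pCons a p *s axis j 1 = [:a:] *s axis j 1 + [:0, 1:] *s (p *s axis j 1)" by (simp add: vec_eq_iff axis_def)
    thus ?case using remainder_add[OF remainder_scale[OF remainder_axis] remainder_xi[OF c]] by metis
  qed
  hence "\<forall>j. \<exists>c. remainder A C (q $ j *s axis j 1) c" by blast
  from choice[OF this] obtain c where "\<And>j. remainder A C (q $ j *s axis j 1) (c j)" by blast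
  hence "remainder A C (\<Sum>j\<in>UNIV. q $ j *s axis j 1) (\<Sum>j\<in>UNIV. c j)" by (intro remainder_sum) auto
  thus ?thesis by (auto simp: basis_expansion)
qed

lemma weak_apply_single:
  assumes "w \<in> L2loc" "test1 \<phi>"
  shows "weak_apply R w (\<lambda>l. if l = i then \<phi> else (\<lambda>_. 0)) = row_pairing (row i R) w \<phi>"
proof -
  have "adj_op p (\<lambda>_. 0) = (\<lambda>_. 0)" for p
    using adj_op_lincomb[OF smooth_fun_const smooth_fun_const, of p 1 0 0] by (simp add: fun_eq_iff)
  hence "row_pairing q w (if l = i then \<phi> else (\<lambda>_. 0)) = (if l = i then row_pairing q w \<phi> else 0)" for q l
    by (simp add: row_pairing_def)
  thus ?thesis using assms test1_zero by (subst weak_apply_eq) (auto cong: if_cong)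
qed

lemma behavior_row:
  assumes "(u, y) \<in> poly_behavior P Q" "test1 \<phi>"
  shows "row_pairing (row i P) u \<phi> = row_pairing (row i Q) y \<phi>"
proof -
  have "u \<in> L2loc" "y \<in> L2loc" using assms(1) by (auto simp: poly_behavior_def)
  moreover have "test_fun (\<lambda>l. if l = i then \<phi> else (\<lambda>_. 0))" using assms(2) test1_zero by (simp add: test_fun_iff)
  ultimately show ?thesis using assms by (auto simp: poly_behavior_def weak_apply_single[symmetric])
qed

text \<open>The inclusion is tested on two families of trajectories: free responses force the
  remainder of every row of \<open>Q\<close> to vanish, and exponential inputs compare
  \<open>P\<close> with \<open>Q D + R B\<close>.\<close>

lemma behavior_imp_realizes:
  fixes A :: "real^'d^'d" and B :: "real^'n^'d" and C :: "real^'d^'n" and D :: "real^'n^'n"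
  assumes sub: "external_behavior A B C D \<subseteq> poly_behavior P Q"
  shows "\<exists>R. realizes A B C D P Q R"
proof -
  have out: "(u, \<lambda>t. C *v x t + D *v u t) \<in> external_behavior A B C D" if "trajectory A B u x" for u x
    unfolding external_behavior_def using that trajectory_output_L2loc[OF that] by (auto simp: state_behavior_iff)
  have rem: "remainder A C (row i Q) 0" for i
  proof -
    obtain c where "remainder A C (row i Q) c" using remainder_exists by blast
    then obtain r where r: "row i Q v* const_pmat C = r v* xi_minus A + const_pvec c" by (auto simp: remainder_def)
    have "z \<bullet> c = 0" for z
    proof -
      let ?x = "\<lambda>t. mexp A t *v z"
      have tr: "trajectory A B (\<lambda>_. 0) ?x" using mexp_trajectory[of A B 0 z] by simp
      have c: "continuous_on UNIV (\<lambda>t. ?x t $ m)" for m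
        using DERIV_isCont[OF mexp_vec_deriv[of "mat 1" A z m]] by (simp add: continuous_at_imp_continuous_on)
      have "(\<Sum>m\<in>UNIV. c $ m * ?x 0 $ m) = 0"
      proof (rule pairing_continuous_zero[of "\<lambda>t. \<Sum>m\<in>UNIV. c $ m * ?x t $ m"])
        show "continuous_on UNIV (\<lambda>t. \<Sum>m\<in>UNIV. c $ m * ?x t $ m)" by (intro continuous_intros c)
        fix \<phi> assume \<phi>: "test1 \<phi>"
        have z0: "row_pairing p (\<lambda>_. 0) \<phi> = 0" for p :: "real poly^'n" by (simp add: row_pairing_def)
        have "row_pairing (row i P) (\<lambda>_. 0) \<phi> = row_pairing (row i Q) (\<lambda>t. C *v ?x t + D *v 0) \<phi>"
          using behavior_row[OF subsetD[OF sub out[OF tr]] \<phi>] .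
        hence "row_pairing (const_pvec c) ?x \<phi> = 0"
          using row_pairing_trajectory[OF tr \<phi> r, of D] unfolding z0 by simp
        moreover have "adj_op [:k:] \<phi> = (\<lambda>t. k * \<phi> t)" for k by (simp add: adj_op_def fun_eq_iff)
        ultimately show "pairing \<phi> (\<lambda>t. \<Sum>m\<in>UNIV. c $ m * ?x t $ m) = 0"
          by (simp add: pairing_sum_right \<phi> locint_cmult locint_continuous[OF c] pairing_cmult_right row_pairing_def
              const_pvec_def pairing_cmult_left)
      qed
      thus ?thesis by (simp add: inner_vec_def mult.commute)
    qed
    hence "c = 0" by (rule vector_zeroI)
    thus ?thesis using r by (auto simp: remainder_def)
  qed
  then obtain r where r: "\<And>i. row i Q v* const_pmat C = r i v* xi_minus A" unfolding remainder_0_iff by metis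
  define R where "R = (\<chi> i. r i)"
  have rowR: "row i R = r i" for i by (auto simp: R_def row_def vec_lambda_eta)
  have "row i (Q ** const_pmat C) = row i (R ** xi_minus A)" for i
    unfolding row_matrix_mult rowR by (rule r)
  hence QC: "Q ** const_pmat C = R ** xi_minus A" by (simp add: row_def vec_eq_iff)
  define P' where "P' = Q ** const_pmat D + R ** const_pmat B"
  have re: "realizes A B C D P' Q R" using QC by (simp add: realizes_def P'_def)
  have "P $ i $ j = P' $ i $ j" for i j
  proof -
    have "poly (P $ i $ j) s = poly (P' $ i $ j) s" for s
    proof -
      \<comment> \<open>An exponential in a single input channel makes a row of operators act as the
        value of one entry at \<open>s\<close>. Both \<open>P\<close> and \<open>P'\<close> produce
        the same weak output, so they agree at every real \<open>s\<close>.\<close>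
      let ?e = "\<lambda>t. exp (s * t)" and ?u = "\<lambda>t. axis j (exp (s * t)) :: real^'n"
      define g where "g = poly (P $ i $ j) s - poly (P' $ i $ j) s"
      have "continuous_on UNIV (\<lambda>t. if i = j then ?e t else 0)" for i :: 'n by (cases "i = j") (auto intro: continuous_intros)
      hence uL: "?u \<in> L2loc" unfolding axis_def by (intro L2loc_continuous continuous_on_vec_lambda)
      obtain x where x: "trajectory A B ?u x" using solution_exists[OF uL] by blast
      have "g * exp (s * 0) = 0"
      proof (rule pairing_continuous_zero[of "\<lambda>t. g * ?e t"])
        show "continuous_on UNIV (\<lambda>t. g * ?e t)" by (intro continuous_intros)
        fix \<phi> assume \<phi>: "test1 \<phi>"
        have "row_pairing (row i K) ?u \<phi> = poly (K $ i $ j) s * pairing \<phi> ?e" for K :: "real poly^'n^'n"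
        proof -
          have "(\<lambda>t. ?u t $ m) = (if m = j then ?e else (\<lambda>_. 0))" for m by (auto simp: axis_def)
          hence "row_pairing (row i K) ?u \<phi> = (\<Sum>m\<in>UNIV. if m = j then pairing (adj_op (K $ i $ j) \<phi>) ?e else 0)"
            unfolding row_pairing_def by (intro sum.cong) (auto simp: row_def)
          thus ?thesis by (simp add: pairing_adj_op_exp[OF \<phi>])
        qed
        moreover have "row_pairing (row i P) ?u \<phi> = row_pairing (row i P') ?u \<phi>"
          using behavior_row[OF subsetD[OF sub out[OF x]] \<phi>] behavior_row[OF subsetD[OF realizes_imp_behavior_subset[OF re] out[OF x]] \<phi>]
          by simp
        ultimately show "pairing \<phi> (\<lambda>t. g * ?e t) = 0" unfolding pairing_cmult_right by (auto simp: g_def)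
      qed
      thus ?thesis by (simp add: g_def)
    qed
    thus ?thesis by (simp add: poly_eq_poly_eq_iff[symmetric] fun_eq_iff)
  qed
  hence "P = P'" by (simp add: vec_eq_iff)
  thus ?thesis using re by blast
qed

section \<open>Positive-real pairs from storage functions\<close>

abbreviation cp :: "real poly \<Rightarrow> complex poly" where
  "cp \<equiv> map_poly complex_of_real"

lemma coeff_cp [simp]: "coeff (cp p) k = complex_of_real (coeff p k)"
  by (simp add: coeff_map_poly)

lemma cp_add: "cp (p + q) = cp p + cp q"
  by (simp add: poly_eq_iff)

lemma cp_diff: "cp (p - q) = cp p - cp q"
  by (simp add: poly_eq_iff)

lemma cp_mult: "cp (p * q) = cp p * cp q"
  by (simp add: poly_eq_iff coeff_mult)

lemma cp_const: "cp [:a:] = [:complex_of_real a:]"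
  by (simp add: poly_eq_iff coeff_pCons split: nat.split)

lemma cp_smult: "cp (smult a p) = smult (complex_of_real a) (cp p)"
  by (simp add: poly_eq_iff)

lemma cp_1: "cp 1 = 1"
  using cp_const[of 1] by (simp add: one_pCons)

lemma cp_X: "cp [:0, 1:] = [:0, 1:]"
  by (simp add: poly_eq_iff coeff_pCons split: nat.split)

lemma cp_0_iff: "cp p = 0 \<longleftrightarrow> p = 0"
  by (simp add: poly_eq_iff)

lemma cp_sum: "cp (sum f S) = (\<Sum>x\<in>S. cp (f x))"
  by (induction S rule: infinite_finite_induct) (auto simp: cp_add)

lemma poly_cp_cnj: "poly (cp p) (cnj s) = cnj (poly (cp p) s)"
proof -
  have "degree (cp p) = degree p" by (rule degree_map_poly) simp
  thus ?thesis by (simp add: poly_altdef)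
qed

lemma cp_pcompose: "cp (pcompose p q) = pcompose (cp p) (cp q)"
proof (induction p)
  case (pCons a p)
  have "cp (pCons a p) = pCons (complex_of_real a) (cp p)"
    by (simp add: poly_eq_iff coeff_pCons split: nat.split)
  thus ?case using pCons by (simp add: pcompose_pCons cp_add cp_mult cp_const)
qed simp

definition cpm :: "real poly^'b^'a \<Rightarrow> complex poly^'b^'a" where
  "cpm M = (\<chi> i j. cp (M $ i $ j))"

lemma cpm_mult: "cpm (M ** N) = cpm M ** cpm N"
  by (simp add: cpm_def matrix_matrix_mult_def vec_eq_iff cp_sum cp_mult)

lemma cpm_add: "cpm (M + N) = cpm M + cpm N"
  by (simp add: cpm_def vec_eq_iff cp_add)

lemma det_cpm: "det (cpm M) = cp (det M)"
  unfolding cpm_def by (rule det_hom[symmetric]) (auto simp: cp_add cp_mult cp_1)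

lemma cpm_const: "cpm (const_pmat M) = const_pmat (cmat M)"
  by (simp add: cpm_def const_pmat_def cmat_def vec_eq_iff cp_const)

lemma cpm_xi_minus: "cpm (xi_minus A) = xi_minus (cmat A)"
  by (auto simp: cpm_def xi_minus_def cmat_def vec_eq_iff cp_diff cp_const cp_X)

lemma peval_eq: "peval M s = (\<chi> i j. poly (cpm M $ i $ j) s)"
  by (simp add: peval_def cpm_def)

lemma peval_mult: "peval (M ** N) s = peval M s ** peval N s"
  by (simp add: peval_eq cpm_mult) (simp add: matrix_matrix_mult_def vec_eq_iff poly_sum)

lemma peval_add: "peval (M + N) s = peval M s + peval N s"
  by (simp add: peval_eq cpm_add vec_eq_iff)

lemma peval_const: "peval (const_pmat M) s = cmat M"
  by (simp add: peval_def const_pmat_def cmat_def vec_eq_iff cp_const)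

lemma peval_xi_minus: "peval (xi_minus A) s = mat s - cmat A"
  by (simp only: peval_eq cpm_xi_minus) (auto simp: xi_minus_def mat_def vec_eq_iff)

lemma peval_cnj: "peval M (cnj s) $ i $ j = cnj (peval M s $ i $ j)"
  by (simp add: peval_def poly_cp_cnj)

lemma peval_pstar: "peval (pstar M) s = transpose (peval M (- s))"
proof -
  have "cp [:0, -1:] = [:0, -1:]" by (simp add: poly_eq_iff coeff_pCons split: nat.split)
  thus ?thesis by (simp add: peval_def pstar_def transpose_def vec_eq_iff cp_pcompose poly_pcompose)
qed

lemma pveval_vmm: "pveval (p v* M) s = pveval p s v* peval M s"
  by (simp add: pveval_def peval_def vector_matrix_mult_def vec_eq_iff cp_sum cp_mult poly_sum)

text \<open>Bilinear, without conjugation, so that matrices move across it as in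
  \<open>cdot_vmm\<close>; Hermitian products carry an explicit \<open>cnjv\<close>.\<close>

definition cdot :: "'a::comm_ring_1^'n \<Rightarrow> 'a^'n \<Rightarrow> 'a" where
  "cdot x y = (\<Sum>i\<in>UNIV. x $ i * y $ i)"

definition cnjv :: "complex^'n \<Rightarrow> complex^'n" where
  "cnjv x = (\<chi> i. cnj (x $ i))"

lemma cdot_vmm: "cdot (r v* M) x = cdot r (M *v x)"
proof -
  have "(\<Sum>i\<in>UNIV. (\<Sum>j\<in>UNIV. r $ j * M $ j $ i) * x $ i) = (\<Sum>j\<in>UNIV. r $ j * (\<Sum>i\<in>UNIV. M $ j $ i * x $ i))"
    unfolding sum_distrib_left sum_distrib_right by (subst sum.swap) (simp add: mult.assoc)
  thus ?thesis by (simp add: cdot_def vector_matrix_mult_def matrix_vector_mult_def)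
qed

lemma cdot_add_left: "cdot (x + y) z = cdot x z + cdot y z"
  and cdot_add_right: "cdot z (x + y) = cdot z x + cdot z y"
  and cdot_scale_right: "cdot z (c *s x) = c * cdot z x"
  and cdot_scale_left: "cdot (c *s x) z = c * cdot x z"
  by (simp_all add: cdot_def sum.distrib algebra_simps sum_distrib_left)

lemma cnjv_simps: "cnjv (cnjv x) = x" "cnjv (x + y) = cnjv x + cnjv y" "cnjv (c *s x) = cnj c *s cnjv x"
  "cnjv 0 = 0" "cnjv x $ i = cnj (x $ i)"
  by (simp_all add: cnjv_def vec_eq_iff)

lemma cnjv_eq_0: "cnjv x = 0 \<longleftrightarrow> x = 0"
  by (auto simp: cnjv_def vec_eq_iff)

lemma cnjv_cmat: "cnjv (cmat M *v x) = cmat M *v cnjv x"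
  by (simp add: cnjv_def cmat_def matrix_vector_mult_def vec_eq_iff)

definition re_vec :: "complex^'n \<Rightarrow> real^'n" where "re_vec x = (\<chi> i. Re (x $ i))"
definition im_vec :: "complex^'n \<Rightarrow> real^'n" where "im_vec x = (\<chi> i. Im (x $ i))"

lemma cvec_eqI: "re_vec x = re_vec y \<Longrightarrow> im_vec x = im_vec y \<Longrightarrow> x = y"
  by (simp add: re_vec_def im_vec_def vec_eq_iff complex_eq_iff)

lemma re_vec_simps: "re_vec (x + y) = re_vec x + re_vec y" "re_vec (cmat M *v x) = M *v re_vec x" "re_vec 0 = 0"
  and im_vec_simps: "im_vec (x + y) = im_vec x + im_vec y" "im_vec (cmat M *v x) = M *v im_vec x" "im_vec 0 = 0"
  by (simp_all add: re_vec_def im_vec_def cmat_def matrix_vector_mult_def vec_eq_iff)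

lemma Re_cdot_cnjv: "Re (cdot (cnjv x) y) = re_vec x \<bullet> re_vec y + im_vec x \<bullet> im_vec y"
  by (simp add: cdot_def cnjv_def re_vec_def im_vec_def inner_vec_def sum.distrib)

lemma Im_cdot_cnjv: "Im (cdot (cnjv x) y) = re_vec x \<bullet> im_vec y - im_vec x \<bullet> re_vec y"
  by (simp add: cdot_def cnjv_def re_vec_def im_vec_def inner_vec_def sum_subtractf algebra_simps)

lemma cmat_vmm: "r v* cmat M = cmat (transpose M) *v r"
  by (simp add: cmat_def matrix_vector_mult_def vector_matrix_mult_def transpose_def vec_eq_iff mult.commute)

lemma mat_mult_vec: "mat s *v x = s *s x" for s :: "'a::comm_ring_1"
  by (simp add: vec_eq_iff matrix_vector_mult_def mat_def if_distrib[of "\<lambda>y. y * _"] cong: if_cong)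

lemma vmm_mat_diff: "r v* (mat s - M) = s *s r - r v* M" for s :: "'a::comm_ring_1"
  by (simp add: vec_eq_iff vector_matrix_mult_def mat_def algebra_simps sum_subtractf if_distrib[of "\<lambda>y. _ * y"] cong: if_cong)

lemma cmat_simps: "cmat (M ** N) = cmat M ** cmat N" "cmat (M + N') = cmat M + cmat N'" "cmat (M - N') = cmat M - cmat N'"
  by (simp_all add: cmat_def matrix_matrix_mult_def vec_eq_iff)

lemma cnjv_vmm: "cnjv (x v* peval M s) = cnjv x v* peval M (cnj s)"
  by (simp add: vec_eq_iff cnjv_def vector_matrix_mult_def peval_cnj)

text \<open>For real polynomials \<open>Q(cnj s)^T\<close> is the conjugate transpose of
  \<open>Q(s)\<close>, so the form in (a) is twice the real part of \<open>w P(s)\<close> against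
  the conjugate of \<open>w Q(s)\<close>. This is the supply of an exponential trajectory whose
  input is that conjugate.\<close>

lemma hpsd_iff:
  fixes P Q :: "real poly^'n^'n"
  shows "hpsd (peval P s ** transpose (peval Q (cnj s)) + peval Q s ** transpose (peval P (cnj s)))
    \<longleftrightarrow> (\<forall>w. 0 \<le> Re (cdot (w v* peval P s) (cnjv (w v* peval Q s))))"
proof -
  let ?M = "peval P s ** transpose (peval Q (cnj s)) + peval Q s ** transpose (peval P (cnj s))"
  let ?q = "\<lambda>v. \<Sum>i\<in>UNIV. \<Sum>j\<in>UNIV. cnj (v $ i) * ?M $ i $ j * v $ j"
  have q: "?q (cnjv w) = complex_of_real (2 * Re (cdot (w v* peval P s) (cnjv (w v* peval Q s))))" for w
  proof -
    have "?q (cnjv w) = cdot w (?M *v cnjv w)"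
      by (simp add: cdot_def cnjv_def matrix_vector_mult_def sum_distrib_left mult.assoc)
    also have "\<dots> = cdot (w v* peval P s) (cnjv (w v* peval Q s)) + cdot (w v* peval Q s) (cnjv (w v* peval P s))"
      by (simp add: matrix_vector_mult_add_rdistrib matrix_vector_mul_assoc[symmetric] cdot_add_right cdot_vmm cnjv_vmm)
    also have "cdot (w v* peval Q s) (cnjv (w v* peval P s)) = cnj (cdot (w v* peval P s) (cnjv (w v* peval Q s)))"
      by (simp add: cdot_def cnjv_def mult.commute)
    finally show ?thesis by (simp add: complex_add_cnj)
  qed
  have all: "(\<forall>v. R v) \<longleftrightarrow> (\<forall>w. R (cnjv w))" for R :: "complex^'n \<Rightarrow> bool" by (metis cnjv_simps(1))
  have "hpsd ?M \<longleftrightarrow> (\<forall>w. Im (?q (cnjv w)) = 0 \<and> 0 \<le> Re (?q (cnjv w)))"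
    unfolding hpsd_def Let_def by (rule all)
  thus ?thesis unfolding q by simp
qed

lemma rank_full_iff: "rank M = CARD('n) \<longleftrightarrow> (\<forall>w. w v* M = 0 \<longrightarrow> w = 0)" for M :: "'a::field^'m^'n"
proof -
  have comb: "w v* M = (\<Sum>i\<in>UNIV. w $ i *s row i M)" for w
    by (simp add: vec_eq_iff vector_matrix_mult_def row_def)
  have rows: "rows M = range (\<lambda>i. row i M)" by (auto simp: rows_def)
  show ?thesis
  proof (intro iffI allI impI)
    fix w assume r: "rank M = CARD('n)" and w: "w v* M = 0"
    show "w = 0"
    proof (rule ccontr)
      assume "w \<noteq> 0"
      then obtain i where i: "w $ i \<noteq> 0" by (auto simp: vec_eq_iff)
      let ?S = "(\<lambda>j. row j M) ` (UNIV - {i})"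
      have "w $ i *s row i M = - (\<Sum>j\<in>UNIV - {i}. w $ j *s row j M)"
        using w unfolding comb by (simp add: sum.remove[of UNIV i] eq_neg_iff_add_eq_0)
      also have "\<dots> \<in> vec.span ?S" by (intro vec.span_neg vec.span_sum vec.span_scale vec.span_base) auto
      finally have "inverse (w $ i) *s (w $ i *s row i M) \<in> vec.span ?S" by (rule vec.span_scale)
      hence "row i M \<in> vec.span ?S" using i by (simp add: vector_smult_assoc)
      hence "rows M \<subseteq> vec.span ?S" by (auto simp: rows_def) (metis Diff_iff UNIV_I image_eqI singletonD vec.span_base)
      hence "vec.dim (rows M) \<le> card ?S" by (intro vec.dim_le_card) auto
      also have "\<dots> \<le> card (UNIV - {i})" by (rule card_image_le) simp
      also have "\<dots> < CARD('n)" by (rule psubset_card_mono) auto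
      finally show False using r by (simp add: row_rank_def_gen)
    qed
  next
    assume *: "\<forall>w. w v* M = 0 \<longrightarrow> w = 0"
    have "(\<lambda>w. w v* M) = (*v) (transpose M)" by auto
    hence lin: "Vector_Spaces.linear (*s) (*s) (\<lambda>w. w v* M)" by (metis matrix_vector_mul_linear_gen)
    have "inj (\<lambda>w. w v* M)" using * by (intro injI) (metis vector_matrix_mult_diff_distrib right_minus_eq)
    hence "vec.dim (range (\<lambda>w. w v* M)) = vec.dim (UNIV :: ('a^'n) set)"
      by (intro vec.dim_image_eq[OF lin]) (simp add: inj_on_subset)
    moreover have "w v* M \<in> vec.span (rows M)" for w
      unfolding comb by (intro vec.span_sum vec.span_scale vec.span_base) (auto simp: rows_def)
    hence "vec.dim (range (\<lambda>w. w v* M)) \<le> vec.dim (rows M)" by (intro vec.dim_mono) auto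
    moreover have "vec.dim (rows M) \<le> card (rows M)" by (rule vec.dim_le_card') (simp add: rows)
    moreover have "card (rows M) \<le> CARD('n)" unfolding rows by (rule card_image_le) simp
    ultimately show "rank M = CARD('n)" by (simp add: row_rank_def_gen vec.dim_UNIV card_cart_basis)
  qed
qed

lemma PmQ_kernel: "w v* PmQ P Q s = 0 \<longleftrightarrow> w v* peval P s = 0 \<and> w v* peval Q s = 0"
proof -
  have "(w v* PmQ P Q s) $ Inl j = (w v* peval P s) $ j" "(w v* PmQ P Q s) $ Inr j = - (w v* peval Q s) $ j" for j
    by (simp_all add: vector_matrix_mult_def PmQ_def sum_negf)
  moreover have "w v* PmQ P Q s = 0 \<longleftrightarrow> (\<forall>j. (w v* PmQ P Q s) $ Inl j = 0) \<and> (\<forall>j. (w v* PmQ P Q s) $ Inr j = 0)"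
    by (auto simp: vec_eq_iff) (metis sum.exhaust_sel)
  ultimately show ?thesis by (simp add: vec_eq_iff)
qed

lemma realizes_peval:
  assumes "realizes A B C D P Q R"
  shows "w v* peval Q s v* cmat C = w v* peval R s v* (mat s - cmat A)"
    and "w v* peval P s = w v* peval Q s v* cmat D + w v* peval R s v* cmat B"
proof -
  have "peval Q s ** cmat C = peval R s ** (mat s - cmat A)"
    using assms by (metis realizes_def peval_mult peval_const peval_xi_minus)
  thus "w v* peval Q s v* cmat C = w v* peval R s v* (mat s - cmat A)" by (simp add: vmm_assoc)
  have "P = Q ** const_pmat D + R ** const_pmat B" using assms by (simp add: realizes_def)
  hence "peval P s = peval Q s ** cmat D + peval R s ** cmat B"
    by (simp add: peval_mult peval_const peval_add)
  thus "w v* peval P s = w v* peval Q s v* cmat D + w v* peval R s v* cmat B"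
    by (simp add: vmm_assoc vector_matrix_mult_add_rdistrib)
qed

lemma resolvent_exists:
  assumes "poly (cp (det (xi_minus A))) s \<noteq> 0"
  shows "\<exists>N. (mat s - cmat A) ** N = mat 1 \<and> N ** (mat s - cmat A) = mat 1"
proof -
  have "poly (cp (det (xi_minus A))) s = det (\<chi> i j. poly (cpm (xi_minus A) $ i $ j) s)"
    by (simp add: det_cpm[symmetric] poly_det)
  also have "(\<chi> i j. poly (cpm (xi_minus A) $ i $ j) s) = mat s - cmat A"
    unfolding peval_eq[symmetric] by (rule peval_xi_minus)
  finally have "invertible (mat s - cmat A)" using assms by (simp add: invertible_det_nz)
  thus ?thesis by (simp add: invertible_def)
qed

lemma resolvent_state:
  assumes "poly (cp (det (xi_minus A))) s \<noteq> 0"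
  obtains x where "s *s x = cmat A *v x + w"
proof -
  obtain N where N: "(mat s - cmat A) ** N = mat 1" using resolvent_exists[OF assms] by blast
  have "(mat s - cmat A) *v (N *v w) = w" by (simp add: matrix_vector_mul_assoc N)
  thus ?thesis by (intro that[of "N *v w"]) (simp add: matrix_vector_mult_diff_rdistrib mat_mult_vec algebra_simps)
qed

text \<open>On a trajectory with time factor \<open>e^{s t}\<close> the differential equation
  \<open>P u = Q y\<close> becomes an equation between numbers.\<close>

lemma transfer_identity:
  assumes re: "realizes A B C D P Q R" and x: "s *s x = cmat A *v x + cmat B *v u"
  shows "cdot (w v* peval P s) u = cdot (w v* peval Q s) (cmat C *v x + cmat D *v u)"
proof -
  have Bu: "cmat B *v u = (mat s - cmat A) *v x"
    using x by (simp add: matrix_vector_mult_diff_rdistrib mat_mult_vec)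
  have "cdot (w v* peval P s) u = cdot (w v* peval Q s) (cmat D *v u) + cdot (w v* peval R s) (cmat B *v u)"
    by (simp only: realizes_peval(2)[OF re] cdot_add_left cdot_vmm)
  also have "cdot (w v* peval R s) (cmat B *v u) = cdot (w v* peval Q s) (cmat C *v x)"
    unfolding Bu cdot_vmm[symmetric] realizes_peval(1)[OF re] ..
  finally show ?thesis by (simp add: cdot_add_right add.commute)
qed

text \<open>A nonempty open set on which \<open>f\<close> is negative cannot lie in a finite set. In
  the application \<open>F\<close> is the spectrum of \<open>A\<close>, where exponential
  trajectories for a prescribed input may fail to exist.\<close>

lemma nonneg_off_finite:
  fixes f :: "complex \<Rightarrow> real"
  assumes "open S" "continuous_on S f" "finite F" "\<And>s. s \<in> S \<Longrightarrow> s \<notin> F \<Longrightarrow> 0 \<le> f s" "s \<in> S"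
  shows "0 \<le> f s"
proof (rule ccontr)
  assume "\<not> 0 \<le> f s"
  define U where "U = S \<inter> f -` {..<0}"
  have "open U" unfolding U_def by (rule continuous_open_preimage[OF assms(2,1)]) simp
  moreover have "U \<subseteq> F" using assms(4) by (fastforce simp: U_def)
  ultimately have "U \<subseteq> interior F" by (simp add: interior_maximal)
  also have "interior F = {}" by (rule empty_interior_finite[OF assms(3)])
  finally show False using \<open>\<not> 0 \<le> f s\<close> assms(5) by (auto simp: U_def)
qed

lemma continuous_on_row_form:
  "continuous_on S (\<lambda>s. Re (cdot (w v* peval P s) (cnjv (w v* peval Q s))))"
  unfolding cdot_def cnjv_def vector_matrix_mult_def peval_def
  by (simp, intro continuous_intros)

section \<open>Storage evaluated on complex states\<close>

context
  fixes A :: "real^'d^'d" and B :: "real^'n^'d" and C :: "real^'d^'n" and D :: "real^'n^'n" and X :: "real^'d^'d"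
  assumes sX: "symm_mat X" and pX: "psd X" and dX: "\<And>x u. 0 \<le> dissipation A B C D X x u"
begin

lemma complex_storage_nonneg: "0 \<le> Re (cdot (cnjv x) (cmat X *v x))"
  and complex_storage_real: "Im (cdot (cnjv x) (cmat X *v x)) = 0"
  using pX symm_inner[OF sX, of "re_vec x" "im_vec x"] by (simp_all add: Re_cdot_cnjv Im_cdot_cnjv re_vec_simps im_vec_simps psd_def)

lemma complex_dissipation:
  "Re (cdot (cnjv u) (cmat C *v x + cmat D *v u)) - Re (cdot (cnjv x) (cmat X *v (cmat A *v x + cmat B *v u)))
   = dissipation A B C D X (re_vec x) (re_vec u) + dissipation A B C D X (im_vec x) (im_vec u)"
  by (simp add: Re_cdot_cnjv re_vec_simps im_vec_simps dissipation_def)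

lemma complex_storage_kernel:
  assumes "cdot (cnjv x) (cmat X *v x) = 0" shows "cmat X *v x = 0"
proof -
  have "re_vec x \<bullet> (X *v re_vec x) + im_vec x \<bullet> (X *v im_vec x) = 0"
    using arg_cong[OF assms, of Re] by (simp add: Re_cdot_cnjv re_vec_simps im_vec_simps)
  moreover have "0 \<le> re_vec x \<bullet> (X *v re_vec x)" "0 \<le> im_vec x \<bullet> (X *v im_vec x)" using pX by (auto simp: psd_def)
  ultimately have "re_vec x \<bullet> (X *v re_vec x) = 0" "im_vec x \<bullet> (X *v im_vec x) = 0" by auto
  thus ?thesis by (intro cvec_eqI) (simp_all add: re_vec_simps im_vec_simps psd_kernel[OF pX])
qed

lemma complex_dissipation_kernel:
  assumes "Re (cdot (cnjv u) (cmat C *v x + cmat D *v u)) = Re (cdot (cnjv x) (cmat X *v (cmat A *v x + cmat B *v u)))"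
  shows "cmat (transpose A) *v (cmat X *v x) + cmat X *v (cmat A *v x + cmat B *v u) = cmat (transpose C) *v u"
    and "cmat C *v x + cmat D *v u + cmat (transpose D) *v u = cmat (transpose B) *v (cmat X *v x)"
proof -
  have "dissipation A B C D X (re_vec x) (re_vec u) = 0" "dissipation A B C D X (im_vec x) (im_vec u) = 0"
    using assms complex_dissipation[of u x] dX[of "re_vec x" "re_vec u"] dX[of "im_vec x" "im_vec u"] by linarith+
  note k = dissipation_kernel[OF sX dX this(1)] dissipation_kernel[OF sX dX this(2)]
  show "cmat (transpose A) *v (cmat X *v x) + cmat X *v (cmat A *v x + cmat B *v u) = cmat (transpose C) *v u"
    using k(1,3) by (intro cvec_eqI) (simp_all only: re_vec_simps im_vec_simps)
  show "cmat C *v x + cmat D *v u + cmat (transpose D) *v u = cmat (transpose B) *v (cmat X *v x)"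
    using k(2,4) by (intro cvec_eqI) (simp_all only: re_vec_simps im_vec_simps)
qed

lemma storage_kernel_invariant: "X *v z = 0 \<Longrightarrow> X *v (A *v z) = 0 \<and> C *v z = 0"
proof -
  assume z: "X *v z = 0"
  have "z \<bullet> (X *v (A *v z)) = 0" using symm_inner[OF sX] z by (metis inner_zero_right)
  hence "dissipation A B C D X z 0 = 0" by (simp add: dissipation_def)
  from dissipation_kernel[OF sX dX this] z show ?thesis by simp
qed

text \<open>With the conjugate of \<open>w Q(s)\<close> as input, the form in (a) is the supply of
  an exponential trajectory. The supply dominates the storage rate, which is \<open>Re s\<close>
  times a nonnegative number.\<close>

lemma passive_positive:
  assumes re: "realizes A B C D P Q R" and s: "Re s > 0"
  shows "0 \<le> Re (cdot (w v* peval P s) (cnjv (w v* peval Q s)))"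
proof (rule nonneg_off_finite[where S = "{s. Re s > 0}" and F = "{s. poly (cp (det (xi_minus A))) s = 0}"
      and f = "\<lambda>s. Re (cdot (w v* peval P s) (cnjv (w v* peval Q s)))"])
  show "open {s. Re s > 0}" by (rule open_halfspace_Re_gt)
  show "finite {s. poly (cp (det (xi_minus A))) s = 0}"
    by (rule poly_roots_finite) (simp add: cp_0_iff det_xi_minus_nonzero)
  fix s assume s: "s \<in> {s. Re s > 0}" "s \<notin> {s. poly (cp (det (xi_minus A))) s = 0}"
  define u where "u = cnjv (w v* peval Q s)"
  obtain x where x: "s *s x = cmat A *v x + cmat B *v u" using s by (auto intro: resolvent_state)
  have "cdot (w v* peval P s) u = cdot (cnjv u) (cmat C *v x + cmat D *v u)"
    using transfer_identity[OF re x] by (simp add: u_def cnjv_simps)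
  moreover have "Re (cdot (cnjv x) (cmat X *v (cmat A *v x + cmat B *v u))) = Re s * Re (cdot (cnjv x) (cmat X *v x))"
    unfolding x[symmetric] vector_scalar_commute cdot_scale_right using complex_storage_real by simp
  ultimately have "Re (cdot (w v* peval P s) u) \<ge> Re s * Re (cdot (cnjv x) (cmat X *v x))"
    using complex_dissipation[of u x] dX[of "re_vec x" "re_vec u"] dX[of "im_vec x" "im_vec u"] by simp
  moreover have "0 \<le> Re s * Re (cdot (cnjv x) (cmat X *v x))" using s complex_storage_nonneg by simp
  ultimately show "0 \<le> Re (cdot (w v* peval P s) (cnjv (w v* peval Q s)))" by (simp add: u_def)
qed (use s continuous_on_row_form in auto)

lemma symmetric_range:
  assumes "\<And>z. X *v z = 0 \<Longrightarrow> y \<bullet> z = 0" shows "\<exists>x. X *v x = y"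
proof -
  have sub: "subspace (range ((*v) X))" by (rule linear_subspace_image) auto
  obtain p q where pq: "p \<in> span (range ((*v) X))" "\<And>w. w \<in> span (range ((*v) X)) \<Longrightarrow> orthogonal q w" "y = p + q"
    using orthogonal_subspace_decomp_exists by blast
  have "w \<bullet> (X *v q) = 0" for w
    using pq(2)[OF span_base[OF rangeI], of w] symm_inner[OF sX, of q w] by (simp add: orthogonal_def)
  hence "X *v q = 0" by (rule vector_zeroI)
  hence "y \<bullet> q = 0" by (rule assms)
  moreover have "q \<bullet> p = 0" using pq(2)[OF pq(1)] by (simp add: orthogonal_def)
  ultimately have "q \<bullet> q = 0" using pq(3) by (simp add: inner_add_right inner_commute)
  hence "y = p" using pq(3) by simp
  have e: "span (range ((*v) X)) = range ((*v) X)" using sub span_eq_iff by blast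
  show ?thesis using pq(1) unfolding e \<open>y = p\<close> by auto
qed

lemma symmetric_range_complex:
  assumes "\<And>z. X *v z = 0 \<Longrightarrow> re_vec y \<bullet> z = 0" "\<And>z. X *v z = 0 \<Longrightarrow> im_vec y \<bullet> z = 0"
  shows "\<exists>x. cmat X *v x = y"
proof -
  obtain a b where ab: "X *v a = re_vec y" "X *v b = im_vec y" using symmetric_range assms by meson
  have "re_vec (\<chi> i. Complex (a $ i) (b $ i)) = a" "im_vec (\<chi> i. Complex (a $ i) (b $ i)) = b"
    by (simp_all add: re_vec_def im_vec_def vec_eq_iff)
  thus ?thesis using ab by (intro exI[of _ "\<chi> i. Complex (a $ i) (b $ i)"] cvec_eqI) (simp_all add: re_vec_simps im_vec_simps)
qed

lemma complex_kernel_iff: "cmat X *v x = 0 \<longleftrightarrow> X *v re_vec x = 0 \<and> X *v im_vec x = 0"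
  using re_vec_simps(2)[of X x] im_vec_simps(2)[of X x] re_vec_simps(3) im_vec_simps(3) cvec_eqI[of "cmat X *v x" 0] by metis

text \<open>\<open>\<xi>\<close> is an eigenvector of \<open>A\<close> modulo the kernel of
  \<open>X\<close> with positive growth rate, and storage cannot grow without input.\<close>

lemma mode_in_kernel:
  assumes "cmat X *v (cmat A *v \<xi>) = \<mu> *s (cmat X *v \<xi>)" "Re \<mu> > 0"
  shows "cmat X *v \<xi> = 0"
proof (rule complex_storage_kernel)
  have "Re (cdot (cnjv \<xi>) (cmat X *v (cmat A *v \<xi>))) \<le> 0"
    using complex_dissipation[of 0 \<xi>] dX[of "re_vec \<xi>" "re_vec 0"] dX[of "im_vec \<xi>" "im_vec 0"]
    by (simp add: cnjv_simps cdot_def)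
  hence "Re \<mu> * Re (cdot (cnjv \<xi>) (cmat X *v \<xi>)) \<le> 0"
    unfolding assms(1) cdot_scale_right using complex_storage_real by simp
  hence "Re (cdot (cnjv \<xi>) (cmat X *v \<xi>)) = 0"
    using assms(2) complex_storage_nonneg[of \<xi>] by (simp add: mult_le_0_iff)
  thus "cdot (cnjv \<xi>) (cmat X *v \<xi>) = 0" using complex_storage_real[of \<xi>] by (simp add: complex_eq_iff)
qed

text \<open>Excludes uncontrollable left modes in the closed right half-plane that are orthogonal to
  the unobservable states. Such an \<open>r\<close> is orthogonal to the kernel of \<open>X\<close>,
  so its conjugate is \<open>X x\<close> for some \<open>x\<close>; the dissipation inequality is
  then an equality at \<open>x\<close>, which makes \<open>x\<close> unobservable, and orthogonality
  gives \<open>x\<close> zero storage.\<close>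

lemma left_mode_zero:
  assumes rA: "r v* (mat s - cmat A) = 0" and rB: "r v* cmat B = 0" and s: "Re s \<ge> 0"
    and runobs: "\<And>z. Vo_kernel C A z \<Longrightarrow> re_vec r \<bullet> z = 0 \<and> im_vec r \<bullet> z = 0"
    and ker: "\<And>z. X *v z = 0 \<Longrightarrow> Vo_kernel C A z"
  shows "r = 0"
proof -
  have rc: "re_vec (cnjv r) = re_vec r" "im_vec (cnjv r) = - im_vec r" by (simp_all add: re_vec_def im_vec_def cnjv_def vec_eq_iff)
  obtain x where x: "cmat X *v x = cnjv r"
    using symmetric_range_complex[of "cnjv r"] runobs ker unfolding rc by fastforce
  have rA': "r v* cmat A = s *s r" using rA by (simp add: vmm_mat_diff)
  have "cmat (transpose A) *v (cmat X *v x) = cnjv (r v* cmat A)" unfolding x cmat_vmm cnjv_cmat ..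
  hence AX: "cmat (transpose A) *v (cmat X *v x) = cnj s *s (cmat X *v x)" unfolding rA' cnjv_simps x .
  have BX: "cmat (transpose B) *v (cmat X *v x) = 0"
    using arg_cong[OF rB, of cnjv] unfolding x cmat_vmm cnjv_cmat by (simp add: cnjv_simps)
  have XA: "cdot (cnjv x) (cmat X *v (cmat A *v x)) = s * cdot (cnjv x) (cmat X *v x)"
  proof -
    have "cdot (cnjv x) (cmat X *v (cmat A *v x)) = cdot (cnjv x v* cmat X) (cmat A *v x)" by (simp add: cdot_vmm)
    also have rX: "cnjv x v* cmat X = r" using sX x arg_cong[OF x, of cnjv]
      by (simp add: cmat_vmm symm_mat_def cnjv_cmat[symmetric] cnjv_simps)
    also have "cdot r (cmat A *v x) = s * cdot r x" by (simp add: cdot_vmm[symmetric] rA' cdot_scale_left)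
    also have "cdot r x = cdot (cnjv x) (cmat X *v x)"
      unfolding rX[symmetric] cdot_vmm ..
    finally show ?thesis .
  qed
  have "Re (cdot (cnjv x) (cmat X *v (cmat A *v x))) = Re s * Re (cdot (cnjv x) (cmat X *v x))"
    unfolding XA using complex_storage_real by simp
  moreover have "Re (cdot (cnjv x) (cmat X *v (cmat A *v x))) \<le> 0"
    using complex_dissipation[of 0 x] dX[of "re_vec x" "re_vec 0"] dX[of "im_vec x" "im_vec 0"] by (simp add: cnjv_simps cdot_def)
  moreover have "0 \<le> Re s * Re (cdot (cnjv x) (cmat X *v x))" using s complex_storage_nonneg by simp
  \<comment> \<open>\<open>Re s\<close> times the storage of \<open>x\<close> is both nonnegative
    and nonpositive: the equality case with zero input.\<close>
  ultimately have "Re (cdot (cnjv 0) (cmat C *v x + cmat D *v 0)) = Re (cdot (cnjv x) (cmat X *v (cmat A *v x + cmat B *v 0)))"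
    by (simp add: cnjv_simps cdot_def)
  from complex_dissipation_kernel[OF this]
  have XAx: "cmat X *v (cmat A *v x) = (- cnj s) *s (cmat X *v x)" and Cx: "cmat C *v x = 0"
    unfolding AX BX by (simp_all add: vec_eq_iff eq_neg_iff_add_eq_0 add.commute)
  have "cmat (C ** matpow A k) *v x = 0" for k
  proof (induction k)
    case 0 thus ?case using Cx by simp
  next
    case (Suc k)
    \<comment> \<open>\<open>z\<close> lies in the kernel of \<open>X\<close>, hence is
      unobservable; so, as far as outputs are concerned, \<open>A\<close> acts on \<open>x\<close>
      as multiplication by \<open>- cnj s\<close>.\<close>
    define z where "z = cmat A *v x + cnj s *s x"
    have "cmat X *v z = 0" using XAx by (simp add: z_def matrix_vector_right_distrib vector_scalar_commute vec_eq_iff)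
    hence "X *v re_vec z = 0" "X *v im_vec z = 0" by (auto simp: complex_kernel_iff)
    hence "(C ** matpow A k) *v re_vec z = 0" "(C ** matpow A k) *v im_vec z = 0" using ker Vo_kernel_all by blast+
    hence z: "cmat (C ** matpow A k) *v z = 0" by (intro cvec_eqI) (simp_all add: re_vec_simps im_vec_simps)
    have "cmat (C ** matpow A (Suc k)) *v x = cmat (C ** matpow A k) *v (cmat A *v x)"
      by (simp add: matpow_Suc2 matrix_mul_assoc matrix_vector_mul_assoc cmat_simps)
    also have "cmat A *v x = z - cnj s *s x" by (simp add: z_def)
    also have "cmat (C ** matpow A k) *v (z - cnj s *s x) = 0"
      by (simp add: matrix_vector_mult_diff_distrib z vector_scalar_commute Suc)
    finally show ?case .
  qed
  hence "(C ** matpow A k) *v re_vec x = 0" "(C ** matpow A k) *v im_vec x = 0" for k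
    using re_vec_simps(2)[of "C ** matpow A k" x] im_vec_simps(2)[of "C ** matpow A k" x] by (simp_all add: re_vec_simps im_vec_simps)
  hence "Vo_kernel C A (re_vec x)" "Vo_kernel C A (im_vec x)" by (auto simp: Vo_kernel_def)
  hence "re_vec r \<bullet> re_vec x = 0" "im_vec r \<bullet> re_vec x = 0" "re_vec r \<bullet> im_vec x = 0" "im_vec r \<bullet> im_vec x = 0" using runobs by auto
  hence "cdot (cnjv x) (cmat X *v x) = 0"
    unfolding x complex_eq_iff Re_cdot_cnjv Im_cdot_cnjv rc by (simp add: inner_commute)
  hence "cmat X *v x = 0" by (rule complex_storage_kernel)
  thus ?thesis using x cnjv_eq_0 by metis
qed

end

section \<open>Coprimeness of the generated realization and proof of the positive-real
  conditions\<close>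

lemma mat_vec_scale: "M *v (c *s x) = c *s (M *v x)" for c :: "'a::comm_ring_1"
  by (simp add: vec_eq_iff matrix_vector_mult_def sum_distrib_left mult_ac)

lemma xi_minus_mult_vec: "xi_minus M *v p = [:0, 1:] *s p - const_pmat M *v p" for M :: "'a::comm_ring_1^'d^'d"
  by (simp add: vec_eq_iff xi_minus_def const_pmat_def matrix_vector_mult_def left_diff_distrib sum_subtractf
      if_distrib[of "\<lambda>p. p * _"] cong: if_cong)

lemma const_pmat_mult_vec: "const_pmat M *v const_pvec x = const_pvec (M *v x)" for M :: "'a::comm_ring_1^'d^'e"
  by (simp add: vec_eq_iff const_pmat_def const_pvec_def matrix_vector_mult_def poly_eq_iff coeff_sum coeff_pCons mult.commute
      split: nat.split)

text \<open>For unobservable \<open>z\<close> one has \<open>xi^k R z = R A^k z\<close>. The degree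
  of the right-hand side is bounded in \<open>k\<close>, that of the left-hand side is not unless
  \<open>R z = 0\<close>.\<close>

lemma realizes_unobservable:
  fixes R :: "real poly^'d^'n" and A :: "real^'d^'d"
  assumes re: "realizes A B C D P Q R" and z: "Vo_kernel C A z"
  shows "R *v const_pvec z = 0"
proof -
  define f where "f v i = (R *v const_pvec v) $ i" for v :: "real^'d" and i
  have step: "[:0, 1:] * f z i = f (A *v z) i" if "C *v z = 0" for z i
  proof -
    have "(Q ** const_pmat C) *v const_pvec z = (R ** xi_minus A) *v const_pvec z" using re by (simp add: realizes_def)
    hence "0 = R *v ([:0, 1:] *s const_pvec z - const_pvec (A *v z))"
      by (simp add: matrix_vector_mul_assoc[symmetric] const_pmat_mult_vec xi_minus_mult_vec that const_pvec_0)
    thus ?thesis by (simp add: f_def matrix_vector_mult_diff_distrib mat_vec_scale vec_eq_iff)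
  qed
  have pw: "[:0, 1:] ^ k * f z i = f (matpow A k *v z) i" for k i
  proof (induction k)
    case (Suc k)
    have "C *v (matpow A k *v z) = 0" using Vo_kernel_all[OF z] by (simp add: matrix_vector_mul_assoc)
    from step[OF this, of i] Suc show ?case by (simp add: matpow_Suc matrix_vector_mul_assoc mult.assoc)
  qed simp
  have "f z i = 0" for i
  proof (rule ccontr)
    assume nz: "f z i \<noteq> 0"
    define N where "N = Max (range (\<lambda>m. degree (R $ i $ m)))"
    have bound: "degree (f v i) \<le> N" for v
      unfolding f_def matrix_vector_mult_def vec_lambda_beta
    proof (rule degree_sum_le)
      fix m :: 'd
      have "degree (R $ i $ m * const_pvec v $ m) \<le> degree (R $ i $ m)"
        by (simp add: const_pvec_def mult.commute[of _ "[:_:]"] degree_smult_le)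
      also have "\<dots> \<le> N" by (simp add: N_def)
      finally show "degree (R $ i $ m * const_pvec v $ m) \<le> N" .
    qed simp
    have dg: "degree ([:0, 1:] ^ Suc N * f z i) = Suc N + degree (f z i)"
      using nz by (subst degree_mult_eq) (auto simp: degree_power_eq)
    thus False using bound[of "matpow A (Suc N) *v z"] unfolding pw[symmetric] dg by linarith
  qed
  thus ?thesis by (simp add: f_def vec_eq_iff)
qed

lemma Re_poly_mult: "map_poly Re (g * cp f) = map_poly Re g * f"
  and Im_poly_mult: "map_poly Im (g * cp f) = map_poly Im g * f"
  by (simp_all add: poly_eq_iff coeff_map_poly coeff_mult)

lemma smult_sum_right: "smult c (sum h S) = (\<Sum>x\<in>S. smult c (h x))"
  by (induction S rule: infinite_finite_induct) (auto simp: smult_add_right)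

lemma Re_poly_sum: "map_poly Re (sum h S) = (\<Sum>x\<in>S. map_poly Re (h x))"
  and Im_poly_sum: "map_poly Im (sum h S) = (\<Sum>x\<in>S. map_poly Im (h x))"
proof -
  have "map_poly Re (a + b) = map_poly Re a + map_poly Re b" "map_poly Im (a + b) = map_poly Im a + map_poly Im b" for a b
    by (simp_all add: poly_eq_iff coeff_map_poly)
  thus "map_poly Re (sum h S) = (\<Sum>x\<in>S. map_poly Re (h x))" "map_poly Im (sum h S) = (\<Sum>x\<in>S. map_poly Im (h x))"
    by (induction S rule: infinite_finite_induct; simp)+
qed

definition re_row :: "complex poly^'n \<Rightarrow> real poly^'n" where "re_row p = (\<chi> j. map_poly Re (p $ j))"
definition im_row :: "complex poly^'n \<Rightarrow> real poly^'n" where "im_row p = (\<chi> j. map_poly Im (p $ j))"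

lemma row_split: "p $ j = cp (re_row p $ j) + smult \<i> (cp (im_row p $ j))"
  by (simp add: re_row_def im_row_def poly_eq_iff coeff_map_poly complex_eq)

lemma re_row_vmm: "re_row (p v* cpm M) = re_row p v* M"
  and im_row_vmm: "im_row (p v* cpm M) = im_row p v* M"
  by (simp_all add: re_row_def im_row_def vec_eq_iff vector_matrix_mult_def cpm_def Re_poly_sum Im_poly_sum Re_poly_mult Im_poly_mult)

lemma vmm_det_cancel:
  fixes M :: "'a::idom^'n^'n"
  assumes "v v* M = 0" "det M \<noteq> 0" shows "v = 0"
proof -
  have "det M *s v = v v* M v* adjm M" by (simp add: vmm_assoc matrix_mult_adjm vmm_mat)
  also have "\<dots> = 0" by (simp add: assms)
  finally show ?thesis using assms(2) by (simp add: vec_eq_iff)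
qed

text \<open>If \<open>w\<close> kills \<open>Q(s)\<close> and \<open>R(s)\<close>, then
  \<open>w Q\<close> and \<open>w R\<close> are divisible by \<open>xi - s\<close>, and the quotient
  of \<open>w Q\<close> again annihilates free outputs. As the rows of \<open>Q\<close> generate all
  such rows and \<open>det Q \<noteq> 0\<close>, the constant \<open>w\<close> is a multiple of
  \<open>xi - s\<close>. The generators are real, so the quotient is split into a real and an
  imaginary row.\<close>

lemma joint_left_kernel:
  fixes w :: "complex^'n" and A :: "real^'d^'d"
  assumes re: "realizes A B C D P Q R" and gen: "\<And>q. remainder A C q 0 \<Longrightarrow> \<exists>k. q = k v* Q"
    and dQ: "det Q \<noteq> 0" and wQ: "w v* peval Q s = 0" and wR: "w v* peval R s = 0"
  shows "w = 0"
proof -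
  define W where "W = const_pvec w"
  have ev: "poly ((W v* cpm M) $ j) s = (w v* peval M s) $ j" for M :: "real poly^'b^'n" and j
    by (simp add: W_def const_pvec_def vector_matrix_mult_def peval_eq poly_sum)
  have "\<exists>\<eta>. (W v* cpm Q) $ j = [:-s, 1:] * \<eta>" for j
    using ev[of Q j] wQ by (metis dvdE poly_eq_0_iff_dvd zero_index)
  then obtain \<eta>' where \<eta>': "\<And>j. (W v* cpm Q) $ j = [:-s, 1:] * \<eta>' j" by metis
  have "\<exists>\<rho>. (W v* cpm R) $ j = [:-s, 1:] * \<rho>" for j
    using ev[of R j] wR by (metis dvdE poly_eq_0_iff_dvd zero_index)
  then obtain \<rho>' where \<rho>': "\<And>j. (W v* cpm R) $ j = [:-s, 1:] * \<rho>' j" by metis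
  define \<eta> where "\<eta> = (\<chi> j. \<eta>' j)"
  define \<rho> where "\<rho> = (\<chi> j. \<rho>' j)"
  have \<eta>: "W v* cpm Q = [:-s, 1:] *s \<eta>" and \<rho>: "W v* cpm R = [:-s, 1:] *s \<rho>"
    using \<eta>' \<rho>' by (simp_all add: vec_eq_iff \<eta>_def \<rho>_def)
  have "cpm Q ** cpm (const_pmat C) = cpm R ** cpm (xi_minus A)"
    using re by (simp add: realizes_def cpm_mult[symmetric])
  hence "[:-s, 1:] *s (\<eta> v* cpm (const_pmat C)) = [:-s, 1:] *s (\<rho> v* cpm (xi_minus A))"
    unfolding vmm_scale[symmetric] \<eta>[symmetric] \<rho>[symmetric] by (simp add: vmm_assoc)
  hence eq: "\<eta> v* cpm (const_pmat C) = \<rho> v* cpm (xi_minus A)"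
    by (simp add: vec_eq_iff del: mult_pCons_left)
  have "re_row \<eta> v* const_pmat C = re_row \<rho> v* xi_minus A" "im_row \<eta> v* const_pmat C = im_row \<rho> v* xi_minus A"
    unfolding re_row_vmm[symmetric] im_row_vmm[symmetric] eq by simp_all
  hence "remainder A C (re_row \<eta>) 0" "remainder A C (im_row \<eta>) 0" unfolding remainder_0_iff by blast+
  then obtain k1 k2 where k: "re_row \<eta> = k1 v* Q" "im_row \<eta> = k2 v* Q" using gen by meson
  define \<kappa> where "\<kappa> = (\<chi> i. cp (k1 $ i) + smult \<i> (cp (k2 $ i)))"
  have "\<eta> $ j = (\<kappa> v* cpm Q) $ j" for j
    unfolding row_split[of \<eta>] k
    by (simp add: vector_matrix_mult_def cp_sum cp_mult \<kappa>_def cpm_def distrib_right sum.distrib smult_sum_right)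
  hence \<eta>\<kappa>: "\<eta> = \<kappa> v* cpm Q" by (simp add: vec_eq_iff)
  have "c *s v + (- c) *s v = 0" for c :: "complex poly" and v :: "complex poly^'n"
    by (simp add: vec_eq_iff)
  hence "(W + (- [:-s, 1:]) *s \<kappa>) v* cpm Q = 0"
    unfolding vmm_add vmm_scale \<eta> \<eta>\<kappa> .
  hence "W + (- [:-s, 1:]) *s \<kappa> = 0"
    by (rule vmm_det_cancel) (simp add: det_cpm cp_0_iff dQ)
  hence "poly ((W + (- [:-s, 1:]) *s \<kappa>) $ i) s = 0" for i by simp
  thus ?thesis by (simp add: W_def const_pvec_def vec_eq_iff)
qed

lemma pveval_cnj: "pveval p (cnj s) = cnjv (pveval p s)"
  by (simp add: pveval_def cnjv_def poly_cp_cnj)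

lemma infinite_imaginary_axis:
  assumes "finite F" shows "infinite ({s. Re s = 0} - F)"
proof
  assume "finite ({s. Re s = 0} - F)"
  hence "finite {s. Re s = 0}" using assms by simp
  moreover have "inj (\<lambda>x. Complex 0 x)" by (auto intro: injI)
  moreover have "range (\<lambda>x. Complex 0 x) \<subseteq> {s. Re s = 0}" by auto
  ultimately show False using finite_subset finite_imageD infinite_UNIV_char_0 by blast
qed

lemma poly_eq_on_infinite:
  fixes f g :: "complex poly"
  assumes "infinite S" "\<And>s. s \<in> S \<Longrightarrow> poly f s = poly g s" shows "poly f s = poly g s"
proof -
  have "f - g = 0"
  proof (rule ccontr)
    assume "f - g \<noteq> 0"
    hence "finite {s. poly (f - g) s = 0}" by (rule poly_roots_finite)
    moreover have "S \<subseteq> {s. poly (f - g) s = 0}" using assms(2) by auto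
    ultimately show False using assms(1) finite_subset by blast
  qed
  thus ?thesis by simp
qed

text \<open>For (b), a row \<open>w\<close> killing \<open>P(s)\<close> and \<open>Q(s)\<close>
  makes \<open>w R(s)\<close> an uncontrollable left mode, which \<open>left_mode_zero\<close>
  excludes. For (c) with \<open>Re l < 0\<close> the point is reflected to
  \<open>\<mu> = - l\<close>: losslessness on the imaginary axis yields polynomial identities, and
  at \<open>\<mu>\<close> these describe a growing mode without input.\<close>

lemma storage_imp_positive_real_pair:
  fixes A :: "real^'d^'d" and B :: "real^'n^'d" and C :: "real^'d^'n" and D :: "real^'n^'n"
  assumes X: "symm_mat X" "psd X" "psd (Omega A B C D X)"
    and re: "realizes A B C D P Q R" and gen: "\<And>q. remainder A C q 0 \<Longrightarrow> \<exists>k. q = k v* Q" and dQ: "det Q \<noteq> 0"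
  shows "positive_real_pair P Q"
proof -
  have dX: "0 \<le> dissipation A B C D X x u" for x u using X psd_Omega_iff by blast
  have ker: "X *v z = 0 \<Longrightarrow> Vo_kernel C A z" for z by (rule kernel_imp_Vo_kernel[OF X(2,1,3)])
  have rank: "w = 0" if s: "Re s \<ge> 0" and w: "w v* peval P s = 0" "w v* peval Q s = 0" for w s
  proof -
    let ?r = "w v* peval R s"
    have "?r v* (mat s - cmat A) = 0"
      using realizes_peval(1)[OF re, of w s] w by (simp add: vec_eq_iff vector_matrix_mult_def)
    moreover have "?r v* cmat B = 0"
      using realizes_peval(2)[OF re, of w s] w by (simp add: vec_eq_iff vector_matrix_mult_def)
    moreover have "re_vec ?r \<bullet> z = 0 \<and> im_vec ?r \<bullet> z = 0" if z: "Vo_kernel C A z" for z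
    proof -
      have "(R *v const_pvec z) $ i = 0" for i using realizes_unobservable[OF re z] by simp
      hence "poly (cp ((R *v const_pvec z) $ i)) s = 0" for i by simp
      hence "(\<Sum>m\<in>UNIV. peval R s $ i $ m * complex_of_real (z $ m)) = 0" for i
        by (simp add: matrix_vector_mult_def const_pvec_def cp_sum cp_smult poly_sum peval_def mult.commute)
      hence "cdot w (peval R s *v (\<chi> m. complex_of_real (z $ m))) = 0"
        by (simp add: cdot_def matrix_vector_mult_def)
      hence "cdot ?r (\<chi> m. complex_of_real (z $ m)) = 0" by (simp add: cdot_vmm)
      hence "Re (cdot ?r (\<chi> m. complex_of_real (z $ m))) = 0" "Im (cdot ?r (\<chi> m. complex_of_real (z $ m))) = 0" by simp_all
      thus ?thesis by (simp add: cdot_def re_vec_def im_vec_def inner_vec_def)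
    qed
    ultimately have "?r = 0" using left_mode_zero[OF X(1,2) dX, of ?r s] s ker by blast
    thus "w = 0" using joint_left_kernel[OF re gen dQ w(2)] by blast
  qed
  have c: "pveval p l = 0"
    if pM: "p v* (P ** pstar Q + Q ** pstar P) = 0" and pl: "pveval p l v* PmQ P Q l = 0" for p :: "real poly^'n" and l
  proof (cases "Re l \<ge> 0")
    case True
    thus ?thesis using rank pl unfolding PmQ_kernel by blast
  next
    case False
    define \<mu> where "\<mu> = - l"
    have \<mu>: "Re \<mu> > 0" using False by (simp add: \<mu>_def)
    define ev where "ev s = pveval p s" for s
    define b where "b s = ev s v* peval Q s" for s
    define a where "a s = ev s v* peval P s" for s
    define r where "r s = ev s v* peval R s" for s
    \<comment> \<open>On the imaginary axis \<open>- s\<close> is the conjugate of \<open>s\<close>,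
      so there \<open>v\<close> and \<open>\<pi>\<close> are the conjugates of \<open>b\<close> and
      of \<open>- r\<close>; unlike conjugates they are polynomial in \<open>s\<close> and make
      sense off the axis.\<close>
    define v where "v s = b (- s)" for s
    define \<pi> where "\<pi> s = (-1) *s r (- s)" for s
    \<comment> \<open>A generalized inverse of \<open>X\<close>. It recovers the state from
      \<open>\<pi> = X x\<close> up to the kernel of \<open>X\<close>, so that the state equation
      can be written in terms of \<open>\<pi>\<close> alone.\<close>
    obtain W where W: "X ** W ** X = X"
    proof -
      obtain g where g: "linear g" "\<And>y. y \<in> range ((*v) X) \<Longrightarrow> X *v g y = y"
        using linear_exists_right_inverse_on[OF matrix_vector_mul_linear[of X] subspace_UNIV] by auto
      have "(X ** matrix g ** X) *v x = X *v x" for x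
        using g(2)[of "X *v x"] matrix_works[of g "X *v x"] g(1)[unfolded linear_matrix_vector_mul_eq[symmetric]] by (simp add: matrix_vector_mul_assoc[symmetric])
      hence "X ** matrix g ** X = X" by (simp add: matrix_eq)
      thus ?thesis by (rule that)
    qed
    have XAW: "X ** A ** W ** X = X ** A"
    proof -
      have "(X ** A ** W ** X) *v x = (X ** A) *v x" for x
      proof -
        have "X *v (x - (W ** X) *v x) = 0" by (simp add: matrix_vector_mult_diff_distrib matrix_vector_mul_assoc matrix_mul_assoc W)
        hence "X *v (A *v (x - (W ** X) *v x)) = 0" using storage_kernel_invariant[OF X(1,2) dX] by blast
        thus ?thesis by (simp add: matrix_vector_mult_diff_distrib matrix_vector_mul_assoc matrix_mul_assoc)
      qed
      thus ?thesis by (simp add: matrix_eq)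
    qed
    let ?F = "{s. poly (cp (det (xi_minus A))) s = 0}"
    let ?S = "{s. Re s = 0} - (?F \<union> uminus ` ?F)"
    have "finite ?F" by (rule poly_roots_finite) (simp add: cp_0_iff det_xi_minus_nonzero)
    hence inf: "infinite ?S" by (intro infinite_imaginary_axis) auto
    have axis: "\<pi> s = cmat X *v (cmat W *v \<pi> s) \<and> s *s \<pi> s = cmat (X ** A ** W) *v \<pi> s + cmat (X ** B) *v v s"
      if s: "s \<in> ?S" for s
    proof -
      have s0: "cnj s = - s" "poly (cp (det (xi_minus A))) s \<noteq> 0" "poly (cp (det (xi_minus A))) (- s) \<noteq> 0"
      proof -
        have "s \<notin> uminus ` ?F" "s \<notin> ?F" "Re s = 0" using s by auto
        moreover have "s = uminus (- s)" by simp
        ultimately have "- s \<notin> ?F" "s \<notin> ?F" "Re s = 0" by blast+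
        thus "cnj s = - s" "poly (cp (det (xi_minus A))) s \<noteq> 0" "poly (cp (det (xi_minus A))) (- s) \<noteq> 0"
          by (auto intro: complex_eqI)
      qed
      have cn: "ev (- s) = cnjv (ev s)" using pveval_cnj[of p s] by (simp add: ev_def s0)
      have cb: "v s = cnjv (b s)" and cr: "\<pi> s = (-1) *s cnjv (r s)" and ca: "a (- s) = cnjv (a s)"
        by (simp_all add: v_def b_def \<pi>_def r_def a_def cn cnjv_vmm s0)
      define u where "u = v s"
      obtain x where x: "s *s x = cmat A *v x + cmat B *v u" using resolvent_state[OF s0(2)] .
      \<comment> \<open>The row equation assumed for \<open>p\<close>, evaluated at \<open>s\<close>
        and applied to \<open>p(- s)\<close>, says that this exponential trajectory has supply with
        zero real part.\<close>
      have lossless: "Re (cdot (a s) u) = 0"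
      proof -
        have "a s v* transpose (peval Q (- s)) + b s v* transpose (peval P (- s)) = 0"
        proof -
          have "pveval (p v* (P ** pstar Q + Q ** pstar P)) s = a s v* transpose (peval Q (- s)) + b s v* transpose (peval P (- s))"
            unfolding pveval_vmm peval_add peval_mult peval_pstar a_def b_def ev_def vmm_assoc
            by (simp add: vec_eq_iff vector_matrix_mult_def sum.distrib algebra_simps)
          thus ?thesis using pM by (simp add: pveval_def vec_eq_iff)
        qed
        hence "cdot (a s v* transpose (peval Q (- s)) + b s v* transpose (peval P (- s))) (ev (- s)) = 0"
          by (simp add: cdot_def)
        hence "cdot (a s) (b (- s)) + cdot (b s) (cnjv (a s)) = 0"
          unfolding cdot_add_left cdot_vmm transpose_matrix_vector ca[symmetric] by (simp only: a_def[of "- s", symmetric] b_def[of "- s", symmetric])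
        moreover have "cdot (b s) (cnjv (a s)) = cnj (cdot (a s) (cnjv (b s)))"
          by (simp add: cdot_def cnjv_def mult.commute)
        ultimately have "cdot (a s) u + cnj (cdot (a s) u) = 0" using cb by (simp add: u_def v_def)
        thus ?thesis by (simp add: complex_add_cnj)
      qed
      have "cdot (a s) u = cdot (cnjv u) (cmat C *v x + cmat D *v u)"
        using transfer_identity[OF re x, of "ev s"] by (simp add: a_def u_def cb b_def[symmetric] cnjv_simps)
      moreover have "Re (cdot (cnjv x) (cmat X *v (cmat A *v x + cmat B *v u))) = 0"
        using s complex_storage_real[OF X(1,2) dX] by (simp add: x[symmetric] vector_scalar_commute cdot_scale_right)
      ultimately have "Re (cdot (cnjv u) (cmat C *v x + cmat D *v u)) = Re (cdot (cnjv x) (cmat X *v (cmat A *v x + cmat B *v u)))"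
        using lossless by simp
      from complex_dissipation_kernel(1)[OF X(1,2) dX this]
      have k: "(cmat X *v x) v* cmat A + s *s (cmat X *v x) = u v* cmat C"
        unfolding x[symmetric] vector_scalar_commute cmat_vmm .
      have bC: "b s v* cmat C = s *s r s - r s v* cmat A"
        using realizes_peval(1)[OF re, of "ev s" s] by (simp add: b_def r_def vmm_mat_diff)
      have uC: "u v* cmat C = \<pi> s v* cmat A + s *s \<pi> s"
        using arg_cong[OF bC, of cnjv] unfolding cr vmm_scale u_def cb
        by (simp add: cmat_vmm cnjv_cmat[symmetric] cnjv_simps s0 vec_eq_iff)
      \<comment> \<open>The equality case and the conjugate of \<open>Q C = R (xi I - A)\<close> are
        the same linear equation, one solved by \<open>X x\<close> and the other by
        \<open>\<pi> s\<close>; as \<open>- s\<close> is not an eigenvalue of \<open>A\<close>, the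
        solutions coincide.\<close>
      have "(cmat X *v x - \<pi> s) v* (mat (- s) - cmat A) = 0"
        using k unfolding uC vmm_mat_diff vector_matrix_mult_diff_distrib by (simp add: vec_eq_iff algebra_simps)
      moreover obtain N' where "(mat (- s) - cmat A) ** N' = mat 1" using resolvent_exists[OF s0(3)] by blast
      ultimately have "(cmat X *v x - \<pi> s) v* mat 1 = 0"
        by (metis vmm_assoc vector_matrix_mult_0)
      hence \<pi>x: "\<pi> s = cmat X *v x" by (simp add: vmm_mat)
      have "\<pi> s = cmat X *v (cmat W *v \<pi> s)" unfolding \<pi>x
        by (simp add: matrix_vector_mul_assoc cmat_simps(1)[symmetric] matrix_mul_assoc W)
      moreover have "s *s \<pi> s = cmat (X ** A ** W) *v \<pi> s + cmat (X ** B) *v v s"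
      proof -
        have "s *s \<pi> s = cmat X *v (cmat A *v x + cmat B *v u)" by (simp add: \<pi>x x[symmetric] vector_scalar_commute)
        also have "\<dots> = cmat (X ** A) *v x + cmat (X ** B) *v u"
          by (simp add: matrix_vector_right_distrib matrix_vector_mul_assoc cmat_simps)
        also have "cmat (X ** A) *v x = cmat (X ** A ** W) *v \<pi> s"
          unfolding \<pi>x matrix_vector_mul_assoc cmat_simps(1)[symmetric] XAW ..
        finally show ?thesis by (simp add: u_def)
      qed
      ultimately show ?thesis by blast
    qed
    define vP where "vP j = pcompose (cp ((p v* Q) $ j)) [:0, -1:]" for j
    define \<pi>P where "\<pi>P m = - pcompose (cp ((p v* R) $ m)) [:0, -1:]" for m
    have vp: "v s $ j = poly (vP j) s" for s j
      by (simp only: v_def b_def ev_def pveval_vmm[symmetric] vP_def) (simp add: pveval_def poly_pcompose)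
    have \<pi>p: "\<pi> s $ m = poly (\<pi>P m) s" for s m
      by (simp only: \<pi>_def r_def ev_def pveval_vmm[symmetric] \<pi>P_def) (simp add: pveval_def poly_pcompose)
    have mp: "(cmat M *v \<pi> s) $ i = poly (\<Sum>k\<in>UNIV. [:complex_of_real (M $ i $ k):] * \<pi>P k) s" for M :: "real^'d^'d" and s i
      by (simp add: matrix_vector_mult_def cmat_def \<pi>p poly_sum)
    have mv: "(cmat M *v v s) $ i = poly (\<Sum>k\<in>UNIV. [:complex_of_real (M $ i $ k):] * vP k) s" for M :: "real^'n^'d" and s i
      by (simp add: matrix_vector_mult_def cmat_def vp poly_sum)
    have ident1: "\<pi> \<mu> = cmat X *v (cmat W *v \<pi> \<mu>)"
    proof -
      have "\<pi> s $ i = (cmat (X ** W) *v \<pi> s) $ i" if "s \<in> ?S" for s i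
        using axis[OF that] by (simp add: cmat_simps matrix_vector_mul_assoc)
      hence "poly (\<pi>P i) \<mu> = poly (\<Sum>k\<in>UNIV. [:complex_of_real ((X ** W) $ i $ k):] * \<pi>P k) \<mu>" for i
        using poly_eq_on_infinite[OF inf] unfolding \<pi>p mp by blast
      thus ?thesis
        unfolding vec_eq_iff matrix_vector_mul_assoc cmat_simps(1)[symmetric] mp \<pi>p by blast
    qed
    have ident2: "\<mu> *s \<pi> \<mu> = cmat (X ** A ** W) *v \<pi> \<mu> + cmat (X ** B) *v v \<mu>"
    proof -
      have "poly ([:0, 1:] * \<pi>P i) s = poly ((\<Sum>k\<in>UNIV. [:complex_of_real ((X ** A ** W) $ i $ k):] * \<pi>P k)
          + (\<Sum>k\<in>UNIV. [:complex_of_real ((X ** B) $ i $ k):] * vP k)) s" if "s \<in> ?S" for s i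
        using arg_cong[OF conjunct2[OF axis[OF that]], of "\<lambda>w. w $ i"] unfolding poly_add mp[symmetric] mv[symmetric]
        by (simp add: \<pi>p)
      hence "poly ([:0, 1:] * \<pi>P i) \<mu> = poly ((\<Sum>k\<in>UNIV. [:complex_of_real ((X ** A ** W) $ i $ k):] * \<pi>P k)
          + (\<Sum>k\<in>UNIV. [:complex_of_real ((X ** B) $ i $ k):] * vP k)) \<mu>" for i
        using poly_eq_on_infinite[OF inf] by blast
      thus ?thesis unfolding poly_add mp[symmetric] mv[symmetric] by (simp add: vec_eq_iff \<pi>p)
    qed
    \<comment> \<open>At \<open>\<mu>\<close> the input vanishes because \<open>p(l)\<close> kills
      \<open>Q(l)\<close>; what remains is a free mode with positive growth rate.\<close>
    have "v \<mu> = 0" using pl by (simp add: v_def b_def ev_def \<mu>_def PmQ_kernel)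
    define \<xi> where "\<xi> = cmat W *v \<pi> \<mu>"
    have x\<pi>: "cmat X *v \<xi> = \<pi> \<mu>" using ident1 by (simp add: \<xi>_def)
    have "cmat X *v (cmat A *v \<xi>) = \<mu> *s (cmat X *v \<xi>)"
      using ident2 \<open>v \<mu> = 0\<close> unfolding x\<pi> by (simp add: \<xi>_def matrix_vector_mul_assoc cmat_simps matrix_mul_assoc)
    hence "cmat X *v \<xi> = 0" by (rule mode_in_kernel[OF X(1,2) dX _ \<mu>])
    hence "r l = 0" unfolding x\<pi> by (simp add: \<pi>_def \<mu>_def vec_eq_iff)
    moreover have "pveval p l v* peval Q l = 0" using pl by (simp add: PmQ_kernel)
    ultimately show ?thesis using joint_left_kernel[OF re gen dQ] by (simp add: r_def ev_def)
  qed
  show ?thesis unfolding positive_real_pair_def hpsd_iff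
    using passive_positive[OF X(1,2) dX re] rank c by (auto simp: rank_full_iff PmQ_kernel)
qed

section \<open>Supply forms on polynomial inputs\<close>

text \<open>Polynomial vectors serve as finitely supported input sequences: the coefficient of
  \<open>z^k\<close> is the input at time \<open>k\<close>, and multiplication by \<open>zz\<close>
  is a delay by one step.\<close>

definition cf :: "'a::zero poly^'n \<Rightarrow> nat \<Rightarrow> 'a^'n" where
  "cf U k = (\<chi> i. coeff (U $ i) k)"

definition pv :: "complex poly^'n \<Rightarrow> complex \<Rightarrow> complex^'n" where
  "pv U z = (\<chi> i. poly (U $ i) z)"

abbreviation zz :: "complex poly" where "zz \<equiv> [:0, 1:]"

lemma cf_eqI: "(\<And>k. cf U k = cf W k) \<Longrightarrow> U = W"
  by (simp add: cf_def vec_eq_iff poly_eq_iff)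

lemma cf_add: "cf (U + W) k = cf U k + cf W k"
  and cf_scale: "cf ([:c:] *s U) k = c *s cf U k"
  for U W :: "complex poly^'n"
  by (simp_all add: cf_def vec_eq_iff)

lemma cf_zz_0: "cf (zz *s U) 0 = 0"
  and cf_zz_Suc: "cf (zz *s U) (Suc k) = cf U k"
  by (simp_all add: cf_def vec_eq_iff coeff_pCons)

lemma cf_0: "cf 0 k = (0::complex^'n)"
  by (simp add: cf_def vec_eq_iff)

lemma finite_cf: "finite {k. cf U k \<noteq> 0}"
proof (rule finite_subset)
  show "{k. cf U k \<noteq> 0} \<subseteq> (\<Union>i. {k. coeff (U $ i) k \<noteq> 0})" by (auto simp: cf_def vec_eq_iff)
  show "finite (\<Union>i. {k. coeff (U $ i) k \<noteq> 0})"
    by (rule finite_UN_I) (auto simp: coeff_eq_0 intro!: finite_subset[OF _ finite_atMost] le_degree)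
qed

lemma cf_bound: "\<exists>N. \<forall>k\<ge>N. cf U k = 0"
proof -
  obtain N where "\<And>k. k \<in> {k. cf U k \<noteq> 0} \<Longrightarrow> k < N" using finite_nat_set_iff_bounded finite_cf by metis
  thus ?thesis by (intro exI[of _ N]) (auto simp: not_less[symmetric])
qed

lemma pv_scale: "pv (f *s U) z = poly f z *s pv U z"
  by (simp add: pv_def vec_eq_iff)

text \<open>Outputs of finite inputs are in general infinite sequences, so one argument is a
  polynomial vector and the other an arbitrary sequence.\<close>

definition half :: "complex poly^'n \<Rightarrow> (nat \<Rightarrow> complex^'n) \<Rightarrow> complex" where
  "half U h = (\<Sum>k | cf U k \<noteq> 0. cdot (cnjv (cf U k)) (h k))"

lemma cdot_0_left: "cdot 0 x = 0" by (simp add: cdot_def)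

lemma half_eq:
  assumes "\<And>k. k \<ge> N \<Longrightarrow> cf U k = 0"
  shows "half U h = (\<Sum>k<N. cdot (cnjv (cf U k)) (h k))"
  unfolding half_def
  by (rule sum.mono_neutral_left) (use assms in \<open>auto simp: cnjv_simps cdot_0_left not_less[symmetric]\<close>)

lemma common_bound:
  fixes U W :: "complex poly^'n"
  shows "\<exists>N. (\<forall>k\<ge>N. cf U k = 0) \<and> (\<forall>k\<ge>N. cf W k = 0)"
proof -
  obtain M N where "\<forall>k\<ge>M. cf U k = 0" "\<forall>k\<ge>N. cf W k = 0" using cf_bound by metis
  thus ?thesis by (intro exI[of _ "max M N"]) auto
qed

lemma half_add_left: "half (U + W) h = half U h + half W h"
proof -
  obtain N where N: "\<forall>k\<ge>N. cf U k = 0" "\<forall>k\<ge>N. cf W k = 0" using common_bound by blast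
  have "half U h = (\<Sum>k<N. cdot (cnjv (cf U k)) (h k))" "half W h = (\<Sum>k<N. cdot (cnjv (cf W k)) (h k))"
    "half (U + W) h = (\<Sum>k<N. cdot (cnjv (cf (U + W) k)) (h k))"
    by (intro half_eq; use N in \<open>simp add: cf_add\<close>)+
  thus ?thesis by (simp add: cf_add cnjv_simps cdot_add_left sum.distrib)
qed

lemma half_scale_left: "half ([:c:] *s U) h = cnj c * half U h"
proof -
  obtain N where N: "\<forall>k\<ge>N. cf U k = 0" using cf_bound by blast
  have "half U h = (\<Sum>k<N. cdot (cnjv (cf U k)) (h k))"
    "half ([:c:] *s U) h = (\<Sum>k<N. cdot (cnjv (cf ([:c:] *s U) k)) (h k))"
    by (intro half_eq; use N in \<open>simp add: cf_scale\<close>)+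
  thus ?thesis by (simp add: cf_scale cnjv_simps cdot_scale_left sum_distrib_left)
qed

lemma half_add_right: "half U (\<lambda>k. g k + h k) = half U g + half U h"
  by (simp add: half_def cdot_add_right sum.distrib)

lemma half_scale_right: "half U (\<lambda>k. c *s h k) = c * half U h"
  by (simp add: half_def cdot_scale_right sum_distrib_left)

lemma half_shift: "half (zz *s U) h = half U (\<lambda>k. h (Suc k))"
proof -
  obtain N where N: "\<forall>k\<ge>N. cf U k = 0" using cf_bound by blast
  have "half U (\<lambda>k. h (Suc k)) = (\<Sum>k<N. cdot (cnjv (cf U k)) (h (Suc k)))"
    using N by (auto intro!: half_eq)
  moreover have "half (zz *s U) h = (\<Sum>k<Suc N. cdot (cnjv (cf (zz *s U) k)) (h k))"
  proof (rule half_eq)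
    fix k assume "Suc N \<le> k"
    then obtain j where "k = Suc j" "N \<le> j" by (cases k) auto
    thus "cf (zz *s U) k = 0" using N by (simp only: cf_zz_Suc)
  qed
  ultimately show ?thesis
    by (simp only: sum.lessThan_Suc_shift cf_zz_0 cf_zz_Suc cnjv_simps cdot_0_left add_0)
qed

lemma quadratic_discriminant_bound:
  fixes b :: complex
  assumes c: "c \<ge> 0" and q: "\<And>t. 0 \<le> a + 2 * Re (t * b) + (cmod t)\<^sup>2 * c"
  shows "(cmod b)\<^sup>2 \<le> a * c"
proof -
  have *: "0 \<le> a - 2 * x * (cmod b)\<^sup>2 + x\<^sup>2 * (cmod b)\<^sup>2 * c" for x :: real
  proof -
    have "Re (complex_of_real (- x) * cnj b * b) = - x * (cmod b)\<^sup>2"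
      using cmod_power2[of b] by (simp add: power2_eq_square algebra_simps)
    thus ?thesis using q[of "complex_of_real (- x) * cnj b"] by (simp add: norm_mult power_mult_distrib)
  qed
  show ?thesis
  proof (cases "c = 0")
    case True
    show ?thesis
    proof (rule ccontr)
      assume "\<not> ?thesis"
      hence "(cmod b)\<^sup>2 > 0" using True by simp
      thus False using *[of "(a + 1) / (2 * (cmod b)\<^sup>2)"] True by (simp add: field_simps)
    qed
  next
    case False
    hence "c > 0" using c by simp
    thus ?thesis using *[of "1 / c"] by (simp add: field_simps power2_eq_square)
  qed
qed

text \<open>Two forms are instances: the l2 form \<open>hS\<close> and the supply form
  \<open>hE\<close>, which may be degenerate. Invariance under the delay makes multiplication by
  \<open>z\<close> isometric for the seminorm; the estimates for factors \<open>z - l\<close> with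
  \<open>l\<close> in the open disc rest on this.\<close>

locale shift_form =
  fixes h :: "complex poly^'k \<Rightarrow> complex poly^'k \<Rightarrow> complex"
  assumes add_left: "h (U + U') W = h U W + h U' W"
    and scale_left: "h ([:c:] *s U) W = cnj c * h U W"
    and herm: "h W U = cnj (h U W)"
    and nonneg: "0 \<le> Re (h U U)"
    and shift: "h (zz *s U) (zz *s W) = h U W"
begin

lemma add_right: "h W (U + U') = h W U + h W U'"
  unfolding herm[of W "U + U'"] herm[of W U] herm[of W U'] add_left by simp

lemma scale_right: "h W ([:c:] *s U) = c * h W U"
  unfolding herm[of W "[:c:] *s U"] herm[of W U] scale_left by simp

lemma quadratic: "Re (h (U + [:t:] *s W) (U + [:t:] *s W)) = Re (h U U) + 2 * Re (t * h U W) + (cmod t)\<^sup>2 * Re (h W W)"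
proof -
  have "h (U + [:t:] *s W) (U + [:t:] *s W) = h U U + (t * h U W + cnj (t * h U W)) + (t * cnj t) * h W W"
    unfolding add_left add_right scale_left scale_right herm[of W U] by (simp add: algebra_simps)
  moreover have "t * cnj t = complex_of_real ((cmod t)\<^sup>2)" using complex_norm_square[of t] by simp
  ultimately show ?thesis by (simp add: complex_add_cnj)
qed

lemma cauchy_schwarz: "(cmod (h U W))\<^sup>2 \<le> Re (h U U) * Re (h W W)"
proof (rule quadratic_discriminant_bound)
  show "0 \<le> Re (h W W)" by (rule nonneg)
  fix t show "0 \<le> Re (h U U) + 2 * Re (t * h U W) + (cmod t)\<^sup>2 * Re (h W W)"
    unfolding quadratic[symmetric] by (rule nonneg)
qed

definition nrm :: "complex poly^'k \<Rightarrow> real" where "nrm U = sqrt (Re (h U U))"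

lemma nrm_nonneg: "0 \<le> nrm U" by (simp add: nrm_def nonneg)

lemma nrm_square: "(nrm U)\<^sup>2 = Re (h U U)" by (simp add: nrm_def nonneg)

lemma cauchy_schwarz_nrm: "cmod (h U W) \<le> nrm U * nrm W"
  by (rule power2_le_imp_le) (use cauchy_schwarz[of U W] in \<open>simp_all add: power_mult_distrib nrm_square nrm_nonneg\<close>)

lemma nrm_triangle: "nrm (U + W) \<le> nrm U + nrm W"
proof (rule power2_le_imp_le)
  have "Re (h (U + W) (U + W)) = Re (h U U) + 2 * Re (h U W) + Re (h W W)"
    using quadratic[of U 1 W] by (simp add: one_pCons[symmetric] vec_eq_iff)
  moreover have "Re (h U W) \<le> nrm U * nrm W"
    using complex_Re_le_cmod cauchy_schwarz_nrm order_trans by blast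
  ultimately show "(nrm (U + W))\<^sup>2 \<le> (nrm U + nrm W)\<^sup>2" by (simp add: nrm_square power2_sum)
qed (simp add: nrm_nonneg)

lemma nrm_scale: "nrm ([:c:] *s U) = cmod c * nrm U"
proof -
  have "h ([:c:] *s U) ([:c:] *s U) = (c * cnj c) * h U U"
    by (simp add: scale_left scale_right)
  also have "c * cnj c = complex_of_real ((cmod c)\<^sup>2)" using complex_norm_square[of c] by simp
  finally show ?thesis by (simp add: nrm_def real_sqrt_mult)
qed

lemma nrm_minus: "nrm (- U) = nrm U"
proof -
  have "- U = [:-1:] *s U" by (simp add: vec_eq_iff)
  thus ?thesis using nrm_scale[of "-1" U] by simp
qed

lemma nrm_0: "nrm 0 = 0"
  using nrm_scale[of 0 0] by (simp add: vec_eq_iff)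

lemma nrm_triangle_diff: "nrm (U - W) \<le> nrm U + nrm W"
  using nrm_triangle[of U "- W"] by (simp add: nrm_minus)

lemma nrm_sum: "finite I \<Longrightarrow> nrm (sum f I) \<le> (\<Sum>i\<in>I. nrm (f i))"
  by (induction I rule: finite_induct) (auto simp: nrm_0 intro: order_trans[OF nrm_triangle])

lemma nrm_zz: "nrm (zz *s U) = nrm U" by (simp add: nrm_def shift)

lemma nrm_poly_scale: "\<exists>C\<ge>0. \<forall>U. nrm (f *s U) \<le> C * nrm U"
proof (induction f)
  case 0
  show ?case by (intro exI[of _ 0]) (simp add: nrm_0)
next
  case (pCons a f)
  then obtain C where C: "C \<ge> 0" "\<And>U. nrm (f *s U) \<le> C * nrm U" by blast
  have "nrm (pCons a f *s U) \<le> (cmod a + C) * nrm U" for U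
  proof -
    have "pCons a f *s U = [:a:] *s U + zz *s (f *s U)" by (simp add: vec_eq_iff)
    hence "nrm (pCons a f *s U) \<le> nrm ([:a:] *s U) + nrm (zz *s (f *s U))" using nrm_triangle by metis
    also have "\<dots> \<le> cmod a * nrm U + C * nrm U" unfolding nrm_scale nrm_zz using C(2) by simp
    finally show ?thesis by (simp add: algebra_simps)
  qed
  thus ?case using C(1) by (intro exI[of _ "cmod a + C"]) auto
qed

text \<open>\<open>z U = (z - l) U + l U\<close>, and multiplication by \<open>z\<close> is
  isometric.\<close>

lemma nrm_root: "(1 - cmod l) * nrm U \<le> nrm ([:-l, 1:] *s U)"
proof -
  have "zz *s U = [:-l, 1:] *s U + [:l:] *s U" by (simp add: vec_eq_iff)
  hence "nrm U \<le> nrm ([:-l, 1:] *s U) + cmod l * nrm U" using nrm_triangle nrm_scale nrm_zz by metis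
  thus ?thesis by (simp add: algebra_simps)
qed

lemma null_orthogonal: "nrm U = 0 \<Longrightarrow> h U W = 0"
  using cauchy_schwarz_nrm[of U W] by simp

lemma null_scale: "nrm U = 0 \<Longrightarrow> nrm (f *s U) = 0"
  using nrm_poly_scale[of f] nrm_nonneg[of "f *s U"] by (metis mult_zero_right order_antisym)

lemma null_root: "cmod l < 1 \<Longrightarrow> nrm ([:-l, 1:] *s U) = 0 \<Longrightarrow> nrm U = 0"
  using nrm_root[of l U] nrm_nonneg[of U] by (simp add: mult_le_0_iff)

lemma nrm_add_null: "nrm W = 0 \<Longrightarrow> nrm (U + W) = nrm U"
  using nrm_triangle[of U W] nrm_triangle_diff[of "U + W" W] by simp

end

definition hS :: "complex poly^'n \<Rightarrow> complex poly^'n \<Rightarrow> complex" where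
  "hS U W = half U (cf W)"

lemma hS_eq: "(\<And>k. k \<ge> N \<Longrightarrow> cf U k = 0) \<Longrightarrow> hS U W = (\<Sum>k<N. cdot (cnjv (cf U k)) (cf W k))"
  unfolding hS_def by (rule half_eq)

lemma cdot_cnjv_self: "cdot (cnjv x) x = complex_of_real ((norm x)\<^sup>2)"
proof -
  have "cdot (cnjv x) x = complex_of_real (\<Sum>i\<in>UNIV. (cmod (x $ i))\<^sup>2)"
    by (simp add: cdot_def cnjv_def mult.commute[of "cnj _"] complex_norm_square[symmetric])
  also have "(\<Sum>i\<in>UNIV. (cmod (x $ i))\<^sup>2) = (norm x)\<^sup>2"
    by (simp add: norm_vec_def L2_set_def sum_nonneg)
  finally show ?thesis .
qed

interpretation S: shift_form hS
proof
  fix U U' W :: "complex poly^'k" and c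
  show "hS (U + U') W = hS U W + hS U' W" by (simp add: hS_def half_add_left)
  show "hS ([:c:] *s U) W = cnj c * hS U W" by (simp only: hS_def half_scale_left)
  show "hS (zz *s U) (zz *s W) = hS U W" by (simp only: hS_def half_shift cf_zz_Suc)
  show "hS W U = cnj (hS U W)"
  proof -
    obtain N where N: "\<forall>k\<ge>N. cf U k = 0" "\<forall>k\<ge>N. cf W k = 0" using common_bound by blast
    have "hS U W = (\<Sum>k<N. cdot (cnjv (cf U k)) (cf W k))" "hS W U = (\<Sum>k<N. cdot (cnjv (cf W k)) (cf U k))"
      using N by (auto intro!: hS_eq)
    thus ?thesis by (simp add: cdot_def cnjv_def mult.commute)
  qed
  show "0 \<le> Re (hS U U)" by (simp add: hS_def half_def cdot_cnjv_self sum_nonneg)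
qed

lemma norm_vsmult: "norm (c *s x) = cmod c * norm x" for x :: "complex^'n"
  by (simp add: norm_vec_def L2_set_def norm_mult power_mult_distrib sum_distrib_left[symmetric] real_sqrt_mult)

lemma pv_bound:
  fixes l :: complex
  assumes l: "cmod l < 1"
  shows "norm (pv U l) \<le> S.nrm U / (1 - cmod l)"
proof -
  obtain N where N: "\<forall>k\<ge>N. cf U k = 0" using cf_bound by blast
  have le: "norm (cf U k) \<le> S.nrm U" for k
  proof (cases "k < N")
    case True
    have "(norm (cf U k))\<^sup>2 \<le> (\<Sum>k<N. (norm (cf U k))\<^sup>2)"
      by (rule member_le_sum) (use True in auto)
    also have "\<dots> = (S.nrm U)\<^sup>2"
      using hS_eq[of N U U] N by (simp add: S.nrm_square cdot_cnjv_self)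
    finally show ?thesis by (rule power2_le_imp_le) (rule S.nrm_nonneg)
  qed (use N S.nrm_nonneg in simp)
  have "pv U l = (\<Sum>k<N. l ^ k *s cf U k)"
  proof -
    have "poly (U $ i) l = (\<Sum>k<N. l ^ k * coeff (U $ i) k)" for i
    proof -
      have z: "coeff (U $ i) k = 0" if "k \<ge> N" for k using N that by (simp add: cf_def vec_eq_iff)
      have "poly (U $ i) l = (\<Sum>k\<le>degree (U $ i). coeff (U $ i) k * l ^ k)" by (rule poly_altdef)
      also have "\<dots> = (\<Sum>k\<in>{..degree (U $ i)} \<union> {..<N}. coeff (U $ i) k * l ^ k)"
        by (rule sum.mono_neutral_left) (auto simp: coeff_eq_0)
      also have "\<dots> = (\<Sum>k<N. coeff (U $ i) k * l ^ k)"
        by (rule sum.mono_neutral_right) (auto simp: z not_less)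
      finally show ?thesis by (simp add: mult.commute)
    qed
    thus ?thesis by (simp add: pv_def vec_eq_iff cf_def)
  qed
  hence "norm (pv U l) \<le> (\<Sum>k<N. norm (l ^ k *s cf U k))" by (simp add: norm_sum)
  also have "\<dots> \<le> (\<Sum>k<N. cmod l ^ k * S.nrm U)"
  proof (rule sum_mono)
    fix k
    have "norm (l ^ k *s cf U k) = cmod l ^ k * norm (cf U k)"
      by (simp only: norm_vsmult norm_power)
    thus "norm (l ^ k *s cf U k) \<le> cmod l ^ k * S.nrm U" using le by (simp add: mult_left_mono)
  qed
  also have "\<dots> = (\<Sum>k<N. cmod l ^ k) * S.nrm U" by (simp add: sum_distrib_right)
  also have "\<dots> \<le> (1 / (1 - cmod l)) * S.nrm U"
  proof (rule mult_right_mono)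
    have "(\<Sum>k<N. cmod l ^ k) \<le> (\<Sum>k. cmod l ^ k)" using l by (intro sum_le_suminf summable_geometric) auto
    thus "(\<Sum>k<N. cmod l ^ k) \<le> 1 / (1 - cmod l)" using l by (simp add: suminf_geometric)
  qed (rule S.nrm_nonneg)
  finally show ?thesis by simp
qed

text \<open>Induction over the roots of \<open>g\<close>, wherever they lie. A root equal to
  \<open>l\<close> is removed by \<open>nrm_root\<close>; for another root \<open>m\<close> the
  induction hypothesis is applied to \<open>(z - m) U\<close>, whose value at \<open>l\<close> is
  \<open>l - m\<close> times that of \<open>U\<close>. Roots on or outside the unit circle therefore
  do no harm.\<close>

lemma pv_multiple_bound:
  fixes l :: complex
    and g :: "complex poly"
  assumes l: "cmod l < 1" and g: "g \<noteq> 0"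
  shows "\<exists>K\<ge>0. \<forall>U :: complex poly^'n. norm (pv U l) \<le> K * S.nrm (g *s U)"
  using g
proof (induction "degree g" arbitrary: g)
  case 0
  then obtain c where c: "g = [:c:]" "c \<noteq> 0" by (metis degree_eq_zeroE pCons_0_0)
  have "norm (pv U l) \<le> (1 / ((1 - cmod l) * cmod c)) * S.nrm (g *s U)" for U :: "complex poly^'n"
    using pv_bound[OF l, of U] c by (simp add: S.nrm_scale)
  thus ?case using l by (intro exI[of _ "1 / ((1 - cmod l) * cmod c)"]) simp
next
  case (Suc n)
  then obtain m where "poly g m = 0"
    using Fundamental_Theorem_Algebra.fundamental_theorem_of_algebra[of g] by (metis constant_degree nat.distinct(1))
  then obtain g' where g': "g = [:-m, 1:] * g'" using poly_eq_0_iff_dvd by blast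
  have g'0: "g' \<noteq> 0" using Suc(3) g' by auto
  have "degree g = degree [:-m, 1:] + degree g'" unfolding g' by (rule degree_mult_eq) (use g'0 in auto)
  hence "degree g' = n" using Suc(2) by simp
  then obtain K where K: "K \<ge> 0" "\<And>U :: complex poly^'n. norm (pv U l) \<le> K * S.nrm (g' *s U)"
    using Suc(1) g'0 by blast
  show ?case
  proof (cases "m = l")
    case True
    have "norm (pv U l) \<le> K / (1 - cmod l) * S.nrm (g *s U)" for U :: "complex poly^'n"
    proof -
      have "(1 - cmod l) * S.nrm (g' *s U) \<le> S.nrm (g *s U)"
        using S.nrm_root[of l "g' *s U"] by (simp add: g' True vector_smult_assoc)
      hence "S.nrm (g' *s U) \<le> S.nrm (g *s U) / (1 - cmod l)" using l by (simp add: field_simps)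
      hence "K * S.nrm (g' *s U) \<le> K * (S.nrm (g *s U) / (1 - cmod l))" using K(1) by (rule mult_left_mono)
      thus ?thesis using K(2)[of U] by simp
    qed
    thus ?thesis using K(1) l by (intro exI[of _ "K / (1 - cmod l)"]) simp
  next
    case False
    have "norm (pv U l) \<le> K / cmod (l - m) * S.nrm (g *s U)" for U :: "complex poly^'n"
    proof -
      have "norm ((l - m) *s pv U l) = cmod (l - m) * norm (pv U l)"
        by (rule norm_vsmult)
      moreover have "pv ([:-m, 1:] *s U) l = (l - m) *s pv U l" by (simp add: pv_scale)
      moreover have "g' *s ([:-m, 1:] *s U) = g *s U" by (simp add: vector_smult_assoc g' mult.commute)
      ultimately have "cmod (l - m) * norm (pv U l) \<le> K * S.nrm (g *s U)"
        using K(2)[of "[:-m, 1:] *s U"] by metis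
      thus ?thesis using False by (simp add: field_simps)
    qed
    thus ?thesis using K(1) by (intro exI[of _ "K / cmod (l - m)"]) simp
  qed
qed

lemma circle_mean:
  fixes p :: "complex poly"
  assumes g: "g holomorphic_on ball 0 R" and r: "0 < r" "r < R"
  shows "((\<lambda>t. cnj (poly p (circlepath 0 r t)) * g (circlepath 0 r t)) has_integral
     (\<Sum>k\<le>degree p. cnj (coeff p k) * complex_of_real (r ^ (2 * k)) * ((deriv ^^ k) g 0 / fact k))) {0..1}"
proof -
  let ?c = "circlepath 0 r"
  have nz: "?c t \<noteq> 0" and cn: "cnj (?c t) = complex_of_real (r\<^sup>2) / ?c t" for t
  proof -
    have "cmod (?c t) = r" using r by (simp add: circlepath norm_mult)
    thus "?c t \<noteq> 0" using r by auto
    have "?c t * cnj (?c t) = complex_of_real (r\<^sup>2)" using complex_norm_square[of "?c t"] \<open>cmod _ = r\<close> by simp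
    thus "cnj (?c t) = complex_of_real (r\<^sup>2) / ?c t" using \<open>?c t \<noteq> 0\<close> by (simp add: field_simps)
  qed
  have "((\<lambda>t. g (?c t) / ?c t ^ k) has_integral ((deriv ^^ k) g 0 / fact k)) {0..1}" for k
  proof -
    have "((\<lambda>u. g u / (u - 0) ^ Suc k) has_contour_integral (2 * pi * \<i> / fact k) * (deriv ^^ k) g 0) ?c"
      by (rule Cauchy_has_contour_integral_higher_derivative_circlepath)
        (use g r in \<open>auto intro!: holomorphic_on_imp_continuous_on intro: holomorphic_on_subset\<close>)
    hence "((\<lambda>t. g (?c t) / ?c t ^ Suc k * (2 * pi * \<i> * ?c t)) has_integral (2 * pi * \<i> / fact k) * (deriv ^^ k) g 0) {0..1}"
      unfolding has_contour_integral_def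
    proof (rule has_integral_eq[rotated])
      fix t :: real assume "t \<in> {0..1}"
      hence "vector_derivative ?c (at t within {0..1}) = 2 * pi * \<i> * ?c t"
        by (simp add: vector_derivative_circlepath01) (simp add: circlepath)
      thus "g (?c t) / (?c t - 0) ^ Suc k * vector_derivative ?c (at t within {0..1}) = g (?c t) / ?c t ^ Suc k * (2 * pi * \<i> * ?c t)"
        by simp
    qed
    from has_integral_mult_right[OF this, of "1 / (2 * pi * \<i>)"]
    show ?thesis using nz by (simp add: field_simps)
  qed
  hence "((\<lambda>t. \<Sum>k\<le>degree p. cnj (coeff p k) * complex_of_real (r ^ (2 * k)) * (g (?c t) / ?c t ^ k)) has_integral
     (\<Sum>k\<le>degree p. cnj (coeff p k) * complex_of_real (r ^ (2 * k)) * ((deriv ^^ k) g 0 / fact k))) {0..1}"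
    by (intro has_integral_sum has_integral_mult_right) auto
  moreover have "(\<Sum>k\<le>degree p. cnj (coeff p k) * complex_of_real (r ^ (2 * k)) * (g (?c t) / ?c t ^ k))
      = cnj (poly p (?c t)) * g (?c t)" for t
    by (simp add: poly_altdef cn sum_distrib_right power_divide power_mult[symmetric])
  ultimately show ?thesis by simp
qed

lemma common_denominator:
  fixes f :: "'i \<Rightarrow> 'a::idom fract"
  assumes "finite S"
  shows "\<exists>g. g \<noteq> 0 \<and> (\<forall>i\<in>S. \<exists>p. Fract g 1 * f i = Fract p 1)"
  using assms
proof (induction S rule: finite_induct)
  case empty
  show ?case by (intro exI[of _ 1]) simp
next
  case (insert j S)
  then obtain g where g: "g \<noteq> 0" "\<forall>i\<in>S. \<exists>p. Fract g 1 * f i = Fract p 1" by blast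
  obtain a b where ab: "f j = Fract a b" "b \<noteq> 0" by (cases "f j") auto
  have "\<exists>p. Fract (g * b) 1 * f i = Fract p 1" if "i \<in> insert j S" for i
  proof (cases "i = j")
    case True
    hence "Fract (g * b) 1 * f i = Fract (g * a) 1" using ab by (simp add: eq_fract)
    thus ?thesis by blast
  next
    case False
    hence "i \<in> S" using that by simp
    hence "\<exists>p. Fract g 1 * f i = Fract p 1" using g(2) by (rule bspec[rotated])
    then obtain p where "Fract g 1 * f i = Fract p 1" by (elim exE)
    moreover have "Fract (g * b) 1 = Fract b 1 * Fract g 1" by (simp add: mult.commute)
    ultimately have "Fract (g * b) 1 * f i = Fract b 1 * Fract p 1" by (simp only: mult.assoc)
    hence "Fract (g * b) 1 * f i = Fract (b * p) 1" by simp
    thus ?thesis by blast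
  qed
  thus ?case using g ab by (intro exI[of _ "g * b"]) simp
qed

lemma Fract_sum: "Fract (sum f S) 1 = (\<Sum>i\<in>S. Fract (f i) 1)" for f :: "'i \<Rightarrow> 'a::idom"
proof (induction S rule: infinite_finite_induct)
  case (insert x F)
  have "Fract (f x + sum f F) 1 = Fract (f x) 1 + Fract (sum f F) 1" by simp
  thus ?case using insert by simp
qed (simp_all add: Zero_fract_def)

text \<open>Over the fraction field injectivity gives a left inverse; clearing denominators brings
  it back to the ring. It serves to recover a polynomial vector, up to the factor \<open>g\<close>,
  from its image under a matrix.\<close>

lemma left_inverse_multiple:
  fixes M :: "'a::idom^'n^'m"
  assumes ker: "\<And>x. M *v x = 0 \<Longrightarrow> x = 0"
  shows "\<exists>L g. g \<noteq> 0 \<and> L ** M = mat g"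
proof -
  define F where "F = (\<chi> i j. Fract (M $ i $ j) 1)"
  have "x = 0" if "F *v x = 0" for x
  proof -
    obtain g where g: "g \<noteq> 0" "\<forall>i\<in>UNIV. \<exists>p. Fract g 1 * x $ i = Fract p 1"
      using common_denominator[of UNIV "\<lambda>i. x $ i"] by auto
    then obtain y where y: "\<And>i. Fract g 1 * x $ i = Fract (y i) 1" by (metis UNIV_I)
    have "(M *v (\<chi> i. y i)) $ j = 0" for j
    proof -
      have "Fract ((M *v (\<chi> i. y i)) $ j) 1 = (\<Sum>i\<in>UNIV. F $ j $ i * Fract (y i) 1)"
        by (simp add: matrix_vector_mult_def Fract_sum F_def)
      also have "\<dots> = Fract g 1 * (F *v x) $ j"
        by (simp add: y[symmetric] matrix_vector_mult_def sum_distrib_left mult_ac)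
      also have "\<dots> = Fract 0 1" using that by (simp add: Zero_fract_def)
      finally show ?thesis by (simp add: eq_fract)
    qed
    hence "(\<chi> i. y i) = 0" by (intro ker) (simp add: vec_eq_iff)
    hence "Fract g 1 * x $ i = 0" for i using y by (simp add: vec_eq_iff Zero_fract_def)
    moreover have "Fract g 1 \<noteq> 0" using g(1) by (simp add: Zero_fract_def eq_fract)
    ultimately show ?thesis by (simp add: vec_eq_iff)
  qed
  hence "\<exists>H. H ** F = mat 1" unfolding matrix_left_invertible_ker by blast
  then obtain H where H: "H ** F = mat 1" by (elim exE)
  obtain g where g: "g \<noteq> 0" "\<forall>k\<in>UNIV. \<exists>p. Fract g 1 * (case k of (i, j) \<Rightarrow> H $ i $ j) = Fract p 1"
    using common_denominator[of UNIV "\<lambda>k. case k of (i, j) \<Rightarrow> H $ i $ j"] by auto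
  hence "\<forall>k. \<exists>p. Fract g 1 * (case k of (i, j) \<Rightarrow> H $ i $ j) = Fract p 1" by simp
  from choice[OF this] obtain L where "\<forall>k. Fract g 1 * (case k of (i, j) \<Rightarrow> H $ i $ j) = Fract (L k) 1" by (elim exE)
  hence L: "Fract g 1 * H $ i $ j = Fract (L (i, j)) 1" for i j by (metis case_prod_conv)
  have "((\<chi> i j. L (i, j)) ** M) $ i $ j = (mat g) $ i $ j" for i j
  proof -
    have "Fract (((\<chi> i j. L (i, j)) ** M) $ i $ j) 1 = (\<Sum>k\<in>UNIV. Fract (L (i, k)) 1 * F $ k $ j)"
      by (simp add: matrix_matrix_mult_def Fract_sum F_def)
    also have "\<dots> = Fract g 1 * (H ** F) $ i $ j"
      by (simp add: L[symmetric] matrix_matrix_mult_def sum_distrib_left mult_ac)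
    also have "\<dots> = Fract (mat g $ i $ j) 1" unfolding H by (simp add: mat_def Zero_fract_def One_fract_def)
    finally show ?thesis by (simp add: eq_fract)
  qed
  hence "(\<chi> i j. L (i, j)) ** M = mat g" by (simp add: vec_eq_iff)
  thus ?thesis using g(1) by blast
qed

section \<open>The Cayley transform\<close>

definition pm :: "complex poly^'b^'c \<Rightarrow> complex \<Rightarrow> complex^'b^'c" where
  "pm M s = (\<chi> i j. poly (M $ i $ j) s)"

lemma pm_mult: "pm (M ** N) s = pm M s ** pm N s"
  by (simp add: pm_def matrix_matrix_mult_def vec_eq_iff poly_sum)

lemma pm_mat: "pm (mat c) s = mat (poly c s)"
  by (auto simp: pm_def mat_def vec_eq_iff)

lemma pm_cpm: "pm (cpm M) s = peval M s"
  by (simp add: pm_def peval_eq)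

lemma pv_mult: "pv (M *v U) s = pm M s *v pv U s"
  by (simp add: pm_def pv_def matrix_vector_mult_def vec_eq_iff poly_sum)

lemma pv_vmm: "pv (U v* M) s = pv U s v* pm M s"
  by (simp add: pm_def pv_def vector_matrix_mult_def vec_eq_iff poly_sum)

lemma det_pm: "det (pm M s) = poly (det M) s"
  by (simp add: pm_def poly_det)

lemma norm_cdot_le: "cmod (cdot x y) \<le> norm x * norm y"
proof -
  have "cmod (cdot x y) \<le> (\<Sum>i\<in>UNIV. cmod (x $ i) * cmod (y $ i))"
    unfolding cdot_def by (rule order_trans[OF norm_sum]) (simp add: norm_mult)
  also have "\<dots> \<le> L2_set (\<lambda>i. cmod (x $ i)) UNIV * L2_set (\<lambda>i. cmod (y $ i)) UNIV"
    using L2_set_mult_ineq[of "\<lambda>i. cmod (x $ i)" "\<lambda>i. cmod (y $ i)" UNIV] by simp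
  finally show ?thesis by (simp add: norm_vec_def)
qed

lemma norm_cnjv: "norm (cnjv x) = norm x"
  by (simp add: norm_vec_def cnjv_def)

lemma norm_add_square:
  fixes x y :: "complex^'n"
  shows "(norm (x + y))\<^sup>2 = (norm x)\<^sup>2 + 2 * Re (cdot x (cnjv y)) + (norm y)\<^sup>2"
    and norm_diff_square: "(norm (x - y))\<^sup>2 = (norm x)\<^sup>2 - 2 * Re (cdot x (cnjv y)) + (norm y)\<^sup>2"
proof -
  have n: "(norm z)\<^sup>2 = (\<Sum>i\<in>UNIV. (Re (z $ i))\<^sup>2 + (Im (z $ i))\<^sup>2)" for z :: "complex^'n"
    by (simp add: norm_vec_def L2_set_def sum_nonneg cmod_power2)
  show "(norm (x + y))\<^sup>2 = (norm x)\<^sup>2 + 2 * Re (cdot x (cnjv y)) + (norm y)\<^sup>2"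
    unfolding n by (simp add: cdot_def cnjv_def sum.distrib[symmetric] sum_distrib_left power2_eq_square algebra_simps)
  show "(norm (x - y))\<^sup>2 = (norm x)\<^sup>2 - 2 * Re (cdot x (cnjv y)) + (norm y)\<^sup>2"
    unfolding n by (simp add: cdot_def cnjv_def sum.distrib[symmetric] sum_subtractf[symmetric] sum_distrib_left power2_eq_square algebra_simps)
qed

lemma cdot_eq_square_imp_eq:
  assumes "cdot x (cnjv y) = complex_of_real ((norm y)\<^sup>2)" "norm x \<le> norm y"
  shows "x = y"
proof -
  have "(norm (x - y))\<^sup>2 = (norm x)\<^sup>2 - (norm y)\<^sup>2" using norm_diff_square[of x y] assms(1) by simp
  also have "\<dots> \<le> 0" using assms(2) by (simp add: power_mono)
  finally show ?thesis by simp
qed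

lemma positive_real_pairD:
  assumes "positive_real_pair P Q"
  shows "Re s > 0 \<Longrightarrow> 0 \<le> Re (cdot (w v* peval P s) (cnjv (w v* peval Q s)))"
    and "Re s \<ge> 0 \<Longrightarrow> w v* peval P s = 0 \<Longrightarrow> w v* peval Q s = 0 \<Longrightarrow> w = 0"
    and "p v* (P ** pstar Q + Q ** pstar P) = 0 \<Longrightarrow> pveval p s v* peval P s = 0 \<Longrightarrow> pveval p s v* peval Q s = 0
      \<Longrightarrow> pveval p s = 0"
proof -
  note d = assms[unfolded positive_real_pair_def hpsd_iff rank_full_iff PmQ_kernel]
  show "Re s > 0 \<Longrightarrow> 0 \<le> Re (cdot (w v* peval P s) (cnjv (w v* peval Q s)))" using d by blast
  show "Re s \<ge> 0 \<Longrightarrow> w v* peval P s = 0 \<Longrightarrow> w v* peval Q s = 0 \<Longrightarrow> w = 0" using d by blast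
  show "p v* (P ** pstar Q + Q ** pstar P) = 0 \<Longrightarrow> pveval p s v* peval P s = 0 \<Longrightarrow> pveval p s v* peval Q s = 0
      \<Longrightarrow> pveval p s = 0" using d by blast
qed

lemma det_eq_0_left_kernel:
  fixes M :: "'a::field^'n^'n"
  assumes "det M = 0" shows "\<exists>w. w \<noteq> 0 \<and> w v* M = 0"
proof (rule ccontr)
  assume "\<not> ?thesis"
  hence "\<forall>w. transpose M *v w = 0 \<longrightarrow> w = 0"
    by (auto simp: matrix_vector_mult_def vector_matrix_mult_def transpose_def mult.commute)
  hence "\<exists>B. B ** transpose M = mat 1" unfolding matrix_left_invertible_ker .
  hence "invertible (transpose M)" unfolding invertible_left_inverse .
  thus False using assms by (simp add: invertible_det_nz)
qed

text \<open>Maximum principle for the Cayley transform of the transfer function: a zero of \<open>det Q\<close> in the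
  open right half-plane would propagate to all of it.\<close>
lemma positive_real_det_nonzero:
  fixes A :: "real^'d^'d" and P Q :: "real poly^'n^'n"
  assumes re: "realizes A B C D P Q R" and pr: "positive_real_pair P Q" and s: "Re s > 0"
  shows "poly (cp (det Q)) s \<noteq> 0"
proof
  assume "poly (cp (det Q)) s = 0"
  hence "det (peval Q s) = 0" by (simp add: det_pm pm_cpm[symmetric] det_cpm)
  then obtain w where w: "w \<noteq> 0" "w v* peval Q s = 0" using det_eq_0_left_kernel by blast
  \<comment> \<open>\<open>P + Q\<close> is invertible throughout the open half-plane, in contrast
    to \<open>Q\<close>: on a kernel row \<open>w P = - w Q\<close>, and (a) then gives
    \<open>w Q = 0\<close>, so that (b) applies.\<close>
  define H where "H = cpm P + cpm Q"
  define K where "K = transpose (adjm (transpose H))"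
  have KH: "K ** H = mat (det H)" unfolding K_def by (rule adjm_mult)
  have pmH: "x v* pm H z = x v* peval P z + x v* peval Q z" for x z
    by (simp add: H_def pm_def peval_eq vec_eq_iff vector_matrix_mult_def sum.distrib algebra_simps)
  have ker: "x = 0" if "Re z > 0" "x v* pm H z = 0" for x z
  proof -
    have neg: "x v* peval P z = - (x v* peval Q z)" using that(2) pmH[of x z] by (simp add: eq_neg_iff_add_eq_0)
    have "cdot (- y) (cnjv y) = - complex_of_real ((norm y)\<^sup>2)" for y :: "complex^'n"
      using cdot_cnjv_self[of "cnjv y"] by (simp add: cnjv_simps norm_cnjv cdot_def sum_negf)
    hence "(norm (x v* peval Q z))\<^sup>2 \<le> 0"
      using positive_real_pairD(1)[OF pr that(1), of x] unfolding neg by simp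
    thus ?thesis using positive_real_pairD(2)[OF pr, of z x] that(1) neg by simp
  qed
  have dH: "poly (det H) z \<noteq> 0" if "Re z > 0" for z
    using det_eq_0_left_kernel[of "pm H z"] ker[OF that] by (auto simp: det_pm)
  define x0 where "x0 = w v* peval P s"
  have x0: "x0 \<noteq> 0" using positive_real_pairD(2)[OF pr, of s w] s w x0_def by auto
  define y where "y z = (1 / poly (det H) z) *s (x0 v* pm K z)" for z
  have yH: "y z v* pm H z = x0" if "Re z > 0" for z
    unfolding y_def vmm_scale vmm_assoc pm_mult[symmetric] KH pm_mat vmm_mat
    using dH[OF that] by (simp add: vec_eq_iff)
  \<comment> \<open>By (a), \<open>norm (y (P - Q)) \<le> norm (y (P + Q)) = norm x0\<close>, so
    \<open>f\<close> is bounded by the square of \<open>norm x0\<close>; the bound is attained at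
    \<open>s\<close>, where \<open>y = w\<close> and \<open>w Q = 0\<close>.\<close>
  define f where "f z = cdot (y z v* peval P z - y z v* peval Q z) (cnjv x0)" for z
  have le: "norm (y z v* peval P z - y z v* peval Q z) \<le> norm x0" if "Re z > 0" for z
  proof (rule power2_le_imp_le)
    show "(norm (y z v* peval P z - y z v* peval Q z))\<^sup>2 \<le> (norm x0)\<^sup>2"
      unfolding norm_diff_square yH[OF that, symmetric] pmH norm_add_square
      using positive_real_pairD(1)[OF pr that, of "y z"] by simp
  qed simp
  have fle: "norm (f z) \<le> (norm x0)\<^sup>2" if "Re z > 0" for z
  proof -
    have "norm (f z) \<le> norm (y z v* peval P z - y z v* peval Q z) * norm x0"
      unfolding f_def using norm_cdot_le[of "y z v* peval P z - y z v* peval Q z" "cnjv x0"] by (simp only: norm_cnjv)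
    also have "\<dots> \<le> norm x0 * norm x0" by (rule mult_right_mono[OF le[OF that]]) simp
    finally show ?thesis by (simp add: power2_eq_square)
  qed
  have fs: "f s = complex_of_real ((norm x0)\<^sup>2)"
  proof -
    have "w v* pm H s = x0" using w(2) by (simp add: pmH x0_def)
    hence "(y s - w) v* pm H s = 0" using yH[OF s] by (simp add: vec_eq_iff vector_matrix_mult_def algebra_simps sum_subtractf)
    hence "y s = w" using ker[OF s] by fastforce
    thus ?thesis using cdot_cnjv_self[of "cnjv x0"] w(2) by (simp add: f_def x0_def[symmetric] cnjv_simps norm_cnjv)
  qed
  have "f constant_on {z. Re z > 0}"
  proof (rule maximum_modulus_principle[of f _ "{z. Re z > 0}" s])
    show "f holomorphic_on {z. Re z > 0}"
      unfolding f_def y_def cdot_def vector_matrix_mult_def cnjv_def peval_eq pm_def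
      using dH by (auto intro!: holomorphic_intros)
    show "open {z. Re z > 0}" by (simp add: open_halfspace_Re_gt)
    show "connected {z. Re z > 0}" by (simp add: convex_halfspace_Re_gt convex_connected)
    show "norm (f z) \<le> norm (f s)" if "z \<in> {z. Re z > 0}" for z
      using fle[of z] that unfolding fs by (simp add: norm_power)
  qed (use s in \<open>simp_all add: open_halfspace_Re_gt\<close>)
  hence fc: "f z = complex_of_real ((norm x0)\<^sup>2)" if "Re z > 0" for z
    using fs s that by (auto simp: constant_on_def)
  \<comment> \<open>Equality in Cauchy-Schwarz turns constancy of \<open>f\<close> into
    \<open>y (P - Q) = y (P + Q)\<close>.\<close>
  have yQ: "y z v* peval Q z = 0" if "Re z > 0" for z
  proof -
    have "y z v* peval P z - y z v* peval Q z = x0"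
      by (rule cdot_eq_square_imp_eq) (use fc[OF that] le[OF that] in \<open>simp_all add: f_def\<close>)
    hence "y z v* peval P z - y z v* peval Q z = y z v* peval P z + y z v* peval Q z"
      unfolding yH[OF that, symmetric] pmH .
    hence "2 *s (y z v* peval Q z) = 0" by (simp add: vec_eq_iff)
    thus ?thesis by (simp add: vec_eq_iff)
  qed
  let ?F = "{z. poly (cp (det (xi_minus A))) z = 0}"
  have "finite ?F" by (rule poly_roots_finite) (simp add: cp_0_iff det_xi_minus_nonzero)
  moreover have "infinite {z. Re z > 0}"
  proof
    assume "finite {z. Re z > 0}"
    hence "{z. Re z > 0} = {}" by (rule finite_imp_not_open) (rule open_halfspace_Re_gt)
    moreover have "1 \<in> {z. Re z > 0}" by simp
    ultimately show False by blast
  qed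
  ultimately have "\<not> {z. Re z > 0} \<subseteq> ?F" using finite_subset by blast
  \<comment> \<open>At a point off the spectrum of \<open>A\<close>, \<open>y Q = 0\<close> forces
    \<open>y R = 0\<close> and then \<open>y P = 0\<close>, against
    \<open>y (P + Q) = x0 \<noteq> 0\<close>.\<close>
  then obtain z where z: "Re z > 0" "poly (cp (det (xi_minus A))) z \<noteq> 0" by auto
  obtain N where N: "(mat z - cmat A) ** N = mat 1" using resolvent_exists[OF z(2)] by blast
  have "y z v* peval R z v* (mat z - cmat A) = 0"
    using realizes_peval(1)[OF re, of "y z" z] yQ[OF z(1)] by simp
  hence "y z v* peval R z v* mat 1 = 0" by (metis N vmm_assoc vector_matrix_mult_0)
  hence "y z v* peval R z = 0" by (simp add: vmm_mat)
  hence "y z v* peval P z = 0" using realizes_peval(2)[OF re, of "y z" z] yQ[OF z(1)] by simp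
  thus False using yH[OF z(1)] yQ[OF z(1)] x0 by (simp add: pmH)
qed

section \<open>Polynomials and power series in the Cayley variable\<close>

definition mob :: "real \<Rightarrow> nat \<Rightarrow> complex poly \<Rightarrow> complex poly" where
  "mob a m p = (\<Sum>k\<le>m. smult (coeff p k * of_real a ^ k) ([:1, -1:] ^ k * [:1, 1:] ^ (m - k)))"

lemma poly_mob:
  assumes "degree p \<le> m" "z \<noteq> -1"
  shows "poly (mob a m p) z = (1 + z) ^ m * poly p (of_real a * (1 - z) / (1 + z))"
proof -
  have z: "1 + z \<noteq> 0" using assms(2) by (metis add.inverse_unique)
  have "poly p (of_real a * (1 - z) / (1 + z)) = (\<Sum>k\<le>m. coeff p k * (of_real a * (1 - z) / (1 + z)) ^ k)"
    unfolding poly_altdef by (rule sum.mono_neutral_left) (use assms(1) in \<open>auto simp: coeff_eq_0\<close>)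
  hence "(1 + z) ^ m * poly p (of_real a * (1 - z) / (1 + z))
      = (\<Sum>k\<le>m. (1 + z) ^ m * (coeff p k * (of_real a * (1 - z) / (1 + z)) ^ k))"
    by (simp add: sum_distrib_left)
  also have "\<dots> = (\<Sum>k\<le>m. coeff p k * of_real a ^ k * ((1 - z) ^ k * (1 + z) ^ (m - k)))"
  proof (rule sum.cong[OF refl])
    fix k assume "k \<in> {..m}"
    hence "(1 + z) ^ m = (1 + z) ^ (m - k) * (1 + z) ^ k" by (simp add: power_add[symmetric])
    thus "(1 + z) ^ m * (coeff p k * (of_real a * (1 - z) / (1 + z)) ^ k)
        = coeff p k * of_real a ^ k * ((1 - z) ^ k * (1 + z) ^ (m - k))"
      using z by (simp add: power_divide power_mult_distrib)
  qed
  finally show ?thesis by (simp add: mob_def poly_sum add.commute)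
qed

text \<open>The Cayley map \<open>a (1 - z) / (1 + z)\<close> expanded at \<open>z = 0\<close>.
  Input-output identities are stated formally in \<open>z\<close> because output sequences are
  infinite; values are taken inside the disc or after denominators are cleared.\<close>

definition sF :: "real \<Rightarrow> complex fps" where
  "sF a = fps_const (of_real a) * (1 - fps_X) * inverse (1 + fps_X)"

definition ph :: "real \<Rightarrow> complex poly \<Rightarrow> complex fps" where
  "ph a p = poly (map_poly fps_const p) (sF a)"

lemma map_fps_const_add: "map_poly fps_const (p + q) = map_poly fps_const p + map_poly fps_const (q :: complex poly)"
  by (simp add: poly_eq_iff coeff_map_poly)

lemma map_fps_const_mult: "map_poly fps_const (p * q) = map_poly fps_const p * map_poly fps_const (q :: complex poly)"
proof -
  have s: "fps_const (sum f S) = (\<Sum>x\<in>S. fps_const (f x))" for f :: "nat \<Rightarrow> complex" and S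
    by (induction S rule: infinite_finite_induct) (auto simp: fps_const_add[symmetric] simp del: fps_const_add)
  show ?thesis by (simp add: poly_eq_iff coeff_map_poly coeff_mult s)
qed

lemma ph_add: "ph a (p + q) = ph a p + ph a q"
  and ph_mult: "ph a (p * q) = ph a p * ph a q"
  by (simp_all add: ph_def map_fps_const_add map_fps_const_mult)

lemma ph_pCons: "ph a (pCons c p) = fps_const c + sF a * ph a p"
  by (simp add: ph_def map_poly_pCons)

lemma ph_0: "ph a 0 = 0" and ph_const: "ph a [:c:] = fps_const c"
  and ph_X: "ph a [:0, 1:] = sF a" and ph_1: "ph a 1 = 1"
  by (simp_all add: ph_def map_poly_pCons one_pCons)

lemma ph_sum: "ph a (sum f S) = (\<Sum>x\<in>S. ph a (f x))"
  by (induction S rule: infinite_finite_induct) (auto simp: ph_add ph_0)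

lemma ph_minus: "ph a (- p) = - ph a p"
  using ph_add[of a "-p" p] by (simp add: ph_0 eq_neg_iff_add_eq_0)

lemma one_plus_X: "(1 + fps_X) * inverse (1 + fps_X :: complex fps) = 1"
  by (subst mult.commute, rule inverse_mult_eq_1) simp

lemma sF_mult: "(1 + fps_X) * sF a = fps_const (of_real a) * (1 - fps_X)"
proof -
  have "(1 + fps_X) * sF a = fps_const (of_real a) * (1 - fps_X) * ((1 + fps_X) * inverse (1 + fps_X))"
    unfolding sF_def by (simp only: mult_ac)
  thus ?thesis unfolding one_plus_X by simp
qed

text \<open>Formal counterpart of \<open>poly_mob\<close>: the power \<open>(1 + z)^m\<close> clears
  the denominator of the Cayley map. Both versions are needed to pass between sequences and
  values.\<close>

lemma fps_of_mob:
  assumes "degree p \<le> m"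
  shows "fps_of_poly (mob a m p) = (1 + fps_X) ^ m * ph a p"
proof -
  have "ph a p = (\<Sum>k\<le>m. fps_const (coeff p k) * sF a ^ k)"
  proof -
    have d: "degree (map_poly fps_const p) = degree p" by (rule degree_map_poly) simp
    have "ph a p = (\<Sum>k\<le>degree p. fps_const (coeff p k) * sF a ^ k)"
      unfolding ph_def poly_altdef d by (simp add: coeff_map_poly)
    also have "\<dots> = (\<Sum>k\<le>m. fps_const (coeff p k) * sF a ^ k)"
      by (rule sum.mono_neutral_left) (use assms in \<open>auto simp: coeff_eq_0\<close>)
    finally show ?thesis .
  qed
  hence "(1 + fps_X) ^ m * ph a p = (\<Sum>k\<le>m. (1 + fps_X) ^ m * (fps_const (coeff p k) * sF a ^ k))"
    by (simp add: sum_distrib_left)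
  also have "\<dots> = (\<Sum>k\<le>m. fps_const (coeff p k * of_real a ^ k) * ((1 - fps_X) ^ k * (1 + fps_X) ^ (m - k)))"
  proof (rule sum.cong[OF refl])
    fix k assume "k \<in> {..m}"
    hence "(1 + fps_X :: complex fps) ^ m = (1 + fps_X) ^ (m - k) * (1 + fps_X) ^ k" by (simp add: power_add[symmetric])
    hence "(1 + fps_X) ^ m * (fps_const (coeff p k) * sF a ^ k)
        = (1 + fps_X) ^ (m - k) * fps_const (coeff p k) * ((1 + fps_X) * sF a) ^ k"
      by (simp add: power_mult_distrib mult_ac)
    thus "(1 + fps_X) ^ m * (fps_const (coeff p k) * sF a ^ k)
        = fps_const (coeff p k * of_real a ^ k) * ((1 - fps_X) ^ k * (1 + fps_X) ^ (m - k))"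
      unfolding sF_mult by (simp add: power_mult_distrib fps_const_power mult_ac fps_const_mult[symmetric] del: fps_const_mult)
  qed
  finally show ?thesis
    by (simp add: mob_def fps_of_poly_sum fps_of_poly_smult fps_of_poly_mult fps_of_poly_power fps_of_poly_pCons
        fps_const_neg[symmetric] del: fps_const_neg)
qed

lemma poly_has_fps_expansion: "(\<lambda>z. poly p z) has_fps_expansion fps_of_poly p" for p :: "complex poly"
proof (induction p)
  case (pCons c p)
  have "(\<lambda>z. c + z * poly p z) has_fps_expansion fps_const c + fps_X * fps_of_poly p"
    by (intro fps_expansion_intros pCons)
  thus ?case by (simp add: fps_of_poly_pCons mult.commute)
qed simp

lemma ph_has_fps_expansion: "(\<lambda>z. poly p (of_real a * (1 - z) / (1 + z))) has_fps_expansion ph a p"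
proof (induction p)
  case (pCons c p)
  have "(\<lambda>z. of_real a * (1 - z) * inverse (1 + z)) has_fps_expansion sF a"
    unfolding sF_def by (intro fps_expansion_intros) simp
  hence "(\<lambda>z. c + (of_real a * (1 - z) * inverse (1 + z)) * poly p (of_real a * (1 - z) / (1 + z))) has_fps_expansion fps_const c + sF a * ph a p"
    by (intro fps_expansion_intros pCons)
  thus ?case by (simp add: ph_pCons divide_inverse)
qed (simp add: ph_0)

definition phm :: "real \<Rightarrow> complex poly^'b^'c \<Rightarrow> complex fps^'b^'c" where
  "phm a M = (\<chi> i j. ph a (M $ i $ j))"

definition fm :: "complex^'b^'c \<Rightarrow> complex fps^'b^'c" where
  "fm M = (\<chi> i j. fps_const (M $ i $ j))"

definition fv :: "(nat \<Rightarrow> complex^'b) \<Rightarrow> complex fps^'b" where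
  "fv h = (\<chi> i. Abs_fps (\<lambda>k. h k $ i))"

lemma phm_mult: "phm a (M ** N) = phm a M ** phm a N"
  by (simp add: phm_def matrix_matrix_mult_def vec_eq_iff ph_sum ph_mult)

lemma phm_add: "phm a (M + N) = phm a M + phm a N"
  by (simp add: phm_def vec_eq_iff ph_add)

lemma phm_const: "phm a (const_pmat M) = fm M"
  by (simp add: phm_def const_pmat_def fm_def vec_eq_iff ph_const)

lemma phm_xi_minus: "phm a (xi_minus M) = mat (sF a) - fm M"
  using ph_add[of a "[:0, 1:]" "- [:_:]"]
  by (simp only: phm_def xi_minus_def fm_def mat_def vec_eq_iff)
     (auto simp: ph_minus ph_const ph_X diff_conv_add_uminus ph_add ph_0 simp del: add_uminus_conv_diff)

lemma phm_mat: "phm a (mat p) = mat (ph a p)"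
  by (auto simp: phm_def mat_def vec_eq_iff ph_0)

lemma fv_add: "fv (\<lambda>k. g k + h k) = fv g + fv h"
  by (simp add: fv_def vec_eq_iff fps_eq_iff)

lemma fv_scale: "fv (\<lambda>k. c *s h k) = fps_const c *s fv h"
  by (simp add: fv_def vec_eq_iff fps_eq_iff)

lemma fv_mult: "fv (\<lambda>k. M *v h k) = fm M *v fv h"
  by (simp add: fv_def fm_def matrix_vector_mult_def vec_eq_iff fps_eq_iff fps_sum_nth)

lemma fv_Suc: "h 0 = 0 \<Longrightarrow> fv h = fps_X *s fv (\<lambda>k. h (Suc k))"
  by (auto simp: fv_def vec_eq_iff fps_eq_iff)

lemma fv_cf: "fv (cf U) $ i = fps_of_poly (U $ i)"
  by (simp add: fv_def cf_def fps_eq_iff)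

lemma fv_eq_iff: "fv g = fv h \<longleftrightarrow> g = h"
  by (auto simp: fv_def vec_eq_iff fps_eq_iff fun_eq_iff)

lemma fps_vec_cancel: "c \<noteq> 0 \<Longrightarrow> c *s x = c *s y \<Longrightarrow> x = y" for c :: "'a::idom"
  by (simp add: vec_eq_iff)

lemma half_components: "half U h = (\<Sum>i\<in>UNIV. \<Sum>k\<le>degree (U $ i). cnj (coeff (U $ i) k) * h k $ i)"
proof -
  obtain N where N: "\<forall>k\<ge>N. cf U k = 0" using cf_bound by blast
  have z: "coeff (U $ i) k = 0" if "k \<ge> N" for i k using N that by (simp add: cf_def vec_eq_iff)
  have "half U h = (\<Sum>k<N. \<Sum>i\<in>UNIV. cnj (coeff (U $ i) k) * h k $ i)"
    by (subst half_eq[of N]) (use N in \<open>simp_all add: cdot_def cnjv_def cf_def\<close>)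
  also have "\<dots> = (\<Sum>i\<in>UNIV. \<Sum>k<N. cnj (coeff (U $ i) k) * h k $ i)" by (rule sum.swap)
  also have "\<dots> = (\<Sum>i\<in>UNIV. \<Sum>k\<le>degree (U $ i). cnj (coeff (U $ i) k) * h k $ i)"
  proof (rule sum.cong[OF refl])
    fix i
    have "(\<Sum>k<N. cnj (coeff (U $ i) k) * h k $ i) = (\<Sum>k\<in>{..degree (U $ i)} \<union> {..<N}. cnj (coeff (U $ i) k) * h k $ i)"
      by (rule sum.mono_neutral_left) (auto simp: z not_less)
    also have "\<dots> = (\<Sum>k\<le>degree (U $ i). cnj (coeff (U $ i) k) * h k $ i)"
      by (rule sum.mono_neutral_right) (auto simp: coeff_eq_0)
    finally show "(\<Sum>k<N. cnj (coeff (U $ i) k) * h k $ i) = (\<Sum>k\<le>degree (U $ i). cnj (coeff (U $ i) k) * h k $ i)" .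
  qed
  finally show ?thesis .
qed

text \<open>Parseval. Polynomials are holomorphic across the unit circle, so radius 1 is admissible
  in \<open>circle_mean\<close>.\<close>

lemma hS_mean:
  "((\<lambda>t. cdot (cnjv (pv U (circlepath 0 1 t))) (pv W (circlepath 0 1 t))) has_integral hS U W) {0..1}"
proof -
  have "((\<lambda>t. cnj (poly (U $ i) (circlepath 0 1 t)) * poly (W $ i) (circlepath 0 1 t)) has_integral
     (\<Sum>k\<le>degree (U $ i). cnj (coeff (U $ i) k) * cf W k $ i)) {0..1}" for i
  proof -
    have "(deriv ^^ k) (poly (W $ i)) 0 / fact k = cf W k $ i" for k
      using fps_nth_fps_expansion[OF poly_has_fps_expansion, of "W $ i" k] by (simp add: cf_def)
    thus ?thesis using circle_mean[of "poly (W $ i)" 2 1 "U $ i"]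
      by (simp add: holomorphic_intros)
  qed
  hence "((\<lambda>t. \<Sum>i\<in>UNIV. cnj (poly (U $ i) (circlepath 0 1 t)) * poly (W $ i) (circlepath 0 1 t)) has_integral hS U W) {0..1}"
    unfolding hS_def half_components by (intro has_integral_sum) auto
  thus ?thesis by (simp add: cdot_def cnjv_def pv_def)
qed

lemma cmat_mat: "cmat (mat c) = mat (of_real c)"
  by (auto simp: cmat_def mat_def vec_eq_iff)

lemma Re_of_real_mult: "Re (complex_of_real r * z) = r * Re z"
  by simp

lemma Re_cayley:
  assumes "cmod z < 1" "a > 0"
  shows "Re (of_real a * (1 - z) / (1 + z)) > 0"
proof -
  have "1 + z \<noteq> 0" using assms(1) by (metis add.inverse_unique less_irrefl norm_minus_cancel norm_one)
  hence p: "cmod (1 + z) > 0" by simp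
  have "Re ((1 - z) / (1 + z)) = (1 - (cmod z)\<^sup>2) / (cmod (1 + z))\<^sup>2"
    unfolding cmod_power2 by (simp add: Re_divide power2_eq_square algebra_simps)
  moreover have "(cmod z)\<^sup>2 < 1" using assms(1) by (simp add: power_less_one_iff abs_square_less_1)
  ultimately have "Re ((1 - z) / (1 + z)) > 0" using p by simp
  moreover have "of_real a * (1 - z) / (1 + z) = of_real a * ((1 - z) / (1 + z))" by simp
  ultimately show ?thesis using assms(2) by (simp only: Re_of_real_mult zero_less_mult_iff) simp
qed

text \<open>The number \<open>a\<close> is real so that real states stay real, positive so that the
  unit disc corresponds to the right half-plane, and outside the spectrum of \<open>A\<close> so
  that \<open>N\<close>, the inverse of \<open>a I - A\<close>, exists.\<close>

locale cayley =
  fixes A :: "real^'d^'d" and B :: "real^'n^'d" and C :: "real^'d^'n" and D :: "real^'n^'n"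
    and P Q :: "real poly^'n^'n" and R :: "real poly^'d^'n" and a :: real and N :: "real^'d^'d"
  assumes re: "realizes A B C D P Q R" and pr: "positive_real_pair P Q" and a: "a > 0"
    and N: "(mat a - A) ** N = mat 1"
begin

abbreviation "al \<equiv> complex_of_real a"

definition sig :: "complex \<Rightarrow> complex" where "sig z = al * (1 - z) / (1 + z)"

text \<open>Implicit midpoint rule with step length \<open>2 / a\<close>: \<open>mid\<close> is the
  mean of the old state \<open>x\<close> and the new state \<open>2 mid - x\<close>, and
  \<open>a (mid - x) = A mid + B u\<close>. Outputs are taken at the midpoint too, so a step
  involves the same dissipation expression as the continuous system.\<close>

definition mid :: "complex^'d \<Rightarrow> complex^'n \<Rightarrow> complex^'d" where
  "mid x u = cmat N *v (al *s x + cmat B *v u)"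

lemma mid_eq: "al *s mid x u = cmat A *v mid x u + (al *s x + cmat B *v u)"
proof -
  have "cmat ((mat a - A) ** N) = mat 1" unfolding N cmat_mat by simp
  hence "(mat al - cmat A) ** cmat N = mat 1" by (simp add: cmat_simps cmat_mat)
  hence "(mat al - cmat A) *v mid x u = al *s x + cmat B *v u"
    by (simp add: mid_def matrix_vector_mul_assoc)
  thus ?thesis by (simp add: matrix_vector_mult_diff_rdistrib mat_mult_vec algebra_simps)
qed

lemma mid_add: "mid (x + y) (u + v) = mid x u + mid y v"
  and mid_scale: "mid (c *s x) (c *s u) = c *s mid x u"
  and mid_0: "mid 0 0 = 0"
  by (simp_all add: mid_def vec_eq_iff matrix_vector_mult_def algebra_simps sum.distrib sum_distrib_left)

primrec st :: "complex poly^'n \<Rightarrow> nat \<Rightarrow> complex^'d" where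
  "st U 0 = 0"
| "st U (Suc k) = 2 *s mid (st U k) (cf U k) - st U k"

definition out :: "complex poly^'n \<Rightarrow> nat \<Rightarrow> complex^'n" where
  "out U k = cmat C *v mid (st U k) (cf U k) + cmat D *v cf U k"

lemma st_add: "st (U + W) k = st U k + st W k"
proof (induction k)
  case (Suc k)
  thus ?case by (simp only: st.simps cf_add mid_add vsmult_add) (simp add: algebra_simps)
qed simp

lemma st_scale: "st ([:c:] *s U) k = c *s st U k"
  by (induction k) (simp_all only: st.simps cf_scale mid_scale, simp_all add: vec_eq_iff algebra_simps)

lemma out_add: "out (U + W) k = out U k + out W k"
  by (simp add: out_def st_add cf_add mid_add matrix_vector_right_distrib)

lemma out_scale: "out ([:c:] *s U) k = c *s out U k"
  by (simp only: out_def st_scale cf_scale mid_scale mat_vec_scale vsmult_add)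

lemma st_zz: "st (zz *s U) (Suc k) = st U k"
proof (induction k)
  case 0
  show ?case by (simp only: st.simps cf_zz_0 mid_0) simp
next
  case (Suc k)
  thus ?case by (simp only: st.simps(2)[of "zz *s U" "Suc k"] cf_zz_Suc st.simps(2)[of U k])
qed

lemma out_zz_Suc: "out (zz *s U) (Suc k) = out U k"
  by (simp only: out_def st_zz cf_zz_Suc)

text \<open>In generating functions the recursion, multiplied by \<open>1 + z\<close>, is the
  resolvent equation at \<open>s = a (1 - z) / (1 + z)\<close>: the midpoints are the state of the
  original system at the transformed frequency.\<close>

lemma fv_mid: "sF a *s fv (\<lambda>k. mid (st U k) (cf U k))
    = fm (cmat A) *v fv (\<lambda>k. mid (st U k) (cf U k)) + fm (cmat B) *v fv (cf U)"
proof -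
  let ?M = "fv (\<lambda>k. mid (st U k) (cf U k))" and ?X = "fv (st U)"
  have 1: "fps_const al *s ?M = fm (cmat A) *v ?M + (fps_const al *s ?X + fm (cmat B) *v fv (cf U))"
    unfolding fv_scale[symmetric] fv_mult[symmetric] fv_add[symmetric] mid_eq ..
  have "(\<lambda>k. st U (Suc k) + st U k) = (\<lambda>k. 2 *s mid (st U k) (cf U k))" by simp
  hence "fv (\<lambda>k. st U (Suc k)) + ?X = fps_const 2 *s ?M" by (simp only: fv_add[symmetric] fv_scale[symmetric])
  moreover have "?X = fps_X *s fv (\<lambda>k. st U (Suc k))" by (rule fv_Suc) simp
  ultimately have 2: "?X + fps_X *s ?X = fps_X *s (fps_const 2 *s ?M)" by (metis vsmult_add)
  have "(1 + fps_X) *s (sF a *s ?M) = (1 + fps_X) *s (fm (cmat A) *v ?M + fm (cmat B) *v fv (cf U))"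
  proof -
    have "(1 + fps_X) * (sF a * ?M $ i) = (1 + fps_X) * (fm (cmat A) *v ?M + fm (cmat B) *v fv (cf U)) $ i" for i
    proof -
      have e1: "fm (cmat A) *v ?M + fm (cmat B) *v fv (cf U) = fps_const al *s ?M - fps_const al *s ?X"
        unfolding 1 by simp
      have e2: "?X $ i + fps_X * ?X $ i = fps_X * (2 * ?M $ i)"
        using arg_cong[OF 2, of "\<lambda>v. v $ i"] by (simp add: numeral_fps_const)
      have "(1 + fps_X) * (sF a * ?M $ i) = fps_const al * (1 - fps_X) * ?M $ i"
        using sF_mult[of a] by (simp add: mult.assoc[symmetric])
      also have "\<dots> = (1 + fps_X) * (fps_const al * ?M $ i - fps_const al * ?X $ i)"
        using e2 by algebra
      finally show ?thesis unfolding e1 by simp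
    qed
    thus ?thesis by (simp only: vec_eq_iff vector_smult_component) blast
  qed
  thus ?thesis by (rule fps_vec_cancel[rotated]) (simp add: fps_eq_iff exI[of _ 0])
qed

lemma series_identity: "phm a (cpm Q) *v fv (out U) = phm a (cpm P) *v fv (cf U)"
proof -
  let ?M = "fv (\<lambda>k. mid (st U k) (cf U k))"
  have QC: "phm a (cpm Q) ** fm (cmat C) = phm a (cpm R) ** (mat (sF a) - fm (cmat A))"
    using re unfolding realizes_def
    by (metis cpm_mult cpm_const cpm_xi_minus phm_mult phm_const phm_xi_minus)
  have "P = Q ** const_pmat D + R ** const_pmat B" using re by (simp add: realizes_def)
  hence Pd: "phm a (cpm P) = phm a (cpm Q) ** fm (cmat D) + phm a (cpm R) ** fm (cmat B)"
    by (simp add: cpm_mult cpm_add cpm_const phm_mult phm_add phm_const)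
  have "(mat (sF a) - fm (cmat A)) *v ?M = fm (cmat B) *v fv (cf U)"
    using fv_mid[of U] by (simp add: matrix_vector_mult_diff_rdistrib mat_mult_vec)
  hence "(phm a (cpm Q) ** fm (cmat C)) *v ?M = (phm a (cpm R) ** fm (cmat B)) *v fv (cf U)"
    unfolding QC matrix_vector_mul_assoc[symmetric] by simp
  moreover have "fv (out U) = fm (cmat C) *v ?M + fm (cmat D) *v fv (cf U)"
    unfolding fv_mult[symmetric] fv_add[symmetric] by (simp add: out_def[abs_def])
  ultimately show ?thesis unfolding Pd
    by (simp add: matrix_vector_right_distrib matrix_vector_mult_add_rdistrib matrix_vector_mul_assoc add.commute)
qed

definition del :: "complex poly" where "del = det (cpm Q)"

definition adj :: "complex poly^'n^'n" where "adj = transpose (adjm (transpose (cpm Q)))"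

text \<open>\<open>del\<close> times the transfer matrix \<open>Q^{-1} P\<close>, written as a
  polynomial matrix.\<close>

definition KP :: "complex poly^'n^'n" where "KP = adj ** cpm P"

lemma adj_mult: "adj ** cpm Q = mat del"
  unfolding adj_def del_def by (rule adjm_mult)

lemma series_identity_scalar: "ph a del *s fv (out U) = phm a KP *v fv (cf U)"
proof -
  have "phm a adj *v (phm a (cpm Q) *v fv (out U)) = phm a adj *v (phm a (cpm P) *v fv (cf U))"
    by (simp add: series_identity)
  thus ?thesis
    unfolding matrix_vector_mul_assoc phm_mult[symmetric] adj_mult KP_def phm_mat mat_mult_vec .
qed

lemma del_nonzero: "Re s > 0 \<Longrightarrow> poly del s \<noteq> 0"
  using positive_real_det_nonzero[OF re pr] by (simp add: del_def det_cpm)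

lemma ph_del_nth_0: "fps_nth (ph a del) 0 \<noteq> 0"
proof -
  have "poly del al \<noteq> 0" by (rule del_nonzero) (simp add: a)
  moreover have "fps_nth (ph a del) 0 = poly del al"
    using fps_nth_fps_expansion[OF ph_has_fps_expansion[where p = del and a = a], of 0] by simp
  ultimately show ?thesis by simp
qed

text \<open>Condition (a) for the row \<open>v\<^sup>* adj Q\<close>.\<close>
lemma adj_positive: "Re s > 0 \<Longrightarrow> 0 \<le> Re (cnj (poly del s) * cdot (cnjv v) (pm KP s *v v))"
proof -
  assume s: "Re s > 0"
  let ?w = "cnjv v v* pm adj s"
  have "?w v* peval Q s = poly del s *s cnjv v"
    by (simp only: vmm_assoc pm_cpm[symmetric] pm_mult[symmetric] adj_mult pm_mat vmm_mat)
  hence "cnjv (?w v* peval Q s) = cnj (poly del s) *s v" by (simp add: cnjv_simps)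
  moreover have "?w v* peval P s = cnjv v v* pm KP s"
    by (simp only: vmm_assoc pm_cpm[symmetric] pm_mult[symmetric] KP_def)
  ultimately show ?thesis using positive_real_pairD(1)[OF pr s, of ?w]
    by (simp add: cdot_scale_right cdot_vmm)
qed

text \<open>In the open disc the transformed transfer function is holomorphic, since
  \<open>del\<close> has no zero in the open right half-plane, and the Taylor coefficients of its
  product with \<open>U\<close> are the outputs. The supply with weights \<open>r^{2k}\<close> is
  then a circle mean of nonnegative numbers by \<open>adj_positive\<close>.\<close>

lemma supply_nonneg: "0 \<le> Re (half U (out U))"
proof -
  define g where "g i z = (pm KP (sig z) *v pv U z) $ i / poly del (sig z)" for i z
  have sp: "Re (sig z) > 0" if "cmod z < 1" for z unfolding sig_def using Re_cayley[OF that a] .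
  have nz: "1 + z \<noteq> 0" if "cmod z < 1" for z
    using that by (metis add.inverse_unique less_irrefl norm_minus_cancel norm_one)
  have hol: "g i holomorphic_on ball 0 1" for i
  proof -
    have sh: "sig holomorphic_on ball 0 1" unfolding sig_def[abs_def] using nz by (auto intro!: holomorphic_intros)
    hence c: "(\<lambda>z. poly p (sig z)) holomorphic_on ball 0 1" for p
      using holomorphic_on_compose_gen[of sig "ball 0 1" "poly p" UNIV] by (simp add: o_def holomorphic_intros)
    show ?thesis unfolding g_def[abs_def] matrix_vector_mult_def pm_def pv_def
      using c sp del_nonzero sh by (auto intro!: holomorphic_intros)
  qed
  have coeffs: "(deriv ^^ k) (g i) 0 / fact k = out U k $ i" for k i
  proof -
    have e: "(\<lambda>z. (\<Sum>j\<in>UNIV. poly (KP $ i $ j) (sig z) * poly (U $ j) z) / poly del (sig z)) has_fps_expansion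
        (\<Sum>j\<in>UNIV. ph a (KP $ i $ j) * fps_of_poly (U $ j)) / ph a del"
      unfolding sig_def
      by (intro has_fps_expansion_divide' has_fps_expansion_sum has_fps_expansion_mult ph_has_fps_expansion
          poly_has_fps_expansion ph_del_nth_0)
    have "(\<Sum>j\<in>UNIV. ph a (KP $ i $ j) * fps_of_poly (U $ j)) = fv (out U) $ i * ph a del"
      using arg_cong[OF series_identity_scalar[of U], of "\<lambda>v. v $ i"]
      by (simp add: matrix_vector_mult_def phm_def fv_cf mult.commute)
    moreover have "ph a del \<noteq> 0" using ph_del_nth_0 by auto
    ultimately have "(\<Sum>j\<in>UNIV. ph a (KP $ i $ j) * fps_of_poly (U $ j)) / ph a del = fv (out U) $ i" by simp
    moreover have "g i = (\<lambda>z. (\<Sum>j\<in>UNIV. poly (KP $ i $ j) (sig z) * poly (U $ j) z) / poly del (sig z))"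
      by (simp add: g_def fun_eq_iff matrix_vector_mult_def pm_def pv_def)
    ultimately show ?thesis using fps_nth_fps_expansion[OF e, of k] by (simp add: fv_def)
  qed
  \<comment> \<open>A polynomial in \<open>r\<close>, so letting \<open>r\<close> tend to 1 asks for
    no information on the boundary circle.\<close>
  define f where "f r = (\<Sum>i\<in>UNIV. \<Sum>k\<le>degree (U $ i). cnj (coeff (U $ i) k) * complex_of_real (r ^ (2 * k)) * out U k $ i)" for r :: real
  have f1: "f 1 = half U (out U)" by (simp add: f_def half_components)
  have pos: "0 \<le> Re (f r)" if r: "0 < r" "r < 1" for r
  proof -
    let ?c = "circlepath 0 r"
    have "((\<lambda>t. \<Sum>i\<in>UNIV. cnj (poly (U $ i) (?c t)) * g i (?c t)) has_integral f r) {0..1}"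
      unfolding f_def using circle_mean[OF hol r] by (intro has_integral_sum) (auto simp: coeffs)
    hence "((\<lambda>t. Re (\<Sum>i\<in>UNIV. cnj (poly (U $ i) (?c t)) * g i (?c t))) has_integral Re (f r)) {0..1}"
      by (rule has_integral_Re)
    moreover have "0 \<le> Re (\<Sum>i\<in>UNIV. cnj (poly (U $ i) (?c t)) * g i (?c t))" for t
    proof -
      have "cmod (?c t) = r" using r by (simp add: circlepath norm_mult)
      hence s: "Re (sig (?c t)) > 0" using sp r by simp
      let ?d = "poly del (sig (?c t))" and ?v = "pv U (?c t)"
      have "(\<Sum>i\<in>UNIV. cnj (poly (U $ i) (?c t)) * g i (?c t)) = cdot (cnjv ?v) (pm KP (sig (?c t)) *v ?v) / ?d"
        by (simp add: g_def cdot_def cnjv_def sum_divide_distrib pv_def)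
      also have "\<dots> = (cnj ?d * cdot (cnjv ?v) (pm KP (sig (?c t)) *v ?v)) / complex_of_real ((cmod ?d)\<^sup>2)"
        using del_nonzero[OF s] by (simp add: complex_norm_square field_simps del: of_real_power)
      finally show ?thesis using adj_positive[OF s, of ?v] by (simp only: Re_divide_of_real) (rule divide_nonneg_nonneg, simp_all)
    qed
    ultimately show ?thesis by (rule has_integral_nonneg)
  qed
  have "continuous_on UNIV (\<lambda>r. Re (f r))" unfolding f_def by (intro continuous_intros)
  hence "((\<lambda>r. Re (f r)) \<longlongrightarrow> Re (f 1)) (at_left 1)"
    by (metis UNIV_I continuous_on_def tendsto_within_subset top_greatest)
  moreover have "eventually (\<lambda>r. 0 \<le> Re (f r)) (at_left 1)"
    using eventually_at_left_real[of 0 "1::real"] by (auto elim!: eventually_mono intro: pos)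
  ultimately have "0 \<le> Re (f 1)" by (rule tendsto_lowerbound) simp
  thus ?thesis unfolding f1 .
qed

text \<open>The Hermitian part of the supply. Its seminorm can vanish on nonzero inputs, namely
  lossless ones; these form a module over the polynomials.\<close>

definition hE :: "complex poly^'n \<Rightarrow> complex poly^'n \<Rightarrow> complex" where
  "hE U W = (half U (out W) + cnj (half W (out U))) / 2"

sublocale E: shift_form hE
proof
  fix U U' W :: "complex poly^'n" and c
  show "hE (U + U') W = hE U W + hE U' W"
    by (simp add: hE_def half_add_left out_add[abs_def] half_add_right field_simps)
  have "out ([:c:] *s U) = (\<lambda>k. c *s out U k)" by (rule ext) (rule out_scale)
  thus "hE ([:c:] *s U) W = cnj c * hE U W"
    by (simp only: hE_def half_scale_left half_scale_right complex_cnj_mult) (simp add: field_simps)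
  show "hE W U = cnj (hE U W)" by (simp add: hE_def add.commute)
  show "0 \<le> Re (hE U U)" using supply_nonneg[of U] by (simp add: hE_def)
  show "hE (zz *s U) (zz *s W) = hE U W" by (simp only: hE_def half_shift out_zz_Suc)
qed

lemma nrm_square_half: "(E.nrm U)\<^sup>2 = Re (half U (out U))"
  by (simp add: E.nrm_square hE_def)

definition mdeg :: nat where
  "mdeg = max (degree del) (Max (range (\<lambda>k. degree (KP $ fst k $ snd k))))"

definition q :: "complex poly" where "q = mob a mdeg del"

definition NP :: "complex poly^'n^'n" where "NP = (\<chi> i j. mob a mdeg (KP $ i $ j))"

lemma degree_le_mdeg: "degree del \<le> mdeg" "degree (KP $ i $ j) \<le> mdeg"
proof -
  have "degree (KP $ i $ j) \<le> Max (range (\<lambda>k. degree (KP $ fst k $ snd k)))"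
    by (rule Max_ge) (auto intro: image_eqI[of _ _ "(i, j)"])
  thus "degree (KP $ i $ j) \<le> mdeg" by (simp add: mdeg_def)
qed (simp add: mdeg_def)

lemma poly_q: "z \<noteq> -1 \<Longrightarrow> poly q z = (1 + z) ^ mdeg * poly del (sig z)"
  unfolding q_def sig_def by (rule poly_mob) (rule degree_le_mdeg)

lemma pm_NP: "z \<noteq> -1 \<Longrightarrow> pm NP z = (\<chi> i j. (1 + z) ^ mdeg * pm KP (sig z) $ i $ j)"
  unfolding NP_def sig_def pm_def by (simp add: vec_eq_iff poly_mob degree_le_mdeg)

text \<open>\<open>q\<close> is a denominator of the transformed transfer matrix and
  \<open>NP\<close> the matching numerator, so inputs divisible by \<open>q\<close> have finite
  outputs. On such inputs the supply is a mean over the unit circle itself.\<close>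

lemma out_q: "out (q *s U) = cf (NP *v U)"
proof -
  have "ph a del *s fv (out (q *s U)) = phm a KP *v fv (cf (q *s U))" by (rule series_identity_scalar)
  also have "fv (cf (q *s U)) = (fps_of_poly q) *s fv (cf U)" by (simp add: vec_eq_iff fv_cf fps_of_poly_mult)
  also have "phm a KP *v (fps_of_poly q *s fv (cf U)) = fps_of_poly q *s (phm a KP *v fv (cf U))" by (rule mat_vec_scale)
  also have "\<dots> = ph a del *s ((1 + fps_X) ^ mdeg *s (phm a KP *v fv (cf U)))"
    unfolding q_def fps_of_mob[OF degree_le_mdeg(1)] by (simp add: vector_smult_assoc mult.commute)
  also have "(1 + fps_X) ^ mdeg *s (phm a KP *v fv (cf U)) = fv (cf (NP *v U))"
    by (simp add: vec_eq_iff fv_cf matrix_vector_mult_def fps_of_poly_sum fps_of_poly_mult NP_def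
        fps_of_mob[OF degree_le_mdeg(2)] phm_def sum_distrib_left mult.assoc)
  finally have "fv (out (q *s U)) = fv (cf (NP *v U))"
    by (rule fps_vec_cancel[rotated]) (use ph_del_nth_0 in auto)
  thus ?thesis by (simp only: fv_eq_iff)
qed

definition psi :: "complex \<Rightarrow> complex^'n \<Rightarrow> complex^'n \<Rightarrow> complex" where
  "psi z v w = cnj (poly q z) * cdot (cnjv v) (pm NP z *v w) + cnj (cnj (poly q z) * cdot (cnjv w) (pm NP z *v v))"

text \<open>Inside the disc this is (a) up to the factor \<open>|1 + z|^{2 mdeg}\<close>. With
  denominators cleared the form is continuous, so nonnegativity extends to the boundary.\<close>

lemma psi_nonneg:
  assumes "cmod z \<le> 1"
  shows "0 \<le> Re (psi z v v)"
proof -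
  define f where "f z = Re (cnj (poly q z) * cdot (cnjv v) (pm NP z *v v))" for z
  have inner: "0 \<le> f z" if z: "cmod z < 1" for z
  proof -
    have z1: "z \<noteq> -1" using z by auto
    have s: "Re (sig z) > 0" unfolding sig_def using Re_cayley[OF z a] .
    have "(pm NP z *v v) = (1 + z) ^ mdeg *s (pm KP (sig z) *v v)"
      by (simp add: pm_NP[OF z1] vec_eq_iff matrix_vector_mult_def sum_distrib_left mult.assoc)
    hence "cnj (poly q z) * cdot (cnjv v) (pm NP z *v v)
        = ((1 + z) ^ mdeg * cnj ((1 + z) ^ mdeg)) * (cnj (poly del (sig z)) * cdot (cnjv v) (pm KP (sig z) *v v))"
      by (simp only: poly_q[OF z1] cdot_scale_right complex_cnj_mult) (simp only: mult_ac)
    also have "(1 + z) ^ mdeg * cnj ((1 + z) ^ mdeg) = complex_of_real ((cmod ((1 + z) ^ mdeg))\<^sup>2)"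
      by (rule complex_norm_square[symmetric, simplified of_real_power[symmetric]])
    finally show ?thesis unfolding f_def using adj_positive[OF s, of v]
      by (simp only: Re_of_real_mult) simp
  qed
  have "continuous_on UNIV f" unfolding f_def cdot_def pm_def matrix_vector_mult_def
    by (intro continuous_intros; simp)
  hence cl: "closed {z. 0 \<le> f z}" by (intro closed_Collect_le continuous_intros)
  have "ball 0 1 \<subseteq> {z. 0 \<le> f z}" using inner by auto
  hence "closure (ball 0 1) \<subseteq> {z. 0 \<le> f z}" using cl by (rule closure_minimal)
  hence "0 \<le> f z" using assms by (auto simp: closure_ball)
  thus ?thesis by (simp add: psi_def f_def)
qed

lemma nrm_q_mean: "((\<lambda>t. Re (psi (circlepath 0 1 t) (pv U (circlepath 0 1 t)) (pv U (circlepath 0 1 t)))) has_integral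
    2 * (E.nrm (q *s U))\<^sup>2) {0..1}"
proof -
  have "(E.nrm (q *s U))\<^sup>2 = Re (hS (q *s U) (NP *v U))"
    by (simp add: nrm_square_half out_q hS_def)
  moreover have "((\<lambda>t. 2 * Re (cdot (cnjv (pv (q *s U) (circlepath 0 1 t))) (pv (NP *v U) (circlepath 0 1 t)))) has_integral
      2 * Re (hS (q *s U) (NP *v U))) {0..1}"
    by (intro has_integral_mult_right has_integral_Re hS_mean)
  ultimately show ?thesis
    by (simp add: psi_def pv_scale pv_mult cnjv_simps cdot_scale_left)
qed

end

section \<open>The boundary form on the unit circle\<close>

definition reflected :: "nat \<Rightarrow> complex poly \<Rightarrow> complex poly" where
  "reflected m p = (\<Sum>k\<le>m. monom (cnj (coeff p k)) (m - k))"

lemma poly_reflected: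
  assumes "degree p \<le> m" "cmod z = 1"
  shows "poly (reflected m p) z = z ^ m * cnj (poly p z)"
proof -
  have zc: "z * cnj z = 1" using complex_norm_square[of z] assms(2) by simp
  have "poly p z = (\<Sum>k\<le>m. coeff p k * z ^ k)"
    unfolding poly_altdef by (rule sum.mono_neutral_left) (use assms(1) in \<open>auto simp: coeff_eq_0\<close>)
  hence "z ^ m * cnj (poly p z) = (\<Sum>k\<le>m. cnj (coeff p k) * (z ^ m * cnj z ^ k))"
    by (simp add: sum_distrib_left mult_ac)
  also have "\<dots> = (\<Sum>k\<le>m. cnj (coeff p k) * z ^ (m - k))"
  proof (rule sum.cong[OF refl])
    fix k assume "k \<in> {..m}"
    hence "z ^ m = z ^ (m - k) * z ^ k" by (simp add: power_add[symmetric])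
    hence "z ^ m * cnj z ^ k = z ^ (m - k) * (z * cnj z) ^ k" by (simp only: power_mult_distrib mult.assoc)
    thus "cnj (coeff p k) * (z ^ m * cnj z ^ k) = cnj (coeff p k) * z ^ (m - k)" by (simp add: zc)
  qed
  finally show ?thesis by (simp add: reflected_def poly_sum poly_monom)
qed

lemma degree_mob_le: "degree (mob a m p) \<le> m"
  unfolding mob_def
proof (rule degree_sum_le)
  fix k assume "k \<in> {..m}"
  have "degree (smult (coeff p k * of_real a ^ k) ([:1, -1:] ^ k * [:1, 1:] ^ (m - k)) :: complex poly)
      \<le> degree ([:1, -1:] ^ k * [:1, 1:] ^ (m - k) :: complex poly)" by (rule degree_smult_le)
  also have "\<dots> \<le> degree ([:1, -1:] ^ k :: complex poly) + degree ([:1, 1:] ^ (m - k) :: complex poly)" by (rule degree_mult_le)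
  also have "\<dots> \<le> k + (m - k)" by (intro add_mono order_trans[OF degree_power_le]) auto
  finally show "degree (smult (coeff p k * of_real a ^ k) ([:1, -1:] ^ k * [:1, 1:] ^ (m - k)) :: complex poly) \<le> m"
    using \<open>k \<in> {..m}\<close> by simp
qed simp

lemma poly_bounded_disc: "\<exists>K\<ge>0. \<forall>z. cmod z \<le> 1 \<longrightarrow> cmod (poly p z) \<le> K"
proof (induction p)
  case (pCons c p)
  then obtain K where K: "K \<ge> 0" "\<And>z. cmod z \<le> 1 \<Longrightarrow> cmod (poly p z) \<le> K" by blast
  have "cmod (c + z * poly p z) \<le> cmod c + K" if "cmod z \<le> 1" for z
  proof -
    have "cmod (z * poly p z) \<le> 1 * K" unfolding norm_mult by (rule mult_mono) (use K that in auto)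
    thus ?thesis using norm_triangle_ineq[of c "z * poly p z"] by simp
  qed
  thus ?case using K(1) by (intro exI[of _ "cmod c + K"]) auto
qed (auto intro: exI[of _ 0])

lemma S_component_bound: "S.nrm (axis i (W $ j) :: complex poly^'n) \<le> S.nrm W"
proof (rule power2_le_imp_le)
  obtain M where M: "\<forall>k\<ge>M. cf W k = 0" using cf_bound by blast
  have c: "cf (axis i (W $ j)) k = axis i (cf W k $ j)" for k
    by (simp add: cf_def axis_def vec_eq_iff)
  have n: "norm (axis i x :: complex^'n) = cmod x" for x
    by (simp add: norm_vec_def L2_set_def axis_def if_distrib[of "\<lambda>x. (cmod x)\<^sup>2"] cong: if_cong)
  have "(S.nrm (axis i (W $ j) :: complex poly^'n))\<^sup>2 = (\<Sum>k<M. (norm (cf (axis i (W $ j) :: complex poly^'n) k))\<^sup>2)"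
  proof -
    have "cf (axis i (W $ j) :: complex poly^'n) k = 0" if "k \<ge> M" for k
      unfolding c using M that by (simp add: axis_def vec_eq_iff)
    thus ?thesis unfolding S.nrm_square by (subst hS_eq[of M]) (simp_all add: cdot_cnjv_self)
  qed
  also have "\<dots> \<le> (\<Sum>k<M. (norm (cf W k))\<^sup>2)"
  proof (rule sum_mono)
    fix k
    have "cmod (cf W k $ j) \<le> norm (cf W k)" by (rule Finite_Cartesian_Product.norm_nth_le)
    thus "(norm (cf (axis i (W $ j) :: complex poly^'n) k))\<^sup>2 \<le> (norm (cf W k))\<^sup>2"
      unfolding c n by (rule power_mono) simp
  qed
  also have "\<dots> = (S.nrm W)\<^sup>2"
    by (simp only: S.nrm_square, subst hS_eq[of M]) (use M in \<open>simp_all add: cdot_cnjv_self\<close>)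
  finally show "(S.nrm (axis i (W $ j) :: complex poly^'n))\<^sup>2 \<le> (S.nrm W)\<^sup>2" .
qed (rule S.nrm_nonneg)

lemma S_matrix_bound:
  fixes L :: "complex poly^'m^'n"
  shows "\<exists>K\<ge>0. \<forall>W. S.nrm (L *v W) \<le> K * S.nrm W"
proof -
  have "\<forall>k. \<exists>K\<ge>0. \<forall>U :: complex poly^'n. S.nrm (L $ fst k $ snd k *s U) \<le> K * S.nrm U"
    using S.nrm_poly_scale by blast
  then obtain K where K: "\<And>k. K k \<ge> 0" "\<And>k (U :: complex poly^'n). S.nrm (L $ fst k $ snd k *s U) \<le> K k * S.nrm U"
    by metis
  have "S.nrm (L *v W) \<le> (\<Sum>i\<in>UNIV. \<Sum>j\<in>UNIV. K (i, j)) * S.nrm W" for W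
  proof -
    have "L *v W = (\<Sum>i\<in>UNIV. \<Sum>j\<in>UNIV. L $ i $ j *s axis i (W $ j))"
    proof -
      have "(\<Sum>i\<in>UNIV. \<Sum>j\<in>UNIV. (L $ i $ j *s axis i (W $ j)) $ k) = (L *v W) $ k" for k
        by (subst sum.swap) (simp add: matrix_vector_mult_def axis_def if_distrib[of "\<lambda>x. _ * x"] cong: if_cong)
      thus ?thesis by (simp add: vec_eq_iff)
    qed
    hence "S.nrm (L *v W) \<le> (\<Sum>i\<in>UNIV. S.nrm (\<Sum>j\<in>UNIV. L $ i $ j *s axis i (W $ j) :: complex poly^'n))"
      using S.nrm_sum[of UNIV "\<lambda>i. \<Sum>j\<in>UNIV. L $ i $ j *s axis i (W $ j) :: complex poly^'n"] by simp
    also have "\<dots> \<le> (\<Sum>i\<in>UNIV. \<Sum>j\<in>UNIV. K (i, j) * S.nrm W)"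
    proof (intro sum_mono order_trans[OF S.nrm_sum])
      fix i j
      have "S.nrm (L $ i $ j *s axis i (W $ j) :: complex poly^'n) \<le> K (i, j) * S.nrm (axis i (W $ j) :: complex poly^'n)"
        using K(2)[of "(i, j)"] by simp
      also have "\<dots> \<le> K (i, j) * S.nrm W" using K(1) S_component_bound by (intro mult_left_mono) auto
      finally show "S.nrm (L $ i $ j *s axis i (W $ j) :: complex poly^'n) \<le> K (i, j) * S.nrm W" .
    qed simp
    finally show ?thesis by (simp add: sum_distrib_right)
  qed
  thus ?thesis using K(1) by (intro exI[of _ "\<Sum>i\<in>UNIV. \<Sum>j\<in>UNIV. K (i, j)"]) (auto intro!: sum_nonneg)
qed

text \<open>The degree of one fixed nonzero entry drops whenever \<open>z - l\<close> divides the
  whole vector, so the division stops.\<close>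

lemma vec_root_factor:
  fixes b :: "complex poly^'n"
  assumes "b \<noteq> 0"
  shows "\<exists>k b'. b = [:-l, 1:] ^ k *s b' \<and> pv b' l \<noteq> 0"
proof -
  from assms obtain i where "b $ i \<noteq> 0" by (auto simp: vec_eq_iff)
  thus ?thesis
  proof (induction "degree (b $ i)" arbitrary: b rule: less_induct)
    case less
    show ?case
    proof (cases "pv b l = 0")
      case False
      thus ?thesis by (intro exI[of _ 0] exI[of _ b]) simp
    next
      case True
      hence "\<forall>j. \<exists>c. b $ j = [:-l, 1:] * c" by (simp add: pv_def vec_eq_iff poly_eq_0_iff_dvd dvd_def)
      from choice[OF this] obtain c where c: "\<And>j. b $ j = [:-l, 1:] * c j" by blast
      have c0: "c i \<noteq> 0" using less(2) c[of i] by auto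
      have "degree (b $ i) = degree [:-l, 1:] + degree (c i)" unfolding c by (rule degree_mult_eq) (use c0 in auto)
      hence "degree ((\<chi> j. c j) $ i) < degree (b $ i)" by simp
      from less(1)[OF this] c0 obtain k b' where b': "(\<chi> j. c j) = [:-l, 1:] ^ k *s b'" "pv b' l \<noteq> 0" by auto
      have "b = [:-l, 1:] *s (\<chi> j. c j)" by (simp only: vec_eq_iff c vector_smult_component vec_lambda_beta) blast
      hence "b = [:-l, 1:] ^ Suc k *s b'" unfolding b' by (simp only: vector_smult_assoc power_Suc)
      thus ?thesis using b'(2) by blast
    qed
  qed
qed

lemma mat_vec_columns: "M *v x = (\<Sum>i\<in>UNIV. x $ i *s column i M)" for M :: "'a::comm_ring_1^'n^'m"
  by (simp add: vec_eq_iff matrix_vector_mult_def column_def mult.commute)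

context cayley
begin

text \<open>On the unit circle \<open>reflected mdeg p\<close> is \<open>z^mdeg\<close> times the
  conjugate of \<open>p\<close>, so \<open>Phi\<close> is a polynomial matrix that represents the
  boundary form \<open>psi\<close> up to a factor of modulus 1.\<close>

definition Phi :: "complex poly^'n^'n" where
  "Phi = (\<chi> i j. reflected mdeg q * NP $ i $ j + q * reflected mdeg (NP $ j $ i))"

lemma Phi_psi:
  assumes "cmod z = 1"
  shows "cdot (cnjv v) (pm Phi z *v w) = z ^ mdeg * psi z v w"
proof -
  have dq: "degree q \<le> mdeg" "degree (NP $ i $ j) \<le> mdeg" for i j by (simp_all add: q_def NP_def degree_mob_le)
  have e: "pm Phi z $ i $ j = z ^ mdeg * (cnj (poly q z) * pm NP z $ i $ j + poly q z * cnj (pm NP z $ j $ i))" for i j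
    by (simp add: pm_def Phi_def poly_reflected[OF _ assms] dq algebra_simps)
  have "cdot (cnjv v) (pm Phi z *v w) = (\<Sum>i\<in>UNIV. \<Sum>j\<in>UNIV. z ^ mdeg * (cnj (poly q z) * (cnj (v $ i) * (pm NP z $ i $ j * w $ j))))
      + (\<Sum>i\<in>UNIV. \<Sum>j\<in>UNIV. z ^ mdeg * (poly q z * (cnj (v $ i) * (cnj (pm NP z $ j $ i) * w $ j))))"
    by (simp add: cdot_def cnjv_def matrix_vector_mult_def e sum_distrib_left sum.distrib[symmetric] algebra_simps)
  also have "(\<Sum>i\<in>UNIV. \<Sum>j\<in>UNIV. z ^ mdeg * (poly q z * (cnj (v $ i) * (cnj (pm NP z $ j $ i) * w $ j))))
      = (\<Sum>j\<in>UNIV. \<Sum>i\<in>UNIV. z ^ mdeg * (poly q z * (cnj (v $ i) * (cnj (pm NP z $ j $ i) * w $ j))))"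
    by (rule sum.swap)
  finally show ?thesis
    by (simp add: psi_def cdot_def cnjv_def matrix_vector_mult_def sum_distrib_left algebra_simps)
qed

lemma psi_quadratic: "Re (psi z (v + t *s w) (v + t *s w)) = Re (psi z v v) + 2 * Re (t * psi z v w) + (cmod t)\<^sup>2 * Re (psi z w w)"
proof -
  have herm: "psi z w v = cnj (psi z v w)" by (simp add: psi_def)
  have "psi z (v + t *s w) (v + t *s w) = psi z v v + (t * psi z v w + cnj t * psi z w v) + (t * cnj t) * psi z w w"
    by (simp add: psi_def cnjv_simps cdot_add_left cdot_add_right cdot_scale_left cdot_scale_right
        matrix_vector_right_distrib mat_vec_scale algebra_simps)
  also have "t * cnj t = complex_of_real ((cmod t)\<^sup>2)" using complex_norm_square[of t] by simp
  finally show ?thesis unfolding herm by (simp add: complex_add_cnj del: of_real_power)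
qed

lemma psi_cauchy_schwarz:
  assumes "cmod z \<le> 1" shows "(cmod (psi z v w))\<^sup>2 \<le> Re (psi z v v) * Re (psi z w w)"
proof (rule quadratic_discriminant_bound)
  show "0 \<le> Re (psi z w w)" by (rule psi_nonneg[OF assms])
  fix t show "0 \<le> Re (psi z v v) + 2 * Re (t * psi z v w) + (cmod t)\<^sup>2 * Re (psi z w w)"
    unfolding psi_quadratic[symmetric] by (rule psi_nonneg[OF assms])
qed

text \<open>Pointwise Cauchy-Schwarz for \<open>psi\<close> against unit vectors, integrated over
  the circle. The degenerate supply seminorm is thereby compared with a genuine norm: it controls
  \<open>Phi U\<close>, though in general not \<open>U\<close>.\<close>

lemma Phi_bound_q: "\<exists>K\<ge>0. \<forall>U. (S.nrm (Phi *v U))\<^sup>2 \<le> K * (E.nrm (q *s U))\<^sup>2"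
proof -
  have "\<exists>K\<ge>0. \<forall>z. cmod z = 1 \<longrightarrow> Re (psi z (axis i 1) (axis i 1)) \<le> K" for i
  proof -
    obtain K where K: "K \<ge> 0" "\<And>z. cmod z \<le> 1 \<Longrightarrow> cmod (poly (Phi $ i $ i) z) \<le> K" using poly_bounded_disc by blast
    have "Re (psi z (axis i 1) (axis i 1)) \<le> K" if z: "cmod z = 1" for z
    proof -
      have "cdot (cnjv (axis i 1)) (pm Phi z *v axis i 1) = poly (Phi $ i $ i) z"
        by (simp add: cdot_def cnjv_def axis_def matrix_vector_mult_def pm_def if_distrib[of "\<lambda>x. x * _"] if_distrib[of "\<lambda>x. _ * x"]
            if_distrib[of cnj] cong: if_cong)
      hence "cmod (poly (Phi $ i $ i) z) = cmod (psi z (axis i 1) (axis i 1))"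
        using Phi_psi[OF z, of "axis i 1" "axis i 1"] z by (metis mult_1 norm_mult norm_power power_one)
      thus ?thesis using K(2)[of z] z complex_Re_le_cmod[of "psi z (axis i 1) (axis i 1)"] by simp
    qed
    thus ?thesis using K(1) by blast
  qed
  then obtain K where K: "\<And>i. K i \<ge> 0" "\<And>i z. cmod z = 1 \<Longrightarrow> Re (psi z (axis i 1) (axis i 1)) \<le> K i" by metis
  define K' where "K' = (\<Sum>i\<in>UNIV. K i)"
  have K'0: "K' \<ge> 0" unfolding K'_def by (intro sum_nonneg) (rule K(1))
  have pt: "(norm (pm Phi z *v w))\<^sup>2 \<le> K' * Re (psi z w w)" if z: "cmod z = 1" for z w
  proof -
    have ax: "cdot (cnjv (axis i 1)) x = x $ i" for x :: "complex^'n" and i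
      by (simp add: cdot_def cnjv_def axis_def if_distrib[of "\<lambda>x. x * _"] if_distrib[of cnj] cong: if_cong)
    have "(cmod ((pm Phi z *v w) $ i))\<^sup>2 \<le> K i * Re (psi z w w)" for i
    proof -
      have "cmod ((pm Phi z *v w) $ i) = cmod (psi z (axis i 1) w)"
        using Phi_psi[OF z, of "axis i 1" w] z by (simp add: ax norm_mult norm_power)
      hence "(cmod ((pm Phi z *v w) $ i))\<^sup>2 \<le> Re (psi z (axis i 1) (axis i 1)) * Re (psi z w w)"
        using psi_cauchy_schwarz[of z "axis i 1" w] z by simp
      also have "\<dots> \<le> K i * Re (psi z w w)" using K(2)[OF z] psi_nonneg[of z w] z by (intro mult_right_mono) auto
      finally show ?thesis .
    qed
    hence "(\<Sum>i\<in>UNIV. (cmod ((pm Phi z *v w) $ i))\<^sup>2) \<le> (\<Sum>i\<in>UNIV. K i * Re (psi z w w))" by (rule sum_mono)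
    thus ?thesis by (simp add: norm_vec_def L2_set_def sum_nonneg K'_def sum_distrib_right)
  qed
  have "(S.nrm (Phi *v U))\<^sup>2 \<le> (2 * K') * (E.nrm (q *s U))\<^sup>2" for U
  proof -
    let ?c = "circlepath 0 1"
    have c1: "cmod (?c t) = 1" for t by (simp add: circlepath)
    have "((\<lambda>t. Re (cdot (cnjv (pv (Phi *v U) (?c t))) (pv (Phi *v U) (?c t)))) has_integral (S.nrm (Phi *v U))\<^sup>2) {0..1}"
      unfolding S.nrm_square by (intro has_integral_Re hS_mean)
    moreover have "((\<lambda>t. K' * Re (psi (?c t) (pv U (?c t)) (pv U (?c t)))) has_integral K' * (2 * (E.nrm (q *s U))\<^sup>2)) {0..1}"
      by (intro has_integral_mult_right nrm_q_mean)
    moreover have "Re (cdot (cnjv (pv (Phi *v U) (?c t))) (pv (Phi *v U) (?c t))) \<le> K' * Re (psi (?c t) (pv U (?c t)) (pv U (?c t)))" for t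
      using pt[OF c1] by (simp add: cdot_cnjv_self pv_mult del: of_real_power)
    ultimately have "(S.nrm (Phi *v U))\<^sup>2 \<le> K' * (2 * (E.nrm (q *s U))\<^sup>2)" by (rule has_integral_le)
    thus ?thesis by simp
  qed
  thus ?thesis using K'0 by (intro exI[of _ "2 * K'"]) simp
qed

lemma Phi_bound: "\<exists>K\<ge>0. \<forall>U. S.nrm (Phi *v U) \<le> K * E.nrm U"
proof -
  obtain K where K: "K \<ge> 0" "\<And>U. (S.nrm (Phi *v U))\<^sup>2 \<le> K * (E.nrm (q *s U))\<^sup>2" using Phi_bound_q by blast
  obtain L where L: "L \<ge> 0" "\<And>U. E.nrm (q *s U) \<le> L * E.nrm U" using E.nrm_poly_scale by blast
  have "S.nrm (Phi *v U) \<le> (sqrt K * L) * E.nrm U" for U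
  proof (rule power2_le_imp_le)
    have "(S.nrm (Phi *v U))\<^sup>2 \<le> K * (E.nrm (q *s U))\<^sup>2" by (rule K(2))
    also have "\<dots> \<le> K * (L * E.nrm U)\<^sup>2" by (intro mult_left_mono power_mono L(2) E.nrm_nonneg K(1))
    finally show "(S.nrm (Phi *v U))\<^sup>2 \<le> ((sqrt K * L) * E.nrm U)\<^sup>2" using K(1) by (simp add: power_mult_distrib)
    show "0 \<le> sqrt K * L * E.nrm U" using K(1) L(1) E.nrm_nonneg by simp
  qed
  thus ?thesis using K(1) L(1) by (intro exI[of _ "sqrt K * L"]) simp
qed

text \<open>Where \<open>Phi U = 0\<close> the boundary form vanishes at \<open>U\<close> on the
  whole circle, and with it the mean. A polynomial matrix thus certifies null inputs.\<close>

lemma Phi_null: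
  assumes "Phi *v U = 0" shows "E.nrm (q *s U) = 0"
proof -
  let ?c = "circlepath 0 1"
  have "psi (?c t) (pv U (?c t)) (pv U (?c t)) = 0" for t
  proof -
    have c1: "cmod (?c t) = 1" by (simp add: circlepath)
    have "pm Phi (?c t) *v pv U (?c t) = 0" using assms pv_mult[of Phi U "?c t"] by (simp add: pv_def vec_eq_iff)
    hence "?c t ^ mdeg * psi (?c t) (pv U (?c t)) (pv U (?c t)) = 0"
      unfolding Phi_psi[OF c1, symmetric] by (simp add: cdot_def)
    thus ?thesis using c1 by auto
  qed
  hence "((\<lambda>t. 0) has_integral 2 * (E.nrm (q *s U))\<^sup>2) {0..1::real}" using nrm_q_mean[of U] by simp
  hence "2 * (E.nrm (q *s U))\<^sup>2 = 0" by (rule has_integral_unique) simp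
  thus ?thesis by simp
qed

lemma q_nonzero: "q \<noteq> 0"
proof
  assume "q = 0"
  hence "poly q 0 = 0" by simp
  moreover have "poly q 0 = poly del (sig 0)" by (subst poly_q) auto
  moreover have "poly del (sig 0) \<noteq> 0" by (rule del_nonzero) (simp add: sig_def a)
  ultimately show False by simp
qed

text \<open>Modulo the null module of the supply form, evaluation at a point of the open disc is bounded.
  The columns of \<open>V\<close> outside \<open>J\<close> form a maximal family of null vectors that stays independent at \<open>l\<close>.\<close>
lemma evaluation_modulo_null:
  assumes l: "cmod l < 1"
  shows "\<exists>(V :: complex poly^'n^'n) J d K. poly d l \<noteq> 0 \<and> K \<ge> 0
    \<and> (\<forall>U. \<exists>b. (\<forall>i. i \<notin> J \<longrightarrow> b $ i = 0) \<and> E.nrm (d *s U - V *v b) = 0)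
    \<and> (\<forall>b. (\<forall>i. i \<notin> J \<longrightarrow> b $ i = 0) \<longrightarrow> norm (pv b l) \<le> K * E.nrm (V *v b))"
proof -
  \<comment> \<open>A candidate is a set of column indices together with a square matrix that is
    invertible at \<open>l\<close> and has null columns at these indices; the index set is taken as
    large as possible.\<close>
  define good where "good x = (det (pm (snd x) l) \<noteq> 0 \<and> (\<forall>i\<in>fst x. E.nrm (column i (snd x)) = 0))"
    for x :: "'n set \<times> (complex poly^'n^'n)"
  have "good ({}, mat 1)" by (simp add: good_def pm_mat)
  moreover have "card (fst x) < Suc CARD('n)" for x :: "'n set \<times> (complex poly^'n^'n)"
    by (simp add: less_Suc_eq_le card_mono)
  ultimately obtain x where x: "good x" "\<And>y. good y \<Longrightarrow> card (fst y) \<le> card (fst x)"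
    using ex_has_greatest_nat[of good "({}, mat 1)" "\<lambda>x. card (fst x)" "Suc CARD('n)"] by blast
  define I V where "I = fst x" and "V = snd x"
  have dV: "det (pm V l) \<noteq> 0" and nI: "\<And>i. i \<in> I \<Longrightarrow> E.nrm (column i V) = 0"
    using x(1) by (auto simp: good_def I_def V_def)
  \<comment> \<open>Maximality: a null combination of the remaining columns, freed of its factors
    \<open>z - l\<close>, could replace one of them and enlarge the index set.\<close>
  have indep: "b = 0" if sb: "\<And>i. i \<in> I \<Longrightarrow> b $ i = 0" and nb: "E.nrm (V *v b) = 0" for b
  proof (rule ccontr)
    assume "b \<noteq> 0"
    then obtain k b' where b': "b = [:-l, 1:] ^ k *s b'" "pv b' l \<noteq> 0" using vec_root_factor by blast
    have "E.nrm (V *v b') = 0"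
    proof -
      have "E.nrm ([:-l, 1:] ^ k *s W) = 0 \<Longrightarrow> E.nrm W = 0" for W
      proof (induction k)
        case (Suc k)
        have "[:-l, 1:] ^ Suc k *s W = [:-l, 1:] *s ([:-l, 1:] ^ k *s W)" by (simp only: vector_smult_assoc power_Suc)
        thus ?case using Suc E.null_root[OF l] by metis
      qed simp
      thus ?thesis using nb unfolding b' mat_vec_scale by blast
    qed
    obtain j where j: "pv b' l $ j \<noteq> 0" using b'(2) by (auto simp: vec_eq_iff)
    have "j \<notin> I"
    proof
      assume "j \<in> I"
      hence "[:-l, 1:] ^ k * b' $ j = 0" using sb[of j] unfolding b' by simp
      hence "b' $ j = 0" by (simp del: mult_pCons_left)
      thus False using j by (simp add: pv_def)
    qed
    define V' where "V' = (\<chi> k i. if i = j then (V *v b') $ k else V $ k $ i)"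
    have "pm V' l = (\<chi> k i. if i = j then (pm V l *v pv b' l) $ k else pm V l $ k $ i)"
      unfolding pv_mult[symmetric] by (simp add: pm_def pv_def V'_def vec_eq_iff)
    \<comment> \<open>Cramer's rule: exchanging column \<open>j\<close> for \<open>V b'\<close>
      multiplies the determinant at \<open>l\<close> by the value of entry \<open>j\<close> of
      \<open>b'\<close>.\<close>
    hence "det (pm V' l) = pv b' l $ j * det (pm V l)" by (simp only: cramer_lemma)
    hence "det (pm V' l) \<noteq> 0" using j dV by simp
    moreover have "E.nrm (column i V') = 0" if "i \<in> insert j I" for i
    proof (cases "i = j")
      case True
      hence "column i V' = V *v b'" by (simp add: column_def V'_def vec_eq_iff)
      thus ?thesis using \<open>E.nrm (V *v b') = 0\<close> by simp
    next
      case False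
      hence "column i V' = column i V" by (simp add: column_def V'_def)
      thus ?thesis using that False nI by simp
    qed
    ultimately have "good (insert j I, V')" by (simp add: good_def)
    hence "card (insert j I) \<le> card I" using x(2) by (fastforce simp: I_def)
    thus False using \<open>j \<notin> I\<close> by simp
  qed
  \<comment> \<open>The columns of \<open>Phi V\<close> outside \<open>I\<close> are stacked on the
    identity for the coordinates in \<open>I\<close>. This makes the matrix injective on all
    polynomial vectors, so it has a left inverse up to a factor \<open>g\<close>.\<close>
  define M :: "complex poly^'n^('n + 'n)" where
    "M = (\<chi> r j. case r of Inl i \<Rightarrow> (if j \<in> I then 0 else (Phi ** V) $ i $ j) | Inr i \<Rightarrow> (if i = j \<and> i \<in> I then 1 else 0))"
  have Ml: "(M *v b) $ Inl i = (Phi *v (V *v b)) $ i" if "\<And>i. i \<in> I \<Longrightarrow> b $ i = 0" for b i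
    unfolding matrix_vector_mul_assoc
    by (simp add: matrix_vector_mult_def M_def) (intro sum.cong, auto simp: that)
  have Mr: "(M *v b) $ Inr i = (if i \<in> I then b $ i else 0)" for b i
    by (simp add: matrix_vector_mult_def M_def if_distrib[of "\<lambda>x. x * _"] cong: if_cong)
  have "b = 0" if "M *v b = 0" for b
  proof -
    have sb: "b $ i = 0" if "i \<in> I" for i using Mr[of b i] \<open>M *v b = 0\<close> that by simp
    have "Phi *v (V *v b) = 0" using Ml[OF sb] \<open>M *v b = 0\<close> by (simp add: vec_eq_iff)
    hence "E.nrm (V *v (q *s b)) = 0" unfolding mat_vec_scale by (rule Phi_null)
    hence "q *s b = 0" by (rule indep[rotated]) (simp add: sb)
    thus ?thesis using q_nonzero by (simp add: vec_eq_iff)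
  qed
  from left_inverse_multiple[OF this] obtain L g where Lg: "g \<noteq> 0" "L ** M = mat g" by blast
  define L' where "L' = (\<chi> i j. L $ i $ Inl j)"
  have gb: "g *s b = L' *v (Phi *v (V *v b))" if sb: "\<And>i. i \<in> I \<Longrightarrow> b $ i = 0" for b
  proof -
    have Mlb: "(M *v b) $ Inl j = (Phi *v (V *v b)) $ j" for j by (rule Ml) (rule sb)
    have "g *s b = L *v (M *v b)" unfolding matrix_vector_mul_assoc Lg mat_mult_vec ..
    moreover have "(L *v (M *v b)) $ i = (L' *v (Phi *v (V *v b))) $ i" for i
      unfolding matrix_vector_mult_def[of L] matrix_vector_mult_def[of L'] vec_lambda_beta UNIV_sum_type Mr Mlb
      by (simp add: L'_def sb if_distrib[of "\<lambda>x. _ * x"] cong: if_cong)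
    ultimately show ?thesis by (simp add: vec_eq_iff)
  qed
  obtain K1 where K1: "K1 \<ge> 0" "\<And>U :: complex poly^'n. norm (pv U l) \<le> K1 * S.nrm (g *s U)"
    using pv_multiple_bound[OF l Lg(1)] by blast
  obtain K2 where K2: "K2 \<ge> 0" "\<And>W. S.nrm (L' *v W) \<le> K2 * S.nrm W" using S_matrix_bound by blast
  obtain K3 where K3: "K3 \<ge> 0" "\<And>U. S.nrm (Phi *v U) \<le> K3 * E.nrm U" using Phi_bound by blast
  have bound: "norm (pv b l) \<le> (K1 * K2 * K3) * E.nrm (V *v b)" if sb: "\<And>i. i \<in> I \<Longrightarrow> b $ i = 0" for b
  proof -
    have "norm (pv b l) \<le> K1 * S.nrm (L' *v (Phi *v (V *v b)))" using K1(2)[of b] gb[OF sb] by simp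
    also have "\<dots> \<le> K1 * (K2 * (K3 * E.nrm (V *v b)))"
      by (intro mult_left_mono K1(1) order_trans[OF K2(2)] K2(1) K3(2))
    finally show ?thesis by (simp add: mult.assoc)
  qed
  \<comment> \<open>The adjugate gives coordinates of \<open>det V *s U\<close> with respect to the
    columns of \<open>V\<close>; coordinates on null columns are dropped at no cost in the
    seminorm.\<close>
  have "\<exists>b. (\<forall>i. i \<notin> - I \<longrightarrow> b $ i = 0) \<and> E.nrm (det V *s U - V *v b) = 0" for U
  proof -
    define c where "c = adjm V *v U"
    define b where "b = (\<chi> i. if i \<in> I then 0 else c $ i)"
    have "V *v c = det V *s U" by (simp add: c_def matrix_vector_mul_assoc matrix_mult_adjm mat_mult_vec)
    hence "det V *s U - V *v b = V *v (c - b)" by (simp add: matrix_vector_mult_diff_distrib)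
    also have "\<dots> = (\<Sum>i\<in>UNIV. (c - b) $ i *s column i V)" by (rule mat_vec_columns)
    finally have e: "det V *s U - V *v b = (\<Sum>i\<in>UNIV. (c - b) $ i *s column i V)" .
    have "E.nrm ((c - b) $ i *s column i V) = 0" for i
    proof (cases "i \<in> I")
      case True
      thus ?thesis by (intro E.null_scale nI)
    next
      case False
      hence "(c - b) $ i *s column i V = 0" by (simp add: b_def vec_eq_iff)
      thus ?thesis by (simp add: E.nrm_0)
    qed
    hence "E.nrm (det V *s U - V *v b) \<le> 0" unfolding e using E.nrm_sum[of UNIV "\<lambda>i. (c - b) $ i *s column i V"] by simp
    thus ?thesis using E.nrm_nonneg by (intro exI[of _ b]) (auto simp: b_def intro: order_antisym)
  qed
  moreover have "poly (det V) l \<noteq> 0" using dV by (simp add: det_pm)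
  moreover have "K1 * K2 * K3 \<ge> 0" using K1(1) K2(1) K3(1) by simp
  ultimately show ?thesis using bound by (intro exI[of _ V] exI[of _ "- I"] exI[of _ "det V"] exI[of _ "K1 * K2 * K3"]) auto
qed

end

text \<open>By dimension, an injective map carries an invariant subspace onto itself. This lets
  \<open>mid\<close> and \<open>z - T\<close> be inverted without leaving a subspace.\<close>

lemma invariant_subspace_preimage:
  fixes f :: "complex^'d \<Rightarrow> complex^'d"
  assumes f: "Vector_Spaces.linear (*s) (*s) f" "inj f" and S: "vec.subspace S" "\<And>x. x \<in> S \<Longrightarrow> f x \<in> S" "f x \<in> S"
  shows "x \<in> S"
proof -
  have sub: "f ` S \<subseteq> S" using S(2) by blast
  have "vec.subspace (f ` S)" using f(1) S(1) by (rule vec.linear_subspace_image)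
  moreover have "vec.dim (f ` S) = vec.dim S"
    by (rule vec.dim_image_eq[OF f(1)]) (use f(2) in \<open>auto intro: inj_on_subset\<close>)
  ultimately have "f ` S = S" using vec.subspace_dim_equal[OF _ S(1) sub] by simp
  thus ?thesis using S(3) f(2) by (metis imageE injD)
qed

lemma linear_vecI:
  assumes "\<And>x y. f (x + y) = f x + f y" "\<And>c x. f (c *s x) = c *s f x"
  shows "Vector_Spaces.linear (*s) (*s) (f :: complex^'a \<Rightarrow> complex^'b)"
  by unfold_locales (use assms in \<open>simp_all\<close>)

lemma subspace_vecI:
  fixes S :: "(complex^'a) set"
  assumes "0 \<in> S" "\<And>x y. x \<in> S \<Longrightarrow> y \<in> S \<Longrightarrow> x + y \<in> S" "\<And>c x. x \<in> S \<Longrightarrow> c *s x \<in> S"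
  shows "vec.subspace S"
  using assms by (simp add: vec.subspace_def)

text \<open>Condition (c) speaks of real rows. Off the real axis there is a real polynomial
  \<open>e\<close> with \<open>e(s) = i\<close>, and the real row \<open>p1 + e p2\<close> has the
  value of \<open>p\<close> at \<open>s\<close>; at real \<open>s\<close> the real and imaginary
  rows are treated separately.\<close>

lemma complex_row_kernel:
  fixes p :: "complex poly^'n"
  assumes pr: "positive_real_pair P Q" and M: "p v* cpm (P ** pstar Q + Q ** pstar P) = 0"
    and PQ: "pv p s v* peval P s = 0" "pv p s v* peval Q s = 0"
  shows "pv p s = 0"
proof -
  let ?M = "P ** pstar Q + Q ** pstar P"
  define p1 p2 where "p1 = re_row p" and "p2 = im_row p"
  have "re_row (0 :: complex poly^'n) = 0" "im_row (0 :: complex poly^'n) = 0" by (simp_all add: re_row_def im_row_def vec_eq_iff)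
  hence M12: "p1 v* ?M = 0" "p2 v* ?M = 0" by (simp_all add: p1_def p2_def re_row_vmm[symmetric] im_row_vmm[symmetric] M)
  have split: "pv p z = pveval p1 z + \<i> *s pveval p2 z" for z
    unfolding pv_def pveval_def p1_def p2_def by (simp add: vec_eq_iff) (metis row_split poly_add poly_smult)
  show ?thesis
  proof (cases "Im s = 0")
    case False
    define e where "e = [:- Re s / Im s, 1 / Im s:]"
    have "poly (cp e) s = of_real (- Re s / Im s) + of_real (1 / Im s) * s"
      by (simp add: e_def map_poly_pCons mult.commute)
    also have "\<dots> = \<i>" using False by (simp add: complex_eq_iff)
    finally have es: "poly (cp e) s = \<i>" .
    define p' where "p' = p1 + e *s p2"
    have "p' v* ?M = 0" unfolding p'_def vmm_add vmm_scale M12 by simp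
    moreover have "pveval p' s = pv p s"
      unfolding split p'_def by (simp add: pveval_def vec_eq_iff cp_add cp_mult es)
    ultimately show ?thesis using positive_real_pairD(3)[OF pr, of p' s] PQ by simp
  next
    case True
    have s: "cnj s = s" using True by (simp add: complex_eq_iff)
    have a: "pveval p1 s = (1 / 2) *s (pv p s + cnjv (pv p s))"
      and b: "pveval p2 s = (- \<i> / 2) *s (pv p s + (- 1) *s cnjv (pv p s))"
      by (simp_all add: split cnjv_simps pveval_cnj[symmetric] s vec_eq_iff field_simps)
    have z: "pveval p1 s v* peval Y s = 0 \<and> pveval p2 s v* peval Y s = 0" if "pv p s v* peval Y s = 0" for Y :: "real poly^'n^'n"
      using cnjv_vmm[of "pv p s" Y s] unfolding s a b vmm_scale vmm_add that by (simp add: cnjv_simps)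
    have "pveval p1 s = 0" "pveval p2 s = 0"
      using positive_real_pairD(3)[OF pr M12(1), of s] positive_real_pairD(3)[OF pr M12(2), of s] z[OF PQ(1)] z[OF PQ(2)] by blast+
    thus ?thesis unfolding split by simp
  qed
qed

definition pvec_of :: "nat \<Rightarrow> (nat \<Rightarrow> complex^'n) \<Rightarrow> complex poly^'n" where
  "pvec_of n f = (\<chi> i. \<Sum>k<n. monom (f k $ i) k)"

lemma cf_pvec_of: "cf (pvec_of n f) k = (if k < n then f k else 0)"
  by (auto simp: cf_def pvec_of_def vec_eq_iff coeff_sum)

lemma half_pvec_of: "half (pvec_of n f) h = (\<Sum>k<n. cdot (cnjv (f k)) (h k))"
  by (subst half_eq[of n]) (auto simp: cf_pvec_of)

lemma pv_cf: "(\<And>k. k \<ge> n \<Longrightarrow> cf U k = 0) \<Longrightarrow> pv U z = (\<Sum>k<n. z ^ k *s cf U k)"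
proof -
  assume n: "\<And>k. k \<ge> n \<Longrightarrow> cf U k = 0"
  hence "U = pvec_of n (cf U)" by (intro cf_eqI) (auto simp: cf_pvec_of)
  hence "pv U z = pv (pvec_of n (cf U)) z" by (rule arg_cong)
  thus ?thesis by (simp add: pv_def pvec_of_def vec_eq_iff poly_sum poly_monom mult.commute)
qed

text \<open>The row evaluated at \<open>M\<close> from the right, the sum of the
  \<open>p_k M^k x\<close>; it vanishes on multiples of \<open>xi I - M\<close>. The detour through
  \<open>half\<close> and conjugation makes the linearity and shift rules of \<open>half\<close>
  available.\<close>

definition row_eval :: "complex^'d^'d \<Rightarrow> complex poly^'d \<Rightarrow> complex^'d \<Rightarrow> complex" where
  "row_eval M p x = cnj (half p (\<lambda>k. cnjv ((((*v) M) ^^ k) x)))"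

lemma row_eval_eq:
  "(\<And>k. k \<ge> n \<Longrightarrow> cf p k = 0) \<Longrightarrow> row_eval M p x = (\<Sum>k<n. cdot (cf p k) ((((*v) M) ^^ k) x))"
  unfolding row_eval_def by (subst half_eq[of n]) (auto simp: cdot_def cnjv_def)

lemma row_eval_add: "row_eval M (p + r) x = row_eval M p x + row_eval M r x"
  by (simp add: row_eval_def half_add_left)

lemma row_eval_0: "row_eval M 0 x = 0"
  by (simp add: row_eval_def half_def cf_0)

lemma row_eval_sum: "row_eval M (sum f S) x = (\<Sum>i\<in>S. row_eval M (f i) x)"
  by (induction S rule: infinite_finite_induct) (auto simp: row_eval_add row_eval_0)

lemma funpow_mult_vec_add: "(((*v) M) ^^ k) (x + y) = (((*v) M) ^^ k) x + (((*v) (M :: complex^'d^'d)) ^^ k) y"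
  by (induction k) (simp_all only: funpow.simps o_apply id_apply matrix_vector_right_distrib)

lemma funpow_mult_vec_scale: "(((*v) M) ^^ k) (c *s x) = c *s (((*v) (M :: complex^'d^'d)) ^^ k) x"
  by (induction k) (simp_all only: funpow.simps o_apply id_apply mat_vec_scale)

lemma row_eval_linear_factor: "row_eval M ([:c, d:] *s p) x = row_eval M p (c *s x + d *s (M *v x))"
proof -
  have e: "[:c, d:] *s p = [:c:] *s p + zz *s ([:d:] *s p)" by (simp add: vec_eq_iff)
  have s: "(((*v) M) ^^ Suc k) x = (((*v) M) ^^ k) (M *v x)" for k by (simp only: funpow_Suc_right o_apply)
  have "row_eval M ([:c, d:] *s p) x = c * row_eval M p x + d * row_eval M p (M *v x)"
    unfolding e row_eval_add unfolding row_eval_def half_shift s half_scale_left by simp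
  also have "\<dots> = row_eval M p (c *s x + d *s (M *v x))"
    by (simp add: row_eval_def funpow_mult_vec_add funpow_mult_vec_scale cnjv_simps half_add_right half_scale_right)
  finally show ?thesis .
qed

lemma row_eval_linear_power: "row_eval M ([:c, d:] ^ k *s p) x = row_eval M p (((\<lambda>x. c *s x + d *s (M *v x)) ^^ k) x)"
proof (induction k arbitrary: x)
  case (Suc k)
  have "[:c, d:] ^ Suc k *s p = [:c, d:] *s ([:c, d:] ^ k *s p)" by (simp only: power_Suc vector_smult_assoc)
  thus ?case by (simp only: row_eval_linear_factor Suc funpow_Suc_right o_apply)
qed simp

lemma cf_const_pvec: "cf (const_pvec c) k = (if k = 0 then c else 0)"
  by (auto simp: cf_def const_pvec_def vec_eq_iff coeff_pCons split: nat.split)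

lemma row_eval_const: "row_eval M (const_pvec c) x = cdot c x"
  by (subst row_eval_eq[of 1]) (auto simp: cf_const_pvec)

lemma row_eval_xi_minus: "row_eval M (p v* xi_minus M) x = 0"
proof -
  obtain n where n: "\<forall>k\<ge>n. cf p k = 0" using cf_bound by blast
  have c: "cf (p v* const_pmat M) k = cf p k v* M" for k
    by (simp add: cf_def vector_matrix_mult_def const_pmat_def vec_eq_iff coeff_sum mult.commute)
  have "row_eval M (p v* const_pmat M) x = row_eval M p (M *v x)"
  proof -
    have "row_eval M (p v* const_pmat M) x = (\<Sum>k<n. cdot (cf p k v* M) ((((*v) M) ^^ k) x))"
      by (subst row_eval_eq[of n]) (use n in \<open>simp_all add: c\<close>)
    also have "\<dots> = (\<Sum>k<n. cdot (cf p k) ((((*v) M) ^^ k) (M *v x)))"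
      by (simp add: cdot_vmm funpow_swap1)
    finally show ?thesis using n by (subst row_eval_eq[of n]) auto
  qed
  moreover have "zz *s p = p v* xi_minus M + p v* const_pmat M"
    by (simp add: vec_eq_iff xi_minus_mult)
  moreover have "row_eval M (zz *s p) x = row_eval M p (M *v x)" using row_eval_linear_factor[of M 0 1 p x] by simp
  ultimately show ?thesis by (simp add: row_eval_add)
qed

text \<open>The polynomial with coefficients \<open>f k\<close> at \<open>(a + s) / (a - s)\<close>,
  cleared of denominators by \<open>(a - s)^n\<close>. That point is the Cayley preimage of
  \<open>- s\<close>: null inputs enter through their conjugates, which belong to the reflected
  frequency.\<close>

definition cayp :: "real \<Rightarrow> nat \<Rightarrow> (nat \<Rightarrow> complex^'n) \<Rightarrow> complex poly^'n" where
  "cayp a n f = (\<Sum>k<n. ([:of_real a, 1:] ^ k * [:of_real a, -1:] ^ (n - k)) *s const_pvec (f k))"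

lemma pv_cayp:
  assumes "s \<noteq> of_real a"
  shows "pv (cayp a n f) s = (of_real a - s) ^ n *s (\<Sum>k<n. ((of_real a + s) / (of_real a - s)) ^ k *s f k)"
proof -
  have nz: "of_real a - s \<noteq> 0" using assms by simp
  have "pv (cayp a n f) s = (\<Sum>k<n. ((of_real a + s) ^ k * (of_real a - s) ^ (n - k)) *s f k)"
    by (simp add: pv_def cayp_def const_pvec_def vec_eq_iff poly_sum mult.commute)
  also have "\<dots> = (\<Sum>k<n. ((of_real a - s) ^ n * ((of_real a + s) / (of_real a - s)) ^ k) *s f k)"
  proof (intro sum.cong refl arg_cong2[of _ _ _ _ "(*s)"])
    fix k assume "k \<in> {..<n}"
    hence "(of_real a - s) ^ n = (of_real a - s) ^ (n - k) * (of_real a - s) ^ k" by (simp add: power_add[symmetric])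
    thus "(of_real a + s) ^ k * (of_real a - s) ^ (n - k) = (of_real a - s) ^ n * ((of_real a + s) / (of_real a - s)) ^ k"
      using nz by (simp add: power_divide)
  qed
  finally show ?thesis by (simp add: vec_eq_iff sum_distrib_left mult.assoc)
qed

lemma pv_eq_on_infinite:
  fixes U W :: "complex poly^'n"
  assumes "infinite S" "\<And>s. s \<in> S \<Longrightarrow> pv U s = pv W s" shows "U = W"
proof -
  have "U $ i = W $ i" for i
  proof -
    have "poly (U $ i) s = poly (W $ i) s" for s
      by (rule poly_eq_on_infinite[OF assms(1)]) (use assms(2) in \<open>auto simp: pv_def vec_eq_iff\<close>)
    thus ?thesis by (simp add: poly_eq_poly_eq_iff[symmetric] fun_eq_iff)
  qed
  thus ?thesis by (simp add: vec_eq_iff)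
qed

lemma eq_0_if_cdot: "(\<And>e. cdot x e = 0) \<Longrightarrow> x = (0 :: complex^'n)"
  using cdot_cnjv_self[of "cnjv x"] by (metis cnjv_simps(1) norm_cnjv norm_eq_zero of_real_eq_0_iff zero_eq_power2)

context cayley
begin

definition T :: "complex^'d \<Rightarrow> complex^'d" where "T x = 2 *s mid x 0 - x"

definition fr :: "complex^'d \<Rightarrow> nat \<Rightarrow> complex^'n" where "fr x k = cmat C *v mid ((T ^^ k) x) 0"

text \<open>Cross term of the supply between the free response of \<open>x\<close> and the input
  \<open>U\<close>. Its boundedness in the supply seminorm is what bounds the energy extractable
  from \<open>x\<close>.\<close>

definition ell :: "complex^'d \<Rightarrow> complex poly^'n \<Rightarrow> complex" where "ell x U = half U (fr x)"

lemma mid_add_0: "mid (x + y) 0 = mid x 0 + mid y 0"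
  and mid_scale_0: "mid (c *s x) 0 = c *s mid x 0"
  using mid_add[of x y 0 0] mid_scale[of c x 0] by (simp_all del: vector_smult_rzero add: vec_eq_iff)

lemma mid_split: "mid x u = mid x 0 + mid 0 u"
  using mid_add[of x 0 0 u] by simp

lemma T_add: "T (x + y) = T x + T y" and T_scale: "T (c *s x) = c *s T x"
  by (simp_all add: T_def mid_add_0 mid_scale_0 vec_eq_iff algebra_simps)

lemma T_pow_add: "(T ^^ k) (x + y) = (T ^^ k) x + (T ^^ k) y"
  and T_pow_scale: "(T ^^ k) (c *s x) = c *s (T ^^ k) x"
  by (induction k) (simp_all add: T_add T_scale)

lemma fr_add: "fr (x + y) k = fr x k + fr y k"
  and fr_scale: "fr (c *s x) k = c *s fr x k"
  and fr_T: "fr (T x) k = fr x (Suc k)"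
  by (simp_all add: fr_def T_pow_add T_pow_scale mid_add_0 mid_scale_0 matrix_vector_right_distrib mat_vec_scale funpow_swap1)

lemma ell_add: "ell (x + y) U = ell x U + ell y U"
  and ell_scale: "ell (c *s x) U = c * ell x U"
  and ell_T: "ell (T x) U = ell x (zz *s U)"
  and ell_add_right: "ell x (U + W) = ell x U + ell x W"
  and ell_scale_right: "ell x ([:c:] *s U) = cnj c * ell x U"
proof -
  have "fr (x + y) = (\<lambda>k. fr x k + fr y k)" "fr (c *s x) = (\<lambda>k. c *s fr x k)" "fr (T x) = (\<lambda>k. fr x (Suc k))"
    by (simp_all add: fun_eq_iff fr_add fr_scale fr_T)
  thus "ell (x + y) U = ell x U + ell y U" "ell (c *s x) U = c * ell x U" "ell (T x) U = ell x (zz *s U)"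
    by (simp_all only: ell_def half_shift half_add_right half_scale_right)
  show "ell x (U + W) = ell x U + ell x W" "ell x ([:c:] *s U) = cnj c * ell x U"
    by (simp_all only: ell_def half_add_left half_scale_left)
qed

lemma mid_unique: "al *s m = cmat A *v m + (al *s x + cmat B *v u) \<Longrightarrow> m = mid x u"
proof -
  assume m: "al *s m = cmat A *v m + (al *s x + cmat B *v u)"
  have "N ** (mat a - A) = mat 1" using N by (simp add: matrix_left_right_inverse)
  hence "cmat (N ** (mat a - A)) = mat 1" by (simp add: cmat_mat)
  hence "cmat N ** (mat al - cmat A) = mat 1" by (simp add: cmat_simps cmat_mat)
  moreover have "(mat al - cmat A) *v m = al *s x + cmat B *v u"
    using m by (simp add: matrix_vector_mult_diff_rdistrib mat_mult_vec)
  ultimately show ?thesis unfolding mid_def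
    by (metis matrix_vector_mul_assoc matrix_vector_mul_lid)
qed

lemma zz_power_Suc: "zz ^ Suc j *s U = zz *s (zz ^ j *s U)"
  by (simp only: power_Suc vector_smult_assoc)

lemma out_zz_0: "out (zz *s U) 0 = 0"
  by (simp only: out_def st.simps cf_zz_0 mid_0) simp

lemma out_zz_power: "out (zz ^ j *s U) k = (if k < j then 0 else out U (k - j))"
proof (induction j arbitrary: k)
  case (Suc j)
  show ?case unfolding zz_power_Suc
    by (cases k) (simp_all only: out_zz_0 out_zz_Suc Suc, simp_all)
qed simp

lemma half_zz_power: "half (zz ^ j *s U) h = half U (\<lambda>k. h (k + j))"
proof (induction j arbitrary: h)
  case (Suc j)
  show ?case unfolding zz_power_Suc half_shift Suc by simp
qed simp

lemma half_const: "half (const_pvec e) h = cdot (cnjv e) (h 0)"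
  by (subst half_eq[of 1]) (auto simp: cf_const_pvec)

lemma nrm_zz_power: "E.nrm (zz ^ j *s U) = E.nrm U"
  by (induction j) (simp_all only: zz_power_Suc E.nrm_zz, simp)

lemma out_const_Suc: "out (const_pvec e) (Suc k) = fr (2 *s mid 0 e) k"
proof -
  have "st (const_pvec e) (Suc k) = (T ^^ k) (2 *s mid 0 e)"
  proof (induction k)
    case 0
    show ?case by (simp add: cf_const_pvec)
  next
    case (Suc k)
    thus ?case by (simp only: st.simps(2)[of _ "Suc k"] funpow.simps o_apply T_def cf_const_pvec) simp
  qed
  thus ?thesis by (simp add: out_def fr_def cf_const_pvec)
qed

lemma null_response:
  assumes v: "E.nrm v = 0"
  shows "half v (out W) = - cnj (half W (out v))"
  using E.null_orthogonal[OF v, of W] by (simp add: hE_def add_eq_0_iff)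

text \<open>Tested with impulses at time \<open>j\<close>: their responses start only after
  \<open>v\<close> has ended, so \<open>v\<close> does not meet them, and orthogonality of null
  inputs carries this over to the output of \<open>v\<close> at \<open>j\<close>.\<close>

lemma null_output_finite:
  assumes v: "E.nrm v = 0" and n: "\<forall>k\<ge>n. cf v k = 0" and j: "j \<ge> n"
  shows "out v j = 0"
proof -
  have "half v (out (zz ^ j *s const_pvec e)) = 0" for e
    by (subst half_eq[of n]) (use n j in \<open>auto simp: out_zz_power cdot_def\<close>)
  hence "half (zz ^ j *s const_pvec e) (out v) = 0" for e using null_response[OF v] by (metis complex_cnj_cancel_iff complex_cnj_zero neg_equal_0_iff_equal)
  hence "cdot (cnjv e) (out v j) = 0" for e by (simp add: half_zz_power half_const)
  hence "cdot (cnjv (cnjv e)) (out v j) = 0" for e by blast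
  hence "cdot (out v j) e = 0" for e by (simp add: cnjv_simps cdot_def mult.commute)
  thus ?thesis by (rule eq_0_if_cdot)
qed

text \<open>The free response of a state reached by an impulse is a shifted tail of the impulse
  response. Delaying \<open>v\<close> undoes the shift, and the output of the delayed
  \<open>v\<close> is still 0 at the time of the impulse.\<close>

lemma null_annihilates_reachable:
  assumes v: "E.nrm v = 0"
  shows "ell ((T ^^ i) (2 *s mid 0 e)) v = 0"
proof -
  have "fr ((T ^^ i) x) = (\<lambda>k. fr x (k + i))" for x by (rule ext) (simp add: fr_def funpow_add)
  hence "ell ((T ^^ i) (2 *s mid 0 e)) v = half v (\<lambda>k. out (const_pvec e) (k + Suc i))"
    by (simp add: ell_def out_const_Suc)
  also have "\<dots> = half (zz ^ Suc i *s v) (out (const_pvec e))" by (simp only: half_zz_power)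
  also have "\<dots> = - cnj (half (const_pvec e) (out (zz ^ Suc i *s v)))"
    by (rule null_response) (simp only: nrm_zz_power v)
  also have "\<dots> = 0" unfolding half_const out_zz_power by (simp add: cdot_def)
  finally show ?thesis .
qed

text \<open>The input \<open>z\<^sup>k e\<close>, truncated, steers the state from \<open>0\<close> along the difference of the forced and the free motion.\<close>
lemma null_transfer:
  assumes v: "E.nrm v = 0" and n: "\<forall>k\<ge>n. cf v k = 0"
    and X: "2 *s mid X e - X = z *s X"
  shows "cdot (\<Sum>k<n. z ^ k *s cnjv (cf v k)) (cmat C *v mid X e + cmat D *v e)
    = ell X v - cdot (\<Sum>k<n. z ^ k *s cnjv (out v k)) e"
proof -
  define W where "W = pvec_of n (\<lambda>k. z ^ k *s e)"
  let ?y = "cmat C *v mid X e + cmat D *v e"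
  have midW: "mid (z ^ k *s X - (T ^^ k) X) (z ^ k *s e) = z ^ k *s mid X e - mid ((T ^^ k) X) 0" for k
  proof -
    have "mid (z ^ k *s X + (-1) *s (T ^^ k) X) (z ^ k *s e + 0) = mid (z ^ k *s X) (z ^ k *s e) + mid ((-1) *s (T ^^ k) X) 0" by (rule mid_add)
    thus ?thesis by (simp only: mid_scale mid_scale_0) simp
  qed
  have stW: "k \<le> n \<Longrightarrow> st W k = z ^ k *s X - (T ^^ k) X" for k
  proof (induction k)
    case (Suc k)
    hence "st W (Suc k) = 2 *s (z ^ k *s mid X e - mid ((T ^^ k) X) 0) - (z ^ k *s X - (T ^^ k) X)"
      by (simp add: W_def cf_pvec_of midW)
    also have "\<dots> = z ^ k *s (2 *s mid X e - X) - T ((T ^^ k) X)"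
      by (simp add: T_def vec_eq_iff algebra_simps)
    finally show ?case unfolding X by (simp add: vector_smult_assoc mult.commute)
  qed simp
  have outW: "out W k = z ^ k *s ?y - fr X k" if "k < n" for k
  proof -
    have "out W k = cmat C *v (z ^ k *s mid X e - mid ((T ^^ k) X) 0) + cmat D *v (z ^ k *s e)"
      using that stW[of k] by (simp add: out_def midW[symmetric] W_def cf_pvec_of)
    thus ?thesis by (simp add: fr_def matrix_vector_mult_diff_distrib mat_vec_scale vsmult_add)
  qed
  have sl: "cdot (sum f S) y = (\<Sum>k\<in>S. cdot (f k) y)" for f :: "nat \<Rightarrow> complex^'n" and S y
    by (induction S rule: infinite_finite_induct) (auto simp: cdot_add_left cdot_0_left)
  have "half v (out W) = (\<Sum>k<n. cdot (cnjv (cf v k)) (z ^ k *s ?y - fr X k))"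
    by (subst half_eq[of n]) (use n in \<open>simp_all add: outW\<close>)
  also have "\<dots> = (\<Sum>k<n. cdot (z ^ k *s cnjv (cf v k)) ?y) - (\<Sum>k<n. cdot (cnjv (cf v k)) (fr X k))"
    by (simp add: cdot_def sum_subtractf algebra_simps)
  also have "(\<Sum>k<n. cdot (cnjv (cf v k)) (fr X k)) = ell X v"
    unfolding ell_def by (rule half_eq[symmetric]) (use n in blast)
  finally have 1: "half v (out W) = cdot (\<Sum>k<n. z ^ k *s cnjv (cf v k)) ?y - ell X v" by (simp add: sl)
  have "half W (out v) = (\<Sum>k<n. cdot (cnjv (z ^ k *s e)) (out v k))" unfolding W_def by (rule half_pvec_of)
  hence "cnj (half W (out v)) = cdot (\<Sum>k<n. z ^ k *s cnjv (out v k)) e"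
    by (simp add: sl) (simp add: cdot_def cnjv_def mult_ac)
  thus ?thesis using 1 null_response[OF v, of W] by (simp add: algebra_simps)
qed

end

section \<open>Null inputs\<close>

lemma entry_degree_bound: "\<exists>m. \<forall>i j. degree (M $ i $ j) \<le> m" for M :: "'a::zero poly^'b^'c"
proof -
  have "degree (M $ i $ j) \<le> Max (range (\<lambda>k. degree (M $ fst k $ snd k)))" for i j
    by (rule Max_ge) (auto intro: image_eqI[of _ _ "(i, j)"])
  thus ?thesis by blast
qed

lemma vmm_sum: "(sum f S) v* M = (\<Sum>k\<in>S. f k v* M)" for M :: "'a::comm_ring_1^'b^'c"
  by (induction S rule: infinite_finite_induct) (auto simp: vmm_add)

lemma funpow_commute:
  assumes "\<And>x. f (g x) = g (f x)" shows "(f ^^ k) ((g ^^ j) x) = (g ^^ j) ((f ^^ k) x)"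
proof -
  have 1: "f ((g ^^ j) x) = (g ^^ j) (f x)" for x j by (induction j) (simp_all add: assms)
  show ?thesis by (induction k) (simp_all add: 1)
qed

lemma peval_cnj_mult: "peval M s *v cnjv x = cnjv (peval M (cnj s) *v x)"
  by (simp add: vec_eq_iff matrix_vector_mult_def cnjv_def peval_cnj)

context cayley
begin

text \<open>When the output is a polynomial vector, the formal identity \<open>Q y = P u\<close>
  becomes an identity of values, inside and outside the disc. The excluded point \<open>-1\<close>
  corresponds to \<open>s\<close> at infinity.\<close>

lemma output_polynomial_identity:
  assumes Y: "cf Y = out U" and z: "z \<noteq> -1"
  shows "peval Q (sig z) *v pv Y z = peval P (sig z) *v pv U z"
proof -
  obtain m1 m2 where m12: "\<forall>i j. degree (cpm P $ i $ j) \<le> m1" "\<forall>i j. degree (cpm Q $ i $ j) \<le> m2"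
    using entry_degree_bound by metis
  define m where "m = max m1 m2"
  have m: "degree (cpm P $ i $ j) \<le> m" "degree (cpm Q $ i $ j) \<le> m" for i j
    using m12 by (auto simp: m_def intro: le_max_iff_disj[THEN iffD2])
  have f: "fps_of_poly (\<Sum>j\<in>UNIV. mob a m (cpm K $ i $ j) * V $ j) = (1 + fps_X) ^ m * (phm a (cpm K) *v fv (cf V)) $ i"
    if "\<And>i j. degree (cpm K $ i $ j) \<le> m" for K :: "real poly^'n^'n" and V i
    using that by (simp add: fps_of_poly_sum fps_of_poly_mult fps_of_mob matrix_vector_mult_def phm_def fv_cf sum_distrib_left mult.assoc)
  have "(\<Sum>j\<in>UNIV. mob a m (cpm Q $ i $ j) * Y $ j) = (\<Sum>j\<in>UNIV. mob a m (cpm P $ i $ j) * U $ j)" for i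
  proof -
    have "fps_of_poly (\<Sum>j\<in>UNIV. mob a m (cpm Q $ i $ j) * Y $ j) = fps_of_poly (\<Sum>j\<in>UNIV. mob a m (cpm P $ i $ j) * U $ j)"
      unfolding f[OF m(1)] f[OF m(2)] Y series_identity ..
    thus ?thesis by (simp only: fps_of_poly_eq_iff)
  qed
  from arg_cong[OF this, of "\<lambda>p. poly p z"]
  have "(1 + z) ^ m * (peval Q (sig z) *v pv Y z) $ i = (1 + z) ^ m * (peval P (sig z) *v pv U z) $ i" for i
    by (simp add: poly_sum poly_mob[OF m(1) z] poly_mob[OF m(2) z] sig_def peval_eq pv_def matrix_vector_mult_def sum_distrib_left mult.assoc)
  moreover have "1 + z \<noteq> 0" using z by (metis add.inverse_unique)
  ultimately show ?thesis by (simp add: vec_eq_iff)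
qed

text \<open>\<open>N\<close> inverts \<open>a I - A\<close> and commutes with \<open>A\<close>, so
  \<open>T = (a I + A) N\<close> is the Cayley transform of \<open>A\<close>.\<close>

lemma T_factor:
  shows "al *s (cmat N *v y) + (-1) *s (cmat A *v (cmat N *v y)) = y"
    and "al *s (cmat N *v y) + 1 *s (cmat A *v (cmat N *v y)) = T y"
    and "cmat A *v (cmat N *v y) = cmat N *v (cmat A *v y)"
proof -
  have "al \<noteq> 0" using a by simp
  have m: "mid x 0 = al *s (cmat N *v x)" for x by (simp add: mid_def mat_vec_scale)
  have "al *s (al *s (cmat N *v y)) = al *s (cmat A *v (cmat N *v y)) + al *s y"
    using mid_eq[of y 0] unfolding m by (simp add: mat_vec_scale)
  hence "al *s (al *s (cmat N *v y)) = al *s (cmat A *v (cmat N *v y) + y)" by (simp add: vsmult_add)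
  hence 1: "al *s (cmat N *v y) = cmat A *v (cmat N *v y) + y" by (rule fps_vec_cancel[OF \<open>al \<noteq> 0\<close>])
  thus "al *s (cmat N *v y) + (-1) *s (cmat A *v (cmat N *v y)) = y" by simp
  show "al *s (cmat N *v y) + 1 *s (cmat A *v (cmat N *v y)) = T y"
    unfolding T_def m 1 by (simp add: vec_eq_iff algebra_simps)
  have "al *s y = cmat A *v y + (al *s (y - (1 / al) *s (cmat A *v y)) + cmat B *v 0)"
    using \<open>al \<noteq> 0\<close> by (simp add: vec_eq_iff algebra_simps)
  from mid_unique[OF this] have "y = al *s (cmat N *v (y - (1 / al) *s (cmat A *v y)))" by (simp add: m)
  hence "y = al *s (cmat N *v y) - cmat N *v (cmat A *v y)"
    using \<open>al \<noteq> 0\<close> by (simp add: matrix_vector_mult_diff_distrib mat_vec_scale vec_eq_iff algebra_simps)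
  thus "cmat A *v (cmat N *v y) = cmat N *v (cmat A *v y)"
  proof -
    have "W = Z" if "u = X - Z" "X = W + u" for u W X Z :: "complex^'d"
    proof -
      have "u + Z = X" using that(1) by simp
      thus ?thesis using that(2) by (simp add: add.commute)
    qed
    thus ?thesis using 1 \<open>y = al *s (cmat N *v y) - cmat N *v (cmat A *v y)\<close> by blast
  qed
qed

lemma T_mid: "(T ^^ k) (mid x 0) = mid ((T ^^ k) x) 0"
proof (induction k)
  case (Suc k)
  have "mid (2 *s mid y 0 + (-1) *s y) 0 = 2 *s mid (mid y 0) 0 + (-1) *s mid y 0" for y
    by (simp only: mid_add_0 mid_scale_0)
  hence "T (mid y 0) = mid (T y) 0" for y by (simp add: T_def)
  thus ?case using Suc by simp
qed simp

text \<open>Condition (c) enters here: it lets \<open>det Q\<close> be divided out of \<open>b adj Q\<close>.\<close>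
lemma null_row_divisible:
  assumes v: "E.nrm v = 0" and n: "\<forall>k\<ge>n. cf v k = 0"
  shows "\<exists>p. p v* cpm Q = cayp a n (\<lambda>k. cnjv (cf v k))"
proof -
  \<comment> \<open>\<open>b\<close> and \<open>h\<close> are transforms of the conjugated input and
    of minus the conjugated output. The latter is polynomial because the output of a null input is
    finite.\<close>
  define b where "b = cayp a n (\<lambda>k. cnjv (cf v k))"
  define h where "h = cayp a n (\<lambda>k. (-1) *s cnjv (out v k))"
  define H where "H = pvec_of n (out v)"
  have cH: "cf H = out v" using null_output_finite[OF v n] by (auto simp: H_def cf_pvec_of fun_eq_iff)
  let ?S = "- ({s. poly (cp (det (xi_minus A))) s = 0} \<union> {al})"
  have "finite {s. poly (cp (det (xi_minus A))) s = 0}" by (rule poly_roots_finite) (simp add: cp_0_iff det_xi_minus_nonzero)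
  hence inf: "infinite ?S" by (simp add: Compl_eq_Diff_UNIV infinite_UNIV_char_0)
  define p0 where "p0 = b v* adj"
  have p0Q: "p0 v* cpm Q = del *s b" by (simp add: p0_def vmm_assoc adj_mult vmm_mat)
  \<comment> \<open>The first identity expresses, through \<open>null_transfer\<close>, that
    \<open>v\<close> is orthogonal to forced responses; the second is \<open>Q y = P u\<close> at
    \<open>- s\<close>. Together they show that \<open>p0\<close> annihilates
    \<open>P ** pstar Q + Q ** pstar P\<close>.\<close>
  have ptw: "pv p0 s v* peval P s = poly del s *s pv h s \<and> peval Q (- s) *v pv h s + peval P (- s) *v pv b s = 0"
    if s: "s \<in> ?S" for s
  proof -
    define z where "z = (al + s) / (al - s)"
    define wz where "wz = (\<Sum>k<n. z ^ k *s cnjv (cf v k))"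
    define hz where "hz = (\<Sum>k<n. z ^ k *s cnjv (out v k))"
    have sa: "s \<noteq> al" and snz: "al - s \<noteq> 0" using s by auto
    have a0: "al \<noteq> 0" using a by simp
    have z1: "1 + z = 2 * al / (al - s)" using snz by (simp add: z_def field_simps)
    have pb: "pv b s = (al - s) ^ n *s wz" unfolding b_def wz_def z_def by (rule pv_cayp[OF sa])
    have ph: "pv h s = (-1) *s ((al - s) ^ n *s hz)"
      unfolding h_def hz_def z_def pv_cayp[OF sa] by (simp add: vec_eq_iff sum_negf)
    have QP: "peval Q (- s) *v hz = peval P (- s) *v wz"
    proof -
      have "cnj z \<noteq> -1"
      proof
        assume "cnj z = -1"
        hence "z = cnj (-1)" by (metis complex_cnj_cnj)
        thus False using z1 snz a0 by simp
      qed
      moreover have "sig (cnj z) = cnj (- s)"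
      proof -
        have "al * (1 - z) = - s * (1 + z)" unfolding z1 using snz by (simp add: z_def field_simps)
        moreover have "1 + z \<noteq> 0" unfolding z1 using snz a0 by simp
        ultimately have "al * (1 - z) / (1 + z) = - s" by (simp add: field_simps)
        hence "cnj (al * (1 - z) / (1 + z)) = cnj (- s)" by simp
        thus ?thesis by (simp add: sig_def)
      qed
      ultimately have "peval Q (cnj (- s)) *v pv H (cnj z) = peval P (cnj (- s)) *v pv v (cnj z)"
        using output_polynomial_identity[OF cH, of "cnj z"] by simp
      hence "peval Q (- s) *v cnjv (pv H (cnj z)) = peval P (- s) *v cnjv (pv v (cnj z))"
        by (simp only: peval_cnj_mult)
      moreover have "cnjv (pv v (cnj z)) = wz" unfolding wz_def
        by (subst pv_cf[of n]) (use n in \<open>simp_all add: vec_eq_iff cnjv_def\<close>)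
      moreover have "cnjv (pv H (cnj z)) = hz" unfolding hz_def
        by (subst pv_cf[of n]) (simp_all add: H_def cf_pvec_of vec_eq_iff cnjv_def)
      ultimately show ?thesis by simp
    qed
    have two: "peval Q (- s) *v pv h s + peval P (- s) *v pv b s = 0"
      unfolding ph pb mat_vec_scale QP by simp
    obtain M where M: "(mat s - cmat A) ** M = mat 1" "M ** (mat s - cmat A) = mat 1"
      using resolvent_exists[of A s] s by auto
    have res: "x = 0" if "s *s x = cmat A *v x" for x
    proof -
      have "(mat s - cmat A) *v x = 0" using that by (simp add: matrix_vector_mult_diff_rdistrib mat_mult_vec)
      hence "M *v ((mat s - cmat A) *v x) = 0" by simp
      thus ?thesis unfolding matrix_vector_mul_assoc M by simp
    qed
    have inner: "cdot (pv p0 s v* peval P s) e = cdot (poly del s *s pv h s) e" for e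
    proof -
      obtain m where sm: "s *s m = cmat A *v m + cmat B *v e" using s by (auto intro: resolvent_state)
      define X where "X = ((al - s) / al) *s m"
      have "al *s X = (al - s) *s m" using a0 by (simp add: X_def)
      hence "al *s m = cmat A *v m + (al *s X + cmat B *v e)" using sm by (simp add: vec_eq_iff algebra_simps)
      from mid_unique[OF this] have mX: "mid X e = m" by simp
      have zX: "2 *s mid X e - X = z *s X"
      proof -
        have e: "(1 + z) * ((al - s) / al) = 2" unfolding z1 using snz a0 by simp
        have "2 * m $ i = (1 + z) * X $ i" for i by (simp only: X_def vector_smult_component mult.assoc[symmetric] e)
        thus ?thesis unfolding mX by (simp add: vec_eq_iff algebra_simps)
      qed
      \<comment> \<open>States whose whole free motion is invisible to \<open>v\<close>. The state
        \<open>X\<close> is not given as one reached by an impulse, but \<open>(z - T) X\<close> is;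
        since \<open>z - T\<close> is injective and \<open>K\<close> is \<open>T\<close>-invariant,
        \<open>X\<close> lies in \<open>K\<close>.\<close>
      define K where "K = {y. \<forall>i. ell ((T ^^ i) y) v = 0}"
      have ell0: "ell 0 v = 0" using ell_scale[of 0 0 v] by simp
      have subK: "vec.subspace K" unfolding K_def
        by (rule subspace_vecI) (use T_pow_scale[of _ 0 0] in \<open>simp_all add: ell0 T_pow_add T_pow_scale ell_add ell_scale\<close>)
      have TK: "T y \<in> K" if "y \<in> K" for y using that unfolding K_def by (simp add: funpow_swap1[symmetric]) (metis funpow.simps(2) o_apply)
      define f where "f y = z *s y + (-1) *s T y" for y
      have "X \<in> K"
      proof (rule invariant_subspace_preimage[OF _ _ subK])
        show lin: "Vector_Spaces.linear (*s) (*s) f"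
          by (rule linear_vecI) (simp_all add: f_def T_add T_scale vec_eq_iff algebra_simps)
        show "inj f"
        proof (rule injI)
          fix x y assume "f x = f y"
          define w where "w = x + (-1) *s y"
          have "z *s w = T w" using \<open>f x = f y\<close> unfolding w_def f_def T_add T_scale by (simp add: vec_eq_iff algebra_simps)
          hence w: "(1 + z) *s w = 2 *s mid w 0" by (simp add: T_def vec_eq_iff algebra_simps)
          have "s *s mid w 0 = cmat A *v mid w 0"
          proof -
            have "(2 * al / (al - s)) * w $ i = 2 * mid w 0 $ i" for i using arg_cong[OF w, of "\<lambda>v. v $ i"] unfolding z1 by simp
            hence "2 * (al * w $ i) = 2 * ((al - s) * mid w 0 $ i)" for i using snz by (simp add: field_simps)
            hence "al * w $ i = (al - s) * mid w 0 $ i" for i by simp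
            moreover have "al * mid w 0 $ i = (cmat A *v mid w 0) $ i + al * w $ i" for i
              using arg_cong[OF mid_eq[of w 0], of "\<lambda>v. v $ i"] by simp
            ultimately show ?thesis by (simp add: vec_eq_iff algebra_simps)
          qed
          hence "mid w 0 = 0" by (rule res)
          hence "(1 + z) *s w = 0" using w by simp
          moreover have "1 + z \<noteq> 0" unfolding z1 using snz a0 by simp
          ultimately have "w = 0" by (intro fps_vec_cancel[of "1 + z" w 0]) simp_all
          thus "x = y" by (simp add: w_def)
        qed
        show "f y \<in> K" if "y \<in> K" for y
          unfolding f_def by (intro vec.subspace_add[OF subK] vec.subspace_scale[OF subK] TK that)
        have "f X = 2 *s mid 0 e" unfolding f_def zX[symmetric] T_def mid_split[of X e] by (simp add: vec_eq_iff algebra_simps)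
        thus "f X \<in> K" unfolding K_def using null_annihilates_reachable[OF v] by simp
      qed
      hence "ell ((T ^^ 0) X) v = 0" unfolding K_def by blast
      hence lX: "ell X v = 0" by simp
      let ?y = "cmat C *v m + cmat D *v e"
      have wy: "cdot wz ?y = - cdot hz e" using null_transfer[OF v n zX] unfolding mX lX wz_def hz_def by simp
      have "cdot (pv p0 s v* peval P s) e = cdot (pv p0 s v* peval Q s) ?y" by (rule transfer_identity[OF re sm])
      also have "pv p0 s v* peval Q s = poly del s *s pv b s"
        unfolding pm_cpm[symmetric] pv_vmm[symmetric] p0Q pv_scale ..
      also have "cdot (poly del s *s pv b s) ?y = cdot (poly del s *s pv h s) e"
        unfolding cdot_scale_left pb ph wy by simp
      finally show ?thesis .
    qed
    have "pv p0 s v* peval P s - poly del s *s pv h s = 0"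
      by (rule eq_0_if_cdot) (use inner in \<open>simp add: cdot_def left_diff_distrib sum_subtractf\<close>)
    thus ?thesis using two by simp
  qed
  let ?M = "cpm (P ** pstar Q + Q ** pstar P)"
  have p0P: "p0 v* cpm P = del *s h"
    by (rule pv_eq_on_infinite[OF inf]) (use ptw in \<open>simp add: pv_vmm pv_scale pm_cpm\<close>)
  have p0M: "p0 v* ?M = 0"
  proof (rule pv_eq_on_infinite[OF inf])
    fix s assume s: "s \<in> ?S"
    have q: "pv p0 s v* peval Q s = poly del s *s pv b s"
      unfolding pm_cpm[symmetric] pv_vmm[symmetric] p0Q pv_scale ..
    have "pv (p0 v* ?M) s = pv p0 s v* peval P s v* transpose (peval Q (- s)) + pv p0 s v* peval Q s v* transpose (peval P (- s))"
      by (simp only: pv_vmm pm_cpm peval_add peval_mult peval_pstar vector_matrix_mult_add_rdistrib vmm_assoc)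
    also have "\<dots> = poly del s *s (peval Q (- s) *v pv h s + peval P (- s) *v pv b s)"
      by (simp only: q conjunct1[OF ptw[OF s]] vector_transpose_matrix mat_vec_scale vsmult_add)
    also have "\<dots> = 0" using ptw[OF s] by simp
    finally show "pv (p0 v* ?M) s = pv 0 s" by (simp add: pv_def vec_eq_iff)
  qed
  \<comment> \<open>\<open>del\<close> is good by way of \<open>p0\<close>; a good factor of least
    degree is taken. At a root of it the row \<open>p\<close> kills \<open>P\<close> and
    \<open>Q\<close>, so by (c) \<open>p\<close> vanishes there and the root cancels.\<close>
  define good where "good f \<longleftrightarrow> f \<noteq> 0 \<and> (\<exists>p. p v* cpm P = f *s h \<and> p v* cpm Q = f *s b \<and> p v* ?M = 0)" for f
  have "del \<noteq> 0" using del_nonzero[of 1] by auto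
  hence "good del" unfolding good_def using p0P p0Q p0M by blast
  then obtain f where f: "good f" "\<And>g. good g \<Longrightarrow> degree f \<le> degree g"
    using ex_has_least_nat[of good del degree] by blast
  obtain p where p: "f \<noteq> 0" "p v* cpm P = f *s h" "p v* cpm Q = f *s b" "p v* ?M = 0" using f(1) good_def by blast
  have "degree f = 0"
  proof (rule ccontr)
    assume "degree f \<noteq> 0"
    then obtain l where l: "poly f l = 0"
      using fundamental_theorem_of_algebra[of f] by (metis constant_degree)
    then obtain f' where f': "f = [:-l, 1:] * f'" using poly_eq_0_iff_dvd by blast
    have "pv p l v* peval P l = 0" "pv p l v* peval Q l = 0"
      unfolding pm_cpm[symmetric] pv_vmm[symmetric] p pv_scale l by simp_all
    hence "pv p l = 0" using complex_row_kernel[OF pr p(4)] by blast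
    hence "\<forall>j. \<exists>c. p $ j = [:-l, 1:] * c" by (simp add: pv_def vec_eq_iff poly_eq_0_iff_dvd dvd_def)
    from choice[OF this] obtain c where c: "\<And>j. p $ j = [:-l, 1:] * c j" by blast
    have pc: "p = [:-l, 1:] *s (\<chi> j. c j)" by (simp only: vec_eq_iff c vector_smult_component vec_lambda_beta) blast
    have l0: "[:-l, 1:] \<noteq> 0" by simp
    have "(\<chi> j. c j) v* cpm P = f' *s h" "(\<chi> j. c j) v* cpm Q = f' *s b" "(\<chi> j. c j) v* ?M = 0"
      by (rule fps_vec_cancel[OF l0]; use p(2-4) in \<open>simp only: pc vmm_scale f' vector_smult_assoc vector_smult_rzero\<close>)+
    moreover have "f' \<noteq> 0" using p(1) f' by auto
    ultimately have "good f'" unfolding good_def by blast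
    hence "degree f \<le> degree f'" by (rule f(2))
    moreover have "degree f = degree [:-l, 1:] + degree f'" unfolding f' by (rule degree_mult_eq) (use \<open>f' \<noteq> 0\<close> in auto)
    ultimately show False by simp
  qed
  then obtain c where c: "f = [:c:]" by (rule degree_eq_zeroE)
  hence "([:1 / c:] *s p) v* cpm Q = b" using p(1,3)
    by (simp add: vmm_scale vector_smult_assoc one_pCons[symmetric])
  thus ?thesis unfolding b_def by blast
qed

text \<open>A functional bounded in the seminorm must vanish on null inputs. By divisibility
  \<open>b = p Q\<close>, so \<open>b C = p R (xi I - A)\<close> vanishes when evaluated at
  \<open>A\<close>; expressed through \<open>T\<close>, this evaluation is the pairing of
  \<open>v\<close> with a free response.\<close>

lemma null_ell:
  assumes v: "E.nrm v = 0" shows "ell x v = 0"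
proof -
  obtain n where n: "\<forall>k\<ge>n. cf v k = 0" using cf_bound by blast
  obtain p where p: "p v* cpm Q = cayp a n (\<lambda>k. cnjv (cf v k))" using null_row_divisible[OF v n] by blast
  have QC: "cpm Q ** const_pmat (cmat C) = cpm R ** xi_minus (cmat A)"
    using re unfolding realizes_def by (metis cpm_mult cpm_const cpm_xi_minus)
  define F where "F x = al *s x + 1 *s (cmat A *v x)" for x
  define G where "G x = al *s x + (-1) *s (cmat A *v x)" for x
  define Nf where "Nf x = cmat N *v x" for x
  have GN: "G (Nf y) = y" and FN: "F (Nf y) = T y" and NF: "F (Nf y) = Nf (F y)" for y
    using T_factor[of y] by (simp_all add: F_def G_def Nf_def matrix_vector_right_distrib mat_vec_scale)
  \<comment> \<open>The factor \<open>N^n\<close> cancels the powers introduced by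
    \<open>cayp\<close>: \<open>(a + A)^k (a - A)^{n-k} N^n = T^k\<close>.\<close>
  have pow: "(G ^^ (n - k)) ((F ^^ k) ((Nf ^^ n) y)) = (T ^^ k) y" if "k < n" for k y
  proof -
    have 1: "(F ^^ k) ((Nf ^^ k) y) = (T ^^ k) y" for y k
    proof (induction k arbitrary: y)
      case (Suc k)
      have "(F ^^ Suc k) ((Nf ^^ Suc k) y) = (F ^^ k) (F ((Nf ^^ k) (Nf y)))" by (simp add: funpow_swap1)
      also have "F ((Nf ^^ k) (Nf y)) = (Nf ^^ k) (F (Nf y))" using funpow_commute[of F Nf 1 k] NF by simp
      finally show ?case unfolding Suc FN by (simp add: funpow_swap1)
    qed simp
    have 2: "(G ^^ j) ((Nf ^^ j) y) = y" for j y
    proof (induction j)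
      case (Suc j)
      have "(G ^^ Suc j) ((Nf ^^ Suc j) y) = (G ^^ j) (G (Nf ((Nf ^^ j) y)))" by (simp add: funpow_swap1)
      thus ?case unfolding GN Suc .
    qed simp
    have "(Nf ^^ n) y = (Nf ^^ (n - k)) ((Nf ^^ k) y)" using that by (simp add: funpow_add[symmetric, THEN fun_cong, unfolded o_apply])
    hence "(F ^^ k) ((Nf ^^ n) y) = (Nf ^^ (n - k)) ((F ^^ k) ((Nf ^^ k) y))" using funpow_commute[of F Nf] NF by simp
    thus ?thesis by (simp only: 1 2)
  qed
  have zero: "(\<Sum>k<n. cdot (cnjv (cf v k)) (cmat C *v (T ^^ k) y)) = 0" for y
  proof -
    let ?b = "cayp a n (\<lambda>k. cnjv (cf v k))"
    have cc: "const_pvec w v* const_pmat K = const_pvec (w v* K)" for w and K :: "complex^'d^'n"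
      by (simp add: const_pvec_def const_pmat_def vector_matrix_mult_def vec_eq_iff poly_eq_iff coeff_sum coeff_pCons mult.commute split: nat.split)
    have "?b v* const_pmat (cmat C) = (p v* cpm R) v* xi_minus (cmat A)"
      unfolding p[symmetric] vmm_assoc QC ..
    hence "row_eval (cmat A) (?b v* const_pmat (cmat C)) ((Nf ^^ n) y) = 0" by (simp only: row_eval_xi_minus)
    moreover have "?b v* const_pmat (cmat C)
        = (\<Sum>k<n. [:al, 1:] ^ k *s ([:al, -1:] ^ (n - k) *s const_pvec (cnjv (cf v k) v* cmat C)))"
      unfolding cayp_def vmm_sum vmm_scale cc vector_smult_assoc ..
    ultimately have "(\<Sum>k<n. cdot (cnjv (cf v k) v* cmat C) ((G ^^ (n - k)) ((F ^^ k) ((Nf ^^ n) y)))) = 0"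
      by (simp only: row_eval_sum row_eval_linear_power row_eval_const F_def[abs_def] G_def[abs_def])
    thus ?thesis by (simp add: pow cdot_vmm)
  qed
  have "ell x v = (\<Sum>k<n. cdot (cnjv (cf v k)) (fr x k))" unfolding ell_def by (rule half_eq) (use n in blast)
  thus ?thesis using zero[of "mid x 0"] by (simp add: fr_def T_mid)
qed

end

section \<open>Discrete storage functions\<close>

definition phv :: "real \<Rightarrow> complex poly^'b \<Rightarrow> complex fps^'b" where
  "phv a w = (\<chi> i. ph a (w $ i))"

context cayley
begin

text \<open>Since \<open>VV\<close> is a subspace, membership can be carried through linear maps on
  states; the goal is that it contains every state.\<close>

definition VV :: "(complex^'d) set" where
  "VV = {x. \<exists>K\<ge>0. \<forall>U. cmod (ell x U) \<le> K * E.nrm U}"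

lemma VV_add: "x \<in> VV \<Longrightarrow> y \<in> VV \<Longrightarrow> x + y \<in> VV"
proof -
  assume "x \<in> VV" "y \<in> VV"
  then obtain K L where K: "K \<ge> 0" "\<And>U. cmod (ell x U) \<le> K * E.nrm U" and L: "L \<ge> 0" "\<And>U. cmod (ell y U) \<le> L * E.nrm U"
    unfolding VV_def by blast
  have "cmod (ell (x + y) U) \<le> (K + L) * E.nrm U" for U
    unfolding ell_add using norm_triangle_ineq[of "ell x U" "ell y U"] K(2)[of U] L(2)[of U] by (simp add: algebra_simps)
  thus "x + y \<in> VV" unfolding VV_def using K(1) L(1) by (intro CollectI exI[of _ "K + L"]) simp
qed

lemma VV_scale: "x \<in> VV \<Longrightarrow> c *s x \<in> VV"
proof -
  assume "x \<in> VV"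
  then obtain K where K: "K \<ge> 0" "\<And>U. cmod (ell x U) \<le> K * E.nrm U" unfolding VV_def by blast
  have "cmod (ell (c *s x) U) \<le> (cmod c * K) * E.nrm U" for U
    unfolding ell_scale norm_mult using K(2)[of U] by (simp add: mult.assoc mult_left_mono)
  thus "c *s x \<in> VV" unfolding VV_def using K(1) by (intro CollectI exI[of _ "cmod c * K"]) simp
qed

lemma VV_T: "x \<in> VV \<Longrightarrow> T x \<in> VV"
proof -
  assume "x \<in> VV"
  then obtain K where K: "K \<ge> 0" "\<And>U. cmod (ell x U) \<le> K * E.nrm U" unfolding VV_def by blast
  have "cmod (ell (T x) U) \<le> K * E.nrm U" for U
    unfolding ell_T using K(2)[of "zz *s U"] by (simp only: E.nrm_zz)
  thus "T x \<in> VV" unfolding VV_def using K(1) by blast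
qed

lemma subspace_VV: "vec.subspace VV"
proof (rule subspace_vecI)
  have "cmod (ell 0 U) \<le> 0 * E.nrm U" for U using ell_scale[of 0 0 U] by simp
  thus "0 \<in> VV" unfolding VV_def by blast
qed (auto intro: VV_add VV_scale)

lemma ell_root: "ell (T x + (- l) *s x) U = ell x ([:- cnj l, 1:] *s U)"
proof -
  have "[:- cnj l, 1:] *s U = [:- cnj l:] *s U + zz *s U" by (simp add: vec_eq_iff)
  thus ?thesis by (simp only: ell_add ell_scale ell_T ell_add_right ell_scale_right) simp
qed

text \<open>A bounded functional on the multiples of \<open>z - l\<close> extends: evaluation at \<open>l\<close> is bounded modulo the
  null module, and the functional vanishes there.\<close>
lemma VV_root:
  assumes l: "cmod l < 1" and x: "T x + (- l) *s x \<in> VV"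
  shows "x \<in> VV"
proof -
  \<comment> \<open>\<open>ell\<close> is conjugate-linear in the input, so the root moves to its
    conjugate.\<close>
  define m where "m = cnj l"
  have m: "cmod m < 1" using l by (simp add: m_def)
  obtain K0 where K0: "K0 \<ge> 0" "\<And>U. cmod (ell x ([:- m, 1:] *s U)) \<le> K0 * E.nrm U"
  proof -
    have "\<exists>K\<ge>0. \<forall>U. cmod (ell x ([:- m, 1:] *s U)) \<le> K * E.nrm U"
      using x by (simp only: VV_def mem_Collect_eq ell_root m_def)
    thus ?thesis using that by blast
  qed
  obtain V :: "complex poly^'n^'n" and J d K where V: "poly d m \<noteq> 0" "K \<ge> 0"
    "\<And>U. \<exists>b. (\<forall>i. i \<notin> J \<longrightarrow> b $ i = 0) \<and> E.nrm (d *s U - V *v b) = 0"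
    "\<And>b. (\<forall>i. i \<notin> J \<longrightarrow> b $ i = 0) \<Longrightarrow> norm (pv b m) \<le> K * E.nrm (V *v b)"
    using evaluation_modulo_null[OF m] by blast
  obtain Kd where Kd: "Kd \<ge> 0" "\<And>U. E.nrm (d *s U) \<le> Kd * E.nrm U" using E.nrm_poly_scale by blast
  define S1 where "S1 = (\<Sum>i\<in>UNIV. E.nrm (column i V))"
  define S2 where "S2 = (\<Sum>i\<in>UNIV. cmod (ell x (column i V)))"
  have S12: "S1 \<ge> 0" "S2 \<ge> 0" unfolding S1_def S2_def by (auto intro!: sum_nonneg E.nrm_nonneg)
  \<comment> \<open>\<open>K0 / (1 - cmod m)\<close> pays for the division by \<open>z - m\<close>,
    \<open>1 + S1 * K\<close> for replacing \<open>Y\<close> by \<open>Y - Z\<close>, and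
    \<open>S2 * K\<close> for the constant part \<open>Z\<close>.\<close>
  define K1 where "K1 = K0 / (1 - cmod m) * (1 + S1 * K) + S2 * K"
  have K1: "K1 \<ge> 0" using K0(1) m S12 V(2) by (simp add: K1_def)
  have step1: "cmod (ell x (d *s U)) \<le> K1 * Kd * E.nrm U" for U
  proof -
    obtain b where b: "\<forall>i. i \<notin> J \<longrightarrow> b $ i = 0" "E.nrm (d *s U - V *v b) = 0" using V(3) by blast
    define Y where "Y = V *v b"
    have dU: "d *s U = Y + (d *s U - Y)" by simp
    have null: "E.nrm (d *s U - Y) = 0" using b(2) by (simp add: Y_def)
    have "ell x (Y + (d *s U - Y)) = ell x Y" unfolding ell_add_right null_ell[OF null] by simp
    hence e1: "ell x (d *s U) = ell x Y" using dU by simp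
    have "E.nrm (Y + (d *s U - Y)) = E.nrm Y" by (rule E.nrm_add_null[OF null])
    hence e2: "E.nrm Y \<le> Kd * E.nrm U" using Kd(2)[of U] dU by simp
    define e where "e = pv b m"
    \<comment> \<open>\<open>b\<close> is split into its value at \<open>m\<close> and a multiple of
      \<open>z - m\<close>. Evaluation at \<open>m\<close> is bounded on these \<open>b\<close>, and
      on the multiple the hypothesis on \<open>x\<close> applies.\<close>
    have "\<forall>j. \<exists>c. b $ j - [:e $ j:] = [:- m, 1:] * c"
      by (simp only: dvd_def[symmetric] poly_eq_0_iff_dvd[symmetric]) (simp add: e_def pv_def)
    from choice[OF this] obtain c where c: "\<And>j. b $ j - [:e $ j:] = [:- m, 1:] * c j" by blast
    have bj: "b $ j = [:e $ j:] + [:- m, 1:] * c j" for j using c[of j] by (simp only: diff_eq_eq add.commute)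
    have "b = const_pvec e + [:- m, 1:] *s (\<chi> j. c j)"
      by (simp only: vec_eq_iff vector_add_component vector_smult_component vec_lambda_beta const_pvec_def bj) blast
    hence Y: "Y = V *v const_pvec e + [:- m, 1:] *s (V *v (\<chi> j. c j))"
      by (simp only: Y_def matrix_vector_right_distrib mat_vec_scale)
    define Z where "Z = V *v const_pvec e"
    define W where "W = V *v (\<chi> j. c j)"
    have Z: "Z = (\<Sum>i\<in>UNIV. [:e $ i:] *s column i V)" unfolding Z_def mat_vec_columns by (simp add: const_pvec_def)
    have en: "cmod (e $ i) \<le> norm e" for i by (rule Finite_Cartesian_Product.norm_nth_le)
    have ne: "norm e \<le> K * E.nrm Y" unfolding e_def Y_def by (rule V(4)[OF b(1)])
    have nZ: "E.nrm Z \<le> S1 * norm e"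
    proof -
      have "E.nrm Z \<le> (\<Sum>i\<in>UNIV. E.nrm ([:e $ i:] *s column i V))" unfolding Z by (rule E.nrm_sum) simp
      also have "\<dots> \<le> (\<Sum>i\<in>UNIV. E.nrm (column i V) * norm e)"
        unfolding E.nrm_scale
        by (intro sum_mono, subst mult.commute) (rule mult_left_mono[OF en E.nrm_nonneg])
      finally show ?thesis by (simp add: S1_def sum_distrib_right)
    qed
    have lZ: "cmod (ell x Z) \<le> S2 * norm e"
    proof -
      have s: "ell x (sum f S) = (\<Sum>i\<in>S. ell x (f i))" if "finite S" for f :: "'n \<Rightarrow> complex poly^'n" and S
      proof -
        have "ell x 0 = 0" by (simp add: ell_def half_def cf_0)
        show ?thesis using that by (induction S rule: finite_induct) (simp_all add: ell_add_right \<open>ell x 0 = 0\<close>)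
      qed
      have "cmod (ell x Z) \<le> (\<Sum>i\<in>UNIV. cmod (ell x ([:e $ i:] *s column i V)))" unfolding Z
        by (subst s) (simp_all add: norm_sum)
      also have "\<dots> \<le> (\<Sum>i\<in>UNIV. cmod (ell x (column i V)) * norm e)"
        unfolding ell_scale_right norm_mult complex_mod_cnj
        by (intro sum_mono, subst mult.commute) (rule mult_left_mono[OF en norm_ge_zero])
      finally show ?thesis by (simp add: S2_def sum_distrib_right)
    qed
    have "(1 - cmod m) * E.nrm W \<le> E.nrm ([:- m, 1:] *s W)" by (rule E.nrm_root)
    also have "[:- m, 1:] *s W = Y - Z" by (simp add: Y Z_def W_def)
    also have "E.nrm (Y - Z) \<le> E.nrm Y + S1 * norm e" using E.nrm_triangle_diff[of Y Z] nZ by simp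
    also have "\<dots> \<le> E.nrm Y + S1 * (K * E.nrm Y)" using ne S12 by (simp add: mult_left_mono)
    finally have "E.nrm W \<le> (1 + S1 * K) * E.nrm Y / (1 - cmod m)" using m by (simp add: field_simps)
    hence "K0 * E.nrm W \<le> K0 * ((1 + S1 * K) * E.nrm Y / (1 - cmod m))" using K0(1) by (rule mult_left_mono)
    hence w: "cmod (ell x ([:- m, 1:] *s W)) \<le> K0 / (1 - cmod m) * (1 + S1 * K) * E.nrm Y"
      using K0(2)[of W] by simp
    have "cmod (ell x Y) \<le> cmod (ell x Z) + cmod (ell x ([:- m, 1:] *s W))"
      unfolding Y Z_def[symmetric] W_def[symmetric] ell_add_right by (rule norm_triangle_ineq)
    also have "\<dots> \<le> S2 * (K * E.nrm Y) + K0 / (1 - cmod m) * (1 + S1 * K) * E.nrm Y"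
      by (intro add_mono w order_trans[OF lZ] mult_left_mono ne S12)
    also have "\<dots> = K1 * E.nrm Y" by (simp add: K1_def algebra_simps)
    also have "\<dots> \<le> K1 * (Kd * E.nrm U)" by (intro mult_left_mono e2 K1)
    finally show ?thesis by (simp add: e1 mult.assoc)
  qed
  \<comment> \<open>So far only inputs of the form \<open>d U\<close> are covered. As
    \<open>d(m) \<noteq> 0\<close>, \<open>d\<close> is a nonzero constant plus a multiple of
    \<open>z - m\<close>, and on the latter the functional is already bounded.\<close>
  define d0 where "d0 = poly d m"
  have "[:- m, 1:] dvd d - [:d0:]" by (simp add: poly_eq_0_iff_dvd[symmetric] d0_def)
  then obtain g where "d - [:d0:] = [:- m, 1:] * g" by (elim dvdE)
  hence g: "d = [:d0:] + [:- m, 1:] * g" by (simp only: diff_eq_eq add.commute)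
  obtain Kg where Kg: "Kg \<ge> 0" "\<And>U. E.nrm (g *s U) \<le> Kg * E.nrm U" using E.nrm_poly_scale by blast
  have "cmod (ell x U) \<le> (K1 * Kd + K0 * Kg) / cmod d0 * E.nrm U" for U
  proof -
    have "d *s U = [:d0:] *s U + [:- m, 1:] *s (g *s U)" by (subst g) (simp only: vector_smult_assoc vector_sadd_rdistrib)
    hence "ell x (d *s U) = cnj d0 * ell x U + ell x ([:- m, 1:] *s (g *s U))" by (simp only: ell_add_right ell_scale_right)
    hence "cnj d0 * ell x U = ell x (d *s U) - ell x ([:- m, 1:] *s (g *s U))" by simp
    hence "cmod d0 * cmod (ell x U) \<le> cmod (ell x (d *s U)) + cmod (ell x ([:- m, 1:] *s (g *s U)))"
      by (metis complex_mod_cnj norm_mult norm_triangle_ineq4)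
    also have "\<dots> \<le> K1 * Kd * E.nrm U + K0 * (Kg * E.nrm U)"
      by (intro add_mono step1 order_trans[OF K0(2)] mult_left_mono Kg(2) K0(1))
    finally show ?thesis using V(1) by (simp add: d0_def field_simps)
  qed
  thus ?thesis unfolding VV_def using K1 Kd(1) K0(1) Kg(1) by (intro CollectI exI[of _ "(K1 * Kd + K0 * Kg) / cmod d0"]) simp
qed

lemma VV_mid: "x \<in> VV \<Longrightarrow> mid x 0 \<in> VV"
proof -
  assume x: "x \<in> VV"
  have "mid x 0 = (1 / 2) *s (T x + x)" by (simp add: T_def vector_smult_assoc)
  thus ?thesis using VV_scale[OF VV_add[OF VV_T[OF x] x]] by metis
qed

lemma VV_mid_preimage: "mid x 0 \<in> VV \<Longrightarrow> x \<in> VV"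
proof (rule invariant_subspace_preimage[where f = "\<lambda>x. mid x 0", OF _ _ subspace_VV VV_mid])
  show "Vector_Spaces.linear (*s) (*s) (\<lambda>x. mid x 0)" by (rule linear_vecI) (simp_all add: mid_add_0 mid_scale_0)
  show "inj (\<lambda>x. mid x 0)"
  proof (rule injI)
    fix x y assume "mid x 0 = mid y 0"
    moreover have "al *s w = al *s mid w 0 - cmat A *v mid w 0" for w using mid_eq[of w 0] by simp
    ultimately have "al *s x = al *s y" by metis
    thus "x = y" by (rule fps_vec_cancel[rotated]) (use a in simp)
  qed
qed

lemma VV_T_preimage: "(T ^^ k) x \<in> VV \<Longrightarrow> x \<in> VV"
proof (induction k)
  case (Suc k)
  hence "T ((T ^^ k) x) + (- 0) *s ((T ^^ k) x) \<in> VV" by simp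
  hence "(T ^^ k) x \<in> VV" by (rule VV_root[rotated]) simp
  thus ?case by (rule Suc.IH)
qed simp

text \<open>The point \<open>-1\<close> lies on the unit circle, out of reach of
  \<open>VV_root\<close>. But \<open>T x + x\<close> is twice \<open>mid x 0\<close>, and this map
  is injective and preserves the finite-dimensional space \<open>VV\<close>.\<close>

lemma VV_T_plus_id_preimage: "((\<lambda>x. T x + x) ^^ k) x \<in> VV \<Longrightarrow> x \<in> VV"
proof (induction k)
  case (Suc k)
  let ?y = "((\<lambda>x. T x + x) ^^ k) x"
  have "T ?y + ?y \<in> VV" using Suc.prems by simp
  hence "(1 / 2) *s (T ?y + ?y) \<in> VV" by (rule VV_scale)
  moreover have "(1 / 2) *s (T ?y + ?y) = mid ?y 0" by (simp add: T_def vector_smult_assoc)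
  ultimately have "?y \<in> VV" using VV_mid_preimage by simp
  thus ?case by (rule Suc.IH)
qed simp

text \<open>Generating-function form of \<open>Q y = R x(0)\<close> for the free response; the
  factor \<open>1 + z\<close> and the constant \<open>a\<close> come from the initial term of the
  midpoint recursion.\<close>

lemma free_response_series: "phm a (cpm Q) *v ((1 + fps_X) *s fv (fr x)) = fps_const al *s (phm a (cpm R) *v (\<chi> i. fps_const (x $ i)))"
proof -
  let ?M = "fv (\<lambda>k. mid ((T ^^ k) x) 0)" and ?X = "fv (\<lambda>k. (T ^^ k) x)" and ?x = "\<chi> i. fps_const (x $ i)"
  have 1: "fps_const al *s ?M = fm (cmat A) *v ?M + fps_const al *s ?X"
    unfolding fv_scale[symmetric] fv_mult[symmetric] fv_add[symmetric] mid_eq by simp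
  have 2: "?X $ i + fps_X * ?X $ i = fps_const (x $ i) + fps_X * (2 * ?M $ i)" for i
  proof (rule fps_ext)
    fix k
    show "fps_nth (?X $ i + fps_X * ?X $ i) k = fps_nth (fps_const (x $ i) + fps_X * (2 * ?M $ i)) k"
      by (cases k) (simp_all add: fv_def T_def numeral_fps_const)
  qed
  have "(1 + fps_X) * (((mat (sF a) - fm (cmat A)) *v ?M) $ i) = fps_const al * ?x $ i" for i
  proof -
    have e1: "(fm (cmat A) *v ?M) $ i = fps_const al * ?M $ i - fps_const al * ?X $ i"
      using arg_cong[OF 1, of "\<lambda>v. v $ i"] by simp
    have "(1 + fps_X) * (sF a * ?M $ i - (fm (cmat A) *v ?M) $ i)
        = (fps_const al * (1 - fps_X)) * ?M $ i - (1 + fps_X) * (fps_const al * ?M $ i - fps_const al * ?X $ i)"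
      unfolding sF_mult[symmetric] e1 by (simp only: right_diff_distrib mult.assoc)
    also have "\<dots> = fps_const al * ?x $ i" using 2[of i] by (simp del: fps_const_mult) algebra
    finally show ?thesis by (simp add: matrix_vector_mult_diff_rdistrib mat_mult_vec)
  qed
  hence 3: "(1 + fps_X) *s ((mat (sF a) - fm (cmat A)) *v ?M) = fps_const al *s ?x" by (simp only: vec_eq_iff vector_smult_component) blast
  have QC: "phm a (cpm Q) ** fm (cmat C) = phm a (cpm R) ** (mat (sF a) - fm (cmat A))"
    using re unfolding realizes_def by (metis cpm_mult cpm_const cpm_xi_minus phm_mult phm_const phm_xi_minus)
  have "fv (fr x) = fm (cmat C) *v ?M" unfolding fv_mult[symmetric] by (simp add: fr_def[abs_def])
  hence "phm a (cpm Q) *v ((1 + fps_X) *s fv (fr x)) = (1 + fps_X) *s (phm a (cpm R) *v ((mat (sF a) - fm (cmat A)) *v ?M))"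
    by (simp only: mat_vec_scale matrix_vector_mul_assoc QC)
  also have "\<dots> = phm a (cpm R) *v ((1 + fps_X) *s ((mat (sF a) - fm (cmat A)) *v ?M))" by (simp only: mat_vec_scale)
  finally show ?thesis by (simp only: 3 mat_vec_scale)
qed

lemma phm_Q_cancel: "phm a (cpm Q) *v X = phm a (cpm Q) *v Y \<Longrightarrow> X = Y"
proof -
  assume "phm a (cpm Q) *v X = phm a (cpm Q) *v Y"
  hence "phm a adj *v (phm a (cpm Q) *v X) = phm a adj *v (phm a (cpm Q) *v Y)" by simp
  hence "ph a del *s X = ph a del *s Y"
    unfolding matrix_vector_mul_assoc phm_mult[symmetric] adj_mult phm_mat mat_mult_vec .
  thus ?thesis by (rule fps_vec_cancel[rotated]) (use ph_del_nth_0 in auto)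
qed

lemma fr_binomial: "fps_nth (((1 + fps_X) ^ j *s fv (fr x)) $ i) (k + j) = fr (((\<lambda>x. T x + x) ^^ j) x) k $ i"
proof (induction j arbitrary: k)
  case (Suc j)
  have "((1 + fps_X) ^ Suc j *s fv (fr x)) $ i = ((1 + fps_X) ^ j *s fv (fr x)) $ i + fps_X * ((1 + fps_X) ^ j *s fv (fr x)) $ i"
    by (simp add: algebra_simps)
  hence "fps_nth (((1 + fps_X) ^ Suc j *s fv (fr x)) $ i) (k + Suc j)
      = fps_nth (((1 + fps_X) ^ j *s fv (fr x)) $ i) (Suc k + j) + fps_nth (((1 + fps_X) ^ j *s fv (fr x)) $ i) (k + j)"
    by (simp only: fps_add_nth fps_X_mult_nth) simp
  thus ?case unfolding Suc by (simp add: fr_add fr_T)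
qed (simp add: fv_def)

text \<open>The free response of such a state is, up to finitely many terms, the forced response to a
  polynomial input, so Cauchy-Schwarz applies after a shift.\<close>
lemma VV_reachable:
  assumes x: "cpm R *v const_pvec x = cpm P *v u - cpm Q *v y"
  shows "x \<in> VV"
proof -
  obtain m1 m2 where "\<forall>i j. degree ((\<chi> i j. u $ i :: complex poly^'n^'n) $ i $ j) \<le> m1"
    "\<forall>i j. degree ((\<chi> i j. y $ i :: complex poly^'n^'n) $ i $ j) \<le> m2"
    using entry_degree_bound[of "\<chi> i j. u $ i"] entry_degree_bound[of "\<chi> i j. y $ i"] by metis
  hence m12: "degree (u $ i) \<le> max m1 m2" "degree (y $ i) \<le> max m1 m2" for i by (auto simp: le_max_iff_disj)
  define m where "m = max m1 m2"
  define ud where "ud = (\<chi> i. mob a m (u $ i))"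
  define yd where "yd = (\<chi> i. mob a m (y $ i))"
  have fd: "fv (cf ud) = (1 + fps_X) ^ m *s phv a u" "fv (cf yd) = (1 + fps_X) ^ m *s phv a y"
    by (simp_all add: vec_eq_iff fv_cf ud_def yd_def fps_of_mob m12 m_def phv_def)
  have ph_hom: "phv a (K *v w) = phm a K *v phv a w" for K :: "complex poly^'b^'c" and w
    by (simp add: phv_def phm_def matrix_vector_mult_def vec_eq_iff ph_sum ph_mult)
  have ph_dif: "phv a (v - w) = phv a v - phv a w" for v w :: "complex poly^'n"
    using ph_add[of a "_ - _"] by (simp add: phv_def vec_eq_iff eq_diff_eq ph_add[symmetric])
  have "phv a (const_pvec x) = (\<chi> i. fps_const (x $ i))" by (simp add: phv_def const_pvec_def ph_const)
  hence Rx: "phm a (cpm R) *v (\<chi> i. fps_const (x $ i)) = phm a (cpm P) *v phv a u - phm a (cpm Q) *v phv a y"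
    using arg_cong[OF x, of "phv a"] by (simp add: ph_hom ph_dif)
  have "phm a (cpm Q) *v ((1 + fps_X) ^ Suc m *s fv (fr x)) = (1 + fps_X) ^ m *s (phm a (cpm Q) *v ((1 + fps_X) *s fv (fr x)))"
    by (simp only: mat_vec_scale vector_smult_assoc power_Suc2)
  also have "\<dots> = fps_const al *s ((1 + fps_X) ^ m *s (phm a (cpm P) *v phv a u - phm a (cpm Q) *v phv a y))"
    unfolding free_response_series Rx by (simp add: vector_smult_assoc mult.commute)
  also have "(1 + fps_X) ^ m *s (phm a (cpm P) *v phv a u - phm a (cpm Q) *v phv a y)
      = phm a (cpm P) *v fv (cf ud) - phm a (cpm Q) *v fv (cf yd)"
    unfolding fd mat_vec_scale by (simp add: vec_eq_iff algebra_simps)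
  also have "\<dots> = phm a (cpm Q) *v (fv (out ud) - fv (cf yd))"
    unfolding series_identity[symmetric] by (simp add: matrix_vector_mult_diff_distrib)
  finally have "phm a (cpm Q) *v ((1 + fps_X) ^ Suc m *s fv (fr x)) = phm a (cpm Q) *v (fps_const al *s (fv (out ud) - fv (cf yd)))"
    by (simp only: mat_vec_scale)
  hence key: "(1 + fps_X) ^ Suc m *s fv (fr x) = fps_const al *s (fv (out ud) - fv (cf yd))" by (rule phm_Q_cancel)
  \<comment> \<open>Multiplication of the response series by \<open>(1 + z)^{m+1}\<close> clears the
    Cayley denominators. Beyond the first \<open>m + 1\<close> terms it amounts to applying
    \<open>T + id\<close> that often to the state.\<close>
  define x' where "x' = ((\<lambda>x. T x + x) ^^ Suc m) x"
  have frx': "fr x' k $ i = al * (out ud (k + Suc m) $ i - cf yd (k + Suc m) $ i)" for k i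
    unfolding x'_def fr_binomial[symmetric] key by (simp add: fv_def right_diff_distrib)
  obtain L where L: "\<forall>k\<ge>L. cf ud k = 0" "\<forall>k\<ge>L. cf yd k = 0" using common_bound by blast
  define K where "K = L + Suc m"
  have "fr ((T ^^ L) x') = (\<lambda>k. al *s out ud (k + K))"
  proof (rule ext)
    fix k
    have "fr ((T ^^ L) x') k = fr x' (k + L)" by (simp add: fr_def funpow_add)
    thus "fr ((T ^^ L) x') k = al *s out ud (k + K)"
      using L by (simp add: vec_eq_iff frx' K_def add.assoc)
  qed
  hence e: "ell ((T ^^ L) x') U = al * half (zz ^ K *s U) (out ud)" for U
    by (simp only: ell_def half_scale_right half_zz_power)
  \<comment> \<open>Causality: the delay \<open>K\<close> is at least the length of
    \<open>ud\<close>, so the response to the delayed input starts after \<open>ud\<close> has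
    ended.\<close>
  have "half ud (out (zz ^ K *s U)) = 0" for U
  proof -
    have "half ud (out (zz ^ K *s U)) = (\<Sum>k<K. cdot (cnjv (cf ud k)) (out (zz ^ K *s U) k))"
      by (rule half_eq) (use L(1) in \<open>simp add: K_def\<close>)
    thus ?thesis by (simp add: out_zz_power cdot_def)
  qed
  hence "half (zz ^ K *s U) (out ud) = 2 * hE (zz ^ K *s U) ud" for U by (simp add: hE_def)
  hence "cmod (ell ((T ^^ L) x') U) \<le> (2 * a * E.nrm ud) * E.nrm U" for U
    using E.cauchy_schwarz_nrm[of "zz ^ K *s U" ud] a by (simp add: e norm_mult nrm_zz_power mult_ac)
  hence "(T ^^ L) x' \<in> VV" unfolding VV_def using a E.nrm_nonneg by (intro CollectI exI[of _ "2 * a * E.nrm ud"]) simp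
  hence "x' \<in> VV" by (rule VV_T_preimage)
  thus ?thesis unfolding x'_def by (rule VV_T_plus_id_preimage)
qed

end

lemma matrix_diff_rdistrib: "(A - B) ** C = A ** C - B ** C" for A B :: "'a::comm_ring_1^'b^'c"
  by (simp add: matrix_matrix_mult_def vec_eq_iff sum_subtractf left_diff_distrib)

text \<open>The \<open>f\<close> for which \<open>f I\<close> is a right combination of
  \<open>P\<close> and \<open>Q\<close> form an ideal. By (b), for each point of the closed right
  half-plane the ideal has a member that is nonzero there, so an element of least degree has all its
  roots in the open left half-plane.\<close>

lemma right_half_plane_bezout:
  fixes P Q :: "real poly^'n^'n"
  assumes pr: "positive_real_pair P Q"
  shows "\<exists>f E1 E2. f \<noteq> 0 \<and> (\<forall>l. poly f l = 0 \<longrightarrow> Re l < 0) \<and> cpm P ** E1 - cpm Q ** E2 = mat f"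
proof -
  define Id where "Id f \<longleftrightarrow> (\<exists>E1 E2. cpm P ** E1 - cpm Q ** E2 = mat f)" for f
  have mul: "Id (f * g)" if f: "Id f" for f g
  proof -
    obtain E1 E2 where E: "cpm P ** E1 - cpm Q ** E2 = mat f" using f Id_def by blast
    have "cpm P ** (E1 ** mat g) - cpm Q ** (E2 ** mat g) = (cpm P ** E1 - cpm Q ** E2) ** mat g"
      by (simp only: matrix_mul_assoc matrix_diff_rdistrib)
    also have "\<dots> = mat (f * g)" unfolding E by (auto simp: matrix_matrix_mult_def mat_def vec_eq_iff if_distrib[of "\<lambda>x. x * _"] cong: if_cong)
    finally show ?thesis unfolding Id_def by blast
  qed
  have dif: "Id (f - g)" if fg: "Id f" "Id g" for f g
  proof -
    obtain E1 E2 F1 F2 where E: "cpm P ** E1 - cpm Q ** E2 = mat f" "cpm P ** F1 - cpm Q ** F2 = mat g" using fg Id_def by blast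
    have "cpm P ** (E1 - F1) - cpm Q ** (E2 - F2) = (cpm P ** E1 - cpm Q ** E2) - (cpm P ** F1 - cpm Q ** F2)"
      by (simp add: matrix_matrix_mult_def vec_eq_iff sum_subtractf right_diff_distrib)
    also have "\<dots> = mat (f - g)" unfolding E by (auto simp: mat_def vec_eq_iff)
    finally show ?thesis unfolding Id_def by blast
  qed
  have pt: "\<exists>f. Id f \<and> poly f l \<noteq> 0" if l: "Re l \<ge> 0" for l
  proof -
    have "\<exists>E. E ** transpose (PmQ P Q l) = mat 1"
      unfolding matrix_left_invertible_ker transpose_matrix_vector PmQ_kernel using positive_real_pairD(2)[OF pr l] by blast
    then obtain E where E: "PmQ P Q l ** E = mat 1" unfolding left_invertible_transpose by blast
    define E1 where "E1 = (\<chi> i j. E $ Inl i $ j)"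
    define E2 where "E2 = (\<chi> i j. E $ Inr i $ j)"
    have one: "peval P l ** E1 - peval Q l ** E2 = mat 1"
      unfolding E[symmetric] by (simp add: vec_eq_iff matrix_matrix_mult_def UNIV_sum_type PmQ_def E1_def E2_def sum_negf)
    \<comment> \<open>A constant right inverse of \<open>[P -Q](l)\<close> gives a polynomial
      combination that equals the identity at \<open>l\<close>; its adjugate completes it to
      \<open>det M\<close> times the identity.\<close>
    define M where "M = cpm P ** const_pmat E1 - cpm Q ** const_pmat E2"
    have "pm M l = mat 1"
    proof -
      have "pm (const_pmat K) l = K" for K :: "complex^'n^'n" by (simp add: pm_def const_pmat_def vec_eq_iff)
      moreover have "pm (K - L) l = pm K l - pm L l" for K L :: "complex poly^'n^'n" by (simp add: pm_def vec_eq_iff)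
      ultimately show ?thesis unfolding M_def by (simp add: pm_mult pm_cpm one)
    qed
    hence "poly (det M) l \<noteq> 0" using det_pm[of M l] by simp
    moreover have "Id (det M)"
    proof -
      have "cpm P ** (const_pmat E1 ** adjm M) - cpm Q ** (const_pmat E2 ** adjm M) = M ** adjm M"
        unfolding M_def by (simp only: matrix_mul_assoc matrix_diff_rdistrib)
      thus ?thesis unfolding Id_def matrix_mult_adjm by blast
    qed
    ultimately show ?thesis by blast
  qed
  obtain g where "Id g" "poly g 0 \<noteq> 0" using pt[of 0] by auto
  hence "Id g \<and> g \<noteq> 0" by auto
  then obtain f where f: "Id f" "f \<noteq> 0" "\<And>h. Id h \<Longrightarrow> h \<noteq> 0 \<Longrightarrow> degree f \<le> degree h"
    using ex_has_least_nat[of "\<lambda>f. Id f \<and> f \<noteq> 0" g degree] by blast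
  have "Re l < 0" if "poly f l = 0" for l
  proof (rule ccontr)
    assume "\<not> Re l < 0"
    then obtain h where h: "Id h" "poly h l \<noteq> 0" using pt[of l] by auto
    have "h mod f = h - f * (h div f)" by (simp add: minus_mult_div_eq_mod)
    hence "Id (h mod f)" using dif[OF h(1) mul[OF f(1)]] by simp
    hence "h mod f = 0" using f(3)[of "h mod f"] degree_mod_less'[OF f(2), of h] by fastforce
    hence "f dvd h" by (simp add: mod_eq_0_iff_dvd)
    thus False using h(2) that by (auto elim!: dvdE)
  qed
  thus ?thesis using f(1,2) Id_def by blast
qed

context cayley
begin

text \<open>A point \<open>l\<close> of the open left half-plane corresponds to
  \<open>z = (a + l) / (a - l)\<close> in the open disc, and \<open>T - z\<close> is a multiple of
  \<open>A - l\<close> followed by \<open>mid\<close>.\<close>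

lemma VV_left_half_plane:
  assumes l: "Re l < 0" and x: "cmat A *v x + (- l) *s x \<in> VV"
  shows "x \<in> VV"
proof -
  have nz: "al - l \<noteq> 0" using l a by (auto simp: complex_eq_iff)
  define z where "z = (al + l) / (al - l)"
  have "(cmod (al + l))\<^sup>2 < (cmod (al - l))\<^sup>2"
    using mult_pos_neg[OF a l] unfolding cmod_power2 by (simp add: power2_eq_square algebra_simps)
  hence "cmod (al + l) < cmod (al - l)" by (rule power_less_imp_less_base) simp
  hence z1: "cmod z < 1" using nz by (simp add: z_def norm_divide)
  let ?y = "cmat A *v x + (- l) *s x"
  have m: "mid w 0 = al *s (cmat N *v w)" for w by (simp add: mid_def mat_vec_scale)
  have "T x + (- z) *s x = (2 / (al - l)) *s mid ?y 0"
  proof -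
    have e: "al *s (cmat N *v w) = cmat N *v (cmat A *v w) + w" for w
      using T_factor(1)[of w] T_factor(3)[of w] by (simp add: diff_eq_eq add.commute)
    define p where "p = cmat N *v x"
    define r where "r = cmat N *v (cmat A *v x)"
    have "cmat N *v ?y = r + (- l) *s p" by (simp only: r_def p_def matrix_vector_right_distrib mat_vec_scale)
    moreover have xi: "x $ i = al * p $ i - r $ i" for i
      using arg_cong[OF e[of x], of "\<lambda>v. v $ i"] by (simp add: p_def r_def)
    moreover have "(T x + (- z) *s x) $ i = (2 / (al - l)) * (al * (r $ i - l * p $ i))" for i
    proof -
      have "(T x + (- z) *s x) $ i = 2 * (al * p $ i) - x $ i - z * x $ i" by (simp add: T_def m p_def)
      thus ?thesis unfolding xi z_def using nz by (simp add: field_simps)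
    qed
    ultimately show ?thesis unfolding m by (simp add: vec_eq_iff)
  qed
  hence "T x + (- z) *s x \<in> VV" using VV_scale[OF VV_mid[OF x]] by simp
  thus ?thesis by (rule VV_root[OF z1])
qed

text \<open>Induction over the roots of \<open>f\<close>. By
  \<open>(xi - l) R x = Q C x + R (A - l) x\<close>, passing from \<open>x\<close> to
  \<open>(A - l) x\<close> lowers the degree and changes only \<open>y\<close>; the way back is
  \<open>VV_left_half_plane\<close>.\<close>

lemma VV_multiple:
  assumes "f \<noteq> 0" "\<And>l. poly f l = 0 \<Longrightarrow> Re l < 0" "f *s (cpm R *v const_pvec x) = cpm P *v u - cpm Q *v y"
  shows "x \<in> VV"
  using assms
proof (induction "degree f" arbitrary: f x y)
  case 0
  then obtain c where c: "f = [:c:]" "c \<noteq> 0" by (metis degree_eq_zeroE pCons_0_0)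
  have "const_pvec (c *s x) = [:c:] *s const_pvec x" by (simp add: const_pvec_def vec_eq_iff)
  hence "cpm R *v const_pvec (c *s x) = cpm P *v u - cpm Q *v y" using 0(4) c by (simp only: mat_vec_scale)
  hence "c *s x \<in> VV" by (rule VV_reachable)
  hence "(1 / c) *s (c *s x) \<in> VV" by (rule VV_scale)
  thus ?case using c by (simp add: vector_smult_assoc)
next
  case (Suc n)
  then obtain l where l: "poly f l = 0"
    using fundamental_theorem_of_algebra[of f] by (metis constant_degree nat.distinct(1))
  then obtain g where g: "f = [:-l, 1:] * g" using poly_eq_0_iff_dvd by blast
  have g0: "g \<noteq> 0" using Suc(3) g by auto
  have "degree f = degree [:-l, 1:] + degree g" unfolding g by (rule degree_mult_eq) (use g0 in auto)
  hence dg: "n = degree g" using Suc(2) by simp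
  let ?x = "cmat A *v x + (- l) *s x"
  have QC: "cpm Q ** const_pmat (cmat C) = cpm R ** xi_minus (cmat A)"
    using re unfolding realizes_def by (metis cpm_mult cpm_const cpm_xi_minus)
  have "[:-l, 1:] *s const_pvec x = xi_minus (cmat A) *v const_pvec x + const_pvec ?x"
    unfolding xi_minus_mult_vec const_pmat_mult_vec by (simp add: vec_eq_iff const_pvec_def)
  hence "[:-l, 1:] *s (cpm R *v const_pvec x) = cpm Q *v (const_pmat (cmat C) *v const_pvec x) + cpm R *v const_pvec ?x"
    by (simp only: mat_vec_scale[symmetric] matrix_vector_right_distrib matrix_vector_mul_assoc QC)
  hence e: "f *s (cpm R *v const_pvec x) = cpm Q *v (g *s (const_pmat (cmat C) *v const_pvec x)) + g *s (cpm R *v const_pvec ?x)"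
    by (simp only: g mult.commute[of _ g] vector_smult_assoc[symmetric] vsmult_add mat_vec_scale)
  have "g *s (cpm R *v const_pvec ?x) = cpm P *v u - cpm Q *v (y + g *s (const_pmat (cmat C) *v const_pvec x))"
    using Suc(5) unfolding e by (simp add: matrix_vector_right_distrib algebra_simps eq_diff_eq diff_eq_eq)
  moreover have "Re r < 0" if "poly g r = 0" for r using Suc(4)[of r] that g by simp
  ultimately have "?x \<in> VV" using Suc(1)[OF dg g0] by blast
  thus ?case using VV_left_half_plane Suc(4)[OF l] by blast
qed

lemma VV_all: "x \<in> VV"
proof -
  obtain f E1 E2 where f: "f \<noteq> 0" "\<And>l. poly f l = 0 \<Longrightarrow> Re l < 0" "cpm P ** E1 - cpm Q ** E2 = mat f"
    using right_half_plane_bezout[OF pr] by blast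
  let ?r = "cpm R *v const_pvec x"
  have "f *s ?r = cpm P *v (E1 *v ?r) - cpm Q *v (E2 *v ?r)"
    unfolding mat_mult_vec[symmetric] f(3)[symmetric] by (simp only: matrix_vector_mult_diff_rdistrib matrix_vector_mul_assoc[symmetric])
  thus ?thesis using VV_multiple[OF f(1,2)] by blast
qed

section \<open>Discrete available energy and the resulting storage function\<close>

definition rmid :: "real^'d \<Rightarrow> real^'n \<Rightarrow> real^'d" where
  "rmid x u = N *v (a *\<^sub>R x + B *v u)"

lemma rmid_unique: "a *\<^sub>R m = A *v m + (a *\<^sub>R x + B *v u) \<Longrightarrow> m = rmid x u"
proof -
  assume m: "a *\<^sub>R m = A *v m + (a *\<^sub>R x + B *v u)"
  have "N ** (mat a - A) = mat 1" using N by (simp add: matrix_left_right_inverse)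
  moreover have "(mat a - A) *v m = a *\<^sub>R x + B *v u"
    using m by (simp add: matrix_vector_mult_diff_rdistrib mat_mult_vec scalar_mult_eq_scaleR)
  ultimately show ?thesis unfolding rmid_def by (metis matrix_vector_mul_assoc matrix_vector_mul_lid)
qed

primrec rst :: "real^'d \<Rightarrow> (nat \<Rightarrow> real^'n) \<Rightarrow> nat \<Rightarrow> real^'d" where
  "rst x u 0 = x"
| "rst x u (Suc k) = 2 *\<^sub>R rmid (rst x u k) (u k) - rst x u k"

definition rout :: "real^'d \<Rightarrow> (nat \<Rightarrow> real^'n) \<Rightarrow> nat \<Rightarrow> real^'n" where
  "rout x u k = C *v rmid (rst x u k) (u k) + D *v u k"

definition rval :: "real^'d \<Rightarrow> (nat \<Rightarrow> real^'n) \<Rightarrow> nat \<Rightarrow> real" where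
  "rval x u n = (\<Sum>k<n. - (u k \<bullet> rout x u k))"

definition rvals :: "real^'d \<Rightarrow> real set" where
  "rvals x = {rval x u n | u n. \<forall>k\<ge>n. u k = 0}"

lemma rmid_lin: "rmid (x + y) (u + v) = rmid x u + rmid y v" "rmid (c *\<^sub>R x) (c *\<^sub>R u) = c *\<^sub>R rmid x u"
  by (simp_all add: rmid_def matrix_vector_right_distrib scaleR_right_distrib matrix_vector_mult_scaleR algebra_simps)

lemma rst_lin: "rst (x + y) (\<lambda>k. u k + v k) k = rst x u k + rst y v k" "rst (c *\<^sub>R x) (\<lambda>k. c *\<^sub>R u k) k = c *\<^sub>R rst x u k"
  by (induction k) (simp_all add: rmid_lin algebra_simps)

lemma rout_lin: "rout (x + y) (\<lambda>k. u k + v k) k = rout x u k + rout y v k" "rout (c *\<^sub>R x) (\<lambda>k. c *\<^sub>R u k) k = c *\<^sub>R rout x u k"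
  by (simp_all add: rout_def rst_lin rmid_lin matrix_vector_right_distrib matrix_vector_mult_scaleR algebra_simps)

lemma rval_extend: "(\<And>k. k \<ge> n \<Longrightarrow> u k = 0) \<Longrightarrow> n \<le> m \<Longrightarrow> rval x u m = rval x u n"
  unfolding rval_def by (rule sum.mono_neutral_right) auto

definition cvec :: "real^'b \<Rightarrow> complex^'b" where "cvec v = (\<chi> i. complex_of_real (v $ i))"

lemma cvec_simps: "cvec (x + y) = cvec x + cvec y" "cvec (x - y) = cvec x - cvec y" "cvec (c *\<^sub>R x) = of_real c *s cvec x" "cvec (M *v x) = cmat M *v cvec x"
  "cvec 0 = 0"
  by (simp_all add: cvec_def cmat_def matrix_vector_mult_def vec_eq_iff)

lemma cvec_rmid: "cvec (rmid x u) = mid (cvec x) (cvec u)"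
  by (simp add: rmid_def mid_def cvec_simps)

text \<open>With \<open>s\<close> the supply seminorm of the input, the extracted energy is minus
  the real part of the cross term minus \<open>s^2\<close>, hence at most \<open>K s - s^2\<close>,
  whose maximum is \<open>K^2 / 4\<close>.\<close>

lemma rvals_bdd: "bdd_above (rvals x)"
proof -
  obtain K where K: "K \<ge> 0" "\<And>U. cmod (ell (cvec x) U) \<le> K * E.nrm U" using VV_all[of "cvec x"] unfolding VV_def by blast
  have "rval x u n \<le> K\<^sup>2 / 4" for u n
  proof -
    define U where "U = pvec_of n (\<lambda>k. cvec (u k))"
    have cU: "cf U k = cvec (u k)" if "k < n" for k using that by (simp add: U_def cf_pvec_of)
    have st: "k \<le> n \<Longrightarrow> cvec (rst x u k) = (T ^^ k) (cvec x) + st U k" for k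
    proof (induction k)
      case (Suc k)
      hence "cvec (rst x u (Suc k)) = 2 *s mid ((T ^^ k) (cvec x) + st U k) (0 + cf U k) - ((T ^^ k) (cvec x) + st U k)"
        by (simp add: cvec_simps cvec_rmid cU)
      thus ?case unfolding mid_add funpow.simps o_apply st.simps T_def[of "(T ^^ k) (cvec x)"]
        by (simp add: vec_eq_iff algebra_simps del: rst.simps)
    qed simp
    have out: "cvec (rout x u k) = fr (cvec x) k + out U k" if "k < n" for k
    proof -
      have "cvec (rout x u k) = cmat C *v mid ((T ^^ k) (cvec x) + st U k) (0 + cf U k) + cmat D *v cf U k"
        using that st[of k] by (simp add: rout_def cvec_simps cvec_rmid cU)
      thus ?thesis unfolding mid_add by (simp add: fr_def out_def matrix_vector_right_distrib)
    qed
    have ip: "v \<bullet> w = Re (cdot (cnjv (cvec v)) (cvec w))" for v w :: "real^'n"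
      by (simp add: cdot_def cnjv_def cvec_def inner_vec_def)
    have "rval x u n = - Re (\<Sum>k<n. cdot (cnjv (cf U k)) (fr (cvec x) k + out U k))"
      by (simp add: rval_def ip cU out sum_negf)
    also have "(\<Sum>k<n. cdot (cnjv (cf U k)) (fr (cvec x) k + out U k)) = half U (\<lambda>k. fr (cvec x) k + out U k)"
      by (rule half_eq[symmetric]) (simp add: U_def cf_pvec_of)
    also have "\<dots> = ell (cvec x) U + half U (out U)" unfolding ell_def by (rule half_add_right)
    finally have "rval x u n = - Re (ell (cvec x) U) - (E.nrm U)\<^sup>2" by (simp add: nrm_square_half)
    also have "\<dots> \<le> K * E.nrm U - (E.nrm U)\<^sup>2"
      using K(2)[of U] abs_Re_le_cmod[of "ell (cvec x) U"] by simp
    also have "\<dots> \<le> K\<^sup>2 / 4" using zero_le_power2[of "2 * E.nrm U - K"] by (simp add: power2_eq_square algebra_simps)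
    finally show ?thesis .
  qed
  thus ?thesis unfolding rvals_def by (auto intro!: bdd_aboveI[of _ "K\<^sup>2 / 4"])
qed

lemma rst_Suc: "rst x u (Suc k) = rst (rst x u 1) (\<lambda>k. u (Suc k)) k"
  by (induction k) simp_all

lemma discrete_storage_exists: "\<exists>X. symm_mat X \<and> psd X \<and> psd (Omega A B C D X)"
proof -
  have "\<exists>M. symm_mat M \<and> (\<forall>x. Sup (rvals x) = x \<bullet> (M *v x))"
  proof (rule Sup_value_quadratic_form)
    show z: "0 \<in> rvals x" for x
      unfolding rvals_def by (rule CollectI, intro exI[of _ "\<lambda>_. 0"] exI[of _ 0]) (simp add: rval_def)
    show "bdd_above (rvals x)" for x by (rule rvals_bdd)
    show "c\<^sup>2 * v \<in> rvals (c *\<^sub>R x)" if "v \<in> rvals x" for x v c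
    proof -
      obtain u n where "v = rval x u n" "\<forall>k\<ge>n. u k = 0" using \<open>v \<in> rvals x\<close> rvals_def by auto
      hence "c\<^sup>2 * v = rval (c *\<^sub>R x) (\<lambda>k. c *\<^sub>R u k) n \<and> (\<forall>k\<ge>n. c *\<^sub>R u k = 0)"
        by (simp add: rval_def rout_lin power2_eq_square sum_distrib_left mult.assoc)
      thus ?thesis unfolding rvals_def by blast
    qed
    show "\<exists>p\<in>rvals (x + y). \<exists>r\<in>rvals (x - y). p + r = 2 * v + 2 * w" if v: "v \<in> rvals x" and w: "w \<in> rvals y" for x y v w
    proof -
      obtain u n where u: "v = rval x u n" "\<forall>k\<ge>n. u k = 0" using v rvals_def by auto
      obtain u' n' where u': "w = rval y u' n'" "\<forall>k\<ge>n'. u' k = 0" using w rvals_def by auto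
      define m where "m = max n n'"
      have e: "v = rval x u m" "w = rval y u' m" using u u' rval_extend[of n u m] rval_extend[of n' u' m] by (auto simp: m_def)
      have d: "rout (x - y) (\<lambda>k. u k - u' k) k = rout x u k - rout y u' k" for k
        using rout_lin(1)[of x "(-1) *\<^sub>R y" u "\<lambda>k. (-1) *\<^sub>R u' k" k] rout_lin(2)[of "-1" y u' k] by simp
      have "rval (x + y) (\<lambda>k. u k + u' k) m + rval (x - y) (\<lambda>k. u k - u' k) m = 2 * v + 2 * w"
        by (simp add: e rval_def rout_lin d sum.distrib[symmetric] sum_distrib_left inner_simps)
      moreover have "rval (x + y) (\<lambda>k. u k + u' k) m \<in> rvals (x + y)"
        unfolding rvals_def mem_Collect_eq using u(2) u'(2) by (intro exI[of _ "\<lambda>k. u k + u' k"] exI[of _ m]) (simp add: m_def)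
      moreover have "rval (x - y) (\<lambda>k. u k - u' k) m \<in> rvals (x - y)"
        unfolding rvals_def mem_Collect_eq using u(2) u'(2) by (intro exI[of _ "\<lambda>k. u k - u' k"] exI[of _ m]) (simp add: m_def)
      ultimately show ?thesis by blast
    qed
  qed
  then obtain M where M: "symm_mat M" "\<And>x. Sup (rvals x) = x \<bullet> (M *v x)" by blast
  have z: "0 \<in> rvals x" for x
    unfolding rvals_def by (rule CollectI, intro exI[of _ "\<lambda>_. 0"] exI[of _ 0]) (simp add: rval_def)
  have nonneg: "0 \<le> x \<bullet> (M *v x)" for x
    unfolding M(2)[symmetric] by (rule cSup_upper[OF z rvals_bdd])
  \<comment> \<open>Bellman inequality for a single step, obtained by prepending \<open>w\<close> to
    an input.\<close>
  have dp: "(2 *\<^sub>R rmid x w - x) \<bullet> (M *v (2 *\<^sub>R rmid x w - x)) - w \<bullet> (C *v rmid x w + D *v w) \<le> x \<bullet> (M *v x)" for x w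
  proof -
    let ?x = "2 *\<^sub>R rmid x w - x"
    have "v \<le> x \<bullet> (M *v x) + w \<bullet> (C *v rmid x w + D *v w)" if v: "v \<in> rvals ?x" for v
    proof -
      obtain u n where u: "v = rval ?x u n" "\<forall>k\<ge>n. u k = 0" using v rvals_def by auto
      define u' where "u' k = (case k of 0 \<Rightarrow> w | Suc k \<Rightarrow> u k)" for k
      have s: "rst x u' (Suc k) = rst ?x u k" for k
        unfolding rst_Suc[of x u'] by (simp add: u'_def)
      have "rval x u' (Suc n) = v - w \<bullet> (C *v rmid x w + D *v w)"
        unfolding rval_def u(1) sum.lessThan_Suc_shift by (simp add: rout_def s u'_def del: rst.simps(2))
      moreover have "rval x u' (Suc n) \<in> rvals x"
        unfolding rvals_def using u(2) by (auto simp: u'_def split: nat.split intro!: exI[of _ u'] exI[of _ "Suc n"])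
      hence "rval x u' (Suc n) \<le> x \<bullet> (M *v x)" unfolding M(2)[symmetric] by (rule cSup_upper[OF _ rvals_bdd])
      ultimately show ?thesis by simp
    qed
    hence "Sup (rvals ?x) \<le> x \<bullet> (M *v x) + w \<bullet> (C *v rmid x w + D *v w)"
      using z by (intro cSup_least) auto
    thus ?thesis unfolding M(2) by simp
  qed
  \<comment> \<open>Over a step with midpoint \<open>m\<close> the form \<open>x^T M x\<close> grows
    by \<open>4 m^T M (m - x)\<close>, and \<open>m - x = (A m + B w) / a\<close>; hence the factor
    \<open>4 / a\<close>.\<close>
  define X where "X = (4 / a) *\<^sub>R M"
  have Xv: "X *v x = (4 / a) *\<^sub>R (M *v x)" for x by (simp add: X_def scaleR_matrix_vector_assoc)
  have "transpose X = X" using M(1) by (simp add: symm_mat_def X_def transpose_def vec_eq_iff)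
  moreover have "0 \<le> x \<bullet> (X *v x)" for x unfolding Xv using nonneg[of x] a by simp
  ultimately have X: "symm_mat X" "psd X" by (auto simp: symm_mat_def psd_def)
  have "0 \<le> dissipation A B C D X m w" for m w
  proof -
    \<comment> \<open>Every pair \<open>(m, w)\<close> occurs as midpoint and input of a step: the
      one from \<open>m - b\<close> to \<open>m + b\<close>.\<close>
    define b where "b = (1 / a) *\<^sub>R (A *v m + B *v w)"
    have ab: "a *\<^sub>R b = A *v m + B *v w" using a by (simp add: b_def)
    define x where "x = m - b"
    have "a *\<^sub>R m = A *v m + (a *\<^sub>R x + B *v w)" by (simp add: x_def scaleR_diff_right ab)
    from rmid_unique[OF this] have m: "rmid x w = m" by simp
    have x': "2 *\<^sub>R m - x = m + b" by (simp add: x_def scaleR_2)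
    have sym: "b \<bullet> (M *v m) = m \<bullet> (M *v b)" using symm_inner[OF M(1)] by (metis inner_commute)
    have "(m + b) \<bullet> (M *v (m + b)) - w \<bullet> (C *v m + D *v w) \<le> (m - b) \<bullet> (M *v (m - b))"
      using dp[of x w] unfolding m x' unfolding x_def .
    hence "4 * (m \<bullet> (M *v b)) \<le> w \<bullet> (C *v m + D *v w)"
      by (simp add: matrix_vector_right_distrib matrix_vector_mult_diff_distrib inner_simps sym)
    moreover have "m \<bullet> (X *v (A *v m + B *v w)) = 4 * (m \<bullet> (M *v b))"
      unfolding ab[symmetric] Xv using a by (simp add: matrix_vector_mult_scaleR)
    ultimately show ?thesis by (simp add: dissipation_def)
  qed
  hence "psd (Omega A B C D X)" using psd_Omega_iff[OF X(1)] by blast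
  thus ?thesis using X by blast
qed

end

text \<open>The characteristic polynomial has finitely many roots, so some positive \<open>a\<close>
  is not an eigenvalue of \<open>A\<close> and the Cayley transform applies.\<close>

lemma positive_real_pair_imp_storage:
  assumes re: "realizes A B C D P Q R" and pr: "positive_real_pair P Q"
  shows "\<exists>X. symm_mat X \<and> psd X \<and> psd (Omega A B C D X)"
proof -
  have "finite {s. poly (det (xi_minus A)) s = 0}" by (rule poly_roots_finite) (rule det_xi_minus_nonzero)
  moreover have "infinite {0::real<..}" by (rule infinite_Ioi)
  ultimately have "\<not> {0<..} \<subseteq> {s. poly (det (xi_minus A)) s = 0}" using finite_subset by blast
  then obtain a where a: "a > 0" "poly (det (xi_minus A)) a \<noteq> 0" by auto
  have "(\<chi> i j. poly (xi_minus A $ i $ j) a) = mat a - A" by (auto simp: xi_minus_def mat_def vec_eq_iff)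
  hence "det (mat a - A) \<noteq> 0" using a(2) by (simp add: poly_det)
  then obtain N where "(mat a - A) ** N = mat 1" using invertible_det_nz[of "mat a - A"] by (auto simp: invertible_def)
  then interpret cayley A B C D P Q R a N using re pr a(1) by unfold_locales
  show ?thesis by (rule discrete_storage_exists)
qed

theorem theorem10:
  fixes A :: "real^'d^'d" and B :: "real^'n^'d" and C :: "real^'d^'n" and D :: "real^'n^'n"
    and t0 :: real
  shows "((\<forall>x0. available_energy A B C D t0 x0 < \<infinity>) \<longleftrightarrow>
           (\<exists>P Q. positive_real_pair P Q \<and> external_behavior A B C D = poly_behavior P Q))
       \<and> ((\<exists>P Q. positive_real_pair P Q \<and> external_behavior A B C D = poly_behavior P Q) \<longleftrightarrow>
           (\<exists>X. symm_mat X \<and> psd X \<and> psd (Omega A B C D X)))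
       \<and> ((\<exists>X. symm_mat X \<and> psd X \<and> psd (Omega A B C D X)) \<longleftrightarrow>
           (\<exists>Xm. cond4 A B C D t0 Xm))
       \<and> (observable C A \<and> (\<forall>x0. available_energy A B C D t0 x0 < \<infinity>) \<longrightarrow>
           spectrum_in_closed_lhp A \<and>
           (\<forall>Xm. cond4 A B C D t0 Xm \<longrightarrow>
              (\<forall>X. symm_mat X \<and> psd (Omega A B C D X) \<longrightarrow> psd (X - Xm))))"
proof -
  let ?c1 = "\<forall>x0. available_energy A B C D t0 x0 < \<infinity>"
  let ?c2 = "\<exists>P Q. positive_real_pair P Q \<and> external_behavior A B C D = poly_behavior P Q"
  let ?c3 = "\<exists>X. symm_mat X \<and> psd X \<and> psd (Omega A B C D X)"
  let ?c4 = "\<exists>Xm. cond4 A B C D t0 Xm"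
  \<comment> \<open>The implications form two cycles: 1, 4, 3, 1 and 3, 2, 3.\<close>
  have 14: "?c1 \<Longrightarrow> ?c4" by (rule finite_available_energy_imp_cond4)
  have 43: "?c4 \<Longrightarrow> ?c3" unfolding cond4_def by blast
  have 31: "?c3 \<Longrightarrow> ?c1" using storage_imp_finite by blast
  have 32: ?c2 if c3: ?c3
  proof -
    obtain X where X: "symm_mat X" "psd X" "psd (Omega A B C D X)" using c3 by blast
    obtain P Q R where PQR: "realizes A B C D P Q R" "\<And>q. remainder A C q 0 \<Longrightarrow> \<exists>k. q = k v* Q" "det Q \<noteq> 0"
      using realization_exists[of A B C D] by blast
    have "external_behavior A B C D = poly_behavior P Q"
      using realizes_imp_behavior_subset[OF PQR(1)] behavior_subset_external[OF PQR(1,2)] by blast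
    moreover have "positive_real_pair P Q" by (rule storage_imp_positive_real_pair[OF X PQR])
    ultimately show ?thesis by blast
  qed
  have 23: ?c3 if c2: ?c2
  proof -
    obtain P Q where PQ: "positive_real_pair P Q" "external_behavior A B C D = poly_behavior P Q" using c2 by blast
    obtain R where "realizes A B C D P Q R" using behavior_imp_realizes[of A B C D P Q] PQ(2) by blast
    thus ?thesis using PQ(1) by (rule positive_real_pair_imp_storage)
  qed
  have obs: "spectrum_in_closed_lhp A \<and> (\<forall>Xm. cond4 A B C D t0 Xm \<longrightarrow>
      (\<forall>X. symm_mat X \<and> psd (Omega A B C D X) \<longrightarrow> psd (X - Xm)))" if "observable C A" ?c1
    using observable_spectrum[OF that(1)] observable_imp_minimal[OF that(1)] 14[OF that(2)] by blast
  show ?thesis using 14 43 31 32 23 obs by meson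
qed

end
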